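(* Let $\mathcal V$ be a $\mathbb Z$-graded vertex algebra. Then $(U_+(\mathcal V),\Delta_{\mathcal V}(w),\mathfrak C_{\mathcal V})$ is a vertex coalgebra, and $(U(\mathcal V),\Delta_{\mathcal V}(w))$ is a vertex comodule of $U_+(\mathcal V)$.
   Context: **Restricted mode algebra.** $\mathcal V=\bigoplus_d\mathcal V^d$ is a $\mathbb Z$-graded vertex algebra over $\mathbb C$ with vacuum $|0\rangle$ and translation operator $T$, graded so that $\deg|0\rangle=0$, $\deg T=-1$, $\deg A_{(n)}B=\deg A+\deg B+n+1$. Let $\mathscr O_n=\mathbb C[z_i^{\pm1},(z_i-z_j)^{-1}:1\le i\ne j\le n]$ and $F(\mathcal V)=\bigoplus_{n>0}\mathcal V^{\otimes n}\otimes\mathscr O_n$, with the element $A_1\otimes\cdots\otimes A_n\otimes f$ written $\mathcal O(A_1,\dots,A_n;f)$. Multiplication is $\mathcal O(A_1,\dots,A_m;f)\cdot\mathcal O(B_1,\dots,B_n;g)=\mathcal O(A_1,\dots,A_m,B_1,\dots,B_n;fg)$, where $f$ is a function of the first $m$ variables and $g$ of the last $n$. One also sets $\mathcal O(\emptyset;f)=f\in\mathbb C$. The restricted mode algebra $U(\mathcal V)$ is the quotient of $F(\mathcal V)$ by the linear span of (i) $\mathcal O(A_1,\dots,A_{i-1},|0\rangle,A_{i+1},\dots,A_m;f)-\mathcal O(A_1,\dots,A_{i-1},A_{i+1},\dots,A_m;\mathrm{Res}_{z_i\to0}f)$ (remaining variables relabeled); (ii) $\mathcal O(A_1,\dots,TA_i,\dots,A_m;f)+\mathcal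 O(A_1,\dots,A_i,\dots,A_m;\partial_{z_i}f)$; (iii) $\mathcal O(\dots,A_{i-1},A,B,A_{i+2},\dots;g(z_1,\dots,z_i,z_{i+1},\dots,z_n))-\mathcal O(\dots,A_{i-1},B,A,A_{i+2},\dots;g(z_1,\dots,z_{i+1},z_i,\dots,z_n))-\sum_{k\in\mathbb Z}\mathcal O(\dots,A_{i-1},A_{(k)}B,A_{i+2},\dots;f_k)$ for all $g\in\mathscr O_n$, where $g=\sum_k(z_i-z_{i+1})^kf_k(z_1,\dots,z_{i-1},z_{i+1},\dots,z_n)$ is the Laurent expansion in the limit $z_i-z_{i+1}\to0$ (the sum is finite because the expansion is bounded below and $A_{(k)}B=0$ for large $k$). $U(\mathcal V)$ is a unital algebra with unit $\mathcal O(|0\rangle;z_1^{-1})$. $U_+(\mathcal V)\subset U(\mathcal V)$ is the subalgebra spanned by the unit and the $\mathcal O(A_1,\dots,A_m;f)$ with $f\in\mathbb C[z_i,(z_i-z_j)^{-1}:1\le i\ne j\le m]$. **Meromorphic coproduct and covacuum.** $\Delta_{\mathcal V}(w):U(\mathcal V)\to U(\mathcal V)\otimes U_+(\mathcal V)(\!(w^{-1})\!)$ is the algebra homomorphism $$\Delta_{\mathcal V}(w)(\mathcal O(A_1,\dots,A_n;f))=\sum_{I\sqcup J=\{1,\dots,n\}}\sum_{s\in\mathbb Z}\mathcal O(A_I;\Delta^{(s)}_{IJ}(f))\otimes\mathcal O(A_J;{}_I\Delta^{(s)}_J(f))\,w^{-s},$$ where $I,J$ (possibly empty) are ordered increasingly,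 $A_I=(A_i)_{i\in I}$, and $\sum_s\Delta^{(s)}_{IJ}(f)\otimes{}_I\Delta^{(s)}_J(f)w^{-s}$ (for each $s$ a finite sum of products of a function of $z_I$ and a function of $z_J$) is the expansion, in powers of $w^{-1}$ at large $w$, of $f$ with $z_j$ replaced by $z_j+w$ for $j\in J$. It maps $U_+(\mathcal V)$ to $U_+(\mathcal V)\otimes U_+(\mathcal V)(\!(w^{-1})\!)$. $\mathfrak C_{\mathcal V}:U_+(\mathcal V)\to\mathbb C$ is the linear map sending the unit $\mathcal O(|0\rangle;z_1^{-1})$ to $1$ and $\mathcal O(A_1,\dots,A_n;f)$ to $0$ for $f\in\mathbb C[z_i,(z_i-z_j)^{-1}:1\le i\ne j\le n]$. **Vertex coalgebras and comodules.** A vertex coalgebra is a vector space $V$ with linear maps $\Delta(w)=\sum_n\Delta_nw^{-n-1}:V\to V\otimes V(\!(w^{-1})\!)$ and $\mathfrak C:V\to\mathbb C$ such that: (counit) $(\mathrm{id}\otimes\mathfrak C)\Delta(w)v=v$ for all $v$; (cocreation) $(\mathfrak C\otimes\mathrm{id})\Delta(w)v\in V[w]$ with limit $v$ as $w\to0$; (translation) with $D=(\mathfrak C\otimes\mathrm{id})\Delta_{-2}$, $\frac{d}{dw}\Delta(w)=\Delta(w)D-(D\otimes\mathrm{id})\Delta(w)$; (locality) for all $v$, $(\Delta(w)\otimes\mathrm{id})\Delta(z)v$ and $(\mathrm{id}\otimes P)(\Delta(z)\otimes\mathrm{id})\Delta(w)v$ are expansions of the same element of $V^{\otimes3}[\![z^{-1},w^{-1},(z-w)^{-1}]\!][z,w]$,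 where $P$ swaps tensor factors. A vertex comodule of $(V,\Delta_V(w),\mathfrak C)$ is a vector space $M$ with a linear map $\Delta_M(w):M\to M\otimes V(\!(w^{-1})\!)$ such that $(\mathrm{id}\otimes\mathfrak C)\Delta_M(w)=\mathrm{id}$ and, for all $m\in M$, $(\mathrm{id}\otimes\Delta_V(z))\Delta_M(w)(m)$ and $(\Delta_M(w)\otimes\mathrm{id})\Delta_M(z+w)(m)$ are expansions of the same element of $(M\otimes V\otimes V)[\![z^{-1},w^{-1},(z+w)^{-1}]\!][z,w]$.
   Formalization: In relation (i), Res_{z_i→0} f is read as the residue at z_i=0 plus the residues at z_i=z_j for j>i, since the residue at 0 alone forces U(V)=0; the covacuum is required to send the unit to 1 only when |0⟩≠0. *)

theory Defs
  imports
    Complex_Main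
    "HOL-Library.Poly_Mapping"
    "HOL-Computational_Algebra.Fraction_Field"
    "HOL-Computational_Algebra.Formal_Laurent_Series"
begin

notation fls_nth (infixl \<open>$$\<close> 75)


section \<open>Complex vector spaces\<close>

class complex_vector = ab_group_add +
  fixes scaleC :: "complex \<Rightarrow> 'a \<Rightarrow> 'a" (infixr \<open>*\<^sub>C\<close> 75)
  assumes scaleC_add_right: "a *\<^sub>C (x + y) = a *\<^sub>C x + a *\<^sub>C y"
    and scaleC_add_left: "(a + b) *\<^sub>C x = a *\<^sub>C x + b *\<^sub>C x"
    and scaleC_scaleC: "a *\<^sub>C b *\<^sub>C x = (a * b) *\<^sub>C x"
    and scaleC_one: "1 *\<^sub>C x = x"

global_interpretation complex_vector:
  vector_space "scaleC :: complex \<Rightarrow> 'a \<Rightarrow> 'a::complex_vector"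
  by unfold_locales (rule scaleC_add_right scaleC_add_left scaleC_scaleC scaleC_one)+

abbreviation clinear :: "('a::complex_vector \<Rightarrow> 'b::complex_vector) \<Rightarrow> bool"
  where "clinear \<equiv> Vector_Spaces.linear scaleC scaleC"

instantiation complex :: complex_vector
begin
definition scaleC_complex :: "complex \<Rightarrow> complex \<Rightarrow> complex" where "scaleC_complex = (*)"
instance by standard (simp_all add: scaleC_complex_def algebra_simps)
end

text \<open>\<open>'x \<Rightarrow>\<^sub>0 complex\<close> is the free vector space on \<open>'x\<close>.\<close>

instantiation poly_mapping :: (type, complex_vector) complex_vector
begin
lift_definition scaleC_poly_mapping ::
    "complex \<Rightarrow> ('a \<Rightarrow>\<^sub>0 'b) \<Rightarrow> ('a \<Rightarrow>\<^sub>0 'b)" is "\<lambda>c f x. c *\<^sub>C f x"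
  by (rule finite_subset) auto
instance
  by standard
    (transfer; simp add: fun_eq_iff complex_vector.scale_right_distrib
      complex_vector.scale_left_distrib)+
end

definition congruent_mod :: "'a::complex_vector set \<Rightarrow> 'a \<Rightarrow> 'a \<Rightarrow> bool"
  where "congruent_mod R x y \<longleftrightarrow> x - y \<in> complex_vector.span R"

lemma equivp_congruent_mod: "equivp (congruent_mod R)"
proof (rule equivpI)
  show "reflp (congruent_mod R)"
    by (rule reflpI) (simp add: congruent_mod_def complex_vector.span_zero)
  show "symp (congruent_mod R)"
    by (rule sympI) (metis congruent_mod_def complex_vector.span_neg minus_diff_eq)
  show "transp (congruent_mod R)"
  proof (rule transpI)
    fix x y z
    assume "congruent_mod R x y" "congruent_mod R y z"
    then show "congruent_mod R x z"
      unfolding congruent_mod_def using complex_vector.span_add[of "x - y" R "y - z"] by simp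
  qed
qed

lemma congruent_mod_refl: "congruent_mod R x x"
  by (simp add: congruent_mod_def complex_vector.span_zero)

lemma congruent_mod_eq: "x = y \<Longrightarrow> congruent_mod R x y"
  by (simp add: congruent_mod_refl)

lemma congruent_mod_add:
  "congruent_mod R x y \<Longrightarrow> congruent_mod R x' y' \<Longrightarrow> congruent_mod R (x + x') (y + y')"
  unfolding congruent_mod_def
  by (metis add_diff_add complex_vector.span_add)

lemma congruent_mod_diff:
  "congruent_mod R x y \<Longrightarrow> congruent_mod R x' y' \<Longrightarrow> congruent_mod R (x - x') (y - y')"
  unfolding congruent_mod_def
  using complex_vector.span_diff[of "x - y" R "x' - y'"] by (simp add: algebra_simps)

lemma congruent_mod_uminus: "congruent_mod R x y \<Longrightarrow> congruent_mod R (- x) (- y)"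
  using congruent_mod_diff[OF congruent_mod_refl[of R 0]] by simp

lemma congruent_mod_scale: "congruent_mod R x y \<Longrightarrow> congruent_mod R (c *\<^sub>C x) (c *\<^sub>C y)"
  unfolding congruent_mod_def
  by (metis complex_vector.scale_right_diff_distrib complex_vector.span_scale)


section \<open>Tensor products\<close>

definition bilinear_relations ::
    "(('a::complex_vector \<times> 'b::complex_vector) \<Rightarrow>\<^sub>0 complex) set"
  where "bilinear_relations =
    (let e = (\<lambda>a b. Poly_Mapping.single (a, b) (1 :: complex)) in
      {e (a + a') b - e a b - e a' b | a a' b. True} \<union>
      {e a (b + b') - e a b - e a b' | a b b'. True} \<union>
      {e (c *\<^sub>C a) b - c *\<^sub>C e a b | a b c. True} \<union>
      {e a (c *\<^sub>C b) - c *\<^sub>C e a b | a b c. True})"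

quotient_type (overloaded) ('a, 'b) tensor (infixl \<open>\<otimes>\<close> 75) =
    "('a::complex_vector \<times> 'b::complex_vector) \<Rightarrow>\<^sub>0 complex"
  / "congruent_mod bilinear_relations"
  by (rule equivp_congruent_mod)

instantiation tensor :: (complex_vector, complex_vector) complex_vector
begin
lift_definition zero_tensor :: "'a \<otimes> 'b" is 0 .
lift_definition plus_tensor :: "'a \<otimes> 'b \<Rightarrow> 'a \<otimes> 'b \<Rightarrow> 'a \<otimes> 'b" is "(+)"
  by (rule congruent_mod_add)
lift_definition minus_tensor :: "'a \<otimes> 'b \<Rightarrow> 'a \<otimes> 'b \<Rightarrow> 'a \<otimes> 'b" is "(-)"
  by (rule congruent_mod_diff)
lift_definition uminus_tensor :: "'a \<otimes> 'b \<Rightarrow> 'a \<otimes> 'b" is uminus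
  by (rule congruent_mod_uminus)
lift_definition scaleC_tensor :: "complex \<Rightarrow> 'a \<otimes> 'b \<Rightarrow> 'a \<otimes> 'b" is scaleC
  by (rule congruent_mod_scale)
instance
  by standard
    (transfer; rule congruent_mod_eq;
      simp add: complex_vector.scale_right_distrib complex_vector.scale_left_distrib)+
end

lift_definition tensor :: "'a::complex_vector \<Rightarrow> 'b::complex_vector \<Rightarrow> 'a \<otimes> 'b" (infixl \<open>\<otimes>\<close> 75)
  is "\<lambda>a b. Poly_Mapping.single (a, b) 1" .

text \<open>The linear map induced by a bilinear map.\<close>

definition tensor_lift ::
    "('a::complex_vector \<Rightarrow> 'b::complex_vector \<Rightarrow> 'c::complex_vector) \<Rightarrow> 'a \<otimes> 'b \<Rightarrow> 'c"
  where "tensor_lift \<beta> = (THE h. clinear h \<and> (\<forall>a b. h (a \<otimes> b) = \<beta> a b))"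

definition tensor_map ::
    "('a::complex_vector \<Rightarrow> 'c::complex_vector) \<Rightarrow> ('b::complex_vector \<Rightarrow> 'd::complex_vector)
      \<Rightarrow> 'a \<otimes> 'b \<Rightarrow> 'c \<otimes> 'd"
  where "tensor_map f g = tensor_lift (\<lambda>a b. f a \<otimes> g b)"

definition tensor_swap :: "'a::complex_vector \<otimes> 'b::complex_vector \<Rightarrow> 'b \<otimes> 'a"
  where "tensor_swap = tensor_lift (\<lambda>a b. b \<otimes> a)"

definition tensor_assoc ::
    "('a::complex_vector \<otimes> 'b::complex_vector) \<otimes> 'c::complex_vector \<Rightarrow> 'a \<otimes> ('b \<otimes> 'c)"
  where "tensor_assoc = tensor_lift (\<lambda>x c. tensor_lift (\<lambda>a b. a \<otimes> (b \<otimes> c)) x)"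

text \<open>\<open>id \<otimes> \<phi>\<close> and \<open>\<phi> \<otimes> id\<close> for a functional \<open>\<phi>\<close>, after identifying \<open>V \<otimes> \<complex>\<close> and \<open>\<complex> \<otimes> V\<close> with \<open>V\<close>.\<close>

definition contract_right ::
    "('b::complex_vector \<Rightarrow> complex) \<Rightarrow> 'a::complex_vector \<otimes> 'b \<Rightarrow> 'a"
  where "contract_right \<phi> = tensor_lift (\<lambda>a b. \<phi> b *\<^sub>C a)"

definition contract_left ::
    "('a::complex_vector \<Rightarrow> complex) \<Rightarrow> 'a \<otimes> 'b::complex_vector \<Rightarrow> 'b"
  where "contract_left \<phi> = tensor_lift (\<lambda>a b. \<phi> a *\<^sub>C b)"


section \<open>Vertex coalgebras and vertex comodules\<close>

text \<open>
  An element of \<open>W((w\<^sup>-\<^sup>1))\<close> is a Laurent series of type \<open>'w fls\<close> in the variable \<open>w\<^sup>-\<^sup>1\<close>: the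
  coefficient of \<open>w\<^sup>-\<^sup>s\<close> in \<open>F\<close> is \<open>F $$ s\<close>, and \<open>\<Delta>\<^sub>n\<close>, the coefficient of \<open>w\<^sup>-\<^sup>n\<^sup>-\<^sup>1\<close>, has index \<open>n + 1\<close>.
  The target \<open>V \<otimes> V((w\<^sup>-\<^sup>1))\<close> of a meromorphic coproduct is read as \<open>(V \<otimes> V)((w\<^sup>-\<^sup>1))\<close>.
\<close>

definition coeff_map :: "('a \<Rightarrow> 'b::zero fls) \<Rightarrow> int \<Rightarrow> 'a \<Rightarrow> 'b"
  where "coeff_map \<Delta> s v = \<Delta> v $$ s"

text \<open>
  With \<open>\<epsilon> = 1\<close> or \<open>\<epsilon> = -1\<close>, an element of
  \<open>W[[z\<^sup>-\<^sup>1, w\<^sup>-\<^sup>1, (z + \<epsilon>w)\<^sup>-\<^sup>1]][z, w]\<close> is presented by a family \<open>c i j k\<close> (\<open>i\<close>, \<open>j\<close> integers bounded below,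
  \<open>k\<close> a natural number), standing for the sum of the \<open>c i j k z\<^sup>-\<^sup>i w\<^sup>-\<^sup>j (z + \<epsilon>w)\<^sup>-\<^sup>k\<close>. The presentation
  is not unique. A series in \<open>z\<close> and \<open>w\<close> is a function of two integers, its value at \<open>a\<close>, \<open>b\<close> being
  the coefficient of \<open>z\<^sup>-\<^sup>a w\<^sup>-\<^sup>b\<close>. The two expansions use
  \<open>(z + \<epsilon>w)\<^sup>-\<^sup>k = \<Sum>\<^sub>m (-k gchoose m) \<epsilon>\<^sup>m z\<^sup>-\<^sup>k\<^sup>-\<^sup>m w\<^sup>m\<close> for \<open>z\<close> large compared with \<open>w\<close>, and
  \<open>(z + \<epsilon>w)\<^sup>-\<^sup>k = \<Sum>\<^sub>m (-k gchoose m) \<epsilon>\<^sup>-\<^sup>k\<^sup>-\<^sup>m z\<^sup>m w\<^sup>-\<^sup>k\<^sup>-\<^sup>m\<close> for \<open>w\<close> large compared with \<open>z\<close>.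
  All sums over \<open>(k, m)\<close> below have finite support.
\<close>

definition bounded_family :: "(int \<Rightarrow> int \<Rightarrow> nat \<Rightarrow> 'w::zero) \<Rightarrow> bool"
  where "bounded_family c \<longleftrightarrow> (\<exists>N. \<forall>i j k. c i j k \<noteq> 0 \<longrightarrow> - N \<le> i \<and> - N \<le> j)"

definition expand_z_large ::
    "complex \<Rightarrow> (int \<Rightarrow> int \<Rightarrow> nat \<Rightarrow> 'w::complex_vector) \<Rightarrow> int \<Rightarrow> int \<Rightarrow> 'w"
  where "expand_z_large \<epsilon> c a b = Sum_any (\<lambda>(k, m).
    (((- of_nat k) gchoose m) * \<epsilon> ^ m) *\<^sub>C c (a - int k - int m) (b + int m) k)"

definition expand_w_large ::
    "complex \<Rightarrow> (int \<Rightarrow> int \<Rightarrow> nat \<Rightarrow> 'w::complex_vector) \<Rightarrow> int \<Rightarrow> int \<Rightarrow> 'w"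
  where "expand_w_large \<epsilon> c a b = Sum_any (\<lambda>(k, m).
    (((- of_nat k) gchoose m) * inverse \<epsilon> ^ (k + m)) *\<^sub>C c (a + int m) (b - int k - int m) k)"

definition expansions_of_same_element ::
    "complex \<Rightarrow> (int \<Rightarrow> int \<Rightarrow> 'w::complex_vector) \<Rightarrow> (int \<Rightarrow> int \<Rightarrow> 'w) \<Rightarrow> bool"
  where "expansions_of_same_element \<epsilon> F G \<longleftrightarrow>
    (\<exists>c. bounded_family c \<and> F = expand_z_large \<epsilon> c \<and> G = expand_w_large \<epsilon> c)"

text \<open>
  If \<open>F a b\<close> is the coefficient of \<open>u\<^sup>-\<^sup>a w\<^sup>-\<^sup>b\<close>, then \<open>shift_by_w F\<close> is the series obtained for
  \<open>u = z + w\<close>, the powers of \<open>z + w\<close> being expanded in nonnegative powers of \<open>w\<close>.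
\<close>

definition shift_by_w :: "(int \<Rightarrow> int \<Rightarrow> 'w::complex_vector) \<Rightarrow> int \<Rightarrow> int \<Rightarrow> 'w"
  where "shift_by_w F a b = Sum_any (\<lambda>m::nat.
    ((of_int (int m - a) :: complex) gchoose m) *\<^sub>C F (a - int m) (b + int m))"

definition vertex_coalgebra ::
    "('v::complex_vector \<Rightarrow> ('v \<otimes> 'v) fls) \<Rightarrow> ('v \<Rightarrow> complex) \<Rightarrow> bool"
  where "vertex_coalgebra \<Delta> C \<longleftrightarrow>
    (\<forall>s. clinear (coeff_map \<Delta> s)) \<and> clinear C \<and>
    \<comment> \<open>counit\<close>
    (\<forall>v s. contract_right C (\<Delta> v $$ s) = (if s = 0 then v else 0)) \<and>
    \<comment> \<open>cocreation\<close>
    (\<forall>v. (\<forall>s>0. contract_left C (\<Delta> v $$ s) = 0) \<and> contract_left C (\<Delta> v $$ 0) = v) \<and>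
    \<comment> \<open>translation\<close>
    (let D = (\<lambda>v. contract_left C (\<Delta> v $$ (- 2 + 1))) in
      \<forall>v s. of_int (- (s - 1)) *\<^sub>C (\<Delta> v $$ (s - 1)) = \<Delta> (D v) $$ s - tensor_map D id (\<Delta> v $$ s)) \<and>
    \<comment> \<open>locality\<close>
    (\<forall>v. expansions_of_same_element (- 1)
      (\<lambda>a b. tensor_assoc (tensor_map (coeff_map \<Delta> b) id (\<Delta> v $$ a)))
      (\<lambda>a b. tensor_map id tensor_swap
        (tensor_assoc (tensor_map (coeff_map \<Delta> a) id (\<Delta> v $$ b)))))"

definition vertex_comodule ::
    "('v::complex_vector \<Rightarrow> ('v \<otimes> 'v) fls) \<Rightarrow> ('v \<Rightarrow> complex)
      \<Rightarrow> ('m::complex_vector \<Rightarrow> ('m \<otimes> 'v) fls) \<Rightarrow> bool"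
  where "vertex_comodule \<Delta> C \<Delta>\<^sub>M \<longleftrightarrow>
    (\<forall>s. clinear (coeff_map \<Delta>\<^sub>M s)) \<and>
    (\<forall>m s. contract_right C (\<Delta>\<^sub>M m $$ s) = (if s = 0 then m else 0)) \<and>
    (\<forall>m. expansions_of_same_element 1
      (shift_by_w (\<lambda>a b. tensor_assoc (tensor_map (coeff_map \<Delta>\<^sub>M b) id (\<Delta>\<^sub>M m $$ a))))
      (\<lambda>a b. tensor_map id (coeff_map \<Delta> a) (\<Delta>\<^sub>M m $$ b)))"


section \<open>Graded vertex algebras\<close>

text \<open>
  \<open>nprod n a b\<close> is \<open>a\<^sub>(\<^sub>n\<^sub>) b\<close>. The axiom \<open>locality\<close> is the coefficient of \<open>z\<^sup>-\<^sup>p\<^sup>-\<^sup>1 w\<^sup>-\<^sup>q\<^sup>-\<^sup>1\<close> in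
  \<open>(z - w)\<^sup>N [a(z), b(w)] c = 0\<close>.
\<close>

class graded_vertex_algebra = complex_vector +
  fixes vac :: 'a
    and transl :: "'a \<Rightarrow> 'a"
    and nprod :: "int \<Rightarrow> 'a \<Rightarrow> 'a \<Rightarrow> 'a"
    and grade :: "int \<Rightarrow> 'a set"
  assumes transl_add: "transl (a + b) = transl a + transl b"
    and transl_scaleC: "transl (r *\<^sub>C a) = r *\<^sub>C transl a"
    and nprod_add_left: "nprod n (a + a') b = nprod n a b + nprod n a' b"
    and nprod_scaleC_left: "nprod n (r *\<^sub>C a) b = r *\<^sub>C nprod n a b"
    and nprod_add_right: "nprod n a (b + b') = nprod n a b + nprod n a b'"
    and nprod_scaleC_right: "nprod n a (r *\<^sub>C b) = r *\<^sub>C nprod n a b"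
    and truncation: "\<exists>N. \<forall>n\<ge>N. nprod n a b = 0"
    and vacuum: "nprod n vac a = (if n = - 1 then a else 0)"
    and creation: "nprod (- 1) a vac = a" "n \<ge> 0 \<Longrightarrow> nprod n a vac = 0"
    and transl_vac: "transl vac = 0"
    and translation: "transl (nprod n a b) - nprod n a (transl b) =
      (- of_int n) *\<^sub>C nprod (n - 1) a b"
    and locality: "\<exists>N::nat. \<forall>c p q.
      (\<Sum>j\<le>N. ((- 1) ^ j * of_nat (N choose j)) *\<^sub>C
        (nprod (p + int (N - j)) a (nprod (q + int j) b c)
          - nprod (q + int j) b (nprod (p + int (N - j)) a c))) = 0"
    and grade_zero: "0 \<in> grade d"
    and grade_add: "a \<in> grade d \<Longrightarrow> b \<in> grade d \<Longrightarrow> a + b \<in> grade d"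
    and grade_scaleC: "a \<in> grade d \<Longrightarrow> r *\<^sub>C a \<in> grade d"
    and direct_sum_grade:
      "\<exists>!c. (\<forall>d. c d \<in> grade d) \<and> finite {d. c d \<noteq> 0} \<and> v = sum c {d. c d \<noteq> 0}"
    and grade_vac: "vac \<in> grade 0"
    and grade_transl: "a \<in> grade d \<Longrightarrow> transl a \<in> grade (d - 1)"
    and grade_nprod: "a \<in> grade d \<Longrightarrow> b \<in> grade e \<Longrightarrow> nprod n a b \<in> grade (d + e + n + 1)"


section \<open>The rings of rational functions\<close>

text \<open>
  Rational functions in \<open>z\<^sub>0, z\<^sub>1, \<dots>\<close>; an \<open>n\<close>-variable function is one in \<open>z\<^sub>0, \<dots>, z\<^sub>n\<^sub>-\<^sub>1\<close>.
\<close>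

type_synonym ratfun = "((nat \<Rightarrow>\<^sub>0 nat) \<Rightarrow>\<^sub>0 complex) fract"

definition ratC :: "complex \<Rightarrow> ratfun"
  where "ratC c = Fraction_Field.Fract (Poly_Mapping.single 0 c) 1"

definition var :: "nat \<Rightarrow> ratfun"
  where "var i = Fraction_Field.Fract (Poly_Mapping.single (Poly_Mapping.single i 1) 1) 1"

inductive_set generated_algebra :: "ratfun set \<Rightarrow> ratfun set" for G
  where
    const: "ratC c \<in> generated_algebra G"
  | gen: "g \<in> G \<Longrightarrow> g \<in> generated_algebra G"
  | add: "f \<in> generated_algebra G \<Longrightarrow> g \<in> generated_algebra G \<Longrightarrow> f + g \<in> generated_algebra G"
  | mult: "f \<in> generated_algebra G \<Longrightarrow> g \<in> generated_algebra G \<Longrightarrow> f * g \<in> generated_algebra G"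

definition conf_ring :: "nat \<Rightarrow> ratfun set"
  where "conf_ring n = generated_algebra
    ({var i | i. i < n} \<union> {inverse (var i) | i. i < n} \<union>
     {inverse (var i - var j) | i j. i < n \<and> j < n \<and> i \<noteq> j})"

definition conf_ring_plus :: "nat \<Rightarrow> ratfun set"
  where "conf_ring_plus n = generated_algebra
    ({var i | i. i < n} \<union> {inverse (var i - var j) | i j. i < n \<and> j < n \<and> i \<noteq> j})"

definition poly_eval ::
    "(complex \<Rightarrow> 'k::field) \<Rightarrow> (nat \<Rightarrow> 'k) \<Rightarrow> ((nat \<Rightarrow>\<^sub>0 nat) \<Rightarrow>\<^sub>0 complex) \<Rightarrow> 'k"
  where "poly_eval \<kappa> \<sigma> p = (\<Sum>m\<in>Poly_Mapping.keys p. \<kappa> (Poly_Mapping.lookup p m) *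
    (\<Prod>i\<in>Poly_Mapping.keys m. \<sigma> i ^ Poly_Mapping.lookup m i))"

text \<open>
  Substitution of \<open>\<sigma> i\<close> for \<open>z\<^sub>i\<close>, with \<open>\<kappa>\<close> embedding the constants; it has its intended meaning as soon
  as some representation of \<open>f\<close> as a fraction has a denominator that does not vanish at \<open>\<sigma>\<close>.
\<close>

definition rat_subst ::
    "(complex \<Rightarrow> 'k::field) \<Rightarrow> (nat \<Rightarrow> 'k) \<Rightarrow> ratfun \<Rightarrow> 'k"
  where "rat_subst \<kappa> \<sigma> f = (THE y. \<exists>p q. f = Fraction_Field.Fract p q \<and> poly_eval \<kappa> \<sigma> q \<noteq> 0
    \<and> y = poly_eval \<kappa> \<sigma> p / poly_eval \<kappa> \<sigma> q)"

definition rename_vars :: "(nat \<Rightarrow> nat) \<Rightarrow> ratfun \<Rightarrow> ratfun"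
  where "rename_vars \<pi> = rat_subst ratC (\<lambda>j. var (\<pi> j))"

definition laurent_subst :: "(nat \<Rightarrow> ratfun fls) \<Rightarrow> ratfun \<Rightarrow> ratfun fls"
  where "laurent_subst = rat_subst (\<lambda>c. fls_const (ratC c))"

definition partial_deriv :: "nat \<Rightarrow> ratfun \<Rightarrow> ratfun"
  where "partial_deriv i = (THE d.
    (\<forall>f g. d (f + g) = d f + d g) \<and> (\<forall>f g. d (f * g) = d f * g + f * d g) \<and>
    (\<forall>c. d (ratC c) = 0) \<and> (\<forall>j. d (var j) = (if j = i then 1 else 0)))"

text \<open>The relabelling of the variables that remain when \<open>z\<^sub>i\<close> is removed.\<close>

definition drop_var :: "nat \<Rightarrow> nat \<Rightarrow> nat"
  where "drop_var i j = (if j < i then j else j - 1)"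

text \<open>
  The Laurent expansions of \<open>f\<close> in \<open>t = z\<^sub>i\<close>, and in \<open>t = z\<^sub>i - z\<^sub>j\<close>; the coefficients are functions of
  the remaining, relabelled variables.
\<close>

definition expand_at_zero :: "nat \<Rightarrow> ratfun \<Rightarrow> ratfun fls"
  where "expand_at_zero i =
    laurent_subst (\<lambda>l. if l = i then fls_X else fls_const (var (drop_var i l)))"

definition expand_at_var :: "nat \<Rightarrow> nat \<Rightarrow> ratfun \<Rightarrow> ratfun fls"
  where "expand_at_var i j =
    laurent_subst (\<lambda>l. if l = i then fls_const (var (drop_var i j)) + fls_X
      else fls_const (var (drop_var i l)))"

text \<open>
  The residue used to remove a vacuum at position \<open>i\<close> of \<open>n\<close>. The symbol \<open>\<O>(A\<^sub>1, \<dots>, A\<^sub>n; f)\<close> stands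
  for a radially ordered contour integral, \<open>\<bar>z\<^sub>1\<bar> > \<dots> > \<bar>z\<^sub>n\<bar>\<close> (this is the order for which the
  commutator relations hold). Accordingly \<open>Res\<close> for \<open>z\<^sub>i\<close> tending to \<open>0\<close> is taken on a circle having
  \<open>0\<close> and the later variables inside, and the earlier ones outside: it is the coefficient of
  \<open>z\<^sub>i\<^sup>-\<^sup>1\<close> in the expansion of \<open>f\<close> for \<open>\<bar>z\<^sub>1\<bar> > \<dots> > \<bar>z\<^sub>n\<bar>\<close>. With the residue at \<open>0\<close> alone, that is,
  without the summands at \<open>z\<^sub>i = z\<^sub>j\<close>, the relations would force \<open>U(V) = 0\<close>: the commutator relation for
  \<open>A = |0\<rangle>\<close> and \<open>g = h(z\<^sub>2) / (z\<^sub>1 - z\<^sub>2)\<close> would read \<open>0 - 0 - \<O>(B; h) = 0\<close>.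
\<close>

definition vacuum_residue :: "nat \<Rightarrow> nat \<Rightarrow> ratfun \<Rightarrow> ratfun"
  where "vacuum_residue n i f =
    fls_residue (expand_at_zero i f) + (\<Sum>j\<in>{i<..<n}. fls_residue (expand_at_var i j f))"


section \<open>The restricted mode algebra\<close>

typedef 'v symbol = "{(A :: 'v list, f). A \<noteq> [] \<and> f \<in> conf_ring (length A)}"
  by (rule exI[of _ "([undefined], ratC 0)"]) (simp add: conf_ring_def generated_algebra.const)

definition free_symbol :: "'v list \<Rightarrow> ratfun \<Rightarrow> 'v symbol \<Rightarrow>\<^sub>0 complex"
  where "free_symbol A f = Poly_Mapping.single (Abs_symbol (A, f)) 1"

definition multilinear_relations :: "('v::complex_vector symbol \<Rightarrow>\<^sub>0 complex) set"
  where "multilinear_relations =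
    {free_symbol (xs @ (a + b) # ys) f - free_symbol (xs @ a # ys) f - free_symbol (xs @ b # ys) f
      | xs a b ys f. f \<in> conf_ring (length xs + 1 + length ys)} \<union>
    {free_symbol (xs @ (c *\<^sub>C a) # ys) f - c *\<^sub>C free_symbol (xs @ a # ys) f
      | xs c a ys f. f \<in> conf_ring (length xs + 1 + length ys)} \<union>
    {free_symbol A (f + g) - free_symbol A f - free_symbol A g
      | A f g. A \<noteq> [] \<and> f \<in> conf_ring (length A) \<and> g \<in> conf_ring (length A)} \<union>
    {free_symbol A (ratC c * f) - c *\<^sub>C free_symbol A f
      | A c f. A \<noteq> [] \<and> f \<in> conf_ring (length A)}"

text \<open>\<open>F(V)\<close>, the sum over \<open>n > 0\<close> of the tensor products of \<open>n\<close> copies of \<open>V\<close> with \<open>conf_ring n\<close>.\<close>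

quotient_type (overloaded) 'v mode_space =
    "'v::complex_vector symbol \<Rightarrow>\<^sub>0 complex" / "congruent_mod multilinear_relations"
  by (rule equivp_congruent_mod)

instantiation mode_space :: (complex_vector) complex_vector
begin
lift_definition zero_mode_space :: "'a mode_space" is 0 .
lift_definition plus_mode_space :: "'a mode_space \<Rightarrow> 'a mode_space \<Rightarrow> 'a mode_space" is "(+)"
  by (rule congruent_mod_add)
lift_definition minus_mode_space :: "'a mode_space \<Rightarrow> 'a mode_space \<Rightarrow> 'a mode_space" is "(-)"
  by (rule congruent_mod_diff)
lift_definition uminus_mode_space :: "'a mode_space \<Rightarrow> 'a mode_space" is uminus
  by (rule congruent_mod_uminus)
lift_definition scaleC_mode_space :: "complex \<Rightarrow> 'a mode_space \<Rightarrow> 'a mode_space" is scaleC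
  by (rule congruent_mod_scale)
instance
  by standard
    (transfer; rule congruent_mod_eq;
      simp add: complex_vector.scale_right_distrib complex_vector.scale_left_distrib)+
end

lift_definition nonempty_symbol :: "'v::complex_vector list \<Rightarrow> ratfun \<Rightarrow> 'v mode_space"
  is free_symbol .

text \<open>\<open>\<O>(A; f)\<close>, where \<open>\<O>(\<emptyset>; f)\<close> is the constant \<open>f\<close> times \<open>\<O>(|0\<rangle>; z\<^sub>1\<^sup>-\<^sup>1)\<close>.\<close>

definition mode_symbol :: "'v::graded_vertex_algebra list \<Rightarrow> ratfun \<Rightarrow> 'v mode_space"
  where "mode_symbol A f =
    (if A = [] then (THE c. f = ratC c) *\<^sub>C nonempty_symbol [vac] (inverse (var 0))
     else nonempty_symbol A f)"

definition vacuum_relations :: "'v::graded_vertex_algebra mode_space set"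
  where "vacuum_relations =
    {mode_symbol (xs @ vac # ys) f
      - mode_symbol (xs @ ys) (vacuum_residue (length xs + 1 + length ys) (length xs) f)
      | xs ys f. f \<in> conf_ring (length xs + 1 + length ys)}"

definition translation_relations :: "'v::graded_vertex_algebra mode_space set"
  where "translation_relations =
    {mode_symbol (xs @ transl a # ys) f + mode_symbol (xs @ a # ys) (partial_deriv (length xs) f)
      | xs a ys f. f \<in> conf_ring (length xs + 1 + length ys)}"

definition commutator_relations :: "'v::graded_vertex_algebra mode_space set"
  where "commutator_relations =
    {mode_symbol (xs @ a # b # ys) g
      - mode_symbol (xs @ b # a # ys)
          (rename_vars (id(length xs := Suc (length xs), Suc (length xs) := length xs)) g)
      - Sum_any (\<lambda>k. mode_symbol (xs @ nprod k a b # ys)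
          (expand_at_var (length xs) (Suc (length xs)) g $$ k))
      | xs a b ys g. g \<in> conf_ring (length xs + 2 + length ys)}"

quotient_type (overloaded) 'v mode_algebra =
    "'v::graded_vertex_algebra mode_space"
  / "congruent_mod (vacuum_relations \<union> translation_relations \<union> commutator_relations)"
  by (rule equivp_congruent_mod)

instantiation mode_algebra :: (graded_vertex_algebra) complex_vector
begin
lift_definition zero_mode_algebra :: "'a mode_algebra" is 0 .
lift_definition plus_mode_algebra :: "'a mode_algebra \<Rightarrow> 'a mode_algebra \<Rightarrow> 'a mode_algebra" is "(+)"
  by (rule congruent_mod_add)
lift_definition minus_mode_algebra :: "'a mode_algebra \<Rightarrow> 'a mode_algebra \<Rightarrow> 'a mode_algebra" is "(-)"
  by (rule congruent_mod_diff)
lift_definition uminus_mode_algebra :: "'a mode_algebra \<Rightarrow> 'a mode_algebra" is uminus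
  by (rule congruent_mod_uminus)
lift_definition scaleC_mode_algebra :: "complex \<Rightarrow> 'a mode_algebra \<Rightarrow> 'a mode_algebra" is scaleC
  by (rule congruent_mod_scale)
instance
  by standard
    (transfer; rule congruent_mod_eq;
      simp add: complex_vector.scale_right_distrib complex_vector.scale_left_distrib)+
end

lift_definition mode :: "'v::graded_vertex_algebra list \<Rightarrow> ratfun \<Rightarrow> 'v mode_algebra"
  is mode_symbol .

definition mode_unit :: "'v::graded_vertex_algebra mode_algebra"
  where "mode_unit = mode [vac] (inverse (var 0))"

typedef (overloaded) 'v mode_algebra_plus =
    "complex_vector.span (insert mode_unit
      {mode A f | A f. A \<noteq> [] \<and> f \<in> conf_ring_plus (length A)}) :: 'v::graded_vertex_algebra mode_algebra set"
  using complex_vector.span_zero by blast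

setup_lifting type_definition_mode_algebra_plus

instantiation mode_algebra_plus :: (graded_vertex_algebra) complex_vector
begin
lift_definition zero_mode_algebra_plus :: "'a mode_algebra_plus" is 0
  by (rule complex_vector.span_zero)
lift_definition plus_mode_algebra_plus ::
    "'a mode_algebra_plus \<Rightarrow> 'a mode_algebra_plus \<Rightarrow> 'a mode_algebra_plus" is "(+)"
  by (rule complex_vector.span_add)
lift_definition minus_mode_algebra_plus ::
    "'a mode_algebra_plus \<Rightarrow> 'a mode_algebra_plus \<Rightarrow> 'a mode_algebra_plus" is "(-)"
  by (rule complex_vector.span_diff)
lift_definition uminus_mode_algebra_plus :: "'a mode_algebra_plus \<Rightarrow> 'a mode_algebra_plus" is uminus
  by (rule complex_vector.span_neg)
lift_definition scaleC_mode_algebra_plus ::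
    "complex \<Rightarrow> 'a mode_algebra_plus \<Rightarrow> 'a mode_algebra_plus" is scaleC
  by (rule complex_vector.span_scale)
instance
  by standard
    (transfer; simp add: complex_vector.scale_right_distrib complex_vector.scale_left_distrib)+
end

text \<open>\<open>\<O>(A; f)\<close> as an element of \<open>U\<^sub>+(V)\<close>, for \<open>f\<close> in \<open>conf_ring_plus (length A)\<close>.\<close>

definition mode_plus :: "'v::graded_vertex_algebra list \<Rightarrow> ratfun \<Rightarrow> 'v mode_algebra_plus"
  where "mode_plus A f = Abs_mode_algebra_plus (mode A f)"

definition mode_unit_plus :: "'v::graded_vertex_algebra mode_algebra_plus"
  where "mode_unit_plus = Abs_mode_algebra_plus mode_unit"


section \<open>The meromorphic coproduct and the covacuum\<close>

text \<open>The expansion, as a Laurent series in \<open>w\<^sup>-\<^sup>1\<close>, of \<open>f\<close> with \<open>z\<^sub>j\<close> replaced by \<open>z\<^sub>j + w\<close> for \<open>j \<in> J\<close>.\<close>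

definition expand_shift :: "nat set \<Rightarrow> ratfun \<Rightarrow> ratfun fls"
  where "expand_shift J =
    laurent_subst (\<lambda>j. if j \<in> J then fls_const (var j) + fls_X_inv else fls_const (var j))"

text \<open>
  \<open>ps\<close> writes \<open>h\<close> as a finite sum of products of a function of \<open>z\<^sub>I\<close> and a function of \<open>z\<^sub>J\<close>; the
  factors are given as functions of \<open>card I\<close> and \<open>card J\<close> variables.
\<close>

definition splits :: "nat set \<Rightarrow> nat set \<Rightarrow> ratfun \<Rightarrow> (ratfun \<times> ratfun) list \<Rightarrow> bool"
  where "splits I J h ps \<longleftrightarrow>
    (\<forall>(p, q)\<in>set ps. p \<in> conf_ring (card I) \<and> q \<in> conf_ring_plus (card J)) \<and>
    h = (\<Sum>(p, q)\<leftarrow>ps. rename_vars (\<lambda>k. sorted_list_of_set I ! k) p *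
                       rename_vars (\<lambda>k. sorted_list_of_set J ! k) q)"

definition split_mode ::
    "'v::graded_vertex_algebra list \<Rightarrow> nat set \<Rightarrow> nat set \<Rightarrow> ratfun \<Rightarrow> 'v mode_algebra \<otimes> 'v mode_algebra_plus"
  where "split_mode A I J h =
    (THE x. \<exists>ps. splits I J h ps \<and> x = (\<Sum>(p, q)\<leftarrow>ps. mode (nths A I) p \<otimes> mode_plus (nths A J) q))"

definition coproduct ::
    "'v::graded_vertex_algebra mode_algebra \<Rightarrow> ('v mode_algebra \<otimes> 'v mode_algebra_plus) fls"
  where "coproduct = (THE \<Delta>. (\<forall>s. clinear (coeff_map \<Delta> s)) \<and>
    (\<forall>A f s. A \<noteq> [] \<longrightarrow> f \<in> conf_ring (length A) \<longrightarrow>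
      \<Delta> (mode A f) $$ s = (\<Sum>I\<in>Pow {..<length A}.
        let J = {..<length A} - I in split_mode A I J (expand_shift J f $$ s))))"

text \<open>The restriction of \<^const>\<open>coproduct\<close> to \<open>U\<^sub>+(V)\<close>, with values in \<open>(U\<^sub>+(V) \<otimes> U\<^sub>+(V))((w\<^sup>-\<^sup>1))\<close>.\<close>

definition coproduct_plus ::
    "'v::graded_vertex_algebra mode_algebra_plus \<Rightarrow> ('v mode_algebra_plus \<otimes> 'v mode_algebra_plus) fls"
  where "coproduct_plus x = (THE y. \<forall>s.
    tensor_map Rep_mode_algebra_plus id (y $$ s) = coproduct (Rep_mode_algebra_plus x) $$ s)"

text \<open>The premise \<open>vac \<noteq> 0\<close> excludes only the zero vertex algebra, for which the unit is \<open>0\<close>.\<close>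

definition covacuum :: "'v::graded_vertex_algebra mode_algebra_plus \<Rightarrow> complex"
  where "covacuum = (THE C. clinear C \<and>
    ((vac :: 'v) \<noteq> 0 \<longrightarrow> C mode_unit_plus = 1) \<and>
    (\<forall>A f. A \<noteq> [] \<longrightarrow> f \<in> conf_ring_plus (length A) \<longrightarrow> C (mode_plus A f) = 0))"

end

(* A family of values on the symbols O(A_1,...,A_n; f) descends to a linear map on U(V) as soon as it
respects the relations (i)-(iii), and this is how the coproduct and the covacuum are shown to exist.
For the coproduct, the relations hold because the residue at z_i = 0 and the Laurent expansion at
z_i = z_j commute with the expansion at large w. For the covacuum, the unit must be separated from the
O(A_1,...,A_n; f) with f regular at z_i = 0. To this end U(V) acts on V: O(A_1,...,A_n; f) is the iterated
residue of f times the product of the fields of the A_i, where relation (iii) is the Borcherds commutator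
formula, and functions f regular at z_i = 0 send the vacuum to 0.

Each axiom can then be checked on symbols, where it is a statement about f alone. In the locality and
comodule axioms, the terms on both sides belonging to a partition of {1,...,n} into I, J, K are expansions,
for w and z large in different orders, of the same rational function, f with z_j shifted for j in J and K. *)

theory Submission
 imports Defs
begin

text \<open>The relations number variables by position and renumber them whenever a variable
  disappears. Arbitrary distinct labels replace positions (\<open>labelled_functional\<close>), so
  that restriction to a subset of the variables costs nothing. The value of a splitting must not
  depend on how a function is written as a sum of products p(z_I) q(z_J). This holds because
  functions of z_J that are independent over the constants stay independent over the functions of
  z_I. Expansion at large w turns a pole at z_i = z_j with exactly one of i, j in J into a series
  with polynomial coefficients; this puts the second tensor factor in U_+, and such J leave no
  commutator terms. The class of vertex algebras assumes locality only, so the Borcherds identity is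
  derived from it, by Dong's lemma and Goddard's uniqueness theorem. A presentation by powers of the
  inverses of z, w and z + w or z - w is not unique, so none is written down for f: the functions
  that have one are shown to be closed under multiplication by the generators of the ring.\<close>

abbreviation (input) scale (infixr "*." 75) where "scale == scaleC"
lemmas cv_maximal_independent_subset = complex_vector.maximal_independent_subset
 and cv_scale_minus_left = complex_vector.scale_minus_left
 and cv_scale_right_diff_distrib = complex_vector.scale_right_diff_distrib
 and cv_scale_sum_right = complex_vector.scale_sum_right
 and cv_span_add = complex_vector.span_add
 and cv_span_base = complex_vector.span_base
 and cv_span_induct_alt = complex_vector.span_induct_alt
 and cv_span_mono = complex_vector.span_mono
 and cv_span_scale = complex_vector.span_scale
 and cv_span_zero = complex_vector.span_zero
lemmas RepU = Rep_mode_algebra_plus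
abbreviation (input) "pdv == partial_deriv"
abbreviation (input) "rnm == rename_vars"
abbreviation (input) "xsh == expand_shift"
abbreviation (input) "lsub == laurent_subst"
abbreviation (input) "cspan == complex_vector.span"
abbreviation (input) "lkp == Poly_Mapping.lookup"
abbreviation (input) "sgl == Poly_Mapping.single"
abbreviation (input) "pkeys == Poly_Mapping.keys"
abbreviation (input) "Frc == Fraction_Field.Fract"
abbreviation (input) "RepU == Rep_mode_algebra_plus"
abbreviation (input) "same_exp == expansions_of_same_element"
abbreviation (input) "exz == expand_z_large"
abbreviation (input) "exw == expand_w_large"
abbreviation (input) "bfam == bounded_family"
abbreviation (input) "slist == sorted_list_of_set"
abbreviation (input) "copU == coproduct_plus"
abbreviation (input) "fsubdeg == fls_subdegree"

section \<open>Linear maps and tensor products\<close>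

lemma clinearI:
 assumes "!!x y. f (x + y) = f x + f y" "!!c x. f (c *. x) = c *. f x"
 shows "clinear f"
 by unfold_locales (use assms in auto)

lemma lin_iff: "clinear f \<longleftrightarrow> (ALL x y. f (x + y) = f x + f y) & (ALL c x. f (c *. x) = c *. f x)"
 by (metis Vector_Spaces.linear_iff clinearI)

lemma lin_add: "clinear f ==> f (x + y) = f x + f y"
 and lin_scale: "clinear f ==> f (c *. x) = c *. f x"
 by (simp_all add: lin_iff)

lemma lin_zero: "clinear f ==> f 0 = 0"
 using lin_add[of f 0 0] by simp

lemma lin_neg: "clinear f ==> f (- x) = - f x"
 using lin_add[of f x "- x"] by (simp add: lin_zero eq_neg_iff_add_eq_0 add.commute)

lemma lin_diff: "clinear f ==> f (x - y) = f x - f y"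
 using lin_add[of f x "- y"] by (simp add: lin_neg)

lemma lin_sum: "clinear f ==> f (sum g A) = (SUM x:A. f (g x))"
 by (induction A rule: infinite_finite_induct) (simp_all add: lin_zero lin_add)

lemma lin_sum_list: "clinear f ==> f (sum_list xs) = (SUM x<-xs. f x)"
 by (induction xs) (simp_all add: lin_zero lin_add)

lemma lin_Sum_any:
 assumes "clinear f" "finite {k. g k ~= 0}"
 shows "f (Sum_any g) = Sum_any (%k. f (g k))"
proof -
 have "Sum_any (%k. f (g k)) = (SUM k:{k. g k ~= 0}. f (g k))"
  by (rule Sum_any.expand_superset[OF assms(2)]) (auto simp: lin_zero[OF assms(1)])
 thus ?thesis by (simp add: Sum_any.expand_set lin_sum[OF assms(1)])
qed

lemma Sum_any_superset: "finite A ==> (!!x. x ~: A ==> g x = 0) ==> Sum_any g = sum g A"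
 by (rule Sum_any.expand_superset) auto

lemma lin_id [simp]: "clinear id" "clinear (%x. x)"
 and lin_0 [simp]: "clinear (%x. 0)"
 by (auto intro!: clinearI)

lemma lin_comp: "clinear f ==> clinear g ==> clinear (%x. f (g x))"
 by (simp add: lin_iff)

lemma lin_plus: "clinear f ==> clinear g ==> clinear (%x. f x + g x)"
 by (simp add: lin_iff algebra_simps scaleC_add_right)

lemma lin_minus: "clinear f ==> clinear g ==> clinear (%x. f x - g x)"
 by (simp add: lin_iff algebra_simps cv_scale_right_diff_distrib)

lemma lin_scaled: "clinear f ==> clinear (%x. c *. f x)"
 by (simp add: lin_iff scaleC_add_right scaleC_scaleC mult.commute)

lemma lin_sums: "(!!i. i : A ==> clinear (f i)) ==> clinear (%x. SUM i:A. f i x)"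
 by (induction A rule: infinite_finite_induct) (auto intro: lin_plus)

lemma lin_eq_on_span:
 assumes "clinear f" "clinear g" "!!x. x : S ==> f x = g x" "x : cspan S"
 shows "f x = g x"
 using assms(4)
proof (induction rule: cv_span_induct_alt)
 case base thus ?case by (simp add: lin_zero assms)
next
 case (step c x y) thus ?case
  by (simp add: lin_add[OF assms(1)] lin_add[OF assms(2)] lin_scale[OF assms(1)]
    lin_scale[OF assms(2)] assms(3))
qed

lemma lin_span_in:
 assumes "clinear f" "x : cspan S" "!!x. x : S ==> f x : cspan T"
 shows "f x : cspan T"
 using assms(2)
proof (induction rule: cv_span_induct_alt)
 case base thus ?case by (simp add: lin_zero assms cv_span_zero)
next
 case (step c x y) thus ?case
  by (simp add: lin_add[OF assms(1)] lin_scale[OF assms(1)] assms(3)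
    cv_span_add cv_span_scale)
qed

lemma scaleC_complex [simp]: "(c :: complex) *. d = c * d"
 by (simp add: scaleC_complex_def)

lemma lin_extend:
 fixes f :: "'a::complex_vector => 'b::complex_vector"
 assumes "complex_vector.independent B"
 obtains g where "clinear g" "!!x. x : B ==> g x = f x"
proof -
 interpret vector_space_pair "scaleC :: complex => 'a => 'a" "scaleC :: complex => 'b => 'b"
  by unfold_locales
 show thesis using linear_independent_extend[OF assms, of f] that by blast
qed

lemma lin_left_inverse:
 fixes f :: "'a::complex_vector => 'b::complex_vector"
 assumes "clinear f" "inj f"
 obtains g where "clinear g" "!!x. g (f x) = x"
proof -
 interpret vector_space_pair "scaleC :: complex => 'a => 'a" "scaleC :: complex => 'b => 'b"
  by unfold_locales
 show thesis using linear_injective_left_inverse[OF assms] that by (metis comp_apply id_apply)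
qed

section \<open>Free vector spaces and linear maps out of quotients\<close>

definition free_lift :: "('x => 'b::complex_vector) => ('x \<Rightarrow>\<^sub>0 complex) => 'b"
 where "free_lift ph p = (SUM k:pkeys p. lkp p k *. ph k)"

lemma free_lift_superset:
 "finite A ==> pkeys p <= A ==>
  free_lift ph p = (SUM k:A. lkp p k *. ph k)"
 unfolding free_lift_def by (rule sum.mono_neutral_left) (auto simp: in_keys_iff)

lemma lookup_scaleC [simp]:
 "lkp (c *. p) k = c *. lkp p k"
 by transfer simp

lemma lin_free_lift:
 fixes ph :: "'x => 'b::complex_vector"
 shows "clinear (free_lift ph)"
proof (rule clinearI)
 fix x y :: "'x \<Rightarrow>\<^sub>0 complex"
 let ?A = "pkeys x Un pkeys y"
 have "free_lift ph (x + y) = (SUM k:?A. lkp (x + y) k *. ph k)"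
  by (rule free_lift_superset) (use Poly_Mapping.keys_add[of x y] in auto)
 also have "... = free_lift ph x + free_lift ph y"
  by (subst (1 2) free_lift_superset[of ?A])
    (auto simp: lookup_add scaleC_add_left sum.distrib)
 finally show "free_lift ph (x + y) = free_lift ph x + free_lift ph y" .
next
 fix c and x :: "'x \<Rightarrow>\<^sub>0 complex"
 show "free_lift ph (c *. x) = c *. free_lift ph x"
  by (subst (1 2) free_lift_superset[of "pkeys x"])
    (auto simp: in_keys_iff scaleC_scaleC cv_scale_sum_right)
qed

lemma free_lift_single [simp]: "free_lift ph (sgl k 1) = ph k"
 by (simp add: free_lift_def scaleC_one)

lemma single_span: "p : cspan (range (%k. sgl k (1::complex)))"
proof (induction p rule: update_induct)
 case const show ?case by (rule cv_span_zero)
next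
 case (update f a b)
 have "Poly_Mapping.update a b f = b *. sgl a 1 + f"
  by (rule poly_mapping_eqI) (use update(1) in
   \<open>auto simp: lookup_update lookup_add lookup_single in_keys_iff when_def\<close>)
 thus ?case
  using update(3) by (auto intro!: cv_span_add cv_span_scale intro: cv_span_base)
qed

text \<open>A linear map that kills the generating relations kills their span. This argument lets
  maps descend to the tensor product, to the mode space and to the mode algebra.\<close>

lemma quotient_lift_cong:
 assumes "clinear L" "!!r. r : R ==> L r = 0" "congruent_mod R x y"
 shows "L x = L y"
proof -
 have "L (x - y) = (%_. 0) (x - y)"
  by (rule lin_eq_on_span[OF assms(1) lin_0 assms(2)]) (use assms(3) in "auto simp: congruent_mod_def")
 thus ?thesis by (simp add: lin_diff[OF assms(1)])
qed

section \<open>The universal property of the tensor product\<close>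

definition cbilinear :: "('a::complex_vector => 'b::complex_vector => 'c::complex_vector) => bool"
 where "cbilinear bei \<longleftrightarrow> (ALL a. clinear (bei a)) & (ALL b. clinear (%a. bei a b))"

lemma congruent_mod_base: "x - y : R ==> congruent_mod R x y"
 by (simp add: congruent_mod_def cv_span_base)

lemma tensor_add_left: "(a + a') \<otimes> b = a \<otimes> b + a' \<otimes> b"
proof (transfer, rule congruent_mod_base)
 fix a a' :: 'a and b :: 'b
 show "sgl (a + a', b) (1::complex)
   - (sgl (a, b) 1 + sgl (a', b) 1) : bilinear_relations"
  unfolding bilinear_relations_def Let_def diff_diff_eq[symmetric] by blast
qed

lemma tensor_add_right: "a \<otimes> (b + b') = a \<otimes> b + a \<otimes> b'"
proof (transfer, rule congruent_mod_base)
 fix a :: 'a and b b' :: 'b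
 show "sgl (a, b + b') (1::complex)
   - (sgl (a, b) 1 + sgl (a, b') 1) : bilinear_relations"
  unfolding bilinear_relations_def Let_def diff_diff_eq[symmetric] by blast
qed

lemma tensor_scale_left: "(c *. a) \<otimes> b = c *. (a \<otimes> b)"
 by (transfer, rule congruent_mod_base) (unfold bilinear_relations_def Let_def, blast)

lemma tensor_scale_right: "a \<otimes> (c *. b) = c *. (a \<otimes> b)"
 by (transfer, rule congruent_mod_base) (unfold bilinear_relations_def Let_def, blast)

lemma cbilinear_tensor: "cbilinear (\<otimes>)"
 by (auto simp: cbilinear_def lin_iff tensor_add_left tensor_add_right tensor_scale_left tensor_scale_right)

lemma lin_tensor_left: "clinear (%a. a \<otimes> b)" and clinear_tensor_right: "clinear (%b. a \<otimes> b)"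
 using cbilinear_tensor by (auto simp: cbilinear_def)

lemmas tensor_zero_left [simp] = lin_zero[OF lin_tensor_left]
 and tensor_zero_right [simp] = lin_zero[OF clinear_tensor_right]

lemma abs_tensor_clinear: "clinear abs_tensor"
 by (auto intro!: clinearI simp: plus_tensor.abs_eq scaleC_tensor.abs_eq)

lemma tensor_in_span: "x : cspan {a \<otimes> b | a b. True}"
proof (induction x rule: tensor.abs_induct)
 fix p :: "'a \<times> 'b \<Rightarrow>\<^sub>0 complex"
 show "abs_tensor p : cspan {a \<otimes> b | a b. True}"
  by (rule lin_span_in[OF abs_tensor_clinear single_span])
    (unfold image_iff, elim bexE, hypsubst, rule cv_span_base, force simp: tensor.abs_eq)
qed

lemma tensor_ext:
 assumes "clinear f" "clinear g" "!!a b. f (a \<otimes> b) = g (a \<otimes> b)"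
 shows "f x = g x"
 by (rule lin_eq_on_span[OF assms(1,2) _ tensor_in_span]) (auto simp: assms(3))

text \<open>A scalar is absorbed into the left factor of a pure tensor, so sums of pure tensors
  exhaust the tensor product.\<close>

lemma tensor_induct [case_names tensor add]:
 assumes "!!a b. P (a \<otimes> b)" "!!x y. P x ==> P y ==> P (x + y)"
 shows "P x"
 using tensor_in_span[of x]
proof (induction rule: cv_span_induct_alt)
 case base show ?case using assms(1)[of 0 0] by simp
next
 case (step c x y) thus ?case using assms by (auto simp: tensor_scale_left[symmetric])
qed

text \<open>Existence comes from the linear extension to the free space on pairs, which kills the
  bilinear relations; uniqueness holds because pure tensors span. This gives the \<open>THE\<close>
  in \<open>tensor_lift\<close> its meaning.\<close>

lemma tensor_lift_ex:
 assumes "cbilinear bei"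
 shows "EX! h. clinear h & (ALL a b. h (a \<otimes> b) = bei a b)"
proof -
 define L where "L = free_lift (%(a, b). bei a b)"
 have L: "clinear L" by (simp add: L_def lin_free_lift)
 have rel: "L r = 0" if "r : bilinear_relations" for r
  using that assms unfolding bilinear_relations_def Let_def
  by (auto simp: lin_diff[OF L] lin_scale[OF L] cbilinear_def lin_iff)
    (auto simp: L_def)
 define h where "h x = L (rep_tensor x)" for x
 have h: "h (abs_tensor p) = L p" for p unfolding h_def
  by (rule quotient_lift_cong[OF L rel]) (auto intro: Quotient3_rep_abs[OF Quotient3_tensor] simp: congruent_mod_refl)
 have "clinear h"
 proof (rule clinearI)
  fix x y :: "'a \<otimes> 'b" and c
  show "h (x + y) = h x + h y"
   by (induction x rule: tensor.abs_induct, induction y rule: tensor.abs_induct)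
    (simp add: plus_tensor.abs_eq h lin_add[OF L])
  show "h (c *. x) = c *. h x"
   by (induction x rule: tensor.abs_induct) (simp add: scaleC_tensor.abs_eq h lin_scale[OF L])
 qed
 moreover have "h (a \<otimes> b) = bei a b" for a b
  by (simp add: tensor.abs_eq h) (simp add: L_def)
 ultimately show ?thesis
  by (intro ex1I[of _ h] conjI allI) (auto intro: tensor_ext[THEN ext])
qed

lemma lin_tensor_lift: "cbilinear bei ==> clinear (tensor_lift bei)"
 and tensor_lift [simp]: "cbilinear bei ==> tensor_lift bei (a \<otimes> b) = bei a b"
 using theI'[OF tensor_lift_ex[of bei]] by (auto simp: tensor_lift_def)

lemma cbilinearI:
 assumes "!!a a' b. bei (a + a') b = bei a b + bei a' b" "!!a b b'. bei a (b + b') = bei a b + bei a b'"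
  "!!c a b. bei (c *. a) b = c *. bei a b" "!!c a b. bei a (c *. b) = c *. bei a b"
 shows "cbilinear bei"
 unfolding cbilinear_def by (auto intro!: clinearI simp: assms)

lemma cbilinear_tmap: "clinear f ==> clinear g ==> cbilinear (%a b. f a \<otimes> g b)"
 by (rule cbilinearI)
  (simp_all add: lin_add lin_scale tensor_add_left tensor_add_right tensor_scale_left tensor_scale_right)

lemma tensor_map [simp]: "clinear f ==> clinear g ==> tensor_map f g (a \<otimes> b) = f a \<otimes> g b"
 and lin_tmap: "clinear f ==> clinear g ==> clinear (tensor_map f g)"
 unfolding tensor_map_def by (simp_all add: cbilinear_tmap lin_tensor_lift)

lemma cbilinear_swap: "cbilinear (%a b. b \<otimes> a)"
 by (rule cbilinearI) (simp_all add: tensor_add_left tensor_add_right tensor_scale_left tensor_scale_right)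

lemma tensor_swap [simp]: "tensor_swap (a \<otimes> b) = b \<otimes> a"
 and lin_tensor_swap: "clinear tensor_swap"
 unfolding tensor_swap_def by (simp_all add: cbilinear_swap lin_tensor_lift)

lemma cbilinear_contract_right: "clinear ph ==> cbilinear (%a b. ph b *. a)"
 by (rule cbilinearI)
  (simp_all add: lin_add lin_scale scaleC_add_left scaleC_add_right scaleC_scaleC mult.commute)

lemma contract_right [simp]: "clinear ph ==> contract_right ph (a \<otimes> b) = ph b *. a"
 and lin_contract_right: "clinear ph ==> clinear (contract_right ph)"
 unfolding contract_right_def by (simp_all add: cbilinear_contract_right lin_tensor_lift)

lemma cbilinear_contract_left: "clinear ph ==> cbilinear (%a b. ph a *. b)"
 by (rule cbilinearI)
  (simp_all add: lin_add lin_scale scaleC_add_left scaleC_add_right scaleC_scaleC mult.commute)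

lemma contract_left [simp]: "clinear ph ==> contract_left ph (a \<otimes> b) = ph a *. b"
 and lin_contract_left: "clinear ph ==> clinear (contract_left ph)"
 unfolding contract_left_def by (simp_all add: cbilinear_contract_left lin_tensor_lift)

lemma cbilinear_assoc_inner: "cbilinear (%a b. a \<otimes> (b \<otimes> c))"
 by (rule cbilinearI) (simp_all add: tensor_add_left tensor_add_right tensor_scale_left tensor_scale_right)

lemma cbilinear_assoc: "cbilinear (%x c. tensor_lift (%a b. a \<otimes> (b \<otimes> c)) x)"
 unfolding cbilinear_def
proof (intro conjI allI)
 fix x :: "'a::complex_vector \<otimes> 'b::complex_vector"
 show "clinear (%c :: 'c. tensor_lift (%a b. a \<otimes> (b \<otimes> c)) x)"
 proof (induction x rule: tensor_induct)
  case (tensor a b) show ?case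
   unfolding tensor_lift[OF cbilinear_assoc_inner]
   by (rule clinearI) (simp_all add: tensor_add_right tensor_scale_right)
 next
  case (add x y) thus ?case
   by (simp add: lin_add[OF lin_tensor_lift[OF cbilinear_assoc_inner]] lin_plus)
 qed
qed (rule lin_tensor_lift[OF cbilinear_assoc_inner])

lemma tensor_assoc [simp]: "tensor_assoc ((a \<otimes> b) \<otimes> c) = a \<otimes> (b \<otimes> c)"
 and lin_tensor_assoc: "clinear tensor_assoc"
 unfolding tensor_assoc_def by (simp_all add: cbilinear_assoc cbilinear_assoc_inner lin_tensor_lift)

section \<open>Substitution into rational functions\<close>

lemma poly_mapping_single_induct [case_names zero add]:
 assumes "P 0" "!!m c p. P p ==> P (sgl m c + p)"
 shows "P (p :: 'a \<Rightarrow>\<^sub>0 'b::comm_monoid_add)"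
proof (induction p rule: update_induct)
 case const show ?case by (rule assms(1))
next
 case (update f a b)
 have "Poly_Mapping.update a b f = sgl a b + f"
  by (rule poly_mapping_eqI) (use update(1) in
   \<open>auto simp: lookup_update lookup_add lookup_single in_keys_iff when_def\<close>)
 thus ?case using assms(2) update(3) by simp
qed

definition mon_eval :: "(nat => 'k::field) => (nat \<Rightarrow>\<^sub>0 nat) => 'k"
 where "mon_eval sg m = (\<Prod>i\<in>pkeys m. sg i ^ lkp m i)"

lemma mon_eval_superset:
 "finite A ==> pkeys m <= A ==> mon_eval sg m = (\<Prod>i\<in>A. sg i ^ lkp m i)"
 unfolding mon_eval_def by (rule prod.mono_neutral_left) (auto simp: in_keys_iff)

lemma mon_eval_add: "mon_eval sg (m + n) = mon_eval sg m * mon_eval sg n"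
proof -
 let ?A = "pkeys m Un pkeys n"
 have "mon_eval sg (m + n) = (\<Prod>i\<in>?A. sg i ^ lkp (m + n) i)"
  by (rule mon_eval_superset) (use Poly_Mapping.keys_add[of m n] in auto)
 also have "... = mon_eval sg m * mon_eval sg n"
  by (subst (1 2) mon_eval_superset[of ?A]) (auto simp: lookup_add power_add prod.distrib)
 finally show ?thesis .
qed

lemma mon_eval_0 [simp]: "mon_eval sg 0 = 1"
 by (simp add: mon_eval_def)

lemma mon_eval_single [simp]: "mon_eval sg (sgl i n) = sg i ^ n"
 by (cases "n = 0") (simp_all add: mon_eval_def)

lemma var_nonzero [simp]: "var i ~= 0"
 by (simp add: var_def Zero_fract_def eq_fract)
   (metis lookup_single_eq lookup_zero zero_neq_one)

lemma var_inject [simp]: "var i = var j \<longleftrightarrow> i = j"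
proof -
 have "sgl (sgl i (1::nat)) (1::complex) = sgl (sgl j 1) 1 \<longleftrightarrow> i = j"
  by (metis lookup_single_eq lookup_single_not_eq zero_neq_one)
 thus ?thesis by (simp add: var_def eq_fract)
qed

lemma ratC_0 [simp]: "ratC 0 = 0" and ratC_1 [simp]: "ratC 1 = 1"
 by (simp_all add: ratC_def Zero_fract_def One_fract_def)

lemma ratC_add: "ratC (a + b) = ratC a + ratC b"
 by (simp add: ratC_def single_add)

lemma ratC_mult: "ratC (a * b) = ratC a * ratC b"
 by (simp add: ratC_def mult_single)

lemma ratC_uminus: "ratC (- a) = - ratC a"
 by (simp add: ratC_def single_uminus)

lemma ratC_diff: "ratC (a - b) = ratC a - ratC b"
 using ratC_add[of a "- b"] by (simp add: ratC_uminus)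

lemma ratC_eq_iff [simp]: "ratC a = ratC b \<longleftrightarrow> a = b"
 unfolding ratC_def by (simp add: eq_fract) (metis lookup_single_eq)

lemma ratC_eq_0_iff [simp]: "ratC a = 0 \<longleftrightarrow> a = 0"
 using ratC_eq_iff[of a 0] by (simp del: ratC_eq_iff)

lemma ratC_of_nat: "ratC (of_nat n) = of_nat n"
 by (induction n) (simp_all add: ratC_add)

lemma ratC_of_int: "ratC (of_int n) = of_int n"
 by (cases n) (simp_all add: ratC_of_nat ratC_uminus ratC_diff)

text \<open>Evaluation is multiplicative on polynomials and passes to the fractions in
  \<open>dom\<close>, which have some representation with nonvanishing denominator. Two embeddings
  of the constants are used: into rational functions, for renaming and specialisation, and into
  Laurent series over them, for expansion.\<close>

locale subst_hom =
 fixes kp :: "complex => 'k::field" and sg :: "nat => 'k"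
 assumes emb_1: "kp 1 = 1" and emb_add: "kp (a + b) = kp a + kp b" and emb_mult: "kp (a * b) = kp a * kp b"
begin

lemma emb_0: "kp 0 = 0"
 by (metis add.right_neutral add_left_cancel emb_add)

lemma poly_eval_superset:
 "finite A ==> pkeys p <= A ==>
  poly_eval kp sg p = (SUM m:A. kp (lkp p m) * mon_eval sg m)"
 unfolding poly_eval_def mon_eval_def by (rule sum.mono_neutral_left) (auto simp: in_keys_iff emb_0)

lemma poly_eval_add: "poly_eval kp sg (p + q) = poly_eval kp sg p + poly_eval kp sg q"
proof -
 let ?A = "pkeys p Un pkeys q"
 have "poly_eval kp sg (p + q) = (SUM m:?A. kp (lkp (p + q) m) * mon_eval sg m)"
  by (rule poly_eval_superset) (use Poly_Mapping.keys_add[of p q] in auto)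
 also have "... = poly_eval kp sg p + poly_eval kp sg q"
  by (subst (1 2) poly_eval_superset[of ?A])
    (auto simp: lookup_add emb_add sum.distrib distrib_right)
 finally show ?thesis .
qed

lemma poly_eval_0 [simp]: "poly_eval kp sg 0 = 0"
 by (simp add: poly_eval_def)

lemma poly_eval_single: "poly_eval kp sg (sgl m c) = kp c * mon_eval sg m"
 by (cases "c = 0") (simp_all add: poly_eval_def mon_eval_def emb_0)

lemma poly_eval_1 [simp]: "poly_eval kp sg 1 = 1"
 using poly_eval_single[of 0 1] by (simp add: emb_1)

lemma poly_eval_mult: "poly_eval kp sg (p * q) = poly_eval kp sg p * poly_eval kp sg q"
proof (induction p rule: poly_mapping_single_induct)
 case (add m c p)
 have "poly_eval kp sg (sgl m c * q) = kp c * mon_eval sg m * poly_eval kp sg q"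
  by (induction q rule: poly_mapping_single_induct)
    (simp_all add: distrib_left poly_eval_add mult_single poly_eval_single emb_mult mon_eval_add)
 thus ?case using add by (simp add: distrib_right poly_eval_add poly_eval_single)
qed simp

definition dom :: "ratfun => bool"
 where "dom f \<longleftrightarrow> (EX p q. f = Frc p q & poly_eval kp sg q ~= 0)"

lemma dom_Fract: "poly_eval kp sg q ~= 0 ==> dom (Frc p q)"
 by (auto simp: dom_def)

text \<open>Two representations of a fraction satisfy \<open>p * q' = p' * q\<close>; evaluating
  this identity shows that the quotient of the values does not depend on the choice.\<close>

lemma subst_Fract:
 assumes "poly_eval kp sg q ~= 0"
 shows "rat_subst kp sg (Frc p q) = poly_eval kp sg p / poly_eval kp sg q"
 unfolding rat_subst_def
proof (rule the_equality)
 show "EX p' q'. Frc p q = Frc p' q' & poly_eval kp sg q' ~= 0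
  & poly_eval kp sg p / poly_eval kp sg q = poly_eval kp sg p' / poly_eval kp sg q'"
  using assms by blast
next
 fix y assume "EX p' q'. Frc p q = Frc p' q' & poly_eval kp sg q' ~= 0
  & y = poly_eval kp sg p' / poly_eval kp sg q'"
 then obtain p' q' where *: "Frc p q = Frc p' q'" "poly_eval kp sg q' ~= 0"
  "y = poly_eval kp sg p' / poly_eval kp sg q'" by blast
 have "q ~= 0" "q' ~= 0" using assms *(2) by auto
 hence "p * q' = p' * q" using *(1) by (simp add: eq_fract)
 hence "poly_eval kp sg p * poly_eval kp sg q' = poly_eval kp sg p' * poly_eval kp sg q"
  by (metis poly_eval_mult)
 thus "y = poly_eval kp sg p / poly_eval kp sg q"
  using assms *(2) unfolding *(3) by (simp add: frac_eq_eq)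
qed

lemma domE:
 assumes "dom f"
 obtains p q where "f = Frc p q" "poly_eval kp sg q ~= 0" "q ~= 0"
  "rat_subst kp sg f = poly_eval kp sg p / poly_eval kp sg q"
proof -
 obtain p q where "f = Frc p q" "poly_eval kp sg q ~= 0" using assms by (auto simp: dom_def)
 thus thesis using that[of p q] poly_eval_0 by (metis subst_Fract)
qed

lemma dom_ratC [simp]: "dom (ratC c)" and subst_ratC [simp]: "rat_subst kp sg (ratC c) = kp c"
 by (simp_all add: ratC_def dom_Fract subst_Fract poly_eval_single)

lemma dom_var [simp]: "dom (var i)" and subst_var [simp]: "rat_subst kp sg (var i) = sg i"
 by (simp_all add: var_def dom_Fract subst_Fract poly_eval_single emb_1)

lemma dom_0 [simp]: "dom 0" and subst_0 [simp]: "rat_subst kp sg 0 = 0"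
 and dom_1 [simp]: "dom 1" and subst_1 [simp]: "rat_subst kp sg 1 = 1"
 using dom_ratC[of 0] subst_ratC[of 0] dom_ratC[of 1] subst_ratC[of 1]
 by (simp_all add: emb_0 emb_1)

lemma assumes "dom f" "dom g"
 shows dom_add: "dom (f + g)" and subst_add: "rat_subst kp sg (f + g) = rat_subst kp sg f + rat_subst kp sg g"
  and dom_mult: "dom (f * g)" and subst_mult: "rat_subst kp sg (f * g) = rat_subst kp sg f * rat_subst kp sg g"
proof -
 obtain p q where 1: "f = Frc p q" "poly_eval kp sg q ~= 0" "q ~= 0"
  "rat_subst kp sg f = poly_eval kp sg p / poly_eval kp sg q" by (rule domE[OF assms(1)])
 obtain p' q' where 2: "g = Frc p' q'" "poly_eval kp sg q' ~= 0" "q' ~= 0"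
  "rat_subst kp sg g = poly_eval kp sg p' / poly_eval kp sg q'" by (rule domE[OF assms(2)])
 have a: "f + g = Frc (p * q' + p' * q) (q * q')" and m: "f * g = Frc (p * p') (q * q')"
  using 1(1,3) 2(1,3) by simp_all
 have nz: "poly_eval kp sg (q * q') ~= 0" using 1(2) 2(2) by (simp add: poly_eval_mult)
 show "dom (f + g)" "dom (f * g)" unfolding a m by (rule dom_Fract[OF nz])+
 show "rat_subst kp sg (f + g) = rat_subst kp sg f + rat_subst kp sg g"
  "rat_subst kp sg (f * g) = rat_subst kp sg f * rat_subst kp sg g"
  unfolding a m 1(4) 2(4) subst_Fract[OF nz] using 1(2) 2(2)
  by (simp_all add: poly_eval_mult poly_eval_add add_frac_eq)
qed

lemma assumes "dom f" "rat_subst kp sg f ~= 0"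
 shows dom_inverse: "dom (inverse f)" and subst_inverse: "rat_subst kp sg (inverse f) = inverse (rat_subst kp sg f)"
proof -
 obtain p q where 1: "f = Frc p q" "poly_eval kp sg q ~= 0" "q ~= 0"
  "rat_subst kp sg f = poly_eval kp sg p / poly_eval kp sg q" by (rule domE[OF assms(1)])
 hence "poly_eval kp sg p ~= 0" using assms(2) by auto
 thus "dom (inverse f)" "rat_subst kp sg (inverse f) = inverse (rat_subst kp sg f)"
  using 1 by (simp_all add: dom_Fract subst_Fract)
qed

lemma assumes "dom f"
 shows dom_uminus: "dom (- f)" and subst_uminus: "rat_subst kp sg (- f) = - rat_subst kp sg f"
proof -
 have "- f = ratC (- 1) * f" by (simp add: ratC_uminus)
 moreover have "kp (- 1) = - 1" using emb_add[of 1 "-1"] by (simp add: emb_0 emb_1 eq_neg_iff_add_eq_0 add.commute)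
 ultimately show "dom (- f)" "rat_subst kp sg (- f) = - rat_subst kp sg f"
  using assms by (metis dom_mult dom_ratC, metis subst_mult dom_ratC subst_ratC mult_minus1)
qed

lemma assumes "dom f" "dom g"
 shows dom_diff: "dom (f - g)" and subst_diff: "rat_subst kp sg (f - g) = rat_subst kp sg f - rat_subst kp sg g"
 using assms dom_add[of f "- g"] subst_add[of f "- g"] by (simp_all add: dom_uminus subst_uminus)

end

interpretation ren: subst_hom ratC sg for sg
 by unfold_locales (simp_all add: ratC_add ratC_mult)

interpretation lau: subst_hom "%c. fls_const (ratC c)" sg for sg
 by unfold_locales (simp_all add: ratC_add ratC_mult fls_plus_const fls_const_mult_const)

section \<open>Algebras generated by variables and inverses\<close>

lemma ga_0: "0 : generated_algebra G" and ga_1: "1 : generated_algebra G"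
 using generated_algebra.const[of 0 G] generated_algebra.const[of 1 G] by simp_all

lemma ga_uminus: "f : generated_algebra G ==> - f : generated_algebra G"
 using generated_algebra.mult[OF generated_algebra.const[of "- 1"]] by (fastforce simp: ratC_uminus)

lemma ga_diff: "f : generated_algebra G ==> g : generated_algebra G ==> f - g : generated_algebra G"
 using generated_algebra.add[OF _ ga_uminus] by fastforce

lemma ga_sum: "(!!x. x : A ==> f x : generated_algebra G) ==> sum f A : generated_algebra G"
 by (induction A rule: infinite_finite_induct) (auto intro: ga_0 generated_algebra.add)

lemma ga_power: "f : generated_algebra G ==> f ^ n : generated_algebra G"
 by (induction n) (auto intro: ga_1 generated_algebra.mult)

lemma ga_subset: "G <= generated_algebra H ==> f : generated_algebra G ==> f : generated_algebra H"
 by (rotate_tac, induction rule: generated_algebra.induct)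
   (auto intro: generated_algebra.const generated_algebra.add generated_algebra.mult)

lemma ga_mono: "G <= H ==> generated_algebra G <= generated_algebra H"
 by (meson ga_subset generated_algebra.gen subsetD subsetI)

text \<open>Laurent polynomial directions are recorded in \<open>Z\<close>, invertible differences in \<open>D\<close>.\<close>

definition cgen :: "nat set => nat set => (nat \<times> nat) set => ratfun set"
 where "cgen S Z D = {var i | i. i : S} Un {inverse (var i) | i. i : Z} Un
   {inverse (var i - var j) | i j. (i, j) : D}"

text \<open>A single family of rings covers the two function rings of the definitions and also the
  intermediate ones that arise when an expansion removes some of the poles.\<close>

definition cring :: "nat set => nat set => (nat \<times> nat) set => ratfun set"
 where "cring S Z D = generated_algebra (cgen S Z D)"

definition offdiag :: "nat set => (nat \<times> nat) set"
 where "offdiag S = {(i, j). i : S & j : S & i ~= j}"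

definition conf :: "nat set => ratfun set" where "conf S = cring S S (offdiag S)"
definition confp :: "nat set => ratfun set" where "confp S = cring S {} (offdiag S)"

lemma conf_ring_eq: "conf_ring n = conf {..<n}"
 unfolding conf_ring_def conf_def cring_def cgen_def offdiag_def
 by (rule arg_cong[of _ _ generated_algebra]) auto

lemma conf_ring_plus_eq: "conf_ring_plus n = confp {..<n}"
 unfolding conf_ring_plus_def confp_def cring_def cgen_def offdiag_def
 by (rule arg_cong[of _ _ generated_algebra]) auto

lemmas cring_const [simp] = generated_algebra.const[of _ "cgen S Z D" for S Z D, folded cring_def]
 and cring_add = generated_algebra.add[of _ "cgen S Z D" for S Z D, folded cring_def]
 and cring_mult = generated_algebra.mult[of _ "cgen S Z D" for S Z D, folded cring_def]
 and cring_0 [simp] = ga_0[of "cgen S Z D" for S Z D, folded cring_def]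
 and cring_1 [simp] = ga_1[of "cgen S Z D" for S Z D, folded cring_def]
 and cring_uminus = ga_uminus[of _ "cgen S Z D" for S Z D, folded cring_def]
 and cring_diff = ga_diff[of _ "cgen S Z D" for S Z D, folded cring_def]
 and cring_sum = ga_sum[of _ _ "cgen S Z D" for S Z D, folded cring_def]
 and cring_power = ga_power[of _ "cgen S Z D" for S Z D, folded cring_def]

lemma cring_var: "i : S ==> var i : cring S Z D"
 and cring_inv: "i : Z ==> inverse (var i) : cring S Z D"
 and cring_invdiff: "(i, j) : D ==> inverse (var i - var j) : cring S Z D"
 by (auto simp: cring_def cgen_def intro!: generated_algebra.gen)

lemma cring_mono: "S <= S' ==> Z <= Z' ==> D <= D' ==> cring S Z D <= cring S' Z' D'"
 unfolding cring_def by (rule ga_mono) (auto simp: cgen_def)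

lemma conf_mono: "S <= T ==> conf S <= conf T" and confp_mono: "S <= T ==> confp S <= confp T"
 and confp_conf: "confp S <= conf S"
 unfolding conf_def confp_def by (rule cring_mono; auto simp: offdiag_def)+

lemma cring_induct [consumes 1, case_names const var inv diff add mult]:
 assumes "f : cring S Z D" "!!c. P (ratC c)" "!!i. i : S ==> P (var i)" "!!i. i : Z ==> P (inverse (var i))"
  "!!i j. (i, j) : D ==> P (inverse (var i - var j))"
  "!!f g. f : cring S Z D ==> P f ==> g : cring S Z D ==> P g ==> P (f + g)"
  "!!f g. f : cring S Z D ==> P f ==> g : cring S Z D ==> P g ==> P (f * g)"
 shows "P f"
 using assms(1) unfolding cring_def
 by (induction rule: generated_algebra.induct) (use assms(2-7) in "auto simp: cgen_def cring_def")

text \<open>A condition under which \<^const>\<open>rat_subst\<close> is a ring homomorphism on \<^const>\<open>cring\<close>.\<close>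

definition admissible :: "nat set => (nat \<times> nat) set => (nat => 'k::zero) => bool"
 where "admissible Z D sg \<longleftrightarrow> (ALL i:Z. sg i ~= 0) & (ALL (i, j):D. sg i ~= sg j)"

context subst_hom begin

lemma cring_gens:
 assumes "admissible Z D sg"
 shows "i : Z ==> dom (inverse (var i))" "i : Z ==> rat_subst kp sg (inverse (var i)) = inverse (sg i)"
  "(i, j) : D ==> dom (inverse (var i - var j))"
  "(i, j) : D ==> rat_subst kp sg (inverse (var i - var j)) = inverse (sg i - sg j)"
 using assms by (auto simp: admissible_def dom_inverse subst_inverse dom_diff subst_diff)

lemma cring_dom:
 assumes "admissible Z D sg" "f : cring S Z D"
 shows "dom f"
 using assms(2)
 by (induction rule: cring_induct) (auto simp: cring_gens[OF assms(1)] dom_add dom_mult)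

text \<open>A membership test for all coefficients at once: \<open>B\<close> will be the set of
  Laurent series with coefficients in a prescribed ring, or of series without negative
  powers.\<close>

lemma cring_image:
 assumes "admissible Z D sg" "f : cring S Z D"
  and "!!c. kp c : B" "!!x y. x : B ==> y : B ==> x + y : B" "!!x y. x : B ==> y : B ==> x * y : B"
  and "!!i. i : S ==> sg i : B" "!!i. i : Z ==> inverse (sg i) : B"
  and "!!i j. (i, j) : D ==> inverse (sg i - sg j) : B"
 shows "rat_subst kp sg f : B"
 using assms(2)
 by (induction rule: cring_induct)
  (auto simp: cring_gens[OF assms(1)] subst_add subst_mult cring_dom[OF assms(1)] assms(3-))

end

text \<open>Agreement on variables propagates to the inverted generators because the relation h *
  inverse h = 1 is preserved and inverses in a field are unique. The conditions on \<open>Z\<close>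
  and \<open>D\<close> put the elements being inverted into the ring. Many identities between
  expansions are proved by this comparison.\<close>

lemma ring_hom_unique:
 fixes Ph Ps :: "ratfun => 'k::field"
 assumes "f : cring S Z D" "!!i j. (i, j) : D ==> i ~= j & i : S & j : S" "Z <= S"
  and Ph: "!!f g. f : cring S Z D ==> g : cring S Z D ==> Ph (f + g) = Ph f + Ph g"
   "!!f g. f : cring S Z D ==> g : cring S Z D ==> Ph (f * g) = Ph f * Ph g" "Ph 1 = 1"
  and Ps: "!!f g. f : cring S Z D ==> g : cring S Z D ==> Ps (f + g) = Ps f + Ps g"
   "!!f g. f : cring S Z D ==> g : cring S Z D ==> Ps (f * g) = Ps f * Ps g"
  and eq: "!!c. Ph (ratC c) = Ps (ratC c)" "!!i. i : S ==> Ph (var i) = Ps (var i)"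
 shows "Ph f = Ps f"
proof -
 have Ps1: "Ps 1 = 1" using eq(1)[of 1] Ph(3) by simp
 have inverse_eq: "Ph (inverse h) = Ps (inverse h)"
  if "h ~= 0" "h : cring S Z D" "inverse h : cring S Z D" "Ph h = Ps h" for h
 proof -
  have "Ph (inverse h) * Ph h = 1" "Ps (inverse h) * Ps h = 1"
   using Ph(2)[OF that(3,2)] Ps(2)[OF that(3,2)] that(1) Ph(3) Ps1 by simp_all
  thus ?thesis using that(4) by (metis inverse_unique mult.commute)
 qed
 show ?thesis using assms(1)
 proof (induction rule: cring_induct)
  case (inv i) show ?case
   by (rule inverse_eq) (use inv assms(3) in "auto intro: cring_var cring_inv simp: eq")
 next
  case (diff i j)
  have *: "Ph (var i - var j) = Ps (var i - var j)"
  proof -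
   \<comment> \<open>The maps are assumed compatible with sums and products only, so the difference
     is rewritten with the constant -1.\<close>
   have e: "var i - var j = var i + ratC (- 1) * var j" by (simp add: ratC_uminus)
   show ?thesis unfolding e using assms(2)[OF diff]
    by (simp add: Ph Ps eq cring_var cring_mult)
  qed
  show ?case
   by (rule inverse_eq) (use diff * assms(2)[OF diff] in "auto intro!: cring_var cring_invdiff cring_diff")
 qed (auto simp: eq Ph Ps)
qed

section \<open>Rational functions as a complex vector space\<close>

text \<open>Its purpose is to make the rational functions a complex vector space, so that dependence
  on the function can be treated by linear algebra: bases, extension from subspaces,
  \<open>clinear\<close>.\<close>

class complex_idom = idom + complex_vector +
 assumes scaleC_times: "(c *\<^sub>C x) * y = c *\<^sub>C (x * y)"

instance complex :: complex_idom
 by standard simp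

lemma poly_scaleC_eq: "(c *. p :: _ \<Rightarrow>\<^sub>0 'b::complex_idom) = sgl 0 (c *. 1) * p"
proof -
 have "c *. p = Poly_Mapping.map ((*) (c *. 1)) p"
  by (rule poly_mapping_eqI) (simp add: map.rep_eq scaleC_times when_def)
 thus ?thesis by (simp add: mult_map_scale_conv_mult)
qed

instance poly_mapping :: ("{ordered_cancel_comm_monoid_add, linorder}", complex_idom) complex_idom
 by standard (simp add: poly_scaleC_eq mult.assoc)

instantiation fract :: (complex_idom) complex_vector
begin
definition scaleC_fract :: "complex => 'a fract => 'a fract"
 where "scaleC_fract c x = Frc (c *\<^sub>C 1) 1 * x"
instance
proof
 fix a b :: complex and x y :: "'a fract"
 have m: "(a *\<^sub>C 1) * (b *\<^sub>C 1) = (a * b) *\<^sub>C (1::'a)"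
  by (simp add: scaleC_times scaleC_scaleC)
 show "a *\<^sub>C (x + y) = a *\<^sub>C x + a *\<^sub>C y" by (simp add: scaleC_fract_def distrib_left)
 show "(a + b) *\<^sub>C x = a *\<^sub>C x + b *\<^sub>C x"
  by (simp add: scaleC_fract_def scaleC_add_left distrib_right[symmetric])
 show "a *\<^sub>C b *\<^sub>C x = (a * b) *\<^sub>C x"
  by (simp add: scaleC_fract_def m mult.assoc[symmetric])
 show "1 *\<^sub>C x = x" by (simp add: scaleC_fract_def scaleC_one One_fract_def[symmetric])
qed
end

lemma scaleC_ratfun: "c *. (f :: ratfun) = ratC c * f"
 by (simp add: scaleC_fract_def ratC_def poly_scaleC_eq)

lemma cring_scaleC: "f : cring S Z D ==> c *. f : cring S Z D"
 by (simp add: scaleC_ratfun cring_mult)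

lemma span_cring: "cspan (cring S Z D) = cring S Z D"
 by (rule complex_vector.span_subspace[OF _ _ complex_vector.subspaceI])
   (auto intro: cring_add cring_scaleC cv_span_base)

section \<open>Coefficients of Laurent series\<close>

text \<open>Any lower bounds of the supports serve in place of the subdegrees, because a map applied
  to coefficients may kill the leading ones.\<close>

lemma fls_mult_nth:
 fixes F G :: "'a::comm_ring_1 fls"
 assumes "!!k. k < a ==> F $$ k = 0" "!!k. k < b ==> G $$ k = 0"
 shows "(F * G) $$ n = (SUM i=a..n - b. F $$ i * G $$ (n - i))"
proof -
 let ?d = "fsubdeg F" and ?e = "fsubdeg G"
 let ?f = "%i. F $$ i * G $$ (n - i)"
 let ?U = "{min a ?d..max (n - b) (n - ?e)}"
 have "(F * G) $$ n = (SUM i=?d..n - ?e. ?f i)" by (rule fls_times_nth(2))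
 also have "... = (SUM i:?U. ?f i)"
  by (rule sum.mono_neutral_left) auto
 also have "... = (SUM i=a..n - b. ?f i)"
  by (rule sum.mono_neutral_right) (auto simp: assms)
 finally show ?thesis .
qed

definition coeffs_in :: "'a set => 'a::zero fls => bool"
 where "coeffs_in A F \<longleftrightarrow> (ALL n. F $$ n : A)"

lemma coeffs_inD: "coeffs_in A F ==> F $$ n : A"
 by (simp add: coeffs_in_def)

lemma coeffs_in_add: "coeffs_in (cring S Z D) F ==> coeffs_in (cring S Z D) G ==> coeffs_in (cring S Z D) (F + G)"
 by (auto simp: coeffs_in_def cring_add)

lemma coeffs_in_diff: "coeffs_in (cring S Z D) F ==> coeffs_in (cring S Z D) G ==> coeffs_in (cring S Z D) (F - G)"
 by (auto simp: coeffs_in_def cring_diff)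

lemma coeffs_in_mult: "coeffs_in (cring S Z D) F ==> coeffs_in (cring S Z D) G ==> coeffs_in (cring S Z D) (F * G)"
 by (auto simp: coeffs_in_def fls_times_nth(2) intro!: cring_sum cring_mult)

lemma coeffs_in_const: "f : cring S Z D ==> coeffs_in (cring S Z D) (fls_const f)"
 by (auto simp: coeffs_in_def)

lemma coeffs_in_X: "coeffs_in (cring S Z D) fls_X" "coeffs_in (cring S Z D) fls_X_inv"
 by (auto simp: coeffs_in_def)

lemma fls_inverse_support:
 fixes F :: "'a::field fls"
 assumes "F $$ d ~= 0" "!!k. k < d ==> F $$ k = 0"
 shows "k < - d ==> inverse F $$ k = 0" "inverse F $$ (- d) = inverse (F $$ d)"
proof -
 have d: "fsubdeg F = d" by (rule fls_subdegree_eqI) (use assms in auto)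
 show low: "k < - d ==> inverse F $$ k = 0" for k by (simp add: d)
 have "F ~= 0" using assms(1) by auto
 hence "(F * inverse F) $$ 0 = 1" by simp
 moreover have "(F * inverse F) $$ 0 = (SUM i=d..0 - (- d). F $$ i * inverse F $$ (0 - i))"
  by (rule fls_mult_nth) (use assms low in auto)
 ultimately have "F $$ d * inverse F $$ (- d) = 1" by simp
 thus "inverse F $$ (- d) = inverse (F $$ d)" by (metis inverse_unique)
qed

text \<open>The coefficients of the inverse are computed recursively from
  \<open>F * inverse F = 1\<close>, and the only division is by the leading coefficient of
  \<open>F\<close>.\<close>

lemma coeffs_in_inverse:
 assumes "coeffs_in (cring S Z D) F" "F $$ d ~= 0" "inverse (F $$ d) : cring S Z D" "!!k. k < d ==> F $$ k = 0"
 shows "coeffs_in (cring S Z D) (inverse F)"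
proof -
 let ?H = "inverse F"
 have low: "?H $$ k = 0" if "k < - d" for k using fls_inverse_support(1)[OF assms(2,4) that] .
 have "F ~= 0" using assms(2) by auto
 hence FH: "F * ?H = 1" by simp
 \<comment> \<open>The inverse starts at index -d; the induction runs over the distance from
   there.\<close>
 have "?H $$ (int n - d) : cring S Z D" for n
 proof (induction n rule: less_induct)
  case (less n)
  have "(F * ?H) $$ int n = (SUM i=d..int n - (- d). F $$ i * ?H $$ (int n - i))"
   by (rule fls_mult_nth) (use assms low in auto)
  also have "... = F $$ d * ?H $$ (int n - d) + (SUM i=d+1..int n + d. F $$ i * ?H $$ (int n - i))"
   by (subst sum.remove[of _ d]) (auto intro!: sum.cong)
  finally have "F $$ d * ?H $$ (int n - d) = (if n = 0 then 1 else 0) - (SUM i=d+1..int n + d. F $$ i * ?H $$ (int n - i))"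
   unfolding FH by (simp add: eq_diff_eq)
  hence e: "?H $$ (int n - d) = inverse (F $$ d) * ((if n = 0 then 1 else 0) - (SUM i=d+1..int n + d. F $$ i * ?H $$ (int n - i)))"
   using assms(2) by (simp add: field_simps)
  have "(SUM i=d+1..int n + d. F $$ i * ?H $$ (int n - i)) : cring S Z D"
  proof (intro cring_sum cring_mult coeffs_inD[OF assms(1)])
   fix i assume i: "i : {d+1..int n + d}"
   hence "?H $$ (int (nat (int n + d - i)) - d) : cring S Z D" by (intro less) auto
   thus "?H $$ (int n - i) : cring S Z D" using i by simp
  qed
  thus ?case unfolding e by (intro cring_mult assms(3) cring_diff) auto
 qed
 note nonneg = this
 show ?thesis unfolding coeffs_in_def
 proof
  fix k show "?H $$ k : cring S Z D"
   using nonneg[of "nat (k + d)"] low[of k] by (cases "k < - d") auto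
 qed
qed

definition fls_map :: "('a::zero => 'b::zero) => 'a fls => 'b fls"
 where "fls_map ph F = Abs_fls (%n. ph (F $$ n))"

lemma fls_map_nth [simp]: "ph 0 = 0 ==> fls_map ph F $$ n = ph (F $$ n)"
 unfolding fls_map_def by (rule nth_Abs_fls_lower_bound[of "fsubdeg F"]) auto

lemma fls_map_mult:
 fixes ph :: "ratfun => 'b::comm_ring_1"
 assumes "ph 0 = 0" "!!x y. x : cring S Z D ==> y : cring S Z D ==> ph (x + y) = ph x + ph y"
  "!!x y. x : cring S Z D ==> y : cring S Z D ==> ph (x * y) = ph x * ph y"
  "coeffs_in (cring S Z D) F" "coeffs_in (cring S Z D) G"
 shows "fls_map ph (F * G) = fls_map ph F * fls_map ph G"
proof (rule fls_eqI)
 fix n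
 let ?a = "fsubdeg F" and ?b = "fsubdeg G"
 have ph_sum: "ph (sum f B) = (SUM x:B. ph (f x))" if "!!x. f x : cring S Z D" for f and B :: "int set"
  by (induction B rule: infinite_finite_induct) (simp_all add: assms(1,2) that cring_sum)
 have "(fls_map ph F * fls_map ph G) $$ n = (SUM i=?a..n - ?b. fls_map ph F $$ i * fls_map ph G $$ (n - i))"
  by (rule fls_mult_nth) (simp_all add: assms(1))
 also have "... = ph ((F * G) $$ n)"
  unfolding fls_times_nth(2) using assms(4,5)
  by (subst ph_sum) (auto simp: assms(1,3) coeffs_in_def intro: cring_mult)
 finally show "fls_map ph (F * G) $$ n = (fls_map ph F * fls_map ph G) $$ n" by (simp add: assms(1))
qed

section \<open>Derivations\<close>

text \<open>The Leibniz rule is twisted by \<open>Ph\<close> so that the notion covers maps such as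
  the derivative of an expansion, whose values lie in a different field.\<close>

definition derivation_along :: "ratfun set => (ratfun => 'k::field) => (ratfun => 'k) => bool"
 where "derivation_along A Ph d \<longleftrightarrow> (ALL c. d (ratC c) = 0) &
  (ALL f:A. ALL g:A. d (f + g) = d f + d g & d (f * g) = d f * Ph g + Ph f * d g)"

text \<open>Differentiating h * inverse h = 1 determines the value at the inverse, since
  \<open>Ph h\<close> is nonzero.\<close>

lemma derivation_unique:
 assumes "f : cring S Z D" "!!i j. (i, j) : D ==> i ~= j & i : S & j : S" "Z <= S"
  and d: "derivation_along (cring S Z D) Ph d" "derivation_along (cring S Z D) Ph e"
  and Ph: "!!f g. f : cring S Z D ==> g : cring S Z D ==> Ph (f * g) = Ph f * Ph g" "Ph 1 = 1"
  and eq: "!!i. i : S ==> d (var i) = e (var i)"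
 shows "d f = e f"
proof -
 let ?A = "cring S Z D"
 have c: "d (ratC c) = 0" "e (ratC c) = 0" for c using d by (auto simp: derivation_along_def)
 have a: "d (f + g) = d f + d g" "e (f + g) = e f + e g" 
  and m: "d (f * g) = d f * Ph g + Ph f * d g" "e (f * g) = e f * Ph g + Ph f * e g"
  if "f : ?A" "g : ?A" for f g using that d by (auto simp: derivation_along_def)
 have inverse_eq: "d (inverse h) = e (inverse h)"
  if h: "h ~= 0" "h : ?A" "inverse h : ?A" "d h = e h" for h
 proof -
  have "d (h * inverse h) = 0" "e (h * inverse h) = 0" "Ph (h * inverse h) = 1"
   using h(1) c[of 1] Ph(2) by simp_all
  hence "d h * Ph (inverse h) + Ph h * d (inverse h) = e h * Ph (inverse h) + Ph h * e (inverse h)" "Ph h ~= 0"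
   by (auto simp: m[OF h(2,3)] Ph(1)[OF h(2,3)])
  thus ?thesis using h(4) by simp
 qed
 show ?thesis using assms(1)
 proof (induction rule: cring_induct)
  case (inv i) show ?case
   by (rule inverse_eq) (use inv assms(3) in "auto intro: cring_var cring_inv simp: eq")
 next
  case (diff i j)
  have *: "d (var i - var j) = e (var i - var j)"
  proof -
   have e: "var i - var j = var i + ratC (- 1) * var j" by (simp add: ratC_uminus)
   show ?thesis unfolding e using assms(2)[OF diff]
    by (simp add: a m c eq cring_var cring_mult)
  qed
  show ?case
   by (rule inverse_eq) (use diff * assms(2)[OF diff] in "auto intro!: cring_var cring_invdiff cring_diff")
 qed (auto simp: eq a m c)
qed

lemma Fract_var_power: "Frc (sgl (sgl l n) 1) 1 = var l ^ n"
proof (induction n)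
 case (Suc n)
 have "sgl (sgl l (Suc n)) (1::complex)
   = sgl (sgl l 1) 1 * sgl (sgl l n) 1"
  by (simp add: mult_single single_add[symmetric])
 thus ?case unfolding power_Suc Suc.IH[symmetric] by (simp add: var_def)
qed (simp add: One_fract_def)

text \<open>The substitution of z_i + X for z_i. The coefficient of X is the derivative by z_i,
  which supplies the existence half for \<open>partial_deriv\<close>.\<close>

definition taylor_pt :: "nat => nat => ratfun fls"
 where "taylor_pt i l = (if l = i then fls_const (var i) + fls_X else fls_const (var l))"

lemma taylor_poly:
 "poly_eval (%c. fls_const (ratC c)) (taylor_pt i) p $$ 0 = Frc p 1 &
  (ALL k<0. poly_eval (%c. fls_const (ratC c)) (taylor_pt i) p $$ k = 0)"
proof -
 \<comment> \<open>\<open>B\<close> pairs a series without negative powers with its constant term.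
   It is closed under sums and products, so only variables and constants have to be checked.\<close>
 define B where "B = {(F, f). F $$ 0 = f & (ALL k<0. F $$ k = (0::ratfun))}"
 have add: "(F + G, f + g) : B" and mult: "(F * G, f * g) : B" if "(F, f) : B" "(G, g) : B" for F f G g
  using that by (auto simp: B_def fls_mult_nth[where a = 0 and b = 0])
 have pw: "(F ^ n, f ^ n) : B" if "(F, f) : B" for F f n
 proof (induction n)
  case 0 show ?case by (simp add: B_def)
 next
  case (Suc n) thus ?case using mult[OF that] by simp
 qed
 have mon: "(mon_eval (taylor_pt i) m, Frc (sgl m 1) 1) : B" for m
 proof (induction m rule: poly_mapping_single_induct)
  case zero show ?case by (simp add: B_def One_fract_def)
 next
  case (add l n m)
  have "(taylor_pt i l, var l) : B" by (auto simp: B_def taylor_pt_def)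
  hence "(taylor_pt i l ^ n, Frc (sgl (sgl l n) 1) 1) : B"
   unfolding Fract_var_power by (rule pw)
  from mult[OF this add] show ?case by (simp add: mon_eval_add mult_single)
 qed
 have "(poly_eval (%c. fls_const (ratC c)) (taylor_pt i) p, Frc p 1) : B"
 proof (induction p rule: poly_mapping_single_induct)
  case zero show ?case by (simp add: B_def Zero_fract_def)
 next
  case (add m c p)
  have "(fls_const (ratC c) * mon_eval (taylor_pt i) m, ratC c * Frc (sgl m 1) 1) : B"
   by (rule mult[OF _ mon]) (simp add: B_def)
  note * = this
  note B_add = \<open>!!F f G g. [|(F, f) : B; (G, g) : B|] ==> (F + G, f + g) : B\<close>
  have "ratC c * Frc (sgl m 1) 1 + Frc p 1
   = Frc (sgl m c + p) 1"
   by (simp add: ratC_def mult_single)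
  with B_add[OF * add] show ?case
   by (simp add: lau.poly_eval_add lau.poly_eval_single)
 qed
 thus ?thesis by (auto simp: B_def)
qed

text \<open>The constant term of the shifted denominator is the denominator itself, hence the shift
  can be substituted into every fraction.\<close>

lemma taylor_dom: "lau.dom (taylor_pt i) f"
proof (cases f)
 case (Fract p q)
 hence "Frc q 1 ~= 0" by (simp add: Zero_fract_def eq_fract)
 hence "poly_eval (%c. fls_const (ratC c)) (taylor_pt i) q ~= 0" using taylor_poly[of i q] by auto
 thus ?thesis using Fract by (auto simp: lau.dom_def)
qed

lemma taylor_subst:
 "lsub (taylor_pt i) f $$ 0 = f" "k < 0 ==> lsub (taylor_pt i) f $$ k = 0"
proof -
 obtain p q where f: "f = Frc p q" and q: "q ~= 0" by (cases f) auto
 let ?P = "poly_eval (%c. fls_const (ratC c)) (taylor_pt i) p" and ?Q = "poly_eval (%c. fls_const (ratC c)) (taylor_pt i) q"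
 have Q0: "?Q $$ 0 ~= 0" using q taylor_poly[of i q] by (simp add: Zero_fract_def eq_fract)
 hence "?Q ~= 0" by auto
 hence e: "lsub (taylor_pt i) f = ?P * inverse ?Q"
  unfolding laurent_subst_def f by (subst lau.subst_Fract) (simp_all add: divide_inverse)
 note inv = fls_inverse_support[OF Q0, simplified]
 have Qn: "k < 0 ==> ?Q $$ k = 0" "k < 0 ==> ?P $$ k = 0" for k using taylor_poly[of i] by auto
 have i: "inverse ?Q $$ 0 = inverse (?Q $$ 0)" "k < 0 ==> inverse ?Q $$ k = 0" for k
  using inv Qn by auto
 have n: "lsub (taylor_pt i) f $$ n = (SUM j=0..n. ?P $$ j * inverse ?Q $$ (n - j))" for n
  unfolding e by (subst fls_mult_nth[of 0 _ 0]) (simp_all add: Qn i)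
 show "lsub (taylor_pt i) f $$ 0 = f" unfolding n
  using taylor_poly[of i] q by (simp add: i f)
 show "k < 0 ==> lsub (taylor_pt i) f $$ k = 0" unfolding n by simp
qed

lemma generated_by_vars: "Frc p 1 : cring UNIV {} {}"
proof (induction p rule: poly_mapping_single_induct)
 case zero show ?case by (simp add: Zero_fract_def[symmetric])
next
 case (add m c p)
 have "Frc (sgl m 1) 1 : cring UNIV {} {}"
 proof (induction m rule: poly_mapping_single_induct)
  case zero show ?case by (simp add: One_fract_def[symmetric])
 next
  case (add l n m)
  have "Frc (sgl (sgl l n + m) 1) 1
   = var l ^ n * Frc (sgl m 1) 1" 
   by (simp add: mult_single flip: Fract_var_power)
  thus ?case using add by (simp add: cring_mult cring_power cring_var)
 qed
 from cring_mult[OF cring_const[of c] this]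
 have "Frc (sgl m c) 1 : cring UNIV {} {}"
  by (simp add: ratC_def mult_single)
 from cring_add[OF this add] show ?case by simp
qed

text \<open>The coefficient of X in the Taylor shift is a derivation with the prescribed values.
  Uniqueness holds on polynomials by generation, and on a quotient f = p/q by the Leibniz rule for p
  = f q.\<close>

lemma partial_deriv_ex1: "EX! d. (ALL f g. d (f + g) = d f + d g) & (ALL f g. d (f * g) = d f * g + f * d g) &
  (ALL c. d (ratC c) = 0) & (ALL j. d (var j) = (if j = i then 1 else (0::ratfun)))"
proof (rule ex1I)
 let ?E = "lsub (taylor_pt i)"
 let ?d = "%f. ?E f $$ 1"
 have *: "?d (f + g) = ?d f + ?d g" "?d (f * g) = ?d f * g + f * ?d g" "?d (ratC c) = 0" "?d (var j) = (if j = i then 1 else 0)" for f g c j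
 proof -
  show "?d (f + g) = ?d f + ?d g" by (simp add: laurent_subst_def lau.subst_add taylor_dom)
  have "?d (f * g) = (SUM j=0..1 - 0. ?E f $$ j * ?E g $$ (1 - j))"
   unfolding laurent_subst_def lau.subst_mult[OF taylor_dom taylor_dom]
   by (rule fls_mult_nth) (auto simp: taylor_subst(2)[unfolded laurent_subst_def])
  also have "{0..1 - 0} = {0, 1::int}" by auto
  finally show "?d (f * g) = ?d f * g + f * ?d g" by (simp add: taylor_subst)
  show "?d (ratC c) = 0" "?d (var j) = (if j = i then 1 else 0)" 
   by (auto simp: laurent_subst_def taylor_pt_def)
 qed
 show "(ALL f g. ?d (f + g) = ?d f + ?d g) & (ALL f g. ?d (f * g) = ?d f * g + f * ?d g) &
  (ALL c. ?d (ratC c) = 0) & (ALL j. ?d (var j) = (if j = i then 1 else 0))"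
  using * by blast
 fix e assume e: "(ALL f g. e (f + g) = e f + e g) & (ALL f g. e (f * g) = e f * g + f * e g) &
  (ALL c. e (ratC c) = 0) & (ALL j. e (var j) = (if j = i then 1 else (0::ratfun)))"
 have poly: "e (Frc p 1) = ?d (Frc p 1)" for p
  by (rule derivation_unique[OF generated_by_vars, where Ph = id])
    (use e * in "simp_all add: derivation_along_def")
 show "e = ?d"
 proof
  fix f show "e f = ?d f"
  proof (cases f)
   case (Fract p q)
   hence "Frc p 1 = f * Frc q 1" by (simp add: eq_fract)
   hence "e f * Frc q 1 + f * e (Frc q 1) = ?d f * Frc q 1 + f * ?d (Frc q 1)"
    using poly[of p] e by (metis *(2))
   moreover have "Frc q 1 ~= 0" using Fract by (simp add: Zero_fract_def eq_fract)
   ultimately show ?thesis by (simp add: poly)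
  qed
 qed
qed

lemma pd_add: "pdv i (f + g) = pdv i f + pdv i g"
 and pd_mult: "pdv i (f * g) = pdv i f * g + f * pdv i g"
 and pd_const [simp]: "pdv i (ratC c) = 0"
 and pd_var [simp]: "pdv i (var j) = (if j = i then 1 else 0)"
 using theI'[OF partial_deriv_ex1[of i]] unfolding partial_deriv_def by auto

lemma pd_0 [simp]: "pdv i 0 = 0" and pd_1 [simp]: "pdv i 1 = 0"
 using pd_const[of i 0] pd_const[of i 1] by simp_all

lemma pd_diff: "pdv i (f - g) = pdv i f - pdv i g"
 using pd_add[of i "f - g" g] by simp

lemma pd_inverse: "pdv i (inverse f) = - pdv i f * (inverse f * inverse f)"
proof (cases "f = 0")
 case False
 hence "pdv i f * inverse f + f * pdv i (inverse f) = 0"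
  by (metis pd_mult pd_1 right_inverse)
 hence "inverse f * (pdv i f * inverse f + f * pdv i (inverse f)) = 0" by simp
 hence "inverse f * (pdv i f * inverse f) + pdv i (inverse f) = 0"
  using False by (simp add: distrib_left mult.assoc[symmetric])
 thus ?thesis by (simp add: algebra_simps eq_neg_iff_add_eq_0)
qed simp

lemma lin_pd: "clinear (pdv i)"
 by (rule clinearI) (simp_all add: pd_add scaleC_ratfun pd_mult)

lemma pd_cring: "f : cring S Z D ==> pdv i f : cring S Z D"
proof (induction rule: cring_induct)
 case (inv l) thus ?case
  by (auto simp: pd_inverse intro!: cring_mult cring_uminus cring_inv)
next
 case (diff l m) thus ?case
  by (auto simp: pd_inverse pd_diff intro!: cring_mult cring_uminus cring_invdiff)
qed (auto simp: pd_add pd_mult intro!: cring_add cring_mult)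

section \<open>Specialisations and expansions\<close>

text \<open>The centres at which a variable is expanded: \<open>None\<close> is the point 0 and
  \<open>Some j\<close> the diagonal z_i = z_j. One lemma can then treat both kinds of residue in
  the relations.\<close>

primrec pt :: "nat option => ratfun" where "pt None = 0" | "pt (Some j) = var j"

definition sub_pt :: "nat => nat option => nat => ratfun"
 where "sub_pt i p l = (if l = i then pt p else var l)"

definition sub :: "nat => nat option => ratfun => ratfun"
 where "sub i p = rat_subst ratC (sub_pt i p)"

definition exp_pt :: "nat => nat option => nat => ratfun fls"
 where "exp_pt i p l = (if l = i then fls_const (pt p) + fls_X else fls_const (var l))"

text \<open>The expansion at \<open>z\<^sub>i = pt p\<close>, in contrast to \<^const>\<open>expand_at_zero\<close> and \<^const>\<open>expand_at_var\<close>
  without relabelling of the remaining variables.\<close>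

definition expat :: "nat => nat option => ratfun => ratfun fls"
 where "expat i p = lsub (exp_pt i p)"

definition shift_pt :: "nat set => nat => ratfun fls"
 where "shift_pt J j = (if j : J then fls_const (var j) + fls_X_inv else fls_const (var j))"

lemma xsh_eq: "xsh J = lsub (shift_pt J)"
 by (simp add: expand_shift_def shift_pt_def[abs_def])

definition cwf :: "nat set => nat set => (nat \<times> nat) set => bool"
 where "cwf S Z D \<longleftrightarrow> Z <= S & D <= offdiag S"

lemma cwf_conf [simp]: "cwf S S (offdiag S)" "cwf S {} (offdiag S)"
 by (auto simp: cwf_def)

lemma cring_CU: "cwf S Z D ==> f : cring S Z D ==> f : conf UNIV"
 unfolding conf_def by (rule subsetD[OF cring_mono]) (auto simp: cwf_def offdiag_def)

lemma conf_CU: "f : conf S ==> f : conf UNIV"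
 using conf_mono[of S UNIV] by auto

lemma confp_CU: "f : confp S ==> f : conf UNIV"
 using conf_CU confp_conf by blast

lemma admissible_mono: "admissible Z D sg ==> Z' <= Z ==> D' <= D ==> admissible Z' D' sg"
 by (auto simp: admissible_def)

abbreviation "adm sg == admissible UNIV (offdiag UNIV) sg"

lemma lau_hom:
 assumes "adm sg" "f : conf UNIV" "g : conf UNIV"
 shows "lsub sg (f + g) = lsub sg f + lsub sg g"
  "lsub sg (f * g) = lsub sg f * lsub sg g"
  "lsub sg (f - g) = lsub sg f - lsub sg g"
 using lau.cring_dom[OF assms(1)] assms(2,3)
 by (auto simp: laurent_subst_def conf_def lau.subst_add lau.subst_mult lau.subst_diff)

lemma laurent_simps [simp]: "lsub sg (ratC c) = fls_const (ratC c)" "lsub sg (var i) = sg i"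
 "lsub sg 0 = 0" "lsub sg 1 = 1"
 by (simp_all add: laurent_subst_def)

lemma adm_shift [simp]: "adm (shift_pt J)"
proof -
 have 0: "shift_pt J i $$ 0 = var i" for i by (simp add: shift_pt_def)
 have "shift_pt J i ~= 0" "i ~= j ==> shift_pt J i ~= shift_pt J j" for i j
  by (metis 0 var_nonzero fls_zero_nth) (metis 0 var_inject)
 thus ?thesis by (auto simp: admissible_def offdiag_def)
qed

lemma adm_exp:
 assumes "p ~= Some i"
 shows "adm (exp_pt i p)"
proof -
 have 1: "exp_pt i p l $$ 1 = (if l = i then 1 else 0)" for l by (simp add: exp_pt_def)
 have 0: "l ~= i ==> exp_pt i p l $$ 0 = var l" for l by (simp add: exp_pt_def)
 have "exp_pt i p l ~= 0" for l by (metis 0 1 var_nonzero fls_zero_nth zero_neq_one)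
 moreover have "l ~= m ==> exp_pt i p l ~= exp_pt i p m" for l m
  by (metis 0 1 var_inject zero_neq_one)
 ultimately show ?thesis by (auto simp: admissible_def offdiag_def)
qed

text \<open>No generator of the ring has a pole along z_i = \<open>pt p\<close>, so that z_i can be
  specialised to \<open>pt p\<close>.\<close>

definition avoids :: "nat => nat option => nat set => (nat \<times> nat) set => bool"
 where "avoids i p Z D \<longleftrightarrow> (p = None --> i ~: Z) & (ALL j. p = Some j --> j ~= i & (i, j) ~: D & (j, i) ~: D)"

lemma zero_neq_var [simp]: "0 ~= var i"
 by (metis var_nonzero)

lemma admissible_sub:
 assumes "cwf S Z D" "avoids i p Z D"
 shows "admissible Z D (sub_pt i p)"
proof -
 have "sub_pt i p l ~= 0" if "l : Z" for l
  using that assms(2) by (cases p) (auto simp: sub_pt_def avoids_def)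
 moreover have "sub_pt i p l ~= sub_pt i p m" if "(l, m) : D" for l m
  using that assms by (cases p) (auto simp: sub_pt_def avoids_def cwf_def offdiag_def)
 ultimately show ?thesis by (auto simp: admissible_def)
qed

lemma cring_uminus_1 [simp]: "- 1 : cring S Z D"
 by (rule cring_uminus) simp

lemma sub_hom:
 assumes "cwf S Z D" "avoids i p Z D" "f : cring S Z D" "g : cring S Z D"
 shows "sub i p (f + g) = sub i p f + sub i p g" "sub i p (f * g) = sub i p f * sub i p g"
 using ren.cring_dom[OF admissible_sub[OF assms(1,2)]] assms(3,4)
 by (auto simp: sub_def ren.subst_add ren.subst_mult)

lemma sub_simps [simp]: "sub i p (ratC c) = ratC c" "sub i p (var l) = sub_pt i p l" "sub i p 0 = 0" "sub i p 1 = 1"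
 by (simp_all add: sub_def)

subsection \<open>Coefficient rings\<close>

lemma cring_invdiff_swap: "(j, i) : D ==> inverse (var i - var j) : cring S Z D"
 using cring_uminus[OF cring_invdiff[of j i D S Z]] by (metis inverse_minus_eq minus_diff_eq)

text \<open>At large w, the inverses of z_j + w and of z_i - z_j + w or z_i - z_j - w become series
  in \<open>w^-1\<close> with polynomial coefficients. Hence the inverses of z_j for j in
  \<open>J\<close>, and those of the differences separated by \<open>J\<close>, leave the
  coefficient ring.\<close>

lemma xsh_coeffs:
 assumes "cwf S Z D" "f : cring S Z D"
 shows "coeffs_in (cring S (Z - J) {(i, j) : D. i : J \<longleftrightarrow> j : J}) (xsh J f)"
proof -
 let ?A = "cring S (Z - J) {(i, j) : D. i : J \<longleftrightarrow> j : J}"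
 have adm: "admissible Z D (shift_pt J)"
  by (rule admissible_mono[OF adm_shift]) (use assms(1) in "auto simp: cwf_def offdiag_def")
 have "rat_subst (%c. fls_const (ratC c)) (shift_pt J) f : {F. coeffs_in ?A F}"
 proof (rule lau.cring_image[OF adm assms(2)]; (unfold mem_Collect_eq)?)
  fix i assume "i : S" thus "coeffs_in ?A (shift_pt J i)"
   by (auto simp: shift_pt_def intro!: coeffs_in_add coeffs_in_const coeffs_in_X cring_var)
 next
  fix i assume i: "i : Z"
  hence S: "i : S" using assms(1) by (auto simp: cwf_def)
  show "coeffs_in ?A (inverse (shift_pt J i))"
  proof (cases "i : J")
   case True
   \<comment> \<open>Series here are in \<open>w^-1\<close>, so index -1 is the power w, and the
     leading coefficient of z_i + w is 1.\<close>
   thus ?thesis using S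
    by (auto simp: shift_pt_def intro!: coeffs_in_inverse[where d = "-1"] coeffs_in_add coeffs_in_const coeffs_in_X cring_var)
  next
   case False
   thus ?thesis using S i
    by (auto simp: shift_pt_def intro!: coeffs_in_inverse[where d = 0] coeffs_in_const cring_var cring_inv)
  qed
 next
  fix i j assume ij: "(i, j) : D"
  hence S: "i : S" "j : S" "i ~= j" using assms(1) by (auto simp: cwf_def offdiag_def)
  show "coeffs_in ?A (inverse (shift_pt J i - shift_pt J j))"
  proof (cases "i : J \<longleftrightarrow> j : J")
   case True
   thus ?thesis using S ij
    by (auto simp: shift_pt_def fls_minus_const intro!: coeffs_in_inverse[where d = 0] coeffs_in_const cring_diff cring_var cring_invdiff)
  next
   case False
   hence l: "(shift_pt J i - shift_pt J j) $$ (- 1) = (if i : J then 1 else - 1)" by (auto simp: shift_pt_def)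
   show ?thesis
    by (rule coeffs_in_inverse[where d = "-1"]; (unfold l)?)
      (use False S in "auto simp: shift_pt_def intro!: coeffs_in_diff coeffs_in_add coeffs_in_const coeffs_in_X cring_var cring_uminus")
  qed
 qed (auto intro: coeffs_in_add coeffs_in_mult coeffs_in_const)
 thus ?thesis by (simp add: xsh_eq laurent_subst_def)
qed

text \<open>Setting z_i to \<open>pt p\<close> moves each pole z_i = z_l to z_l = 0 or to z_l = z_j;
  the conditions demand that the target ring allow the poles that result.\<close>

definition exp_target :: "nat => nat option => nat set => nat set => (nat \<times> nat) set => nat set => nat set => (nat \<times> nat) set => bool"
 where "exp_target i p S Z D S' Z' D' \<longleftrightarrow> S - {i} <= S' & Z - {i} <= Z' &
  (ALL (l, m):D. l ~= i --> m ~= i --> (l, m) : D') &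
  (case p of None => ALL l. (l, i) : D | (i, l) : D --> l : Z'
   | Some j => j : S' & (i : Z --> j : Z') & (ALL l. (l, i) : D | (i, l) : D --> l ~= j --> (l, j) : D'))"

lemma expat_coeffs:
 assumes "cwf S Z D" "f : cring S Z D" "p ~= Some i" "exp_target i p S Z D S' Z' D'"
 shows "coeffs_in (cring S' Z' D') (expat i p f)"
proof -
 let ?A = "cring S' Z' D'"
 have adm: "admissible Z D (exp_pt i p)"
  by (rule admissible_mono[OF adm_exp[OF assms(3)]]) (use assms(1) in "auto simp: cwf_def offdiag_def")
 have pt: "pt p : ?A" using assms(4) by (cases p) (auto simp: exp_target_def cring_var)
 \<comment> \<open>Every inverted generator that involves z_i becomes the inverse of c + X or c - X.
   If c = 0 the leading coefficient is 1 or -1, and otherwise c itself must be invertible in the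
   target.\<close>
 have unit: "coeffs_in ?A (inverse (fls_const c + F))" if "F = fls_X | F = - fls_X" "c : ?A" "c ~= 0 ==> inverse c : ?A" for c F
 proof -
  have F: "coeffs_in ?A F" using that(1) by (auto simp: coeffs_in_def intro: cring_uminus)
  show ?thesis
  proof (cases "c = 0")
   case True
   thus ?thesis using that(1)
    by (intro coeffs_in_inverse[where d = 1]) (auto simp: F cring_uminus)
  next
   case False
   thus ?thesis using that
    by (intro coeffs_in_inverse[where d = 0]) (auto intro!: F coeffs_in_add coeffs_in_const)
  qed
 qed
 have "rat_subst (%c. fls_const (ratC c)) (exp_pt i p) f : {F. coeffs_in ?A F}"
 proof (rule lau.cring_image[OF adm assms(2)]; (unfold mem_Collect_eq)?)
  fix l assume "l : S" thus "coeffs_in ?A (exp_pt i p l)" using assms(4)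
   by (auto simp: exp_pt_def exp_target_def intro!: coeffs_in_add coeffs_in_const coeffs_in_X cring_var pt)
 next
  fix l assume l: "l : Z"
  hence S: "l : S" using assms(1) by (auto simp: cwf_def)
  show "coeffs_in ?A (inverse (exp_pt i p l))"
  proof (cases "l = i")
   case True
   have "inverse (pt p) : ?A" if "pt p ~= 0" 
    using that assms(4) l True by (cases p) (auto simp: exp_target_def intro: cring_inv)
   thus ?thesis using True unit[of fls_X "pt p"] pt by (simp add: exp_pt_def)
  next
   case False
   thus ?thesis using S l assms(4)
    by (auto simp: exp_pt_def exp_target_def intro!: coeffs_in_inverse[where d = 0] coeffs_in_const cring_var cring_inv)
  qed
 next
  fix l m assume lm: "(l, m) : D"
  hence S: "l : S" "m : S" "l ~= m" using assms(1) by (auto simp: cwf_def offdiag_def)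
  consider "l = i" | "m = i" | "l ~= i" "m ~= i" by blast
  thus "coeffs_in ?A (inverse (exp_pt i p l - exp_pt i p m))"
  proof cases
   case 1
   have "inverse (pt p - var m) : ?A" if "pt p - var m ~= 0"
    using that assms(4) lm 1 by (cases p) (auto simp: exp_target_def intro!: cring_inv cring_uminus cring_invdiff_swap)
   moreover have "exp_pt i p l - exp_pt i p m = fls_const (pt p - var m) + fls_X"
    using 1 S by (simp add: exp_pt_def fls_minus_const[symmetric])
   moreover have "pt p - var m : ?A" using assms(4) S 1 by (auto simp: exp_target_def intro!: pt cring_diff cring_var)
   ultimately show ?thesis using unit[of fls_X "pt p - var m"] by simp
  next
   case 2
   have "inverse (var l - pt p) : ?A" if "var l - pt p ~= 0"
    using that assms(4) lm 2 by (cases p) (auto simp: exp_target_def intro!: cring_inv cring_uminus cring_invdiff)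
   moreover have "exp_pt i p l - exp_pt i p m = fls_const (var l - pt p) + - fls_X"
    using 2 S by (simp add: exp_pt_def fls_minus_const[symmetric])
   moreover have "var l - pt p : ?A" using assms(4) S 2 by (auto simp: exp_target_def intro!: pt cring_diff cring_var)
   ultimately show ?thesis using unit[of "- fls_X" "var l - pt p"] by simp
  next
   case 3
   thus ?thesis using S lm assms(4)
    by (auto simp: exp_pt_def exp_target_def fls_minus_const intro!: coeffs_in_inverse[where d = 0] coeffs_in_const cring_diff cring_var cring_invdiff)
  qed
 qed (auto intro: coeffs_in_add coeffs_in_mult coeffs_in_const)
 thus ?thesis by (simp add: expat_def laurent_subst_def)
qed

lemma expat_conf:
 assumes "f : conf S" "p = None | p = Some j & j : S & j ~= i"
 shows "expat i p f $$ n : conf (S - {i})"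
 unfolding conf_def
 by (rule coeffs_inD[OF expat_coeffs[OF cwf_conf(1) assms(1)[unfolded conf_def]]])
   (use assms(2) in "auto simp: exp_target_def offdiag_def")

lemma expat_confp:
 assumes "f : confp S" "j : S" "j ~= i"
 shows "expat i (Some j) f $$ n : confp (S - {i})"
 unfolding confp_def
 by (rule coeffs_inD[OF expat_coeffs[OF cwf_conf(2) assms(1)[unfolded confp_def]]])
   (use assms in "auto simp: exp_target_def offdiag_def")

subsection \<open>Taylor's formula\<close>

lemma expat_regular:
 assumes "cwf S Z D" "g : cring S Z D" "avoids i p Z D"
 shows "k < 0 ==> expat i p g $$ k = 0" "expat i p g $$ 0 = sub i p g"
proof -
 have p: "p ~= Some i" using assms(3) by (auto simp: avoids_def)
 have adm: "admissible Z D (exp_pt i p)"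
  by (rule admissible_mono[OF adm_exp[OF p]]) (use assms(1) in "auto simp: cwf_def offdiag_def")
 have e0: "exp_pt i p l $$ 0 = sub_pt i p l" "k < 0 ==> exp_pt i p l $$ k = 0" for l k
  by (auto simp: exp_pt_def sub_pt_def)
 have inv: "k < 0 ==> inverse F $$ k = 0" if "F $$ 0 ~= (0::ratfun)" "ALL k<0. F $$ k = 0" for F k
  using fls_inverse_support(1)[of F 0] that by auto
 have low: "ALL k<0. expat i p g $$ k = 0" if "g : cring S Z D" for g
 proof -
  have "rat_subst (%c. fls_const (ratC c)) (exp_pt i p) g : {F. ALL k<0. F $$ k = 0}"
  proof (rule lau.cring_image[OF adm that]; (unfold mem_Collect_eq)?)
   fix x y :: "ratfun fls" assume "ALL k<0. x $$ k = 0" "ALL k<0. y $$ k = 0"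
   thus "ALL k<0. (x * y) $$ k = 0" by (auto simp: fls_mult_nth[where a = 0 and b = 0])
  next
   fix l assume "l : Z" hence "exp_pt i p l $$ 0 ~= 0"
    using admissible_sub[OF assms(1,3)] by (auto simp: e0 admissible_def)
   thus "ALL k<0. inverse (exp_pt i p l) $$ k = 0" using inv e0(2) by blast
  next
   fix l m assume "(l, m) : D" hence "(exp_pt i p l - exp_pt i p m) $$ 0 ~= 0"
    using admissible_sub[OF assms(1,3)] by (auto simp: e0 admissible_def)
   thus "ALL k<0. inverse (exp_pt i p l - exp_pt i p m) $$ k = 0" by (intro allI impI inv) (auto simp: e0)
  qed (auto simp: e0)
  thus ?thesis by (simp add: expat_def laurent_subst_def)
 qed
 thus "k < 0 ==> expat i p g $$ k = 0" using assms(2) by blast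
 show "expat i p g $$ 0 = sub i p g"
 proof (rule ring_hom_unique[OF assms(2)])
  fix f g assume fg: "f : cring S Z D" "g : cring S Z D"
  note CU = cring_CU[OF assms(1) fg(1)] cring_CU[OF assms(1) fg(2)]
  show "expat i p (f + g) $$ 0 = expat i p f $$ 0 + expat i p g $$ 0"
   by (simp add: expat_def lau_hom[OF adm_exp[OF p] CU])
  show "expat i p (f * g) $$ 0 = expat i p f $$ 0 * expat i p g $$ 0"
   using low[OF fg(1)] low[OF fg(2)] unfolding expat_def lau_hom[OF adm_exp[OF p] CU]
   by (subst fls_mult_nth[where a = 0 and b = 0]) auto
  show "sub i p (f + g) = sub i p f + sub i p g" "sub i p (f * g) = sub i p f * sub i p g"
   by (rule sub_hom[OF assms(1,3) fg])+
 qed (use assms(1) in "auto simp: cwf_def offdiag_def expat_def e0")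
qed

lemma derivation_CU:
 assumes "adm sg"
 shows "derivation_along (conf UNIV) (lsub sg) (%f. lsub sg (pdv i f))"
 using pd_cring[of _ UNIV UNIV "offdiag UNIV" i, folded conf_def]
 by (auto simp: derivation_along_def pd_add pd_mult lau_hom[OF assms] cring_mult[of _ UNIV UNIV "offdiag UNIV", folded conf_def])

lemma deriv_unique_CU:
 assumes "adm sg" "f : conf UNIV" "derivation_along (conf UNIV) (lsub sg) d"
  "derivation_along (conf UNIV) (lsub sg) e" "!!i. d (var i) = e (var i)"
 shows "d f = e f"
 by (rule derivation_unique[where S = UNIV and Z = UNIV and D = "offdiag UNIV" and Ph = "lsub sg"])
   (use assms in "auto simp: conf_def[symmetric] lau_hom[OF assms(1)]", simp add: offdiag_def)

lemma expat_deriv: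
 assumes "f : conf UNIV" "p ~= Some i"
 shows "fls_deriv (expat i p f) = expat i p (pdv i f)"
 unfolding expat_def
 by (rule deriv_unique_CU[OF adm_exp[OF assms(2)] assms(1) _ derivation_CU[OF adm_exp[OF assms(2)]]])
   (auto simp: derivation_along_def lau_hom[OF adm_exp[OF assms(2)]], auto simp: exp_pt_def)

lemma pd_funpow_cring: "f : cring S Z D ==> (pdv i ^^ m) f : cring S Z D"
 by (induction m) (auto intro: pd_cring)

text \<open>Differentiation lowers the index, so m derivatives bring the m-th coefficient down to
  the constant one. Commutation of two expansions is thereby reduced to commutation with a
  specialisation and with derivatives.\<close>

lemma expat_taylor:
 assumes "cwf S Z D" "g : cring S Z D" "avoids i p Z D"
 shows "expat i p g $$ int m = ratC (1 / fact m) * sub i p ((pdv i ^^ m) g)"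
 using assms(2)
proof (induction m arbitrary: g)
 case 0 thus ?case using expat_regular(2)[OF assms(1) _ assms(3)] by simp
next
 case (Suc m)
 have p: "p ~= Some i" using assms(3) by (auto simp: avoids_def)
 have "of_int (int m + 1) * expat i p g $$ (int m + 1) = expat i p (pdv i g) $$ int m"
  by (metis expat_deriv[OF cring_CU[OF assms(1) Suc.prems] p] fls_deriv_nth)
 also have "... = ratC (1 / fact m) * sub i p ((pdv i ^^ Suc m) g)"
  using Suc.IH[OF pd_cring[OF Suc.prems]] by (simp add: funpow_swap1)
 finally have "ratC (of_nat (Suc m)) * expat i p g $$ int (Suc m) = ratC (1 / fact m) * sub i p ((pdv i ^^ Suc m) g)"
  by (simp add: ratC_add ratC_of_nat add.commute)
 hence "ratC (1 / of_nat (Suc m)) * (ratC (of_nat (Suc m)) * expat i p g $$ int (Suc m)) = ratC (1 / of_nat (Suc m)) * (ratC (1 / fact m) * sub i p ((pdv i ^^ Suc m) g))"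
  by simp
 thus ?case by (simp add: mult.assoc[symmetric] ratC_mult[symmetric] del: of_nat_Suc funpow.simps) 
qed

subsection \<open>Expansions in independent directions commute\<close>

text \<open>Both sides, as functions of h, are derivations along the expansion, and by
  \<open>s\<close> they agree on variables.\<close>

lemma pd_coefficient:
 assumes adm: "adm sg" and wf: "cwf S Z D"
  and s: "!!m. m : S ==> fls_map (pdv i) (sg m) = (if m = i then 1 else 0)"
  and h: "h : cring S Z D"
 shows "lsub sg (pdv i h) $$ n = pdv i (lsub sg h $$ n)"
proof -
 let ?E = "lsub sg"
 have wf': "!!i j. (i, j) : D ==> i ~= j & i : S & j : S" "Z <= S"
  using wf by (auto simp: cwf_def offdiag_def)
 have CU: "f : conf UNIV" if "f : cring S Z D" for f using cring_CU[OF wf that] .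
 have "?E (pdv i h) = fls_map (pdv i) (?E h)"
 proof (rule derivation_unique[OF h wf', where Ph = ?E])
  show "derivation_along (cring S Z D) ?E (%h. ?E (pdv i h))"
   using derivation_CU[OF adm] CU by (auto simp: derivation_along_def)
  show "derivation_along (cring S Z D) ?E (%h. fls_map (pdv i) (?E h))"
   unfolding derivation_along_def
  proof (intro conjI ballI allI)
   fix c show "fls_map (pdv i) (?E (ratC c)) = 0" by (auto intro!: fls_eqI)
  next
   fix f g assume fg: "f : cring S Z D" "g : cring S Z D"
   show "fls_map (pdv i) (?E (f + g)) = fls_map (pdv i) (?E f) + fls_map (pdv i) (?E g)"
    by (rule fls_eqI) (simp add: lau_hom[OF adm CU CU] fg pd_add)
   show "fls_map (pdv i) (?E (f * g)) = fls_map (pdv i) (?E f) * ?E g + ?E f * fls_map (pdv i) (?E g)"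
   proof (rule fls_eqI)
    fix n
    let ?a = "fsubdeg (?E f)" and ?b = "fsubdeg (?E g)"
    have 1: "(F * G) $$ n = (SUM i=?a..n - ?b. F $$ i * G $$ (n - i))"
     if "!!k. k < ?a ==> F $$ k = 0" "!!k. k < ?b ==> G $$ k = 0" for F G :: "ratfun fls"
     by (rule fls_mult_nth) (use that in auto)
    show "fls_map (pdv i) (?E (f * g)) $$ n = (fls_map (pdv i) (?E f) * ?E g + ?E f * fls_map (pdv i) (?E g)) $$ n"
     unfolding lau_hom[OF adm CU[OF fg(1)] CU[OF fg(2)]]
     by (simp add: 1 lin_sum[OF lin_pd] pd_mult sum.distrib)
   qed
  qed
 qed (auto simp: lau_hom[OF adm CU CU] s)
 thus ?thesis by simp
qed

lemma coefficient_commute: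
 assumes adm: "adm sg" and wf: "cwf S Z D" "cwf S Z' D'" and av: "avoids i p Z D" "avoids i p Z' D'"
  and target: "exp_target i p S Z D UNIV UNIV (offdiag UNIV)"
  and coeffs: "!!h. h : cring S Z D ==> coeffs_in (cring S Z' D') (lsub sg h)"
  and s: "!!m. m : S ==> fls_map (sub i p) (sg m) = lsub sg (sub_pt i p m)"
   "!!m. m : S ==> fls_map (pdv i) (sg m) = (if m = i then 1 else 0)"
  and h: "h : cring S Z D"
 shows "lsub sg (sub i p h) $$ n = sub i p (lsub sg h $$ n)"
  and "lsub sg (pdv i h) $$ n = pdv i (lsub sg h $$ n)"
proof -
 let ?E = "lsub sg"
 have wf': "!!i j. (i, j) : D ==> i ~= j & i : S & j : S" "Z <= S"
  using wf(1) by (auto simp: cwf_def offdiag_def)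
 have p: "p ~= Some i" using av(1) by (auto simp: avoids_def)
 have CU: "f : conf UNIV" if "f : cring S Z D" for f using cring_CU[OF wf(1) that] .
 have subCU: "sub i p f : conf UNIV" if "f : cring S Z D" for f
  using coeffs_inD[OF expat_coeffs[OF wf(1) that p target], of 0] 
  by (simp add: expat_regular(2)[OF wf(1) that av(1)] conf_def)
 have "?E (sub i p h) = fls_map (sub i p) (?E h)"
 proof (rule ring_hom_unique[OF h wf'])
  fix f g assume fg: "f : cring S Z D" "g : cring S Z D"
  show "?E (sub i p (f + g)) = ?E (sub i p f) + ?E (sub i p g)"
   "?E (sub i p (f * g)) = ?E (sub i p f) * ?E (sub i p g)"
   by (simp_all add: sub_hom[OF wf(1) av(1) fg] lau_hom[OF adm] subCU fg)
  show "fls_map (sub i p) (?E (f + g)) = fls_map (sub i p) (?E f) + fls_map (sub i p) (?E g)"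
   by (rule fls_eqI) (simp add: lau_hom[OF adm CU CU] fg sub_hom[OF wf(2) av(2)] coeffs_inD[OF coeffs])
  show "fls_map (sub i p) (?E (f * g)) = fls_map (sub i p) (?E f) * fls_map (sub i p) (?E g)"
   unfolding lau_hom[OF adm CU[OF fg(1)] CU[OF fg(2)]]
   by (rule fls_map_mult[where S = S and Z = Z' and D = D'])
     (simp_all add: sub_hom[OF wf(2) av(2)] coeffs fg)
 qed (auto simp: s(1) intro!: fls_eqI)
 thus "?E (sub i p h) $$ n = sub i p (?E h $$ n)" by simp
 show "?E (pdv i h) $$ n = pdv i (?E h $$ n)"
  by (rule pd_coefficient[OF adm wf(1) s(2) h])
qed

lemma expat_sub_self: "p ~= Some i ==> expat i p (var i - pt p) = fls_X"
proof -
 assume p: "p ~= Some i"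
 have "var i : conf UNIV" "pt p : conf UNIV" unfolding conf_def by (cases p; simp add: cring_var)+
 hence "expat i p (var i - pt p) = exp_pt i p i - lsub (exp_pt i p) (pt p)"
  by (simp add: expat_def lau_hom(3)[OF adm_exp[OF p]])
 thus ?thesis using p by (cases p) (simp_all add: exp_pt_def)
qed

text \<open>Only powers of z_i - \<open>pt p\<close> have to be cleared; sums are brought to a
  common power. The factor g then lies in a ring that avoids the pole.\<close>

lemma pole_decomposition:
 assumes "f : conf S" "i : S" "p = None | p = Some j & j : S & j ~= i"
 obtains M g where "g : cring S (if p = None then S - {i} else S) (offdiag S - (case p of None => {} | Some j => {(i, j), (j, i)}))"
  "f = inverse (var i - pt p) ^ M * g"
proof -
 let ?A = "cring S (if p = None then S - {i} else S) (offdiag S - (case p of None => {} | Some j => {(i, j), (j, i)}))"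
 let ?u = "var i - pt p"
 have u: "?u ~= 0" "?u : ?A" using assms(2,3) by (auto simp: cring_var cring_diff)
 have triv: "EX M g. g : ?A & f = inverse ?u ^ M * g" if "f : ?A" for f
  using that by (intro exI[of _ "0::nat"]) auto
 have pole: "EX M g. g : ?A & f = inverse ?u ^ M * g" if "f = inverse ?u | f = - inverse ?u" for f
 proof -
  have "f * ?u = 1 | f * ?u = - 1" using that left_inverse[OF u(1)] by (metis minus_mult_left)
  hence "f * ?u : ?A" by auto
  moreover have "f = inverse ?u ^ 1 * (f * ?u)" using u(1) by (simp add: mult.left_commute del: right_minus_eq)
  ultimately show ?thesis by blast
 qed
 have "EX M g. g : ?A & f = inverse ?u ^ M * g"
  using assms(1) unfolding conf_def
 proof (induction rule: cring_induct)
  case (inv l)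
  show ?case
  proof (cases "p = None & l = i")
   case True thus ?thesis by (intro pole) simp
  next
   case False thus ?thesis by (intro triv cring_inv) (use inv in auto)
  qed
 next
  case (diff l m)
  show ?case
  proof (cases "case p of None => False | Some j => (l, m) : {(i, j), (j, i)}")
   case True thus ?thesis
    by (intro pole) (auto split: option.splits simp flip: inverse_minus_eq)
  next
   case False thus ?thesis by (intro triv cring_invdiff) (use diff in "auto split: option.splits")
  qed
 next
  case (add f g)
  then obtain M N a b where *: "a : ?A" "b : ?A" "f = inverse ?u ^ M * a" "g = inverse ?u ^ N * b" by blast
  have "inverse ?u ^ N * ?u ^ N = 1" "inverse ?u ^ M * ?u ^ M = 1"
   using u(1) by (simp_all add: power_mult_distrib[symmetric] del: right_minus_eq)
  moreover have "x * a + y * b = (x * y) * (y' * a + x' * b)" if "y * y' = 1" "x * x' = 1" for x y x' y'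
  proof -
   have "(x * y) * (y' * a + x' * b) = x * (y * y') * a + y * (x * x') * b" by (simp add: algebra_simps)
   thus ?thesis by (simp add: that)
  qed
  ultimately have "f + g = inverse ?u ^ (M + N) * (?u ^ N * a + ?u ^ M * b)"
   unfolding *(3,4) power_add by blast
  thus ?case using * u by (intro exI[of _ "M + N"] exI[of _ "?u ^ N * a + ?u ^ M * b"]) (auto intro!: cring_add cring_mult cring_power)
 next
  case (mult f g)
  then obtain M N a b where *: "a : ?A" "b : ?A" "f = inverse ?u ^ M * a" "g = inverse ?u ^ N * b" by blast
  thus ?case by (intro exI[of _ "M + N"] exI[of _ "a * b"]) (auto simp: power_add intro!: cring_mult)
 next
  case (const c) show ?case by (rule triv) simp
 next
  case (var l) thus ?case by (intro triv cring_var)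
 qed
 thus thesis using that by blast
qed

text \<open>For the regular factor g, Taylor's formula and \<open>coefficient_commute\<close> apply.
  By \<open>u\<close> the pole factor is not moved by the other substitution, so it enters both
  sides as a constant and merely shifts the index k by \<open>M\<close>.\<close>

lemma expat_commute_general:
 assumes adm: "adm sg" and wf: "cwf S Z D" "cwf S Z' D'" and av: "avoids i p Z D" "avoids i p Z' D'"
  and target: "exp_target i p S Z D UNIV UNIV (offdiag UNIV)"
  and coeffs: "!!h. h : cring S Z D ==> coeffs_in (cring S Z' D') (lsub sg h)"
  and s: "!!m. m : S ==> fls_map (sub i p) (sg m) = lsub sg (sub_pt i p m)"
   "!!m. m : S ==> fls_map (pdv i) (sg m) = (if m = i then 1 else 0)"
  and u: "sg i - lsub sg (pt p) = fls_const (var i - pt p)"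
  and g: "g : cring S Z D" and f: "f = inverse (var i - pt p) ^ M * g"
 shows "lsub sg (expat i p f $$ k) $$ n = expat i p (lsub sg f $$ n) $$ k"
proof -
 let ?E = "lsub sg" and ?u = "var i - pt p"
 have p: "p ~= Some i" using av(1) by (auto simp: avoids_def)
 have CU: "f : conf UNIV" if "f : cring S Z D" for f using cring_CU[OF wf(1) that] .
 have CU': "f : conf UNIV" if "f : cring S Z' D'" for f using cring_CU[OF wf(2) that] .
 have subCU: "sub i p f : conf UNIV" if "f : cring S Z D" for f
  using coeffs_inD[OF expat_coeffs[OF wf(1) that p target], of 0] 
  by (simp add: expat_regular(2)[OF wf(1) that av(1)] conf_def)
 note cc = coefficient_commute[OF adm wf av target coeffs s]
 have pds: "?E ((pdv i ^^ m) h) $$ n = (pdv i ^^ m) (?E h $$ n)" if "h : cring S Z D" for h m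
  using that by (induction m) (auto simp: cc(2) pd_funpow_cring)
 have reg: "?E (expat i p g $$ m) $$ n = expat i p (?E g $$ n) $$ m" for m
 proof (cases "m < 0")
  case True
  thus ?thesis using expat_regular(1)[OF wf(1) g av(1)] expat_regular(1)[OF wf(2) coeffs_inD[OF coeffs[OF g]] av(2)]
   by simp
 next
  case False
  then obtain m' where m: "m = int m'" by (metis int_nat_eq linorder_not_less)
  have "?E (ratC (1 / fact m') * sub i p ((pdv i ^^ m') g)) $$ n
    = ratC (1 / fact m') * sub i p ((pdv i ^^ m') (?E g $$ n))"
   by (subst lau_hom(2)[OF adm])
     (simp_all add: conf_def[symmetric] subCU pd_funpow_cring g cc(1) pds cring_const[of _ UNIV UNIV "offdiag UNIV", folded conf_def])
  thus ?thesis unfolding m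
   by (simp add: expat_taylor[OF wf(1) g av(1)] expat_taylor[OF wf(2) coeffs_inD[OF coeffs[OF g]] av(2)])
 qed
 have uCU: "?u : conf UNIV" "inverse ?u : conf UNIV" "?u ~= 0" "var i : conf UNIV" "pt p : conf UNIV"
  unfolding conf_def using p by (cases p; auto intro!: cring_diff cring_var cring_invdiff cring_inv simp: offdiag_def)+
 have pw: "inverse ?u ^ m : conf UNIV" for m using uCU(2) unfolding conf_def by (rule cring_power)
 have Eu: "?E ?u = fls_const ?u" using u by (simp add: lau_hom[OF adm uCU(4,5)])
 have "?E (inverse ?u) * ?E ?u = 1" using uCU(3) by (simp add: lau_hom(2)[OF adm uCU(2,1), symmetric])
 hence "?E (inverse ?u) = fls_const (inverse ?u)" unfolding Eu using uCU(3)
  by (metis fls_const_mult_const fls_const_1 left_inverse inverse_unique mult.commute)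
 hence Epw: "?E (inverse ?u ^ m) = fls_const (inverse ?u ^ m)" for m
  by (induction m) (simp_all add: lau_hom(2)[OF adm uCU(2) pw] fls_const_mult_const)
 have "expat i p (inverse ?u) * expat i p ?u = 1" using uCU(3)
  by (simp add: expat_def lau_hom(2)[OF adm_exp[OF p] uCU(2,1), symmetric])
 hence "expat i p (inverse ?u) = fls_X_inv" unfolding expat_sub_self[OF p]
  by (metis fls_X_fls_X_inv_conv(2) fls_inverse_X inverse_unique mult.commute)
 hence Xpw: "expat i p (inverse ?u ^ m) = fls_X_inv ^ m" for m
  by (induction m) (simp_all add: expat_def lau_hom(2)[OF adm_exp[OF p] uCU(2) pw])
 have X: "expat i p (inverse ?u ^ M * h) $$ k = expat i p h $$ (k + int M)" if "h : conf UNIV" for h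
 proof -
  have "expat i p (inverse ?u ^ M * h) = fls_X_inv ^ M * expat i p h"
   using lau_hom(2)[OF adm_exp[OF p] pw that] Xpw by (simp add: expat_def)
  thus ?thesis by (simp add: fls_X_inv_power_times_conv_shift)
 qed
 have "?E f = fls_const (inverse ?u ^ M) * ?E g" unfolding f lau_hom(2)[OF adm pw CU[OF g]] Epw ..
 hence Ef: "?E f $$ n = inverse ?u ^ M * ?E g $$ n" by simp
 show ?thesis unfolding Ef X[OF CU'[OF coeffs_inD[OF coeffs[OF g]]]] unfolding f X[OF CU[OF g]] by (rule reg)
qed

text \<open>The last assumption says that z_i and the centre of its expansion are translated by the
  same amount, so their difference, and with it the pole, survives the expansion at large w.\<close>

lemma expat_shift_commute:
 assumes "f : conf S" "i : S" "p = None & i ~: J | p = Some j & j : S & j ~= i & (i : J \<longleftrightarrow> j : J)"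
 shows "xsh J (expat i p f $$ k) $$ n = expat i p (xsh J f $$ n) $$ k"
proof -
 let ?Z = "if p = None then S - {i} else S" and ?D = "offdiag S - (case p of None => {} | Some j => {(i, j), (j, i)})"
 have "p = None | p = Some j & j : S & j ~= i" using assms(3) by auto
 from pole_decomposition[OF assms(1,2) this]
 obtain M g where g: "g : cring S ?Z ?D" "f = inverse (var i - pt p) ^ M * g" by blast
 have wf: "cwf S ?Z ?D" "cwf S (?Z - J) {(i, j) : ?D. i : J \<longleftrightarrow> j : J}" by (auto simp: cwf_def)
 show ?thesis unfolding xsh_eq
  by (rule expat_commute_general[OF adm_shift wf, where g = g and M = M];
    (rule xsh_coeffs[unfolded xsh_eq, OF wf(1)])?)
    (use assms g in "auto simp: avoids_def exp_target_def offdiag_def shift_pt_def sub_pt_def fls_minus_const intro!: fls_eqI split: option.splits")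
qed

lemma expat_expat_commute:
 assumes "f : conf S" "i : S" "j : S" "j ~= i" "l ~= i" "l ~= j"
 shows "expat l None (expat i (Some j) f $$ k) $$ n = expat i (Some j) (expat l None f $$ n) $$ k"
proof -
 let ?D = "offdiag S - {(i, j), (j, i)}"
 obtain M g where g: "g : cring S S ?D" "f = inverse (var i - pt (Some j)) ^ M * g"
 proof -
  have "Some j = None | Some j = Some j & j : S & j ~= i" using assms by simp
  from pole_decomposition[OF assms(1,2) this] show thesis using that by auto
 qed
 have wf: "cwf S S ?D" "cwf S S ?D" by (auto simp: cwf_def)
 have nl: "None ~= Some l" by simp
 show ?thesis unfolding expat_def[of l]
  by (rule expat_commute_general[OF adm_exp[OF nl] wf, where g = g and M = M];
    (rule expat_coeffs[unfolded expat_def, OF wf(1)])?)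
    (use assms g in "auto simp: avoids_def exp_target_def offdiag_def exp_pt_def sub_pt_def fls_minus_const intro!: fls_eqI split: option.splits")
qed

section \<open>The Borcherds identity\<close>

lemma lin_nprod: "clinear (nprod n a)" and clinear_nprod_left: "clinear (%a. nprod n a b)"
 and lin_transl: "clinear transl"
 by (auto intro!: clinearI simp: nprod_add_left nprod_add_right nprod_scaleC_left nprod_scaleC_right
   transl_add transl_scaleC)

lemmas nprod_0_right [simp] = lin_zero[OF lin_nprod] and nprod_0_left [simp] = lin_zero[OF clinear_nprod_left]

text \<open>For a series with coefficient \<open>X p q\<close> at x^(-p-1) y^(-q-1), this is
  multiplication by x - y.\<close>

definition d2 :: "(int => int => 'a::complex_vector) => int => int => 'a"
 where "d2 X p q = X (p + 1) q - X p (q + 1)"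

text \<open>\<open>(x - y)\<^sup>r\<close> expanded for \<open>x\<close> large, times the series with coefficients \<open>X\<close>.\<close>

definition expand_diff :: "(int => int => 'a::complex_vector) => int => int => int => 'a"
 where "expand_diff X r p q = Sum_any (%m::nat. ((- 1) ^ m * ((of_int r :: complex) gchoose m)) *. X (p + r - int m) (q + int m))"

definition bounded_right :: "(int => int => 'a::zero) => bool"
 where "bounded_right X \<longleftrightarrow> (EX K. ALL i j. j >= K --> X i j = 0)"

lemma xdf_eq:
 assumes "!!i j. j >= K ==> X i j = 0" "q + int M >= K"
 shows "expand_diff X r p q = (SUM m<M. ((- 1) ^ m * ((of_int r :: complex) gchoose m)) *. X (p + r - int m) (q + int m))"
 unfolding expand_diff_def
 by (rule Sum_any_superset) (use assms in auto)

lemma xdf_step: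
 assumes "bounded_right X"
 shows "expand_diff X r (p + 1) q - expand_diff X r p (q + 1) = expand_diff X (r + 1) p q"
proof -
 obtain K where K: "!!i j. j >= K ==> X i j = 0" using assms by (auto simp: bounded_right_def)
 define M where "M = nat (K - q)"
 have M: "q + int M >= K" by (simp add: M_def)
 let ?c = "%r m. (- 1) ^ m * ((of_int r :: complex) gchoose m)"
 have 1: "expand_diff X r (p + 1) q = (SUM m<Suc M. ?c r m *. X (p + r + 1 - int m) (q + int m))"
  using M by (subst xdf_eq[where K = K and M = "Suc M", OF K]) (auto simp: algebra_simps)
 have 2: "expand_diff X r p (q + 1) = (SUM m<M. ?c r m *. X (p + r + 1 - int (Suc m)) (q + int (Suc m)))"
  using M by (subst xdf_eq[where K = K and M = "M", OF K]) (auto simp: algebra_simps)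
 have 3: "expand_diff X (r + 1) p q = (SUM m<Suc M. ?c (r + 1) m *. X (p + r + 1 - int m) (q + int m))"
  using M by (subst xdf_eq[where K = K and M = "Suc M", OF K]) (auto simp: algebra_simps)
 have "?c (r + 1) (Suc m) = ?c r (Suc m) - ?c r m" for m
  using gbinomial_Suc_Suc[of "of_int r :: complex" m] by (simp add: algebra_simps)
 thus ?thesis unfolding 1 2 3 sum.lessThan_Suc_shift
  by (simp add: complex_vector.scale_left_diff_distrib sum_subtractf del: of_nat_Suc)
qed

lemma xdf_0: "expand_diff X 0 p q = X p q"
 unfolding expand_diff_def
 by (subst Sum_any.expand_superset[of "{0}"]) (auto simp: gbinomial_0_left scaleC_one split: if_splits)

lemma xdf_nat:
 assumes "bounded_right X"
 shows "expand_diff X (int N) p q = (d2 ^^ N) X p q"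
proof (induction N arbitrary: p q)
 case (Suc N)
 have "expand_diff X (int (Suc N)) p q = expand_diff X (int N) (p + 1) q - expand_diff X (int N) p (q + 1)"
  using xdf_step[OF assms, of "int N" p q] by (simp add: add.commute)
 thus ?case by (simp add: Suc d2_def)
qed (simp add: xdf_0)

lemma d2_iter:
 "(d2 ^^ N) X p q = (SUM j<=N. ((- 1) ^ j * of_nat (N choose j)) *. X (p + int (N - j)) (q + int j))"
proof (induction N arbitrary: p q)
 case (Suc N)
 let ?t = "%c j. ((- 1) ^ j * of_nat c :: complex) *. X (p + int (Suc N - j)) (q + int j)"
 have "(d2 ^^ N) X (p + 1) q = (SUM j<=N. ?t (N choose j) j)"
  unfolding Suc by (rule sum.cong) (auto simp: algebra_simps of_nat_diff)
 also have "... = (SUM j<=Suc N. ?t (N choose j) j)" by simp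
 also have "... = ?t 1 0 + (SUM j<=N. ?t (N choose Suc j) (Suc j))" by (subst sum.atMost_Suc_shift) simp
 finally have 1: "(d2 ^^ N) X (p + 1) q = ?t 1 0 + (SUM j<=N. ?t (N choose Suc j) (Suc j))" .
 have 2: "(d2 ^^ N) X p (q + 1) = - (SUM j<=N. ?t (N choose j) (Suc j))"
  unfolding Suc sum_negf[symmetric] by (rule sum.cong) (auto simp: algebra_simps)
 have "(SUM j<=Suc N. ?t (Suc N choose j) j) = ?t 1 0 + (SUM j<=N. ?t ((N choose j) + (N choose Suc j)) (Suc j))"
  by (subst sum.atMost_Suc_shift) (simp only: binomial_Suc_Suc binomial_n_0)
 also have "... = ?t 1 0 + ((SUM j<=N. ?t (N choose j) (Suc j)) + (SUM j<=N. ?t (N choose Suc j) (Suc j)))"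
  by (simp only: sum.distrib[symmetric] of_nat_add distrib_left scaleC_add_left)
 finally have 3: "(SUM j<=Suc N. ?t (Suc N choose j) j) = ?t 1 0 + ((SUM j<=N. ?t (N choose j) (Suc j)) + (SUM j<=N. ?t (N choose Suc j) (Suc j)))" .
 have "(d2 ^^ Suc N) X p q = (d2 ^^ N) X (p + 1) q - (d2 ^^ N) X p (q + 1)"
  by (simp only: funpow.simps comp_apply d2_def[of "(d2 ^^ N) X"])
 thus ?case unfolding 1 2 3 by (simp only: diff_minus_eq_add add.assoc add.commute[of "SUM j<=N. ?t (N choose Suc j) (Suc j)"])
qed (simp add: scaleC_one)

section \<open>Mutual locality and uniqueness of fields\<close>

definition commutator :: "(int => 'v => 'v) => (int => 'v => 'v) => 'v => int => int => 'v::complex_vector"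
 where "commutator A B v p q = A p (B q v) - B q (A p v)"

definition mutually_local :: "(int => 'v => 'v) => (int => 'v => 'v::complex_vector) => bool"
 where "mutually_local A B \<longleftrightarrow> (EX N. ALL v p q. (d2 ^^ N) (commutator A B v) p q = 0)"

abbreviation vop :: "'v::graded_vertex_algebra => int => 'v => 'v"
 where "vop a n == nprod n a"

text \<open>By \<open>d2_iter\<close> the binomial sum in the class axiom is the N-th power of x - y
  applied to the commutator.\<close>

lemma vop_local: "mutually_local (vop a) (vop b)"
 unfolding mutually_local_def d2_iter commutator_def by (rule locality)

lemma d2_zero: "(!!p q. F p q = 0) ==> (d2 ^^ N) F p q = 0"
 by (induction N arbitrary: p q) (auto simp: d2_def)

lemma d2_funpow_mono:
 assumes "!!p q. (d2 ^^ N) F p q = 0" "N <= M"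
 shows "(d2 ^^ M) F p q = 0"
proof -
 have "(d2 ^^ M) F = (d2 ^^ (M - N)) ((d2 ^^ N) F)" using assms(2) by (simp flip: funpow_add[unfolded comp_def, THEN fun_cong])
 thus ?thesis using assms(1) d2_zero by metis
qed

lemma d2_diff: "(d2 ^^ N) (%p q. F p q - G p q) p q = (d2 ^^ N) F p q - (d2 ^^ N) G p q"
 by (induction N arbitrary: p q) (auto simp: d2_def)

lemma d2_clinear: "clinear f ==> (d2 ^^ N) (%p q. f (F p q)) p q = f ((d2 ^^ N) F p q)"
 by (induction N arbitrary: p q) (auto simp: d2_def lin_diff)

text \<open>Goddard's uniqueness theorem.\<close>

lemma field_zero_if_kills_vacuum:
 fixes X :: "int => 'v::graded_vertex_algebra => 'v"
 assumes "!!d. mutually_local X (vop d)" "!!q. X q vac = 0" "!!q. X q 0 = 0"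
 shows "X q d = 0"
proof -
 obtain N where N: "!!v p q. (d2 ^^ N) (commutator X (vop d) v) p q = 0"
  using assms(1)[of d] unfolding mutually_local_def by blast
 let ?f = "commutator X (vop d) vac"
 have f0: "?f p s = 0" if "s >= 0" for p s
  using that by (simp add: commutator_def assms creation(2))
 \<comment> \<open>The commutator on the vacuum vanishes for s >= 0. Starting from s = -1, every
   term of (x - y)^n that raises s is therefore zero, and only the one that shifts p by n
   remains.\<close>
 have "(d2 ^^ n) ?f p s = (if s >= 0 then 0 else ?f (p + int n) (- 1))" if "s >= - 1" for n p s
  using that
 proof (induction n arbitrary: p s)
  case 0 thus ?case using f0 by (cases "s = -1") auto
 next
  case (Suc n) thus ?case by (auto simp: d2_def algebra_simps)
 qed
 from this[of "- 1" N "q - int N"] N have "?f q (- 1) = 0" by simp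
 thus ?thesis by (simp add: commutator_def assms(2) creation(1))
qed

text \<open>The left-hand side of the Borcherds identity: (x - y)^r a(x) b(y) expanded for large x,
  minus (x - y)^r b(y) a(x) expanded for large y. The sign rewrites (x - y)^r as (-1)^r (y -
  x)^r.\<close>

definition bprod :: "'v::graded_vertex_algebra => 'v => int => int => int => 'v => 'v"
 where "bprod a b r p q v = expand_diff (%i j. nprod i a (nprod j b v)) r p q
  - (if even r then 1 else - 1) *. expand_diff (%j i. nprod j b (nprod i a v)) r q p"

lemma bounded_right_nprod: "bounded_right (%i j. nprod i a (nprod j b v))"
proof -
 obtain N where "ALL n>=N. nprod n b v = 0" using truncation by blast
 thus ?thesis unfolding bounded_right_def by (intro exI[of _ N]) auto
qed

lemma bprod_step: "bprod a b r (p + 1) q v - bprod a b r p (q + 1) v = bprod a b (r + 1) p q v"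
proof -
 let ?X = "expand_diff (%i j. nprod i a (nprod j b v))" and ?Y = "expand_diff (%j i. nprod j b (nprod i a v))"
 have 1: "?X r (p + 1) q = ?X r p (q + 1) + ?X (r + 1) p q"
  using xdf_step[OF bounded_right_nprod[of a b v], of r p q] by (simp add: algebra_simps)
 have 2: "?Y r (q + 1) p = ?Y r q (p + 1) + ?Y (r + 1) q p"
  using xdf_step[OF bounded_right_nprod[of b a v], of r q p] by (simp add: algebra_simps)
 show ?thesis unfolding bprod_def 1 2 by (auto simp: algebra_simps scaleC_add_right scaleC_one)
qed

text \<open>For natural r both expansions are the same polynomial, so the expression is (x - y)^r
  times the commutator, which locality kills for large r.\<close>

lemma bprod_large: "EX N. ALL r>=N. ALL p q v. bprod a b r p q v = 0"
proof -
 obtain N where N: "!!v p q. (d2 ^^ N) (commutator (vop a) (vop b) v) p q = 0"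
  using vop_local[of a b] by (auto simp: mutually_local_def)
 have "bprod a b (int M) p q v = 0" if "M >= N" for M p q v
 proof -
  let ?Y = "%j i. nprod j b (nprod i a v)"
  have sw: "(d2 ^^ n) ?Y q p = (if even n then 1 else - 1) *. (d2 ^^ n) (%i j. ?Y j i) p q" for n
   by (induction n arbitrary: p q) (auto simp: d2_def scaleC_one cv_scale_minus_left)
  have "bprod a b (int M) p q v = (d2 ^^ M) (%i j. nprod i a (nprod j b v)) p q - (d2 ^^ M) (%i j. ?Y j i) p q"
   by (simp add: bprod_def xdf_nat[OF bounded_right_nprod] sw scaleC_scaleC scaleC_one)
  also have "... = (d2 ^^ M) (commutator (vop a) (vop b) v) p q"
   by (simp add: d2_diff[symmetric] commutator_def[abs_def])
  finally show ?thesis using d2_funpow_mono[OF N that] by simp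
 qed
 thus ?thesis by (intro exI[of _ "int N"]) (metis nonneg_int_cases of_nat_0_le_iff of_nat_le_iff order_trans)
qed

text \<open>Dong's lemma: \<^term>\<open>bprod a b r p\<close> is local with every \<^term>\<open>vop d\<close>. The three shift operators on
  coefficient functions commute, and \<open>x - y\<close> maps the functions for \<open>r\<close> to those for \<open>r + 1\<close>.\<close>

definition dxy where "dxy L p q s = L (p + 1) q s - L p (q + 1) s"
 for L :: "int => int => int => 'v::complex_vector"
definition dxw where "dxw L p q s = L (p + 1) q s - L p q (s + 1)"
 for L :: "int => int => int => 'v::complex_vector"
definition dyw where "dyw L p q s = L p (q + 1) s - L p q (s + 1)"
 for L :: "int => int => int => 'v::complex_vector"

lemma dyw_d2: "(dyw ^^ N) L p q s = (d2 ^^ N) (L p) q s"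
 by (induction N arbitrary: q s) (auto simp: dyw_def d2_def)

lemma dxw_d2: "(dxw ^^ N) L p q s = (d2 ^^ N) (%p. L p q) p s" for L :: "int => int => int => 'v::complex_vector"
 by (induction N arbitrary: p s) (auto simp: dxw_def d2_def)

lemma shifts_commute:
 fixes L :: "int => int => int => 'v::complex_vector"
 shows "dxy (dyw L) = dyw (dxy L)" "dxw (dyw L) = dyw (dxw L)"
 by (auto simp: fun_eq_iff dxy_def dyw_def dxw_def algebra_simps)

lemma dxw_dyw_commute: "(dxw ^^ N) ((dyw ^^ M) L) = (dyw ^^ M) ((dxw ^^ N) L)"
 for L :: "int => int => int => 'v::complex_vector"
proof -
 have "dxw ((dyw ^^ M) L) = (dyw ^^ M) (dxw L)" for L :: "int => int => int => 'v"
  by (induction M) (simp_all add: shifts_commute(2))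
 thus ?thesis by (induction N) simp_all
qed

lemma dxy_dyw_commute: "dxy ((dyw ^^ M) L) = (dyw ^^ M) (dxy L)"
 for L :: "int => int => int => 'v::complex_vector"
 by (induction M) (simp_all add: shifts_commute(1))

lemma dyw_zero: "((dyw :: (int => int => int => 'v::complex_vector) => _) ^^ M) (%p q s. 0) = (%p q s. 0)" and dxw_zero: "((dxw :: (int => int => int => 'v::complex_vector) => _) ^^ M) (%p q s. 0) = (%p q s. 0)"
 by (induction M) (auto simp: dyw_def dxw_def fun_eq_iff)

text \<open>x - w = (x - y) + (y - w), so the two operators agree on what x - y annihilates.\<close>

lemma dxw_eq_dyw_on_kernel:
 assumes "dxy L = (%p q s. 0)"
 shows "(dxw ^^ K) L = (dyw ^^ K) (L :: int => int => int => 'v::complex_vector)"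
proof (induction K)
 case (Suc K)
 have "dxy ((dyw ^^ K) L) = (%p q s. 0)" by (simp add: dxy_dyw_commute assms dyw_zero)
 hence "dxw ((dyw ^^ K) L) = dyw ((dyw ^^ K) L)"
  by (auto simp: fun_eq_iff dxy_def dxw_def dyw_def)
 thus ?case by (simp add: Suc)
qed simp

text \<open>The shift operators read only coefficients with equal or larger indices, so agreement on
  such a region is inherited. On a region the infinite sums in \<open>bprod\<close> can be truncated
  uniformly.\<close>

definition region_agree :: "int => int => int => (int => int => int => 'v) => (int => int => int => 'v) => bool"
 where "region_agree p0 q0 s0 F G \<longleftrightarrow> (ALL p>=p0. ALL q>=q0. ALL s>=s0. F p q s = G p q s)"

lemma region_agree_shifts:
 "region_agree p0 q0 s0 F G ==> region_agree p0 q0 s0 ((dxw ^^ N) ((dyw ^^ M) F)) ((dxw ^^ N) ((dyw ^^ M) G))"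
proof -
 assume "region_agree p0 q0 s0 F G"
 hence "region_agree p0 q0 s0 ((dyw ^^ M) F) ((dyw ^^ M) G)"
  by (induction M) (auto simp: region_agree_def dyw_def)
 thus ?thesis by (induction N) (auto simp: region_agree_def dxw_def)
qed

lemma shifts_sum:
 fixes F :: "'i => int => int => int => 'v::complex_vector"
 shows "(dxw ^^ N) ((dyw ^^ M) (%p q s. SUM i:A. c i *. F i p q s)) p q s = (SUM i:A. c i *. (dxw ^^ N) ((dyw ^^ M) (F i)) p q s)"
proof -
 have 1: "(dyw ^^ M) (%p q s. SUM i:A. c i *. F i p q s) = (%p q s. SUM i:A. c i *. (dyw ^^ M) (F i) p q s)" for F :: "'i => int => int => int => 'v"
  by (induction M) (auto simp: dyw_def fun_eq_iff sum_subtractf cv_scale_right_diff_distrib)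
 have 2: "(dxw ^^ N) (%p q s. SUM i:A. c i *. F i p q s) = (%p q s. SUM i:A. c i *. (dxw ^^ N) (F i) p q s)" for F :: "'i => int => int => int => 'v"
  by (induction N) (auto simp: dxw_def fun_eq_iff sum_subtractf cv_scale_right_diff_distrib)
 show ?thesis by (simp add: 1 2)
qed

lemma shifts_translate:
 fixes F :: "int => int => int => 'v::complex_vector"
 shows "(dxw ^^ N) ((dyw ^^ M) (%p q s. F (p + i) (q + j) s)) p q s = (dxw ^^ N) ((dyw ^^ M) F) (p + i) (q + j) s"
proof -
 have 1: "(dyw ^^ M) (%p q s. F (p + i) (q + j) s) = (%p q s. (dyw ^^ M) F (p + i) (q + j) s)"
  for F :: "int => int => int => 'v"
  by (induction M) (auto simp: dyw_def fun_eq_iff algebra_simps)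
 have 2: "(dxw ^^ N) (%p q s. F (p + i) (q + j) s) = (%p q s. (dxw ^^ N) F (p + i) (q + j) s)"
  for F :: "int => int => int => 'v"
  by (induction N) (auto simp: dxw_def fun_eq_iff algebra_simps)
 show ?thesis by (simp add: 1 2)
qed

definition triple_comm :: "'v::graded_vertex_algebra => 'v => 'v => 'v => int => int => int => 'v"
 where "triple_comm a b d v i j s = nprod i a (nprod j b (nprod s d v)) - nprod s d (nprod i a (nprod j b v))"

text \<open>[a(x) b(y), d(w)] = a(x) [b(y), d(w)] + [a(x), d(w)] b(y). A power of y - w kills the
  one summand and a power of x - w the other, with exponents independent of v.\<close>

lemma triple_comm_local:
 "EX K. ALL v. (dxw ^^ K) ((dyw ^^ K) (triple_comm a b d v)) = (%p q s. 0)
   & (dxw ^^ K) ((dyw ^^ K) (%i j. triple_comm b a d v j i)) = (%p q s. 0)"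
proof -
 obtain Na Nb where N: "!!v p q. (d2 ^^ Na) (commutator (vop a) (vop d) v) p q = 0"
   "!!v p q. (d2 ^^ Nb) (commutator (vop b) (vop d) v) p q = 0"
  using vop_local[of a d] vop_local[of b d] unfolding mutually_local_def by metis
 define K where "K = max Na Nb"
 have Ka: "(d2 ^^ K) (commutator (vop a) (vop d) v) p q = 0" and Kb: "(d2 ^^ K) (commutator (vop b) (vop d) v) p q = 0" for v p q
  unfolding K_def by (auto intro: d2_funpow_mono[OF N(1)] d2_funpow_mono[OF N(2)])
 have sum: "(dxw ^^ K) ((dyw ^^ K) (%i j s. F i j s + G i j s)) = (%p q s. 0)"
  if "(dyw ^^ K) F = (%p q s. 0)" "(dxw ^^ K) G = (%p q s. 0)" for F G :: "int => int => int => 'a"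
 proof -
  have 1: "(dyw ^^ M) (%i j s. F i j s + G i j s) = (%i j s. (dyw ^^ M) F i j s + (dyw ^^ M) G i j s)" for M
   by (induction M) (auto simp: dyw_def fun_eq_iff)
  show ?thesis unfolding 1 that(1) by (simp add: dxw_dyw_commute that(2) dyw_zero)
 qed
 have 1: "(dxw ^^ K) ((dyw ^^ K) (triple_comm a b d v)) = (%p q s. 0)" for v
 proof -
  have e: "triple_comm a b d v = (%i j s. nprod i a (commutator (vop b) (vop d) v j s) + commutator (vop a) (vop d) (nprod j b v) i s)"
   by (auto simp: triple_comm_def commutator_def fun_eq_iff lin_diff[OF lin_nprod])
  show ?thesis unfolding e
   by (rule sum) (auto simp: fun_eq_iff dyw_d2 dxw_d2 d2_clinear[OF lin_nprod] Ka Kb)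
 qed
 have 2: "(dxw ^^ K) ((dyw ^^ K) (%i j. triple_comm b a d v j i)) = (%p q s. 0)" for v
 proof -
  have e: "(%i j. triple_comm b a d v j i) = (%i j s. commutator (vop b) (vop d) (nprod i a v) j s + nprod j b (commutator (vop a) (vop d) v i s))"
   by (auto simp: triple_comm_def commutator_def fun_eq_iff lin_diff[OF lin_nprod])
  show ?thesis unfolding e
   by (rule sum) (auto simp: fun_eq_iff dyw_d2 dxw_d2 d2_clinear[OF lin_nprod] Ka Kb)
 qed
 show ?thesis using 1 2 by blast
qed

text \<open>Truncation gives a bound for each s separately. Since \<open>nprod s d v\<close>
  vanishes for large s, finitely many bounds matter, and their maximum serves for all s >=
  s0.\<close>

lemma uniform_truncation:
 "EX K. ALL n>=K. nprod n b v = 0 & (ALL s>=s0. nprod n b (nprod s d v) = 0)"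
proof -
 obtain S where S: "!!s. s >= S ==> nprod s d v = 0" using truncation by blast
 have "ALL s. EX N. ALL n>=N. nprod n b (nprod s d v) = 0" using truncation by blast
 from choice[OF this] obtain f where f: "!!s n. n >= f s ==> nprod n b (nprod s d v) = 0" by blast
 obtain N where N: "!!n. n >= N ==> nprod n b v = 0" using truncation by blast
 define K where "K = Max (insert N (f ` {s0..S}))"
 have fin: "finite (insert N (f ` {s0..S}))" by simp
 have "N <= K" unfolding K_def by (rule Max_ge[OF fin]) simp
 moreover have "f s <= K" if "s0 <= s" "s <= S" for s unfolding K_def by (rule Max_ge[OF fin]) (use that in auto)
 ultimately have "ALL n>=K. nprod n b v = 0 & (ALL s>=s0. nprod n b (nprod s d v) = 0)"
  using S f N by (metis linear nprod_0_right order_trans)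
 thus ?thesis by blast
qed

definition bcomm :: "'v::graded_vertex_algebra => 'v => 'v => int => 'v => int => int => int => 'v"
 where "bcomm a b d r v p q s = bprod a b r p q (nprod s d v) - nprod s d (bprod a b r p q v)"

text \<open>On the region above a given index triple the commutator is a finite combination of
  translates of \<open>triple_comm\<close>, and translation commutes with the shift operators. The
  exponent \<open>K\<close> depends neither on v nor on the indices.\<close>

lemma bcomm_weak_local:
 "EX K. ALL v. (dxw ^^ K) ((dyw ^^ K) (bcomm a b d r v)) = (%p q s. 0)"
proof -
 obtain K where K: "!!v. (dxw ^^ K) ((dyw ^^ K) (triple_comm a b d v)) = (%p q s. 0)"
   "!!v. (dxw ^^ K) ((dyw ^^ K) (%i j. triple_comm b a d v j i)) = (%p q s. 0)"
  using triple_comm_local[of a b d] by blast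
 have "(dxw ^^ K) ((dyw ^^ K) (bcomm a b d r v)) p0 q0 s0 = 0" for v p0 q0 s0
 proof -
  obtain N1 where N1: "ALL n>=N1. nprod n b v = 0 & (ALL s>=s0. nprod n b (nprod s d v) = 0)"
   using uniform_truncation by blast
  obtain N2 where N2: "ALL n>=N2. nprod n a v = 0 & (ALL s>=s0. nprod n a (nprod s d v) = 0)"
   using uniform_truncation by blast
  define M where "M = nat (max (N1 - q0) (N2 - p0))"
  let ?c = "%m. (- 1) ^ m * ((of_int r :: complex) gchoose m)"
  let ?e = "if even r then 1 else - 1 :: complex"
  let ?G1 = "%m p q s. triple_comm a b d v (p + (r - int m)) (q + int m) s"
  let ?G2 = "%m p q s. triple_comm b a d v (q + (r - int m)) (p + int m) s"
  have bp: "bprod a b r p q u = (SUM m<M. ?c m *. nprod (p + r - int m) a (nprod (q + int m) b u))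
    - ?e *. (SUM m<M. ?c m *. nprod (q + r - int m) b (nprod (p + int m) a u))"
   if "p >= p0" "q >= q0" "u = v | (EX s>=s0. u = nprod s d v)" for p q u
  proof -
   have A: "j >= N1 ==> nprod j b u = 0" and B: "j >= N2 ==> nprod j a u = 0" for j
    using that(3) N1 N2 by auto
   have "expand_diff (%i j. nprod i a (nprod j b u)) r p q = (SUM m<M. ?c m *. nprod (p + r - int m) a (nprod (q + int m) b u))"
    by (rule xdf_eq[where K = N1]) (use A that M_def in auto)
   moreover have "expand_diff (%j i. nprod j b (nprod i a u)) r q p = (SUM m<M. ?c m *. nprod (q + r - int m) b (nprod (p + int m) a u))"
    by (rule xdf_eq[where K = N2]) (use B that M_def in auto)
   ultimately show ?thesis by (simp only: bprod_def)
  qed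
  \<comment> \<open>The two halves of \<open>bprod\<close> are merged into one sum over a disjoint
    union, so that the operators pass through a single finite sum.\<close>
  have "region_agree p0 q0 s0 (bcomm a b d r v)
    (%p q s. (SUM m:{..<M} <+> {..<M}. (case m of Inl m => ?c m | Inr m => - ?e * ?c m) *.
     (case m of Inl m => ?G1 m | Inr m => ?G2 m) p q s))"
   unfolding region_agree_def
  proof (intro allI impI)
   fix p q s assume "p >= p0" "q >= q0" "s >= s0"
   hence "bcomm a b d r v p q s = ((SUM m<M. ?c m *. nprod (p + r - int m) a (nprod (q + int m) b (nprod s d v)))
    - ?e *. (SUM m<M. ?c m *. nprod (q + r - int m) b (nprod (p + int m) a (nprod s d v))))
    - nprod s d ((SUM m<M. ?c m *. nprod (p + r - int m) a (nprod (q + int m) b v))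
    - ?e *. (SUM m<M. ?c m *. nprod (q + r - int m) b (nprod (p + int m) a v)))"
    unfolding bcomm_def by (subst (1 2) bp) auto
   also have "... = (SUM m<M. ?c m *. ?G1 m p q s) - ?e *. (SUM m<M. ?c m *. ?G2 m p q s)"
    by (simp add: triple_comm_def lin_diff[OF lin_nprod] lin_scale[OF lin_nprod] lin_sum[OF lin_nprod]
     cv_scale_right_diff_distrib sum_subtractf cv_scale_sum_right algebra_simps)
   also have "... = (SUM m:{..<M} <+> {..<M}. (case m of Inl m => ?c m | Inr m => - ?e * ?c m) *.
     (case m of Inl m => ?G1 m | Inr m => ?G2 m) p q s)"
    by (subst sum.Plus) (auto simp: cv_scale_sum_right scaleC_scaleC sum_negf cv_scale_minus_left)
   finally show "bcomm a b d r v p q s = ..." .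
  qed
  from region_agree_shifts[OF this, of K K]
  have "(dxw ^^ K) ((dyw ^^ K) (bcomm a b d r v)) p0 q0 s0 =
   (dxw ^^ K) ((dyw ^^ K) (%p q s. (SUM m:{..<M} <+> {..<M}. (case m of Inl m => ?c m | Inr m => - ?e * ?c m) *.
     (case m of Inl m => ?G1 m | Inr m => ?G2 m) p q s))) p0 q0 s0"
   unfolding region_agree_def by blast
  also have "... = 0" unfolding shifts_sum
  proof (rule sum.neutral, rule ballI)
   fix x assume "x : {..<M} <+> {..<M}"
   have g1: "(dxw ^^ K) ((dyw ^^ K) (?G1 m)) p0 q0 s0 = 0" for m
    using shifts_translate[of K K "triple_comm a b d v" "r - int m" "int m" p0 q0 s0] K(1)[of v] by simp
   have g2: "(dxw ^^ K) ((dyw ^^ K) (?G2 m)) p0 q0 s0 = 0" for m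
    using shifts_translate[of K K "%i j. triple_comm b a d v j i" "int m" "r - int m" p0 q0 s0] K(2)[of v] by simp
   show "(case x of Inl m => ?c m | Inr m => - ?e * ?c m) *. (dxw ^^ K) ((dyw ^^ K) (case x of Inl m => ?G1 m | Inr m => ?G2 m)) p0 q0 s0 = 0"
    using g1 g2 by (cases x) auto
  qed
  finally show ?thesis .
 qed
 thus ?thesis by (auto simp: fun_eq_iff)
qed

text \<open>Descending induction on r from the range where \<open>bprod\<close> vanishes. As x - y
  leads from r to r + 1, a power of y - w sends the family for r into the kernel of x - y; there x -
  w acts as y - w, and the power of x - w in the weak statement turns into one of y - w.\<close>

lemma bcomm_local: "EX M. ALL v. (dyw ^^ M) (bcomm a b d r v) = (%p q s. 0)"
proof -
 obtain N where N: "!!r p q v. r >= N ==> bprod a b r p q v = 0" using bprod_large[of a b] by blast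
 have "EX M. ALL v. (dyw ^^ M) (bcomm a b d r v) = (%p q s. 0)" if "r = N - int n" for n r
  using that
 proof (induction n arbitrary: r)
  case 0
  thus ?case by (intro exI[of _ 0]) (auto simp: bcomm_def fun_eq_iff N)
 next
  case (Suc n)
  obtain M where M: "!!v. (dyw ^^ M) (bcomm a b d (r + 1) v) = (%p q s. 0)"
   using Suc.IH[of "r + 1"] Suc.prems by auto
  obtain K where K: "!!v. (dxw ^^ K) ((dyw ^^ K) (bcomm a b d r v)) = (%p q s. 0)"
   using bcomm_weak_local by blast
  have "(dyw ^^ (K + (K + M))) (bcomm a b d r v) = (%p q s. 0)" for v
  proof -
   let ?L = "bcomm a b d r v"
   have "dxy ?L = bcomm a b d (r + 1) v"
    by (auto simp: fun_eq_iff dxy_def bcomm_def bprod_step[symmetric] lin_diff[OF lin_nprod])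
   hence "dxy ((dyw ^^ M) ?L) = (%p q s. 0)" by (simp add: dxy_dyw_commute M)
   note ker = dxw_eq_dyw_on_kernel[OF this, of K]
   have "(dyw ^^ (K + (K + M))) ?L = (dyw ^^ K) ((dyw ^^ K) ((dyw ^^ M) ?L))" by (simp add: funpow_add)
   also have "... = (dyw ^^ K) ((dxw ^^ K) ((dyw ^^ M) ?L))" by (simp add: ker)
   also have "... = (dyw ^^ M) ((dxw ^^ K) ((dyw ^^ K) ?L))"
   proof -
    have c: "(dyw ^^ K) ((dyw ^^ M) G) = (dyw ^^ M) ((dyw ^^ K) G)" for G :: "int => int => int => 'a"
     by (metis add.commute comp_apply funpow_add)
    show ?thesis unfolding dxw_dyw_commute c ..
   qed
   finally show ?thesis by (simp add: K dyw_zero)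
  qed
  thus ?case by blast
 qed
 from this[of r "nat (N - r)"] show ?thesis
 proof (cases "r <= N")
  case False
  thus ?thesis by (intro exI[of _ 0]) (auto simp: bcomm_def fun_eq_iff N)
 qed auto
qed


section \<open>Translation and the values on the vacuum\<close>

lemma lin_bprod: "clinear (bprod a b r p q)"
proof -
 have lin: "clinear (%v. expand_diff (%i j. nprod i a (nprod j b v)) r p q)" for a b :: 'a and r p q
 proof -
  let ?t = "%v m. ((- 1) ^ m * ((of_int r :: complex) gchoose m)) *. nprod (p + r - int m) a (nprod (q + int m) b v)"
  have fin: "finite {m. ?t v m ~= 0}" for v
  proof -
   obtain N where N: "!!n. n >= N ==> nprod n b v = 0" using truncation by blast
   have "{m. ?t v m ~= 0} <= {..<nat (N - q)}"
   proof (rule subsetI, rule ccontr)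
    fix m assume "m : {m. ?t v m ~= 0}" "m ~: {..<nat (N - q)}"
    thus False using N[of "q + int m"] by simp
   qed
   thus ?thesis by (rule finite_subset) simp
  qed
  show ?thesis unfolding expand_diff_def
  proof (rule clinearI)
   fix v w show "Sum_any (?t (v + w)) = Sum_any (?t v) + Sum_any (?t w)"
    by (subst Sum_any.distrib[OF fin fin, symmetric]) (simp add: nprod_add_right scaleC_add_right)
  next
   fix c v
   have "Sum_any (?t (c *. v)) = Sum_any (%m. c *. ?t v m)"
    by (simp add: nprod_scaleC_right scaleC_scaleC mult.commute)
   also have "... = c *. Sum_any (?t v)"
    by (rule lin_Sum_any[symmetric, OF lin_scaled[OF lin_id(2)] fin])
   finally show "Sum_any (?t (c *. v)) = c *. Sum_any (?t v)" .
  qed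
 qed
 show ?thesis unfolding bprod_def[abs_def] by (intro lin_minus lin_scaled lin)
qed

text \<open>\<open>[T, a(x) b(y)] = (\<partial>\<^sub>x + \<partial>\<^sub>y) a(x) b(y)\<close>, and \<open>\<partial>\<^sub>x + \<partial>\<^sub>y\<close> kills \<open>(x - y)\<^sup>r\<close>.\<close>

lemma transl_xdf:
 assumes "bounded_right X" "!!i j. transl (X i j) = (- of_int i) *. X (i - 1) j + (- of_int j) *. X i (j - 1)"
 shows "transl (expand_diff X r p q) = (- of_int p) *. expand_diff X r (p - 1) q + (- of_int q) *. expand_diff X r p (q - 1)"
proof -
 obtain K where K: "!!i j. j >= K ==> X i j = 0" using assms(1) by (auto simp: bounded_right_def)
 define M where "M = nat (K - q + 1)"
 have M: "q + int M >= K" "q - 1 + int M >= K" by (simp_all add: M_def)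
 let ?c = "%m. (- 1) ^ m * ((of_int r :: complex) gchoose m)"
 let ?Y = "%m. X (p + r - int m) (q + int m - 1)"
 have 1: "transl (expand_diff X r p q) = (SUM m<M. ?c m *. ((- of_int (p + r - int m)) *. ?Y (Suc m) + (- of_int (q + int m)) *. ?Y m))"
  by (subst xdf_eq[where K = K and M = M, OF K M(1)])
   (auto simp: lin_sum[OF lin_transl] transl_scaleC assms(2) algebra_simps intro!: sum.cong)
 have 2: "expand_diff X r (p - 1) q = (SUM m<M. ?c m *. ?Y (Suc m))"
  by (subst xdf_eq[where K = K and M = M, OF K M(1)]) (auto simp: algebra_simps intro!: sum.cong)
 have 3: "expand_diff X r p (q - 1) = (SUM m<M. ?c m *. ?Y m)"
  by (subst xdf_eq[where K = K and M = M, OF K M(2)]) (auto simp: algebra_simps intro!: sum.cong)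
 have YM: "?Y (Suc M) = 0" "?Y M = 0" using M K by auto
 \<comment> \<open>Apart from the two expected sums, T leaves terms from the exponents r - m and m.
   By \<open>rel\<close> they are differences of consecutive values of \<open>g\<close>, and their
   sum telescopes to 0.\<close>
 define g where "g m = (of_nat m * ?c m) *. ?Y m" for m
 have rel: "?c m * (- of_int (r - int m)) = of_nat (Suc m) * ?c (Suc m)" for m
 proof -
  have "of_nat (Suc m) * ((of_int r :: complex) gchoose Suc m) = (of_int r gchoose m) * (of_int r - of_nat m)"
   using gbinomial_absorb_comp[of "of_int r :: complex" m] gbinomial_mult_1[of "of_int r :: complex" m]
   by (simp add: algebra_simps)
  moreover have "of_nat (Suc m) * ?c (Suc m) = - ((- 1) ^ m * (of_nat (Suc m) * ((of_int r :: complex) gchoose Suc m)))"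
   by simp
  ultimately show ?thesis by (simp only: of_int_diff of_int_of_nat_eq) (simp add: algebra_simps)
 qed
 have "transl (expand_diff X r p q) = (SUM m<M. (- of_int p) *. ?c m *. ?Y (Suc m)) + (SUM m<M. (- of_int q) *. ?c m *. ?Y m)
   + (SUM m<M. g (Suc m) - g m)"
  unfolding 1 sum.distrib[symmetric]
 proof (rule sum.cong[OF refl])
  fix m
  have "?c m *. ((- of_int (p + r - int m)) *. ?Y (Suc m) + (- of_int (q + int m)) *. ?Y m)
   = (?c m * (- of_int p) + ?c m * (- of_int (r - int m))) *. ?Y (Suc m) + (?c m * (- of_int q) + - (of_nat m * ?c m)) *. ?Y m"
   unfolding scaleC_add_right scaleC_scaleC by (simp add: algebra_simps)
  also have "... = (- of_int p) *. ?c m *. ?Y (Suc m) + (- of_int q) *. ?c m *. ?Y m + (g (Suc m) - g m)"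
   unfolding rel g_def scaleC_scaleC scaleC_add_left cv_scale_minus_left by (simp add: mult.commute)
  finally show "?c m *. ((- of_int (p + r - int m)) *. ?Y (Suc m) + (- of_int (q + int m)) *. ?Y m) = ..." .
 qed
 also have "(SUM m<M. g (Suc m) - g m) = 0" unfolding sum_lessThan_telescope by (simp add: g_def YM)
 finally show ?thesis unfolding 2 3 cv_scale_sum_right by simp
qed

lemma transl_nprod_vac: "transl (nprod n a vac) = (- of_int n) *. nprod (n - 1) a vac"
 using translation[of n a vac] by (simp add: transl_vac)

lemma transl_nprod2_vac: "transl (nprod i a (nprod j b vac)) =
  (- of_int i) *. nprod (i - 1) a (nprod j b vac) + (- of_int j) *. nprod i a (nprod (j - 1) b vac)"
 using translation[of i a "nprod j b vac"]
 by (simp add: transl_nprod_vac nprod_scaleC_right lin_neg[OF lin_nprod]) (metis eq_diff_eq diff_minus_eq_add)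

text \<open>Both sides vanish for q >= 0 and equal \<open>nprod r a b\<close> for q = -1. On both
  sides T sends the value at q to -q times the value at q - 1, which determines everything
  below.\<close>

lemma bprod_vac: "bprod a b r 0 q vac = nprod q (nprod r a b) vac"
proof -
 have van: "bprod a b r 0 q vac = 0" if "q >= 0" for q
  using that by (simp add: bprod_def expand_diff_def creation(2))
 have m1: "bprod a b r 0 (- 1) vac = nprod r a b"
 proof -
  have "expand_diff (%i j. nprod i a (nprod j b vac)) r 0 (- 1) = nprod r a b"
   by (subst xdf_eq[where K = 0 and M = 1]) (auto simp: creation scaleC_one)
  moreover have "expand_diff (%j i. nprod j b (nprod i a vac)) r (- 1) 0 = 0"
   by (simp add: expand_diff_def creation(2))
  ultimately show ?thesis by (simp add: bprod_def)
 qed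
 have T: "transl (bprod a b r 0 q vac) = (- of_int q) *. bprod a b r 0 (q - 1) vac" for q
 proof -
  have 1: "transl (expand_diff (%i j. nprod i a (nprod j b vac)) r 0 q) = (- of_int q) *. expand_diff (%i j. nprod i a (nprod j b vac)) r 0 (q - 1)"
   by (subst transl_xdf[OF bounded_right_nprod]) (auto simp: transl_nprod2_vac)
  have 2: "transl (expand_diff (%i j. nprod i b (nprod j a vac)) r q 0) = (- of_int q) *. expand_diff (%i j. nprod i b (nprod j a vac)) r (q - 1) 0"
   by (subst transl_xdf[OF bounded_right_nprod]) (auto simp: transl_nprod2_vac)
  show ?thesis unfolding bprod_def
   by (simp add: lin_diff[OF lin_transl] transl_scaleC 1 2 scaleC_scaleC cv_scale_right_diff_distrib mult.commute)
 qed
 have "bprod a b r 0 (- 1 - int n) vac = nprod (- 1 - int n) (nprod r a b) vac" for n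
 proof (induction n)
  case 0 thus ?case by (simp add: m1 creation(1))
 next
  case (Suc n)
  have "of_nat (Suc n) *. bprod a b r 0 (- 1 - int (Suc n)) vac = transl (bprod a b r 0 (- 1 - int n) vac)"
   unfolding T by (simp add: algebra_simps)
  also have "... = of_nat (Suc n) *. nprod (- 1 - int (Suc n)) (nprod r a b) vac"
   unfolding Suc transl_nprod_vac by (simp add: algebra_simps)
  finally show ?case by (metis complex_vector.scale_cancel_left of_nat_eq_0_iff nat.distinct(1))
 qed
 from this[of "nat (- 1 - q)"] show ?thesis using van[of q] creation(2)[of q "nprod r a b"]
  by (cases "q >= 0") auto
qed

text \<open>The difference of the two fields is local with every field, by Dong's lemma, and kills
  the vacuum; Goddard's theorem makes it zero.\<close>

lemma bprod_eq_nprod: "bprod a b r 0 q v = nprod q (nprod r a b) v"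
proof -
 define X where "X q v = bprod a b r 0 q v - nprod q (nprod r a b) v" for q v
 have X0: "X q 0 = 0" "X q vac = 0" for q by (simp_all add: X_def lin_zero[OF lin_bprod] bprod_vac)
 have "mutually_local X (vop d)" for d
 proof -
  obtain M where M: "!!v. (dyw ^^ M) (bcomm a b d r v) = (%p q s. 0)" using bcomm_local by blast
  obtain N where N: "!!v p q. (d2 ^^ N) (commutator (vop (nprod r a b)) (vop d) v) p q = 0"
   using vop_local[of "nprod r a b" d] by (auto simp: mutually_local_def)
  have "(d2 ^^ (max M N)) (commutator X (vop d) v) q s = 0" for v q s
  proof -
   have e: "commutator X (vop d) v = (%q s. bcomm a b d r v 0 q s - commutator (vop (nprod r a b)) (vop d) v q s)"
    by (auto simp: fun_eq_iff commutator_def X_def bcomm_def lin_diff[OF lin_nprod])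
   have "(d2 ^^ M) (bcomm a b d r v 0) q s = 0" for q s
    using M[of v] dyw_d2[of M "bcomm a b d r v" 0 q s] by simp
   thus ?thesis unfolding e d2_diff
    using d2_funpow_mono[of M "bcomm a b d r v 0" "max M N" q s] d2_funpow_mono[OF N, of "max M N"] by simp
  qed
  thus ?thesis unfolding mutually_local_def by blast
 qed
 from field_zero_if_kills_vacuum[OF this X0(2,1)] show ?thesis by (simp add: X_def)
qed

definition iterate_sum :: "'v::graded_vertex_algebra => 'v => int => int => int => 'v => 'v"
 where "iterate_sum a b r p q v = Sum_any (%m::nat. ((of_int p :: complex) gchoose m) *. nprod (p + q - int m) (nprod (r + int m) a b) v)"

lemma iterate_sum_eq:
 assumes "!!n. n >= K ==> nprod n a b = 0" "r + int M >= K"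
 shows "iterate_sum a b r p q v = (SUM m<M. ((of_int p :: complex) gchoose m) *. nprod (p + q - int m) (nprod (r + int m) a b) v)"
 unfolding iterate_sum_def
 by (rule Sum_any_superset) (use assms in auto)

lemma iterate_sum_step: "iterate_sum a b r (p + 1) q v = iterate_sum a b r p (q + 1) v + iterate_sum a b (r + 1) p q v"
proof -
 obtain K where K: "!!n. n >= K ==> nprod n a b = 0" using truncation by blast
 define M where "M = nat (K - r)"
 have M: "r + int (Suc M) >= K" "r + 1 + int M >= K" by (simp_all add: M_def)
 let ?c = "%p m. (of_int p :: complex) gchoose m"
 let ?Y = "%m. nprod (p + 1 + q - int m) (nprod (r + int m) a b) v"
 have 1: "iterate_sum a b r (p + 1) q v = (SUM m<Suc M. ?c (p + 1) m *. ?Y m)"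
  by (subst iterate_sum_eq[OF K M(1)]) (auto simp: algebra_simps)
 have 2: "iterate_sum a b r p (q + 1) v = (SUM m<Suc M. ?c p m *. ?Y m)"
  by (subst iterate_sum_eq[OF K M(1)]) (auto simp: algebra_simps)
 have 3: "iterate_sum a b (r + 1) p q v = (SUM m<M. ?c p m *. ?Y (Suc m))"
  by (subst iterate_sum_eq[OF K M(2)]) (auto simp: algebra_simps)
 have "?c (p + 1) (Suc m) = ?c p (Suc m) + ?c p m" for m
  using gbinomial_Suc_Suc[of "of_int p :: complex" m] by (simp add: algebra_simps)
 thus ?thesis unfolding 1 2 3 sum.lessThan_Suc_shift
  by (simp add: scaleC_add_left sum.distrib del: of_nat_Suc)
qed

text \<open>Both sides satisfy X(r, p+1, q) = X(r, p, q+1) + X(r+1, p, q) and agree at p = 0, which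
  gives p >= 0 by induction.\<close>

theorem borcherds_identity: "bprod a b r p q v = iterate_sum a b r p q v"
proof -
 have base: "bprod a b r 0 q v = iterate_sum a b r 0 q v" for r q
  unfolding bprod_eq_nprod iterate_sum_def
  by (subst Sum_any.expand_superset[of "{0}"]) (auto simp: gbinomial_0_left scaleC_one split: if_splits)
 have up: "bprod a b r (int n) q v = iterate_sum a b r (int n) q v" for n r q
 proof (induction n arbitrary: r q)
  case (Suc n)
  have "bprod a b r (int n + 1) q v = bprod a b r (int n) (q + 1) v + bprod a b (r + 1) (int n) q v"
   using bprod_step[of a b r "int n" q v] by (simp add: algebra_simps)
  hence "bprod a b r (int n + 1) q v = iterate_sum a b r (int n + 1) q v"
   unfolding iterate_sum_step Suc .
  thus ?case by (simp add: add.commute)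
 qed (simp add: base)
 obtain N1 where N1: "!!r p q v. r >= N1 ==> bprod a b r p q v = 0" using bprod_large[of a b] by blast
 obtain N2 where N2: "!!n. n >= N2 ==> nprod n a b = 0" using truncation by blast
 define N where "N = max N1 N2"
 have large: "bprod a b r p q v = iterate_sum a b r p q v" if "r >= N" for r p q
  using that N1 N2 by (simp add: iterate_sum_def N_def)
 \<comment> \<open>Going down in p, the recursion yields the value at r only from the one at r + 1;
   a second induction descends in r from \<open>N\<close>, from which on both sides vanish.\<close>
 have down: "bprod a b r (- int n) q v = iterate_sum a b r (- int n) q v" for n r q
 proof (induction n arbitrary: r q)
  case (Suc n)
  note IH = Suc.IH
  have "bprod a b (N - int k) (- int (Suc n)) q v = iterate_sum a b (N - int k) (- int (Suc n)) q v" for k q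
  proof (induction k arbitrary: q)
   case 0 show ?case by (rule large) simp
  next
   case (Suc k)
   let ?p = "- int (Suc n)" and ?r = "N - int (Suc k)"
   have "bprod a b ?r (?p + 1) (q - 1) v - bprod a b ?r ?p (q - 1 + 1) v = bprod a b (?r + 1) ?p (q - 1) v" by (rule bprod_step)
   moreover have "iterate_sum a b ?r (?p + 1) (q - 1) v = iterate_sum a b ?r ?p (q - 1 + 1) v + iterate_sum a b (?r + 1) ?p (q - 1) v"
    by (rule iterate_sum_step)
   moreover have "bprod a b ?r (?p + 1) (q - 1) v = iterate_sum a b ?r (?p + 1) (q - 1) v"
    using IH[of ?r "q - 1"] by simp
   moreover have "bprod a b (?r + 1) ?p (q - 1) v = iterate_sum a b (?r + 1) ?p (q - 1) v"
    using Suc[of "q - 1"] by simp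
   ultimately show ?case by (simp add: algebra_simps)
  qed
  from this[of "nat (N - r)" q] large[of r "- int (Suc n)" q] show ?case by (cases "r >= N") auto
 qed (simp add: base)
 show ?thesis using up[of r "nat p" q] down[of r "nat (- p)" q] by (cases "p >= 0") auto
qed

lemma transl_eq: "transl a = nprod (- 2) a vac"
 using transl_nprod_vac[of "- 1" a] by (simp add: creation(1) scaleC_one)

text \<open>The class axiom describes only the commutator with T. Here Ta = a_(-2) vac is inserted
  into \<open>bprod\<close> with b = vac and r = -2. The modes of vac are trivial, so at most one
  term survives, in one half or the other according to the sign of n.\<close>

lemma nprod_transl: "nprod n (transl a) v = (- of_int n) *. nprod (n - 1) a v"
proof -
 have c: "(- 1) ^ m * ((- 2 :: complex) gchoose m) = of_nat (Suc m)" for m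
 proof -
  have e: "2 + of_nat m - 1 = (of_nat (Suc m) :: complex)" by simp
  have "((- 2 :: complex) gchoose m) = (- 1) ^ m * of_nat (Suc m choose m)"
   using gbinomial_minus[of "2 :: complex" m] unfolding e binomial_gbinomial by simp
  thus ?thesis by (simp add: mult.assoc[symmetric] power_mult_distrib[symmetric] del: of_nat_Suc)
 qed
 have 1: "expand_diff (%i j. nprod i a (nprod j vac v)) (- 2) 0 n = (if n < 0 then (- of_int n) *. nprod (n - 1) a v else 0)"
 proof (cases "n < 0")
  case True
  define k where "k = nat (- n - 1)"
  have n: "n = - 1 - int k" using True by (simp add: k_def)
  have "expand_diff (%i j. nprod i a (nprod j vac v)) (- 2) 0 n = of_nat (Suc k) *. nprod (n - 1) a v"
   unfolding expand_diff_def
   by (subst Sum_any.expand_superset[of "{k}"]) (auto simp: vacuum n c simp del: of_nat_Suc split: if_splits)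
  thus ?thesis by (simp add: n)
 qed (simp add: expand_diff_def vacuum)
 have 2: "expand_diff (%j i. nprod j vac (nprod i a v)) (- 2) n 0 = (if n > 0 then of_int n *. nprod (n - 1) a v else 0)"
 proof (cases "n > 0")
  case True
  define k where "k = nat (n - 1)"
  have n: "n = 1 + int k" using True by (simp add: k_def)
  have "expand_diff (%j i. nprod j vac (nprod i a v)) (- 2) n 0 = of_nat (Suc k) *. nprod (n - 1) a v"
   unfolding expand_diff_def
   by (subst Sum_any.expand_superset[of "{k}"]) (auto simp: vacuum n c simp del: of_nat_Suc split: if_splits)
  thus ?thesis by (simp add: n)
 next
  case False
  hence "n - 2 - int m ~= - 1" for m by auto
  thus ?thesis using False by (simp add: expand_diff_def vacuum)
 qed
 have "nprod n (transl a) v = bprod a vac (- 2) 0 n v" by (simp add: bprod_eq_nprod transl_eq)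
 thus ?thesis unfolding bprod_def 1 2 by (auto simp: scaleC_one)
qed

section \<open>Renaming of variables\<close>

lemma conf_hom_unique:
 fixes Ph Ps :: "ratfun => 'k::field"
 assumes "f : conf S"
  and "!!f g. f : conf S ==> g : conf S ==> Ph (f + g) = Ph f + Ph g"
   "!!f g. f : conf S ==> g : conf S ==> Ph (f * g) = Ph f * Ph g" "Ph 1 = 1"
  and "!!f g. f : conf S ==> g : conf S ==> Ps (f + g) = Ps f + Ps g"
   "!!f g. f : conf S ==> g : conf S ==> Ps (f * g) = Ps f * Ps g"
  and "!!c. Ph (ratC c) = Ps (ratC c)" "!!i. i : S ==> Ph (var i) = Ps (var i)"
 shows "Ph f = Ps f"
 by (rule ring_hom_unique[where S = S and Z = S and D = "offdiag S"])
   (use assms in "simp_all add: conf_def offdiag_def")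

lemmas conf_closed [simp] = cring_const[of _ S S "offdiag S" for S, folded conf_def]
  cring_0[of S S "offdiag S" for S, folded conf_def] cring_1[of S S "offdiag S" for S, folded conf_def]
 and conf_add = cring_add[of _ S S "offdiag S" for S, folded conf_def]
 and conf_mult = cring_mult[of _ S S "offdiag S" for S, folded conf_def]
 and conf_diff = cring_diff[of _ S S "offdiag S" for S, folded conf_def]
 and conf_sum = cring_sum[of _ _ S S "offdiag S" for S, folded conf_def]
 and conf_scaleC = cring_scaleC[of _ S S "offdiag S" for S, folded conf_def]
 and conf_pd = pd_cring[of _ S S "offdiag S" for S, folded conf_def]
 and conf_var = cring_var[of _ S S "offdiag S" for S, folded conf_def]
 and confp_closed [simp] = cring_const[of _ S "{}" "offdiag S" for S, folded confp_def]
  cring_0[of S "{}" "offdiag S" for S, folded confp_def] cring_1[of S "{}" "offdiag S" for S, folded confp_def]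
 and confp_pd = pd_cring[of _ S "{}" "offdiag S" for S, folded confp_def]

lemma conf_inv: "i : S ==> inverse (var i) : conf S"
 unfolding conf_def by (rule cring_inv)

lemma conf_subspace: "cspan (conf S) = conf S" "cspan (confp S) = confp S"
 unfolding conf_def confp_def by (rule span_cring)+

lemma admissible_rename: "inj_on pqi S ==> admissible S (offdiag S) (%j. var (pqi j))"
 by (auto simp: admissible_def offdiag_def inj_on_def)

lemma admissible_rename_plus: "inj_on pqi S ==> admissible {} (offdiag S) (%j. var (pqi j))"
 by (auto simp: admissible_def offdiag_def inj_on_def)

lemma rename_hom:
 assumes "inj_on pqi S" "f : conf S" "g : conf S"
 shows "rnm pqi (f + g) = rnm pqi f + rnm pqi g" "rnm pqi (f * g) = rnm pqi f * rnm pqi g"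
 using ren.cring_dom[OF admissible_rename[OF assms(1)]] assms(2,3)
 by (auto simp: rename_vars_def conf_def ren.subst_add ren.subst_mult)

lemma rename_simps [simp]: "rnm pqi (ratC c) = ratC c" "rnm pqi (var i) = var (pqi i)"
 "rnm pqi 0 = 0" "rnm pqi 1 = 1"
 by (simp_all add: rename_vars_def)

lemma rename_inverse_var [simp]: "rnm pqi (inverse (var i)) = inverse (var (pqi i))"
 unfolding rename_vars_def by (subst ren.subst_inverse) simp_all

lemma rename_conf: "inj_on pqi S ==> f : conf S ==> rnm pqi f : conf (pqi ` S)"
 unfolding conf_def rename_vars_def
 by (rule ren.cring_image[OF admissible_rename])
   (auto simp: offdiag_def inj_on_def intro: cring_add cring_mult cring_var cring_inv cring_invdiff)

lemma rename_confp: "inj_on pqi S ==> f : confp S ==> rnm pqi f : confp (pqi ` S)"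
 unfolding confp_def rename_vars_def
 by (rule ren.cring_image[OF admissible_rename_plus])
   (auto simp: offdiag_def inj_on_def intro: cring_add cring_mult cring_var cring_invdiff)

lemma rename_scaleC: "inj_on pqi S ==> f : conf S ==> rnm pqi (c *. f) = c *. rnm pqi f"
 by (simp add: scaleC_ratfun rename_hom)

lemma rename_sum: "inj_on pqi S ==> (!!x. x : A ==> f x : conf S) ==> rnm pqi (sum f A) = (SUM x:A. rnm pqi (f x))"
 by (induction A rule: infinite_finite_induct) (auto simp: rename_hom conf_sum)

lemma rename_comp:
 assumes "inj_on pqi S" "inj_on rh (pqi ` S)" "f : conf S"
 shows "rnm rh (rnm pqi f) = rnm (%i. rh (pqi i)) f"
proof (rule conf_hom_unique[OF assms(3)])
 have inj: "inj_on (%i. rh (pqi i)) S" using comp_inj_on[OF assms(1,2)] by (simp add: comp_def)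
 fix f g assume fg: "f : conf S" "g : conf S"
 show "rnm (%i. rh (pqi i)) (f + g) = rnm (%i. rh (pqi i)) f + rnm (%i. rh (pqi i)) g"
  "rnm (%i. rh (pqi i)) (f * g) = rnm (%i. rh (pqi i)) f * rnm (%i. rh (pqi i)) g"
  by (rule rename_hom[OF inj fg])+
 note img = rename_conf[OF assms(1) fg(1)] rename_conf[OF assms(1) fg(2)]
 show "rnm rh (rnm pqi (f + g)) = rnm rh (rnm pqi f) + rnm rh (rnm pqi g)"
  "rnm rh (rnm pqi (f * g)) = rnm rh (rnm pqi f) * rnm rh (rnm pqi g)"
  unfolding rename_hom[OF assms(1) fg] by (rule rename_hom[OF assms(2) img])+
qed simp_all

lemma rename_cong:
 assumes "inj_on pqi S" "!!i. i : S ==> pqi i = rh i" "f : conf S"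
 shows "rnm pqi f = rnm rh f"
proof -
 have inj: "inj_on rh S" using assms(1,2) by (auto simp: inj_on_def)
 show ?thesis
  by (rule conf_hom_unique[OF assms(3)]) (simp_all add: rename_hom[OF assms(1)] rename_hom[OF inj] assms(2))
qed

lemma rename_id:
 assumes "f : conf S" "!!i. i : S ==> pqi i = i"
 shows "rnm pqi f = f"
proof -
 have inj: "inj_on pqi S" using assms(2) by (auto simp: inj_on_def)
 show ?thesis
  by (rule conf_hom_unique[OF assms(1), of "rnm pqi" "%f. f"]) (simp_all add: rename_hom[OF inj] assms(2))
qed

lemma lau_hom_conf:
 assumes "adm sg" "f : conf S" "g : conf S"
 shows "lsub sg (f + g) = lsub sg f + lsub sg g"
  "lsub sg (f * g) = lsub sg f * lsub sg g"
 using lau_hom[OF assms(1) conf_CU conf_CU] assms(2,3) by blast+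

text \<open>Both sides are ring homomorphisms in f. Compatibility of an expansion with renaming is
  thus checked on the substituted points only.\<close>

lemma laurent_rename:
 assumes "inj_on pqi S" "adm sg" "adm ta" "f : conf S" "inj_on rh T"
  "!!h n. h : conf S ==> lsub sg h $$ n : conf T"
  "!!i. i : S ==> ta (pqi i) = fls_map (rnm rh) (sg i)"
 shows "lsub ta (rnm pqi f) $$ n = rnm rh (lsub sg f $$ n)"
proof -
 have "lsub ta (rnm pqi f) = fls_map (rnm rh) (lsub sg f)"
 proof (rule conf_hom_unique[OF assms(4)])
  fix f g assume fg: "f : conf S" "g : conf S"
  show "lsub ta (rnm pqi (f + g)) = lsub ta (rnm pqi f) + lsub ta (rnm pqi g)"
   "lsub ta (rnm pqi (f * g)) = lsub ta (rnm pqi f) * lsub ta (rnm pqi g)"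
   unfolding rename_hom[OF assms(1) fg]
   by (rule lau_hom_conf[OF assms(3) rename_conf[OF assms(1) fg(1)] rename_conf[OF assms(1) fg(2)]])+
  show "fls_map (rnm rh) (lsub sg (f + g)) = fls_map (rnm rh) (lsub sg f) + fls_map (rnm rh) (lsub sg g)"
   by (rule fls_eqI) (simp add: lau_hom_conf[OF assms(2) fg] rename_hom[OF assms(5)] assms(6) fg)
  show "fls_map (rnm rh) (lsub sg (f * g)) = fls_map (rnm rh) (lsub sg f) * fls_map (rnm rh) (lsub sg g)"
   unfolding lau_hom_conf[OF assms(2) fg]
   by (rule fls_map_mult[where S = T and Z = T and D = "offdiag T"])
     (simp_all add: conf_def[symmetric] rename_hom[OF assms(5)] coeffs_in_def assms(6) fg)
 qed (auto simp: assms(7) intro!: fls_eqI)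
 thus ?thesis by simp
qed

lemma expat_rename:
 assumes "inj_on pqi S" "f : conf S" "i : S" "p = None | p = Some j & j : S & j ~= i"
 shows "expat (pqi i) (map_option pqi p) (rnm pqi f) $$ n = rnm pqi (expat i p f $$ n)"
 unfolding expat_def
proof (rule laurent_rename[OF assms(1) _ _ assms(2)])
 show "inj_on pqi (S - {i})" using assms(1) by (auto simp: inj_on_def)
 show "adm (exp_pt i p)" using assms(4) by (intro adm_exp) auto
 show "adm (exp_pt (pqi i) (map_option pqi p))" using assms by (intro adm_exp) (auto simp: inj_on_def)
 show "lsub (exp_pt i p) h $$ n : conf (S - {i})" if "h : conf S" for h n
  using expat_conf[OF that assms(4)] by (simp add: expat_def)
 have "rnm pqi (pt p) = pt (map_option pqi p)" by (cases p) simp_all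
 thus "exp_pt (pqi i) (map_option pqi p) (pqi l) = fls_map (rnm pqi) (exp_pt i p l)" if "l : S" for l
  using assms that by (auto simp: exp_pt_def inj_on_def rename_hom(1) intro!: fls_eqI)
qed

text \<open>The bridge from the definitions, which renumber during the expansion, to
  \<open>expat\<close>, which keeps the labels and leaves the renumbering as a separate
  step.\<close>

lemma expand_at_eq:
 assumes "f : conf S" "i : S"
 shows "expand_at_zero i f $$ n = rnm (drop_var i) (expat i None f $$ n)"
  and "j : S ==> j ~= i ==> expand_at_var i j f $$ n = rnm (drop_var i) (expat i (Some j) f $$ n)"
proof -
 have inj: "inj_on (drop_var i) (S - {i})" by (auto simp: inj_on_def drop_var_def split: if_splits)
 have id: "inj_on (%i. i) S" by simp
 have neq: "drop_var i l ~= drop_var i m" if "l ~= i" "m ~= i" "l ~= m" for l m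
  using that by (auto simp: drop_var_def split: if_splits)
 have adm: "adm (%l. if l = i then fls_const c + fls_X else fls_const (var (drop_var i l)))" for c
 proof -
  let ?s = "%l. if l = i then fls_const c + fls_X else fls_const (var (drop_var i l))"
  have 1: "?s l $$ 1 = (if l = i then 1 else 0)" for l by simp
  have 0: "l ~= i ==> ?s l $$ 0 = var (drop_var i l)" for l by simp
  have "?s l ~= 0" for l
  proof
   assume "?s l = 0"
   hence "fls_nth (?s l) 1 = fls_nth 0 1" "fls_nth (?s l) 0 = fls_nth 0 0" by (rule arg_cong)+
   thus False using 1[of l] 0[of l] by (cases "l = i") simp_all
  qed
  moreover have "l ~= m ==> ?s l ~= ?s m" for l m
  proof (cases "l = i | m = i")
   case True
   assume "l ~= m"
   with True have "?s l $$ 1 ~= ?s m $$ 1" unfolding 1 by auto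
   thus ?thesis by (rule contrapos_nn) (erule arg_cong)
  next
   case False
   assume "l ~= m"
   with False have "?s l $$ 0 ~= ?s m $$ 0" using 0[of l] 0[of m] neq[of l m] by auto
   thus ?thesis by (rule contrapos_nn) (erule arg_cong)
  qed
  ultimately show ?thesis by (auto simp: admissible_def offdiag_def)
 qed
 have "expand_at_zero i (rnm (%i. i) f) $$ n = rnm (drop_var i) (expat i None f $$ n)"
  unfolding expand_at_zero_def expat_def
 proof (rule laurent_rename[OF id _ _ assms(1) inj])
  show "adm (%l. if l = i then fls_X else fls_const (var (drop_var i l)))" using adm[of 0] by (simp only: fls_const_0 add_0)
  show "lsub (exp_pt i None) h $$ n : conf (S - {i})" if "h : conf S" for h n
   using expat_conf[OF that] by (simp add: expat_def)
 qed (auto simp: exp_pt_def adm_exp intro!: fls_eqI)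
 thus "expand_at_zero i f $$ n = rnm (drop_var i) (expat i None f $$ n)"
  by (simp add: rename_id[OF assms(1)])
 assume j: "j : S" "j ~= i"
 have "expand_at_var i j (rnm (%i. i) f) $$ n = rnm (drop_var i) (expat i (Some j) f $$ n)"
  unfolding expand_at_var_def expat_def
 proof (rule laurent_rename[OF id _ _ assms(1) inj])
  show "lsub (exp_pt i (Some j)) h $$ n : conf (S - {i})" if "h : conf S" for h n
   using expat_conf[OF that, of "Some j" j i] j by (simp add: expat_def)
  have "rnm (drop_var i) (var j + 1) = var (drop_var i j) + 1"
   using j by (subst rename_hom[OF inj]) (auto intro: conf_var)
  thus "(if l = i then fls_const (var (drop_var i j)) + fls_X else fls_const (var (drop_var i l))) = fls_map (rnm (drop_var i)) (exp_pt i (Some j) l)" for l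
   by (auto simp: exp_pt_def intro!: fls_eqI)
 qed (use j in "auto simp: adm_exp adm")
 thus "expand_at_var i j f $$ n = rnm (drop_var i) (expat i (Some j) f $$ n)"
  by (simp add: rename_id[OF assms(1)])
qed

lemma xsh_conf: "f : conf S ==> xsh J f $$ n : conf S"
 unfolding conf_def
 by (rule subsetD[OF cring_mono coeffs_inD[OF xsh_coeffs[OF cwf_conf(1)]]]) auto

lemma xsh_rename:
 assumes "inj_on pqi S" "f : conf S" "J <= S"
 shows "xsh (pqi ` J) (rnm pqi f) $$ n = rnm pqi (xsh J f $$ n)"
 unfolding xsh_eq
proof (rule laurent_rename[OF assms(1) _ _ assms(2) assms(1)])
 show "lsub (shift_pt J) h $$ n : conf S" if "h : conf S" for h n
  using xsh_conf[OF that] by (simp add: xsh_eq)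
 show "shift_pt (pqi ` J) (pqi l) = fls_map (rnm pqi) (shift_pt J l)" if "l : S" for l
  using assms that by (auto simp: shift_pt_def inj_on_def intro!: fls_eqI)
qed simp_all

lemma pd_rename:
 assumes "inj_on pqi S" "f : conf S" "i : S"
 shows "pdv (pqi i) (rnm pqi f) = rnm pqi (pdv i f)"
proof (rule derivation_unique[OF assms(2)[unfolded conf_def], where Ph = "rnm pqi"]; (unfold conf_def[symmetric])?)
 show "derivation_along (conf S) (rnm pqi) (%f. pdv (pqi i) (rnm pqi f))"
  by (simp add: derivation_along_def rename_hom[OF assms(1)] pd_add pd_mult)
 show "derivation_along (conf S) (rnm pqi) (%f. rnm pqi (pdv i f))"
  by (simp add: derivation_along_def rename_hom[OF assms(1)] pd_add pd_mult conf_mult conf_pd)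
qed (use assms in "auto simp: rename_hom[OF assms(1)] inj_on_eq_iff offdiag_def")

lemma xsh_id: "f : conf S ==> S Int J = {} ==> xsh J f = fls_const f"
 unfolding xsh_eq
 by (rule conf_hom_unique[of f S])
   (simp_all add: lau_hom_conf[where S = S] fls_plus_const fls_const_mult_const, auto simp: shift_pt_def)

lemma expat_id: "f : conf S ==> i ~: S ==> p ~= Some i ==> expat i p f = fls_const f"
 unfolding expat_def
 by (rule conf_hom_unique[of f S])
   (simp_all add: lau_hom_conf[where S = S] adm_exp fls_plus_const fls_const_mult_const, auto simp: exp_pt_def)

lemma xsh_cong: "f : conf S ==> S Int J = S Int K ==> xsh J f = xsh K f"
 unfolding xsh_eq
 by (rule conf_hom_unique[of f S])
   (simp_all add: lau_hom_conf[where S = S], auto simp: shift_pt_def)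

section \<open>Functions of disjoint sets of variables\<close>

definition polys :: "nat set => ((nat \<Rightarrow>\<^sub>0 nat) \<Rightarrow>\<^sub>0 complex) set"
 where "polys I = {p. ALL m:pkeys p. pkeys m <= I}"

definition rats :: "nat set => ratfun set"
 where "rats I = {Frc p q | p q. p : polys I & q : polys I & q ~= 0}"

lemma polys_add: "p : polys I ==> q : polys I ==> p + q : polys I"
 using Poly_Mapping.keys_add[of p q] by (auto simp: polys_def)

lemma polys_mult: "p : polys I ==> q : polys I ==> p * q : polys I"
proof -
 assume "p : polys I" "q : polys I"
 hence "pkeys m <= I" if "m : pkeys (p * q)" for m
 proof -
  obtain a b where "m = a + b" "a : pkeys p" "b : pkeys q"
   using keys_mult[of p q] \<open>m : _\<close> by auto
  moreover from this have "pkeys a <= I" "pkeys b <= I"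
   using \<open>p : polys I\<close> \<open>q : polys I\<close> by (auto simp: polys_def)
  ultimately show ?thesis using Poly_Mapping.keys_add[of a b] by blast
 qed
 thus ?thesis by (simp add: polys_def)
qed

lemma polys_single: "pkeys m <= I ==> sgl m c : polys I"
 by (simp add: polys_def)

lemma polys_1: "1 : polys I"
 using polys_single[of 0 I 1] by simp

lemma polys_prod: "(!!x. x : A ==> f x : polys I) ==> prod f A : polys I"
 by (induction A rule: infinite_finite_induct) (auto intro: polys_1 polys_mult)

lemma rats_add: "f : rats I ==> g : rats I ==> f + g : rats I"
 and rats_mult: "f : rats I ==> g : rats I ==> f * g : rats I"
proof -
 assume "f : rats I" "g : rats I"
 then obtain p q p' q' where *: "f = Frc p q" "g = Frc p' q'"
  "p : polys I" "q : polys I" "q ~= 0" "p' : polys I" "q' : polys I" "q' ~= 0"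
  unfolding rats_def by blast
 have "f + g = Frc (p * q' + p' * q) (q * q')" "f * g = Frc (p * p') (q * q')"
  using * by simp_all
 moreover have "q * q' ~= 0" using * by simp
 ultimately show "f + g : rats I" "f * g : rats I"
  using * unfolding rats_def by (blast intro: polys_add polys_mult)+
qed

lemma rats_var: "i : I ==> var i : rats I"
 unfolding rats_def var_def using polys_1 polys_single[of "sgl i 1" I 1] by force

lemma rats_const: "ratC c : rats I"
 unfolding rats_def ratC_def using polys_1 polys_single[of 0 I c] by force

lemma rats_inverse: "f : rats I ==> inverse f : rats I"
proof -
 assume "f : rats I"
 then obtain p q where *: "f = Frc p q" "p : polys I" "q : polys I" "q ~= 0"
  unfolding rats_def by blast
 show ?thesis
 proof (cases "p = 0")
  case True
  hence "inverse f = ratC 0" using * by (simp add: fract_collapse)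
  thus ?thesis using rats_const by metis
 next
  case False
  thus ?thesis using * unfolding rats_def by (auto intro: exI)
 qed
qed

lemma rats_uminus: "f : rats I ==> - f : rats I"
 using rats_mult[OF rats_const[of "- 1"]] by (fastforce simp: ratC_uminus)

lemma rats_sum: "(!!x. x : A ==> f x : rats I) ==> sum f A : rats I"
 using rats_const[of 0 I] by (induction A rule: infinite_finite_induct) (auto intro: rats_add)

lemma cring_rats: "cwf S Z D ==> f : cring S Z D ==> f : rats S"
proof -
 assume wf: "cwf S Z D" and f: "f : cring S Z D"
 show ?thesis using f
 proof (induction rule: cring_induct)
  case (inv i) thus ?case using wf by (auto simp: cwf_def intro!: rats_inverse rats_var)
 next
  case (diff i j)
  hence "var i : rats S" "- var j : rats S" using wf by (auto simp: cwf_def offdiag_def intro: rats_uminus rats_var)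
  from rats_inverse[OF rats_add[OF this]] show ?case by simp
 qed (auto intro: rats_const rats_var rats_add rats_mult)
qed

lemma conf_rats: "conf S <= rats S" and confp_rats: "confp S <= rats S"
 unfolding conf_def confp_def using cring_rats[OF cwf_conf(1)] cring_rats[OF cwf_conf(2)] by auto

text \<open>A monomial in the union of two disjoint sets of variables factors in one way only, so
  the convolution sum for this coefficient has a single term.\<close>

lemma lookup_product_disjoint:
 assumes "p : polys I" "q : polys J" "I Int J = {}" "pkeys m <= I" "pkeys n <= J"
 shows "lkp (p * q) (m + n) = lkp p m * lkp q n"
proof -
 have uniq: "l = m & k = n" if "m + n = l + k" "pkeys l <= I" "pkeys k <= J" for l k
 proof -
  have z: "lkp x i = 0" if "pkeys x <= K" "i ~: K" for x :: "nat \<Rightarrow>\<^sub>0 nat" and K i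
   using that by (meson in_keys_iff subsetD)
  have e: "lkp m i + lkp n i = lkp l i + lkp k i" for i
   using that(1) by (metis lookup_add)
  have "lkp l i = lkp m i & lkp k i = lkp n i" for i
  proof (cases "i : I")
   case True
   hence "i ~: J" using assms(3) by auto
   thus ?thesis using e[of i] z[OF assms(5)] z[OF that(3)] by simp
  next
   case False
   thus ?thesis using e[of i] z[OF assms(4)] z[OF that(2)] by simp
  qed
  thus ?thesis by (simp add: poly_mapping_eq_iff fun_eq_iff)
 qed
 have inner: "lkp p l * (SUM k. lkp q k when m + n = l + k) =
  (if l = m then lkp p m * lkp q n else 0)" for l
 proof (cases "l : pkeys p")
  case True
  hence l: "pkeys l <= I" using assms(1) by (auto simp: polys_def)
  have "(SUM k. lkp q k when m + n = l + k) = (SUM k. if k = n then (if l = m then lkp q n else 0) else 0)"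
  proof (rule Sum_any.cong)
   fix k show "(lkp q k when m + n = l + k) = (if k = n then if l = m then lkp q n else 0 else 0)"
   proof (cases "k : pkeys q")
    case True
    hence k: "pkeys k <= J" using assms(2) by (auto simp: polys_def)
    show ?thesis using uniq[OF _ l k] by (auto simp: when_def)
   next
    case False thus ?thesis by (auto simp: in_keys_iff when_def)
   qed
  qed
  thus ?thesis by simp
 next
  case False thus ?thesis by (auto simp: in_keys_iff)
 qed
 show ?thesis unfolding lookup_mult inner by simp
qed

lemma Fract_sum: "Frc (sum f A) 1 = (SUM x:A. Frc (f x) 1)"
proof (induction A rule: infinite_finite_induct)
 case (insert x F)
 thus ?case by (simp flip: insert.IH)
qed (simp_all add: Zero_fract_def[symmetric])

lemma common_denominator:
 assumes "finite T" "!!b. b : T ==> f b : rats J"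
 obtains D N where "D ~= 0" "!!b. b : T ==> N b : polys J" "!!b. b : T ==> Frc D 1 * f b = Frc (N b) 1"
proof -
 have "ALL b:T. EX p q. f b = Frc p q & p : polys J & q : polys J & q ~= 0"
  using assms(2) unfolding rats_def by blast
 then obtain p q where pq: "!!b. b : T ==> f b = Frc (p b) (q b) & p b : polys J & q b : polys J & q b ~= 0"
  by metis
 define D where "D = prod q T"
 define N where "N b = p b * prod q (T - {b})" for b
 have "D ~= 0" using pq assms(1) by (simp add: D_def)
 moreover have "N b : polys J" if "b : T" for b using pq that by (auto simp: N_def intro!: polys_mult polys_prod)
 moreover have "Frc D 1 * f b = Frc (N b) 1" if "b : T" for b
 proof -
  have "D = q b * prod q (T - {b})" unfolding D_def using assms(1) that by (rule prod.remove)
  thus ?thesis using pq[OF that] by (simp add: eq_fract N_def algebra_simps)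
 qed
 ultimately show thesis using that by blast
qed

lemma independent_zero_sum:
 assumes "complex_vector.independent B" "finite T" "T <= B" "(SUM b:T. c b *. b) = 0" "b : T"
 shows "c b = 0"
 using assms complex_vector.independent_explicit_finite_subsets by blast

text \<open>After clearing denominators on both sides, the coefficient of each monomial in z_I gives
  a linear relation with constant coefficients between elements of \<open>B\<close>, which must be
  trivial.\<close>

lemma disjoint_variables_independent:
 assumes "I Int J = {}" "complex_vector.independent B" "B <= rats J" "finite T" "T <= B"
  and "!!b. b : T ==> p b : rats I" "(SUM b:T. p b * b) = 0" "b : T"
 shows "p b = 0"
proof -
 obtain D N where DN: "D ~= 0" "!!b. b : T ==> N b : polys J" "!!b. b : T ==> Frc D 1 * b = Frc (N b) 1"
  using common_denominator[OF assms(4), of "%b. b" J] assms(3,5) by blast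
 obtain E P where EP: "E ~= 0" "!!b. b : T ==> P b : polys I" "!!b. b : T ==> Frc E 1 * p b = Frc (P b) 1"
  using common_denominator[OF assms(4), of p I] assms(6) by blast
 have nz: "Frc D 1 ~= 0" "Frc E 1 ~= 0" using DN(1) EP(1) by (simp_all add: Zero_fract_def eq_fract)
 have "Frc (SUM b:T. P b * N b) 1 = (SUM b:T. Frc E 1 * p b * (Frc D 1 * b))"
  unfolding Fract_sum by (rule sum.cong) (simp_all add: DN(3) EP(3))
 also have "... = Frc E 1 * Frc D 1 * (SUM b:T. p b * b)"
  by (simp add: sum_distrib_left mult_ac del: mult_fract)
 also have "... = 0" by (simp add: assms(7))
 finally have zero: "(SUM b:T. P b * N b) = 0" by (simp add: Zero_fract_def eq_fract)
 have "lkp (P b) m = 0" for m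
 proof (cases "pkeys m <= I")
  case True
  have "(SUM b:T. lkp (P b) m *. N b) = 0"
  proof (rule poly_mapping_eqI)
   fix n
   show "lkp (SUM b:T. lkp (P b) m *. N b) n = lkp 0 n"
   proof (cases "pkeys n <= J")
    case n: True
    have "(SUM b:T. lkp (P b) m * lkp (N b) n) = lkp (SUM b:T. P b * N b) (m + n)"
     unfolding lookup_sum by (rule sum.cong) (simp_all add: lookup_product_disjoint[OF EP(2) DN(2) assms(1) True n])
    thus ?thesis by (simp add: lookup_sum zero)
   next
    case False
    hence "lkp (N b) n = 0" if "b : T" for b using DN(2)[OF that] by (auto simp: polys_def in_keys_iff)
    thus ?thesis by (simp add: lookup_sum)
   qed
  qed
  hence "0 = Frc (SUM b:T. lkp (P b) m *. N b) 1" by (simp add: Zero_fract_def)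
  also have "... = (SUM b:T. lkp (P b) m *. (Frc D 1 * b))"
   unfolding Fract_sum by (rule sum.cong) (simp_all add: DN(3) scaleC_fract_def poly_scaleC_eq)
  also have "... = Frc D 1 * (SUM b:T. lkp (P b) m *. b)"
   by (simp add: sum_distrib_left scaleC_ratfun mult_ac)
  finally have "(SUM b:T. lkp (P b) m *. b) = 0" using nz by simp
  thus ?thesis by (rule independent_zero_sum[OF assms(2,4,5) _ assms(8)])
 next
  case False
  thus ?thesis using EP(2)[OF assms(8)] by (auto simp: polys_def in_keys_iff)
 qed
 hence "P b = 0" by (auto intro: poly_mapping_eqI)
 hence "Frc E 1 * p b = 0" using EP(3)[OF assms(8)] by (simp add: Zero_fract_def)
 thus ?thesis using nz by simp
qed

lemma products_independent:
 assumes "I Int J = {}" "complex_vector.independent B" "B <= rats I" "complex_vector.independent C" "C <= rats J"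
 shows "inj_on (%(b, c). b * c) (B \<times> C)" "complex_vector.independent ((%(b, c). b * c) ` (B \<times> C))"
proof -
 have nzB: "b ~= 0" if "b : B" for b using that assms(2) complex_vector.dependent_zero by blast
 have coeff: "k (b, c) = 0" if "finite T" "T <= B \<times> C" "(SUM x:T. k x *. (fst x * snd x)) = 0" "(b, c) : T" for T and k :: "_ => complex" and b c
 proof -
  let ?k = "%x. if x : T then k x else 0"
  have fin: "finite (fst ` T)" "finite (snd ` T)" using that(1) by simp_all
  have "0 = (SUM x:fst ` T \<times> snd ` T. ?k x *. (fst x * snd x))"
   unfolding that(3)[symmetric] using that(1)
   by (intro sum.mono_neutral_cong_left) (auto simp: fin image_iff intro: rev_image_eqI)
  also have "... = (SUM (b, c):fst ` T \<times> snd ` T. ?k (b, c) *. (b * c))"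
   by (rule sum.cong) auto
  also have "... = (SUM b:fst ` T. SUM c:snd ` T. ?k (b, c) *. (b * c))"
   by (rule sum.cartesian_product[symmetric])
  also have "... = (SUM c:snd ` T. SUM b:fst ` T. ?k (b, c) *. (b * c))"
   by (rule sum.swap)
  also have "... = (SUM c:snd ` T. (SUM b:fst ` T. ?k (b, c) *. b) * c)"
   by (simp only: sum_distrib_right scaleC_ratfun mult.assoc)
  finally have z: "(SUM c:snd ` T. (SUM b:fst ` T. ?k (b, c) *. b) * c) = 0" by simp
  have "(SUM b:fst ` T. ?k (b, c) *. b) = 0"
  proof (rule disjoint_variables_independent[OF assms(1,4,5) fin(2) _ _ z])
   show "snd ` T <= C" using that(2) by auto
   show "(SUM b:fst ` T. ?k (b, c) *. b) : rats I" for c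
    using that(2) assms(3) by (auto simp: scaleC_ratfun intro!: rats_sum rats_mult rats_const)
   show "c : snd ` T" using that(4) by force
  qed
  moreover have "fst ` T <= B" "b : fst ` T" using that(2,4) by force+
  ultimately have "?k (b, c) = 0"
   using independent_zero_sum[OF assms(2) fin(1), of "%b. ?k (b, c)" b] by blast
  thus ?thesis using that(4) by simp
 qed
 show inj: "inj_on (%(b, c). b * c) (B \<times> C)"
 proof (rule inj_onI, rule ccontr)
  fix x y assume xy: "x : B \<times> C" "y : B \<times> C" "(case x of (b, c) => b * c) = (case y of (b, c) => b * c)" "x ~= y"
  have "(SUM z:{x, y}. (if z = x then 1 else - 1) *. (fst z * snd z)) = 0"
   using xy by (auto simp: scaleC_one split_beta)
  thus False using coeff[of "{x, y}" "%z. if z = x then 1 else - 1" "fst x" "snd x"] xy by simp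
 qed
 show "complex_vector.independent ((%(b, c). b * c) ` (B \<times> C))"
  unfolding complex_vector.independent_explicit_finite_subsets
 proof (intro allI impI ballI)
  fix A u v assume A: "A <= (%(b, c). b * c) ` (B \<times> C)" "finite A" "(SUM v:A. u v *. v) = 0" "v : A"
  obtain T where T: "T <= B \<times> C" "A = (%(b, c). b * c) ` T" using A(1) by (meson subset_imageE)
  have injT: "inj_on (%(b, c). b * c) T" using inj T(1) by (rule inj_on_subset)
  have finT: "finite T" using A(2) T(2) injT finite_imageD by blast
  have "(SUM x:T. u (fst x * snd x) *. (fst x * snd x)) = 0"
   using A(3) unfolding T(2) sum.reindex[OF injT] by (simp add: split_beta comp_def)
  moreover obtain x where "x : T" "v = fst x * snd x" using A(4) T(2) by auto
  ultimately show "u v = 0" using coeff[OF finT T(1), of "%x. u (fst x * snd x)" "fst x" "snd x"] by simp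
 qed
qed

lemma lin_times: "clinear (%p :: ratfun. p * q)" "clinear (%p :: ratfun. q * p)"
 by (auto intro!: clinearI simp: distrib_left distrib_right scaleC_ratfun mult_ac)

text \<open>The natural map from the tensor product of the two function spaces into the rational
  functions is injective. This makes the value on a sum of products independent of the way it is
  written.\<close>

lemma bilinear_extension:
 assumes "I Int J = {}" "P <= rats I" "Q <= rats J" "cbilinear bei"
 obtains L where "clinear L" "!!p q. p : P ==> q : Q ==> L (p * q) = bei p q"
proof -
 obtain B where B: "B <= P" "complex_vector.independent B" "P <= cspan B"
  using cv_maximal_independent_subset by blast
 obtain C where C: "C <= Q" "complex_vector.independent C" "Q <= cspan C"
  using cv_maximal_independent_subset by blast
 note ind = products_independent[OF assms(1) B(2) _ C(2)]
 have sub: "B <= rats I" "C <= rats J" using B C assms by auto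
 \<comment> \<open>The values are prescribed on products of elements of two bases; the formula is
   then extended by linearity in one factor at a time.\<close>
 obtain L where L: "clinear L" "!!x. x : (%(b, c). b * c) ` (B \<times> C) ==> L x = (%(b, c). bei b c) (the_inv_into (B \<times> C) (%(b, c). b * c) x)"
  by (rule lin_extend[OF ind(2)[OF sub], of "%x. (%(b, c). bei b c) (the_inv_into (B \<times> C) (%(b, c). b * c) x)"]) blast
 have 1: "L (b * c) = bei b c" if "b : B" "c : C" for b c
  using L(2)[of "b * c"] that the_inv_into_f_f[OF ind(1)[OF sub], of "(b, c)"] by force
 have mult: "clinear (%p. L (p * q))" "clinear (%p. L (q * p))" for q
  by (rule lin_comp[OF L(1) lin_times(1)], rule lin_comp[OF L(1) lin_times(2)])
 have bl: "clinear (bei a)" "clinear (%a. bei a b)" for a b using assms(4) by (auto simp: cbilinear_def)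
 have 2: "L (p * c) = bei p c" if "p : P" "c : C" for p c
  using lin_eq_on_span[OF mult(1)[of c] bl(2), of B c p] 1 that B(3) by blast
 have "L (p * q) = bei p q" if "p : P" "q : Q" for p q
  using lin_eq_on_span[OF mult(2)[of p] bl(1), of C p q] 2 that C(3) by blast
 thus thesis using that L(1) by blast
qed

section \<open>Linear maps on the restricted mode algebra\<close>

text \<open>Positions in a list are replaced by labels: \<open>Ps ls A f\<close> is the value on \<open>\<O>(A l\<^sub>1, \<dots>, A l\<^sub>n; f)\<close>
  for a list \<open>ls\<close> of distinct labels, \<open>f\<close> being a function of the variables with these labels. All
  relabellings then disappear from the relations. The vacuum relation is needed only in the last
  position: it is moved there by commutators.\<close>

locale labelled_functional =
 fixes Ps :: "nat list => (nat => 'v::graded_vertex_algebra) => ratfun => 'w::complex_vector"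
 assumes linear: "clinear (Ps ls A)"
  and cong: "(!!i. i : set ls ==> A i = B i) ==> f : conf (set ls) ==> Ps ls A f = Ps ls B f"
  and rename: "distinct ls ==> inj_on pqi (set ls) ==> f : conf (set ls) ==>
   Ps (map pqi ls) A (rnm pqi f) = Ps ls (%i. A (pqi i)) f"
  and vec_add: "distinct ls ==> i : set ls ==> f : conf (set ls) ==>
   Ps ls (A(i := a + b)) f = Ps ls (A(i := a)) f + Ps ls (A(i := b)) f"
  and vec_scale: "distinct ls ==> i : set ls ==> f : conf (set ls) ==>
   Ps ls (A(i := c *. a)) f = c *. Ps ls (A(i := a)) f"
  and translation: "distinct ls ==> i : set ls ==> f : conf (set ls) ==>
   Ps ls (A(i := transl a)) f = - Ps ls (A(i := a)) (pdv i f)"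
  and commutator: "distinct (xs @ i # j # ys) ==> f : conf (set (xs @ i # j # ys)) ==>
   Ps (xs @ i # j # ys) A f = Ps (xs @ j # i # ys) A f
    + Sum_any (%k. Ps (xs @ j # ys) (A(j := nprod k (A i) (A j))) (expat i (Some j) f $$ k))"
  and vacuum_last: "distinct (xs @ [i]) ==> A i = vac ==> f : conf (set (xs @ [i])) ==>
   Ps (xs @ [i]) A f = Ps xs A (expat i None f $$ (- 1))"
begin

lemma vec_zero: "distinct ls ==> i : set ls ==> f : conf (set ls) ==> Ps ls (A(i := 0)) f = 0"
 using vec_scale[of ls i f A 0 0] by simp

text \<open>Moving the vacuum past z_j costs a commutator, in which \<open>nprod k vac\<close> is
  nonzero for k = -1 only. That term is the residue at z_i = z_j, so the sum in
  \<open>vacuum_residue\<close> arises by itself.\<close>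

lemma vacuum_anywhere:
 "distinct (xs @ i # ys) ==> A i = vac ==> f : conf (set (xs @ i # ys)) ==>
  Ps (xs @ i # ys) A f = Ps (xs @ ys) A (expat i None f $$ (- 1) + (SUM j:set ys. expat i (Some j) f $$ (- 1)))"
proof (induction ys arbitrary: xs)
 case Nil thus ?case by (simp add: vacuum_last)
next
 case (Cons j ys)
 let ?S = "set (xs @ i # j # ys)"
 have c: "expat i (Some j) f $$ k : conf (set (xs @ j # ys))" for k
  using expat_conf[OF Cons.prems(3), of "Some j" j i k] Cons.prems(1)
  by (simp add: insert_Diff_if Un_Diff insert_commute)
 have "Ps (xs @ i # j # ys) A f = Ps (xs @ j # i # ys) A f
    + Sum_any (%k. Ps (xs @ j # ys) (A(j := nprod k vac (A j))) (expat i (Some j) f $$ k))"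
  using commutator[OF Cons.prems(1,3), of A] Cons.prems(2) by simp
 also have "(%k. Ps (xs @ j # ys) (A(j := nprod k vac (A j))) (expat i (Some j) f $$ k))
  = (%k. if k = - 1 then Ps (xs @ j # ys) A (expat i (Some j) f $$ (- 1)) else 0)"
  using vec_zero[of "xs @ j # ys" j _ A, OF _ _ c] Cons.prems(1) by (auto simp: vacuum fun_eq_iff)
 also have "Sum_any ... = Ps (xs @ j # ys) A (expat i (Some j) f $$ (- 1))" by (simp only: Sum_any.delta)
 also have "Ps (xs @ j # i # ys) A f = Ps (xs @ j # ys) A (expat i None f $$ (- 1) + (SUM j:set ys. expat i (Some j) f $$ (- 1)))"
  using Cons.IH[of "xs @ [j]"] Cons.prems by (auto simp: insert_commute)
 finally show ?case using Cons.prems(1) by (simp add: lin_add[OF linear] add_ac)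
qed

end

lemma conf_empty: "f : conf {} ==> EX c. f = ratC c"
 unfolding conf_def
proof (induction rule: cring_induct)
 case (add f g) thus ?case by (metis ratC_add)
next
 case (mult f g) thus ?case by (metis ratC_mult)
qed (auto simp: offdiag_def)

lemma ratC_the [simp]: "(THE c'. ratC c = ratC c') = c"
 by (rule the_equality) auto

subsection \<open>The relations in positional form\<close>

lemma rep_absF: "congruent_mod multilinear_relations (rep_mode_space (abs_mode_space p)) p"
 by (rule Quotient3_rep_abs[OF Quotient3_mode_space]) (simp add: congruent_mod_refl)

lemma rep_absU: "congruent_mod (vacuum_relations Un translation_relations Un commutator_relations)
  (rep_mode_algebra (abs_mode_algebra p)) p"
 by (rule Quotient3_rep_abs[OF Quotient3_mode_algebra]) (simp add: congruent_mod_refl)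

lemma lin_absF: "clinear abs_mode_space"
 by (auto intro!: clinearI simp: plus_mode_space.abs_eq scaleC_mode_space.abs_eq)

lemma lin_absU: "clinear abs_mode_algebra"
 by (auto intro!: clinearI simp: plus_mode_algebra.abs_eq scaleC_mode_algebra.abs_eq)

lemma absF_relation:
 "r : multilinear_relations ==> abs_mode_space r = 0"
 unfolding zero_mode_space.abs_eq
 by (rule Quotient3_rel_abs[OF Quotient3_mode_space]) (simp add: congruent_mod_base)

lemma absU_relation:
 "r : vacuum_relations Un translation_relations Un commutator_relations ==> abs_mode_algebra r = 0"
 unfolding zero_mode_algebra.abs_eq
 by (rule Quotient3_rel_abs[OF Quotient3_mode_algebra]) (simp add: congruent_mod_base)

lemma nonempty_symbol_abs: "nonempty_symbol A f = abs_mode_space (free_symbol A f)"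
 by (simp add: nonempty_symbol.abs_eq)

lemma mode_abs: "mode A f = abs_mode_algebra (mode_symbol A f)"
 by (simp add: mode.abs_eq)

lemma nonempty_symbol_vec_add:
 "f : conf_ring (length xs + 1 + length ys) ==>
  nonempty_symbol (xs @ (a + b) # ys) f = nonempty_symbol (xs @ a # ys) f + nonempty_symbol (xs @ b # ys) f"
proof -
 assume "f : conf_ring (length xs + 1 + length ys)"
 hence "free_symbol (xs @ (a + b) # ys) f - free_symbol (xs @ a # ys) f - free_symbol (xs @ b # ys) f : multilinear_relations"
  unfolding multilinear_relations_def by blast
 from absF_relation[OF this] show ?thesis
  by (simp add: nonempty_symbol_abs lin_diff[OF lin_absF] diff_eq_eq add.commute)
qed

lemma nonempty_symbol_vec_scale:
 "f : conf_ring (length xs + 1 + length ys) ==>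
  nonempty_symbol (xs @ (c *. a) # ys) f = c *. nonempty_symbol (xs @ a # ys) f"
proof -
 assume "f : conf_ring (length xs + 1 + length ys)"
 hence "free_symbol (xs @ (c *. a) # ys) f - c *. free_symbol (xs @ a # ys) f : multilinear_relations"
  unfolding multilinear_relations_def by blast
 from absF_relation[OF this] show ?thesis
  by (simp add: nonempty_symbol_abs lin_diff[OF lin_absF] lin_scale[OF lin_absF])
qed

lemma nonempty_symbol_add:
 "A ~= [] ==> f : conf_ring (length A) ==> g : conf_ring (length A) ==>
  nonempty_symbol A (f + g) = nonempty_symbol A f + nonempty_symbol A g"
proof -
 assume "A ~= []" "f : conf_ring (length A)" "g : conf_ring (length A)"
 hence "free_symbol A (f + g) - free_symbol A f - free_symbol A g : multilinear_relations"
  unfolding multilinear_relations_def by blast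
 from absF_relation[OF this] show ?thesis
  by (simp add: nonempty_symbol_abs lin_diff[OF lin_absF] diff_eq_eq add.commute)
qed

lemma nonempty_symbol_scale:
 "A ~= [] ==> f : conf_ring (length A) ==> nonempty_symbol A (c *. f) = c *. nonempty_symbol A f"
proof -
 assume "A ~= []" "f : conf_ring (length A)"
 hence "free_symbol A (ratC c * f) - c *. free_symbol A f : multilinear_relations"
  unfolding multilinear_relations_def by blast
 from absF_relation[OF this] show ?thesis
  by (simp add: nonempty_symbol_abs scaleC_ratfun lin_diff[OF lin_absF] lin_scale[OF lin_absF])
qed

lemma conf_ring_0: "conf_ring 0 = range ratC"
 unfolding conf_ring_eq using conf_empty by auto

lemma mode_symbol_add:
 "f : conf_ring (length A) ==> g : conf_ring (length A) ==> mode_symbol A (f + g) = mode_symbol A f + mode_symbol A g"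
 and mode_symbol_scale: "f : conf_ring (length A) ==> mode_symbol A (c *. f) = c *. mode_symbol A f"
proof -
 assume f: "f : conf_ring (length A)"
 show "mode_symbol A (c *. f) = c *. mode_symbol A f"
 proof (cases "A = []")
  case True
  then obtain d where d: "f = ratC d" using f by (auto simp: conf_ring_0)
  have "c *. f = ratC (c * d)" by (simp only: d scaleC_ratfun ratC_mult)
  thus ?thesis using True by (simp add: mode_symbol_def d scaleC_scaleC)
 qed (use f in "simp add: mode_symbol_def nonempty_symbol_scale")
 assume g: "g : conf_ring (length A)"
 show "mode_symbol A (f + g) = mode_symbol A f + mode_symbol A g"
 proof (cases "A = []")
  case True
  then obtain d e where d: "f = ratC d" "g = ratC e" using f g by (auto simp: conf_ring_0)
  have "f + g = ratC (d + e)" by (simp only: d ratC_add)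
  thus ?thesis using True by (simp add: mode_symbol_def d scaleC_add_left)
 qed (use f g in "simp add: mode_symbol_def nonempty_symbol_add")
qed

lemma mode_add: "f : conf_ring (length A) ==> g : conf_ring (length A) ==> mode A (f + g) = mode A f + mode A g"
 and mode_scale: "f : conf_ring (length A) ==> mode A (c *. f) = c *. mode A f"
 by (simp_all add: mode_abs mode_symbol_add mode_symbol_scale lin_add[OF lin_absU]
   lin_scale[OF lin_absU])

lemma mode_vec_add: "f : conf_ring (length xs + 1 + length ys) ==>
  mode (xs @ (a + b) # ys) f = mode (xs @ a # ys) f + mode (xs @ b # ys) f"
 and mode_vec_scale: "f : conf_ring (length xs + 1 + length ys) ==>
  mode (xs @ (c *. a) # ys) f = c *. mode (xs @ a # ys) f"
 by (simp_all add: mode_abs mode_symbol_def nonempty_symbol_vec_add nonempty_symbol_vec_scale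
   lin_add[OF lin_absU] lin_scale[OF lin_absU])

lemma mode_vacuum: "f : conf_ring (length xs + 1 + length ys) ==>
  mode (xs @ vac # ys) f = mode (xs @ ys) (vacuum_residue (length xs + 1 + length ys) (length xs) f)"
proof -
 assume "f : conf_ring (length xs + 1 + length ys)"
 hence "mode_symbol (xs @ vac # ys) f - mode_symbol (xs @ ys) (vacuum_residue (length xs + 1 + length ys) (length xs) f)
   : vacuum_relations Un translation_relations Un commutator_relations"
  unfolding vacuum_relations_def by blast
 from absU_relation[OF this] show ?thesis
  by (simp add: mode_abs lin_diff[OF lin_absU])
qed

lemma mode_translation: "f : conf_ring (length xs + 1 + length ys) ==>
  mode (xs @ transl a # ys) f = - mode (xs @ a # ys) (pdv (length xs) f)"
proof -
 assume "f : conf_ring (length xs + 1 + length ys)"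
 hence "mode_symbol (xs @ transl a # ys) f + mode_symbol (xs @ a # ys) (pdv (length xs) f)
   : vacuum_relations Un translation_relations Un commutator_relations"
  unfolding translation_relations_def by blast
 from absU_relation[OF this] show ?thesis
  by (simp add: mode_abs lin_add[OF lin_absU] eq_neg_iff_add_eq_0)
qed

lemma expand_at_var_in:
 assumes "f : conf_ring (n + 2 + m)"
 shows "expand_at_var n (Suc n) f $$ k : conf_ring (n + 1 + m)"
proof -
 let ?S = "{..<n + 2 + m}"
 have f: "f : conf ?S" using assms by (simp add: conf_ring_eq)
 have inj: "inj_on (drop_var n) (?S - {n})" by (auto simp: inj_on_def drop_var_def split: if_splits)
 have sub: "drop_var n ` (?S - {n}) <= {..<n + 1 + m}" by (auto simp: drop_var_def)
 have "expat n (Some (Suc n)) f $$ k : conf (?S - {n})" by (rule expat_conf[OF f, where j = "Suc n"]) simp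
 from rename_conf[OF inj this] show ?thesis
  using expand_at_eq(2)[OF f, of n "Suc n" k] conf_mono[OF sub] by (auto simp: conf_ring_eq)
qed

text \<open>\<open>Sum_any\<close> is 0 by convention on infinite supports. The support here is
  bounded below by the Laurent expansion and above by truncation, so linear maps may be applied
  termwise.\<close>

lemma commutator_support: "f : conf_ring (length xs + 2 + length ys) ==>
  finite {k. mode_symbol (xs @ nprod k a b # ys) (expand_at_var (length xs) (Suc (length xs)) f $$ k) ~= 0}"
proof -
 assume f: "f : conf_ring (length xs + 2 + length ys)"
 let ?E = "expand_at_var (length xs) (Suc (length xs)) f"
 note E = expand_at_var_in[OF f]
 obtain N where N: "!!k. k >= N ==> nprod k a b = 0" using truncation by blast
 have "mode_symbol (xs @ nprod k a b # ys) (?E $$ k) = 0" if "k ~: {fsubdeg ?E..N}" for k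
 proof (cases "k < N")
  case False
  hence "nprod k a b = (0 :: complex) *. 0" using N by simp
  thus ?thesis using nonempty_symbol_vec_scale[of "?E $$ k" xs ys 0 0] E[of k] by (simp add: mode_symbol_def)
 next
  case True
  hence "?E $$ k = 0 *. 0" using that by simp
  moreover have "mode_symbol (xs @ nprod k a b # ys) (0 *. 0) = 0 *. mode_symbol (xs @ nprod k a b # ys) 0"
   by (rule mode_symbol_scale) (simp add: conf_ring_eq)
  ultimately show ?thesis by simp
 qed
 hence "{k. mode_symbol (xs @ nprod k a b # ys) (?E $$ k) ~= 0} <= {fsubdeg ?E..N}" by blast
 thus ?thesis by (rule finite_subset) simp
qed

lemma mode_commutator: "f : conf_ring (length xs + 2 + length ys) ==>
  mode (xs @ a # b # ys) f = mode (xs @ b # a # ys)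
     (rnm (id(length xs := Suc (length xs), Suc (length xs) := length xs)) f)
   + Sum_any (%k. mode (xs @ nprod k a b # ys) (expand_at_var (length xs) (Suc (length xs)) f $$ k))"
proof -
 assume f: "f : conf_ring (length xs + 2 + length ys)"
 hence "mode_symbol (xs @ a # b # ys) f - mode_symbol (xs @ b # a # ys)
     (rnm (id(length xs := Suc (length xs), Suc (length xs) := length xs)) f)
   - Sum_any (%k. mode_symbol (xs @ nprod k a b # ys) (expand_at_var (length xs) (Suc (length xs)) f $$ k))
   : vacuum_relations Un translation_relations Un commutator_relations"
  unfolding commutator_relations_def by blast
 from absU_relation[OF this] show ?thesis
  by (simp add: mode_abs lin_diff[OF lin_absU]
    lin_Sum_any[OF lin_absU commutator_support[OF f]] diff_eq_eq add.commute)
qed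

subsection \<open>Universal property\<close>

lemma drop_var_upt:
 "[0..<n + m] = map (drop_var n) ([0..<n] @ [Suc n..<Suc (n + m)])"
proof -
 have "map (drop_var n) [0..<n] = map id [0..<n]" by (rule map_cong) (auto simp: drop_var_def)
 moreover have "map (drop_var n) [Suc n..<Suc (n + m)] = map (%i. i - 1) (map Suc [n..<n + m])"
  unfolding map_Suc_upt by (rule map_cong) (auto simp: drop_var_def)
 ultimately show ?thesis by (simp add: comp_def upt_add_eq_append[of 0 n m])
qed

lemma inj_drop_var: "n ~: S ==> inj_on (drop_var n) S"
proof (rule inj_onI)
 fix x y assume "n ~: S" "x : S" "y : S" "drop_var n x = drop_var n y"
 moreover from this have "x ~= n" "y ~= n" by auto
 ultimately show "x = y" unfolding drop_var_def by (simp split: if_splits)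
qed

context labelled_functional begin

definition positional :: "'v list => ratfun => 'w"
 where "positional A f = Ps [0..<length A] (%i. A ! i) f"

lemma positional_split:
 assumes "f : conf_ring (length xs + 1 + length ys)"
 shows "positional (xs @ c # ys) f = Ps [0..<length xs + 1 + length ys] ((%i. (xs @ 0 # ys) ! i)(length xs := c)) f"
proof -
 have f: "f : conf (set [0..<length xs + 1 + length ys])" using assms by (simp only: conf_ring_eq set_upt atLeast0LessThan)
 have len: "length (xs @ c # ys) = length xs + 1 + length ys" by simp
 show ?thesis unfolding positional_def len
  by (rule cong[OF _ f]) (auto simp: nth_append nth_Cons')
qed

lemma positional_vec:
 assumes f: "f : conf_ring (length xs + 1 + length ys)"
 shows "positional (xs @ (a + b) # ys) f = positional (xs @ a # ys) f + positional (xs @ b # ys) f"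
  "positional (xs @ (c *. a) # ys) f = c *. positional (xs @ a # ys) f"
  "positional (xs @ transl a # ys) f = - positional (xs @ a # ys) (pdv (length xs) f)"
proof -
 have f': "f : conf (set [0..<length xs + 1 + length ys])" using f by (simp only: conf_ring_eq set_upt atLeast0LessThan)
 have pd: "pdv (length xs) f : conf_ring (length xs + 1 + length ys)"
  using conf_pd f by (simp only: conf_ring_eq)
 have i: "length xs : set [0..<length xs + 1 + length ys]" by auto
 show "positional (xs @ (a + b) # ys) f = positional (xs @ a # ys) f + positional (xs @ b # ys) f"
  "positional (xs @ (c *. a) # ys) f = c *. positional (xs @ a # ys) f"
  "positional (xs @ transl a # ys) f = - positional (xs @ a # ys) (pdv (length xs) f)"
  unfolding positional_split[OF f] positional_split[OF pd]
  by (rule vec_add[OF distinct_upt i f'] vec_scale[OF distinct_upt i f'] translation[OF distinct_upt i f'])+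
qed

lemma positional_drop:
 assumes "g : conf (set ([0..<length xs] @ [Suc (length xs)..<Suc (length xs + length ys)]))"
 shows "positional (xs @ ys) (rnm (drop_var (length xs)) g)
  = Ps ([0..<length xs] @ [Suc (length xs)..<Suc (length xs + length ys)]) (%i. (xs @ ys) ! drop_var (length xs) i) g"
 unfolding positional_def length_append drop_var_upt
 by (rule rename) (use assms in "auto intro: inj_drop_var")

lemma positional_commutator:
 assumes g: "g : conf_ring (length xs + 2 + length ys)"
 shows "positional (xs @ a # b # ys) g = positional (xs @ b # a # ys)
     (rnm (id(length xs := Suc (length xs), Suc (length xs) := length xs)) g)
   + Sum_any (%k. positional (xs @ nprod k a b # ys) (expand_at_var (length xs) (Suc (length xs)) g $$ k))"
proof -
 define n where "n = length xs"
 define m where "m = length ys"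
 let ?A = "%i. (xs @ a # b # ys) ! i"
 let ?X = "[0..<n]" and ?Y = "[Suc (Suc n)..<n + 2 + m]"
 let ?s = "id(n := Suc n, Suc n := n)"
 have upt: "[0..<n + 2 + m] = ?X @ n # Suc n # ?Y"
  using upt_add_eq_append[of 0 n "2 + m"] by (simp add: upt_conv_Cons)
 have g': "g : conf (set (?X @ n # Suc n # ?Y))"
  using g unfolding upt[symmetric] by (simp only: conf_ring_eq set_upt atLeast0LessThan n_def m_def)
 have dist: "distinct (?X @ n # Suc n # ?Y)" unfolding upt[symmetric] by simp
 have len: "length (xs @ c # d # ys) = n + 2 + m" for c d by (simp add: n_def m_def)
 have main: "positional (xs @ a # b # ys) g = Ps (?X @ Suc n # n # ?Y) ?A g
   + Sum_any (%k. Ps (?X @ Suc n # ?Y) (?A(Suc n := nprod k (?A n) (?A (Suc n)))) (expat n (Some (Suc n)) g $$ k))"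
  unfolding positional_def len upt by (rule commutator[OF dist g'])
 have swap: "Ps (?X @ Suc n # n # ?Y) ?A g = positional (xs @ b # a # ys) (rnm ?s g)"
 proof -
  have e: "?X @ n # Suc n # ?Y = map ?s (?X @ Suc n # n # ?Y)" by (auto simp: map_idI)
  have inj: "inj_on ?s (set (?X @ Suc n # n # ?Y))" by (auto simp: inj_on_def)
  have "positional (xs @ b # a # ys) (rnm ?s g) = Ps (map ?s (?X @ Suc n # n # ?Y)) (%i. (xs @ b # a # ys) ! i) (rnm ?s g)"
   unfolding positional_def len upt e ..
  also have "... = Ps (?X @ Suc n # n # ?Y) (%i. (xs @ b # a # ys) ! ?s i) g"
   by (rule rename[OF _ inj]) (use dist g' in "auto simp: insert_commute")
  also have "... = Ps (?X @ Suc n # n # ?Y) ?A g"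
   by (rule cong) (use g' in "auto simp: insert_commute nth_append nth_Cons' n_def")
  finally show ?thesis ..
 qed
 have term_eq: "Ps (?X @ Suc n # ?Y) (?A(Suc n := nprod k (?A n) (?A (Suc n)))) (expat n (Some (Suc n)) g $$ k)
  = positional (xs @ nprod k a b # ys) (expand_at_var n (Suc n) g $$ k)" for k
 proof -
  let ?g = "expat n (Some (Suc n)) g $$ k"
  have Y: "[Suc n..<Suc (n + Suc m)] = Suc n # ?Y" by (simp add: upt_conv_Cons)
  have set: "set (?X @ n # Suc n # ?Y) - {n} = set (?X @ Suc n # ?Y)" by auto
  have gc: "?g : conf (set (?X @ Suc n # ?Y))"
   unfolding set[symmetric] by (rule expat_conf[OF g', where j = "Suc n"]) simp
  have ev: "expand_at_var n (Suc n) g $$ k = rnm (drop_var n) ?g"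
   by (rule expand_at_eq(2)[OF g']) auto
  have "positional (xs @ nprod k a b # ys) (rnm (drop_var (length xs)) ?g)
   = Ps ([0..<length xs] @ [Suc (length xs)..<Suc (length xs + length (nprod k a b # ys))])
     (%i. (xs @ nprod k a b # ys) ! drop_var (length xs) i) ?g"
   by (rule positional_drop) (use gc Y in "simp add: n_def m_def")
  also have "... = Ps (?X @ Suc n # ?Y) (%i. (xs @ nprod k a b # ys) ! drop_var n i) ?g"
   using Y by (simp add: n_def m_def)
  also have "... = Ps (?X @ Suc n # ?Y) (?A(Suc n := nprod k (?A n) (?A (Suc n)))) ?g"
   by (rule cong[OF _ gc]) (auto simp: nth_append nth_Cons' n_def drop_var_def)
  finally show ?thesis unfolding ev by (simp add: n_def)
 qed
 show ?thesis using main unfolding swap term_eq by (simp add: n_def)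
qed

lemma positional_vacuum:
 assumes f: "f : conf_ring (length xs + 1 + length ys)"
 shows "positional (xs @ vac # ys) f = positional (xs @ ys) (vacuum_residue (length xs + 1 + length ys) (length xs) f)"
proof -
 define n where "n = length xs"
 define m where "m = length ys"
 let ?X = "[0..<n]" and ?Y = "[Suc n..<Suc (n + m)]"
 have upt: "[0..<n + 1 + m] = ?X @ n # ?Y"
  using upt_add_eq_append[of 0 n "1 + m"] by (simp add: upt_conv_Cons)
 have f': "f : conf (set (?X @ n # ?Y))"
  using f unfolding upt[symmetric] by (simp only: conf_ring_eq set_upt atLeast0LessThan n_def m_def)
 have dist: "distinct (?X @ n # ?Y)" unfolding upt[symmetric] by simp
 let ?r = "expat n None f $$ (- 1) + (SUM j:set ?Y. expat n (Some j) f $$ (- 1))"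
 have set: "set (?X @ n # ?Y) - {n} = set (?X @ ?Y)" by auto
 have e: "expat n None f $$ k : conf (set (?X @ ?Y))" "j : set ?Y ==> expat n (Some j) f $$ k : conf (set (?X @ ?Y))" for j k
  using expat_conf[OF f', of None undefined n] expat_conf[OF f', of "Some j" j n] unfolding set by auto
 have s: "(SUM j:set ?Y. expat n (Some j) f $$ (- 1)) : conf (set (?X @ ?Y))" by (rule conf_sum) (rule e(2))
 have r: "?r : conf (set (?X @ ?Y))" by (rule conf_add[OF e(1) s])
 have inj: "inj_on (drop_var n) (set (?X @ ?Y))" by (rule inj_drop_var) auto
 have len: "length (xs @ c # ys) = n + 1 + m" for c by (simp add: n_def m_def)
 have rs: "rnm (drop_var n) (SUM j:set ?Y. expat n (Some j) f $$ (- 1)) = (SUM j:set ?Y. rnm (drop_var n) (expat n (Some j) f $$ (- 1)))"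
  by (rule rename_sum[OF inj]) (rule e(2))
 have "rnm (drop_var n) ?r = expand_at_zero n f $$ (- 1) + (SUM j:set ?Y. expand_at_var n j f $$ (- 1))"
  unfolding rename_hom(1)[OF inj e(1) s] rs
  using expand_at_eq(1)[OF f', of n "-1"] expand_at_eq(2)[OF f', of n _ "-1"] by (auto intro!: sum.cong)
 hence vr: "vacuum_residue (n + 1 + m) n f = rnm (drop_var n) ?r"
  unfolding vacuum_residue_def by (auto intro!: sum.cong)
 have "positional (xs @ vac # ys) f = Ps (?X @ ?Y) (%i. (xs @ vac # ys) ! i) ?r"
  unfolding positional_def len upt by (rule vacuum_anywhere[OF dist _ f']) (simp add: n_def)
 also have "... = Ps (?X @ ?Y) (%i. (xs @ ys) ! drop_var n i) ?r"
  by (rule cong[OF _ r]) (auto simp: nth_append n_def drop_var_def)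
 also have "... = positional (xs @ ys) (rnm (drop_var n) ?r)"
  using positional_drop[of ?r xs ys] r by (simp add: n_def m_def)
 finally show ?thesis unfolding vr[symmetric] by (simp add: n_def m_def)
qed

text \<open>Symbols on the empty list are encoded through the unit, so the value there must match
  the vacuum relation: the residue of 1/z is 1. With no labels there are no vectors to specify,
  whence \<open>undefined\<close>.\<close>

lemma positional_unit: "positional [vac] (inverse (var 0)) = Ps [] (%i. undefined) 1"
proof -
 have "expat 0 None (inverse (var 0)) = inverse fls_X"
  unfolding expat_def laurent_subst_def
  by (subst lau.subst_inverse) (simp_all add: exp_pt_def)
 hence e: "expat 0 None (inverse (var 0)) $$ (- 1) = 1" by (simp add: fls_inverse_X)
 have "positional [vac] (inverse (var 0)) = Ps ([] @ [0]) (%i. [vac] ! i) (inverse (var 0))" by (simp add: positional_def)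
 also have "... = Ps [] (%i. [vac] ! i) 1"
  by (subst vacuum_last) (auto simp: e intro: conf_inv)
 also have "... = Ps [] (%i. undefined) 1" by (rule cong) auto
 finally show ?thesis .
qed

lemma positional_lin:
 "positional A (f + g) = positional A f + positional A g" "positional A (c *. f) = c *. positional A f"
 by (simp_all add: positional_def lin_add[OF linear] lin_scale[OF linear])

text \<open>The map is built in three stages, on the free space, modulo multilinearity, and modulo
  the relations of the algebra; the two descents need only that the relations go to 0.\<close>

lemma linear_map_exists:
 obtains L where "clinear L" "!!A f. f : conf_ring (length A) ==> L (mode A f) = positional A f"
proof -
 define L0 where "L0 = free_lift (%s. case Rep_symbol s of (A, f) => positional A f)"
 have L0: "clinear L0" by (simp add: L0_def lin_free_lift)
 have L0f: "L0 (free_symbol A f) = positional A f" if "A ~= []" "f : conf_ring (length A)" for A f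
  unfolding L0_def free_symbol_def using that by (simp add: Abs_symbol_inverse)
 have rel0: "L0 r = 0" if "r : multilinear_relations" for r
  using that unfolding multilinear_relations_def
  by (auto simp: lin_diff[OF L0] lin_scale[OF L0] L0f positional_vec scaleC_ratfun[symmetric] positional_lin
    conf_ring_eq conf_add conf_scaleC)
 define L1 where "L1 x = L0 (rep_mode_space x)" for x
 have L1a: "L1 (abs_mode_space p) = L0 p" for p
  unfolding L1_def by (rule quotient_lift_cong[OF L0 rel0 rep_absF])
 have L1: "clinear L1"
 proof (rule clinearI)
  fix x y c
  show "L1 (x + y) = L1 x + L1 y"
   by (induction x rule: mode_space.abs_induct, induction y rule: mode_space.abs_induct)
    (simp add: plus_mode_space.abs_eq L1a lin_add[OF L0])
  show "L1 (c *. x) = c *. L1 x"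
   by (induction x rule: mode_space.abs_induct) (simp add: scaleC_mode_space.abs_eq L1a lin_scale[OF L0])
 qed
 have L1n: "L1 (nonempty_symbol A f) = positional A f" if "A ~= []" "f : conf_ring (length A)" for A f
  using that by (simp add: nonempty_symbol_abs L1a L0f)
 have inv0: "inverse (var 0) : conf_ring (length [vac :: 'v])" by (auto simp: conf_ring_eq intro: conf_inv)
 have L1s: "L1 (mode_symbol A f) = positional A f" if "f : conf_ring (length A)" for A f
 proof (cases "A = []")
  case True
  hence "f : conf_ring 0" using that by simp
  then obtain c where c: "f = ratC c" by (auto simp: conf_ring_0)
  have "L1 (mode_symbol A f) = c *. Ps [] (%i. undefined) 1"
   using True L1n[OF _ inv0] by (simp add: mode_symbol_def c lin_scale[OF L1] positional_unit)
  also have "... = Ps [] (%i. undefined) (ratC c)"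
   by (simp add: lin_scale[OF linear, symmetric] scaleC_ratfun)
  also have "... = positional A f" unfolding positional_def c by (auto simp: True intro!: cong)
  finally show ?thesis .
 next
  case False thus ?thesis using that by (simp add: mode_symbol_def L1n)
 qed
 have rel1: "L1 r = 0" if r: "r : vacuum_relations Un translation_relations Un commutator_relations" for r
 proof -
  consider (v) xs ys f where "r = mode_symbol (xs @ vac # ys) f
    - mode_symbol (xs @ ys) (vacuum_residue (length xs + 1 + length ys) (length xs) f)" "f : conf_ring (length xs + 1 + length ys)"
   | (t) xs a ys f where "r = mode_symbol (xs @ transl a # ys) f + mode_symbol (xs @ a # ys) (pdv (length xs) f)"
    "f : conf_ring (length xs + 1 + length ys)"
   | (c) xs a b ys g where "r = mode_symbol (xs @ a # b # ys) g
   - mode_symbol (xs @ b # a # ys)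
     (rnm (id(length xs := Suc (length xs), Suc (length xs) := length xs)) g)
   - Sum_any (%k. mode_symbol (xs @ nprod k a b # ys)
     (expand_at_var (length xs) (Suc (length xs)) g $$ k))" "g : conf_ring (length xs + 2 + length ys)"
   using r unfolding vacuum_relations_def translation_relations_def commutator_relations_def by blast
  thus ?thesis
  proof cases
   case v
   have "vacuum_residue (length xs + 1 + length ys) (length xs) f : conf_ring (length (xs @ ys))"
   proof -
    let ?S = "{..<length xs + 1 + length ys}" and ?n = "length xs"
    have f: "f : conf ?S" using v(2) by (simp add: conf_ring_eq)
    have inj: "inj_on (drop_var ?n) (?S - {?n})" by (rule inj_drop_var) simp
    have sub: "drop_var ?n ` (?S - {?n}) <= {..<length (xs @ ys)}" by (auto simp: drop_var_def)
    have "expat ?n p f $$ k : conf (?S - {?n})" if "p = None | p = Some j & j : ?S & j ~= ?n" for p j k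
     by (rule expat_conf[OF f that])
    hence R: "rnm (drop_var ?n) (expat ?n p f $$ k) : conf {..<length (xs @ ys)}" if "p = None | p = Some j & j : ?S & j ~= ?n" for p j k
     using rename_conf[OF inj] conf_mono[OF sub] that by blast
    have "expand_at_zero ?n f $$ (- 1) : conf {..<length (xs @ ys)}"
     using expand_at_eq(1)[OF f, of ?n "-1"] R[of None] by simp
    moreover have "expand_at_var ?n j f $$ (- 1) : conf {..<length (xs @ ys)}" if "j : {?n<..<?n + 1 + length ys}" for j
     using expand_at_eq(2)[OF f, of ?n j "-1"] R[of "Some j" j "- 1"] that by simp
    ultimately show ?thesis unfolding vacuum_residue_def conf_ring_eq
     by (intro conf_add conf_sum) simp_all
   qed
   thus ?thesis using v(2) unfolding v(1) by (simp add: lin_diff[OF L1] L1s positional_vacuum)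
  next
   case t
   have "pdv (length xs) f : conf_ring (length xs + 1 + length ys)"
    using conf_pd t(2) by (simp only: conf_ring_eq)
   thus ?thesis using t(2) unfolding t(1) by (simp add: lin_add[OF L1] L1s positional_vec)
  next
   case c
   let ?s = "id(length xs := Suc (length xs), Suc (length xs) := length xs)"
   have "rnm ?s g : conf (?s ` {..<length xs + 2 + length ys})"
    by (rule rename_conf) (use c(2) in "auto simp: inj_on_def conf_ring_eq")
   moreover have "?s ` {..<length xs + 2 + length ys} <= {..<length xs + 2 + length ys}" by auto
   ultimately have rg: "rnm ?s g : conf_ring (length xs + 2 + length ys)"
    using conf_mono unfolding conf_ring_eq by blast
   have 1: "L1 (mode_symbol (xs @ a # b # ys) g) = positional (xs @ a # b # ys) g"
    "L1 (mode_symbol (xs @ b # a # ys) (rnm ?s g)) = positional (xs @ b # a # ys) (rnm ?s g)"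
    by (rule L1s; use c(2) rg in simp)+
   have 2: "L1 (mode_symbol (xs @ nprod k a b # ys) (expand_at_var (length xs) (Suc (length xs)) g $$ k))
    = positional (xs @ nprod k a b # ys) (expand_at_var (length xs) (Suc (length xs)) g $$ k)" for k
    by (rule L1s) (use expand_at_var_in[OF c(2), of k] in simp)
   show ?thesis unfolding c(1) lin_diff[OF L1] lin_Sum_any[OF L1 commutator_support[OF c(2)]] 1 2
    using positional_commutator[OF c(2), of a b] by simp
  qed
 qed
 define L2 where "L2 x = L1 (rep_mode_algebra x)" for x
 have L2a: "L2 (abs_mode_algebra p) = L1 p" for p
  unfolding L2_def by (rule quotient_lift_cong[OF L1 rel1 rep_absU])
 have L2: "clinear L2"
 proof (rule clinearI)
  fix x y c
  show "L2 (x + y) = L2 x + L2 y"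
   by (induction x rule: mode_algebra.abs_induct, induction y rule: mode_algebra.abs_induct)
    (simp add: plus_mode_algebra.abs_eq L2a lin_add[OF L1])
  show "L2 (c *. x) = c *. L2 x"
   by (induction x rule: mode_algebra.abs_induct) (simp add: scaleC_mode_algebra.abs_eq L2a lin_scale[OF L1])
 qed
 show thesis by (rule that[OF L2]) (simp add: mode_abs L2a L1s)
qed

end

section \<open>Modes indexed by labels\<close>

lemma linear_extension_exists:
 fixes ph :: "'a::complex_vector => 'b::complex_vector"
 assumes "cspan V = V" "!!x y. x : V ==> y : V ==> ph (x + y) = ph x + ph y"
  "!!c x. x : V ==> ph (c *. x) = c *. ph x"
 shows "EX L. clinear L & (ALL v:V. L v = ph v)"
proof -
 obtain B where B: "B <= V" "complex_vector.independent B" "V <= cspan B"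
  using cv_maximal_independent_subset by blast
 obtain L where L: "clinear L" "!!x. x : B ==> L x = ph x" using lin_extend[OF B(2), of ph] by blast
 have sub: "cspan B <= V" using cv_span_mono[OF B(1)] assms(1) by simp
 have "L v = ph v & v : V" if "v : cspan B" for v
  using that
 proof (induction rule: cv_span_induct_alt)
  case base
  have "0 : V" using cv_span_zero[of V] assms(1) by simp
  thus ?case using assms(3)[of 0 0] by (simp add: lin_zero[OF L(1)])
 next
  case (step c x y)
  have V: "x : V" "c *. x : V" "y : V" using step B(1) cv_span_scale[of x V c] cv_span_base[of x V] assms(1) by auto
  hence "c *. x + y : V" using cv_span_add[of "c *. x" V y] cv_span_base assms(1) by metis
  thus ?case using step V by (simp add: lin_add[OF L(1)] lin_scale[OF L(1)] L(2) assms(2,3))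
 qed
 thus ?thesis using L(1) B(3) by blast
qed

text \<open>Turns a map that is linear on a subspace into a total linear map, so that
  \<open>clinear\<close> and the tensor calculus apply; the values outside \<open>V\<close> are a
  choice.\<close>

definition linext :: "'a set => ('a => 'b) => 'a::complex_vector => 'b::complex_vector"
 where "linext V ph = (SOME L. clinear L & (ALL v:V. L v = ph v))"

lemma linext:
 assumes "cspan V = V" "!!x y. x : V ==> y : V ==> ph (x + y) = ph x + ph y"
  "!!c x. x : V ==> ph (c *. x) = c *. ph x"
 shows "clinear (linext V ph)" "v : V ==> linext V ph v = ph v"
 using someI_ex[OF linear_extension_exists[OF assms]] unfolding linext_def by auto

definition pos :: "nat list => nat => nat"
 where "pos ls i = length (takeWhile (%x. x ~= i) ls)"

lemma pos_less: "i : set ls ==> pos ls i < length ls"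
 unfolding pos_def by (induction ls) auto

lemma nth_pos: "i : set ls ==> ls ! pos ls i = i"
 unfolding pos_def by (induction ls) auto

lemma pos_Cons: "pos (x # ls) i = (if x = i then 0 else Suc (pos ls i))"
 by (simp add: pos_def)

lemma pos_append: "pos (xs @ ys) i = (if i : set xs then pos xs i else length xs + pos ys i)"
 by (induction xs) (auto simp: pos_Cons)

lemma pos_inj: "inj_on (pos ls) (set ls)"
 by (rule inj_onI) (metis nth_pos)

lemma pos_image: "pos ls ` set ls <= {..<length ls}"
 using pos_less by auto

lemma pos_map: "inj_on pqi (set ls) ==> i : set ls ==> pos (map pqi ls) (pqi i) = pos ls i"
 by (induction ls) (auto simp: pos_Cons inj_on_def)

lemma pos_upt: "i < n ==> pos [0..<n] i = i"
 using nth_pos[of i "[0..<n]"] pos_less[of i "[0..<n]"] by simp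

lemma map_pos: "distinct ls ==> map (pos ls) ls = [0..<length ls]"
 by (rule nth_equalityI) (auto intro: nth_eq_iff_index_eq[THEN iffD1] simp: nth_pos pos_less)

lemma rename_pos_in: "f : conf (set ls) ==> rnm (pos ls) f : conf_ring (length ls)"
 using rename_conf[OF pos_inj] conf_mono[OF pos_image] by (auto simp: conf_ring_eq)

lemma rename_pos_in_plus: "f : confp (set ls) ==> rnm (pos ls) f : conf_ring_plus (length ls)"
 using rename_confp[OF pos_inj] confp_mono[OF pos_image] by (auto simp: conf_ring_plus_eq)

text \<open>The mode O(A; f) with f a function of the labelled variables; \<open>pos\<close>
  converts labels to the positions of the definitions.\<close>

definition M :: "nat list => (nat => 'v::graded_vertex_algebra) => ratfun => 'v mode_algebra"
 where "M ls A = linext (conf (set ls)) (%f. mode (map A ls) (rnm (pos ls) f))"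

lemma lin_M: "clinear (M ls A)"
 and M_eq: "f : conf (set ls) ==> M ls A f = mode (map A ls) (rnm (pos ls) f)"
proof -
 have 1: "mode (map A ls) (rnm (pos ls) (f + g)) = mode (map A ls) (rnm (pos ls) f) + mode (map A ls) (rnm (pos ls) g)"
  if "f : conf (set ls)" "g : conf (set ls)" for f g
  using that by (simp add: rename_hom[OF pos_inj] mode_add rename_pos_in)
 have 2: "mode (map A ls) (rnm (pos ls) (c *. f)) = c *. mode (map A ls) (rnm (pos ls) f)"
  if "f : conf (set ls)" for f c
  using that by (simp add: rename_scaleC[OF pos_inj] mode_scale rename_pos_in)
 show "clinear (M ls A)" unfolding M_def by (rule linext(1)[OF conf_subspace(1) 1 2])
 show "f : conf (set ls) ==> M ls A f = mode (map A ls) (rnm (pos ls) f)"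
  unfolding M_def by (rule linext(2)[OF conf_subspace(1) 1 2])
qed

lemma M_cong: "(!!i. i : set ls ==> A i = B i) ==> M ls A = M ls B"
proof -
 assume "!!i. i : set ls ==> A i = B i"
 hence "map A ls = map B ls" by simp
 thus ?thesis by (simp only: M_def)
qed

lemma mode_eq_M: "f : conf_ring (length A) ==> mode A f = M [0..<length A] (%i. A ! i) f"
proof -
 assume f: "f : conf_ring (length A)"
 hence f': "f : conf (set [0..<length A])" by (simp only: conf_ring_eq set_upt atLeast0LessThan)
 have "rnm (pos [0..<length A]) f = f" by (rule rename_id[OF f']) (simp add: pos_upt)
 thus ?thesis using M_eq[OF f', of "%i. A ! i"] by (simp add: map_nth)
qed

lemma M_split:
 assumes "distinct (xs @ i # ys)" "f : conf (set (xs @ i # ys))"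
 shows "M (xs @ i # ys) (A(i := a)) f = mode (map A xs @ a # map A ys) (rnm (pos (xs @ i # ys)) f)"
  "rnm (pos (xs @ i # ys)) f : conf_ring (length (map A xs) + 1 + length (map A ys))"
proof -
 have "map (A(i := a)) (xs @ i # ys) = map A xs @ a # map A ys" using assms(1) by auto
 note m = this
 show "M (xs @ i # ys) (A(i := a)) f = mode (map A xs @ a # map A ys) (rnm (pos (xs @ i # ys)) f)"
  unfolding M_eq[OF assms(2)] m ..
 show "rnm (pos (xs @ i # ys)) f : conf_ring (length (map A xs) + 1 + length (map A ys))"
  using rename_pos_in[OF assms(2)] by simp
qed

text \<open>The defining relations hold in labelled form: the renumberings by
  \<open>drop_var\<close> and by the transposition are absorbed by the position function of the new
  list.\<close>

interpretation M: labelled_functional "M :: nat list => (nat => 'v::graded_vertex_algebra) => _"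
proof (rule labelled_functional.intro)
 fix ls :: "nat list" and A B :: "nat => 'v" and f
 show "clinear (M ls A)" by (rule lin_M)
next
 fix ls :: "nat list" and A B :: "nat => 'v" and f :: ratfun
 assume "!!i. i : set ls ==> A i = B i"
 from M_cong[OF this] show "M ls A f = M ls B f" by simp
next
 fix ls :: "nat list" and A :: "nat => 'v" and f and pqi :: "nat => nat"
 assume *: "distinct ls" "inj_on pqi (set ls)" "f : conf (set ls)"
 have f': "rnm pqi f : conf (set (map pqi ls))" using rename_conf[OF *(2,3)] by simp
 have "rnm (pos (map pqi ls)) (rnm pqi f) = rnm (%i. pos (map pqi ls) (pqi i)) f"
  by (rule rename_comp[OF *(2) _ *(3)]) (use pos_inj[of "map pqi ls"] in simp)
 also have "... = rnm (pos ls) f"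
  by (rule rename_cong[OF pos_inj _ *(3), symmetric]) (simp add: pos_map[OF *(2)])
 finally show "M (map pqi ls) A (rnm pqi f) = M ls (%i. A (pqi i)) f"
  unfolding M_eq[OF f'] M_eq[OF *(3)] by (simp add: comp_def)
next
 fix ls :: "nat list" and A :: "nat => 'v" and i f and a b :: 'v and c
 assume *: "distinct ls" "i : set ls" "f : conf (set ls)"
 obtain xs ys where ls: "ls = xs @ i # ys" using *(2) by (meson split_list)
 note sp = M_split[OF *(1,3)[unfolded ls], of A]
 have pi: "pos ls i = length xs" using *(1) unfolding ls by (auto simp: pos_append pos_Cons)
 have pdf: "pdv i f : conf (set ls)" using *(3) by (rule conf_pd)
 show "M ls (A(i := a + b)) f = M ls (A(i := a)) f + M ls (A(i := b)) f"
  "M ls (A(i := c *. a)) f = c *. M ls (A(i := a)) f"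
  unfolding ls sp(1) by (rule mode_vec_add[OF sp(2)] mode_vec_scale[OF sp(2)])+
 show "M ls (A(i := transl a)) f = - M ls (A(i := a)) (pdv i f)"
  unfolding ls sp(1) M_split(1)[OF *(1)[unfolded ls] pdf[unfolded ls]] mode_translation[OF sp(2)]
  using pd_rename[OF pos_inj *(3,2)] pi by (simp add: ls)
next
 fix xs ys :: "nat list" and i j f and A :: "nat => 'v"
 assume d: "distinct (xs @ i # j # ys)" and f: "f : conf (set (xs @ i # j # ys))"
 let ?n = "length xs" and ?p = "pos (xs @ i # j # ys)"
 let ?g = "rnm ?p f"
 have ij: "i ~= j" "i ~: set xs" "j ~: set xs" "i ~: set ys" "j ~: set ys" using d by auto
 have pij: "?p i = ?n" "?p j = Suc ?n" using ij by (auto simp: pos_append pos_Cons)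
 have g: "?g : conf_ring (length (map A xs) + 2 + length (map A ys))" using rename_pos_in[OF f] by simp
 have f2: "f : conf (set (xs @ j # i # ys))" using f by (simp add: insert_commute)
 have set: "set (xs @ i # j # ys) - {i} = set (xs @ j # ys)" using ij by auto
 have ex: "expat i (Some j) f $$ k : conf (set (xs @ j # ys))" for k
  unfolding set[symmetric] by (rule expat_conf[OF f, where j = j]) (use ij in auto)
 have swap: "rnm (id(?n := Suc ?n, Suc ?n := ?n)) ?g = rnm (pos (xs @ j # i # ys)) f"
 proof -
  have "rnm (id(?n := Suc ?n, Suc ?n := ?n)) ?g = rnm (%l. (id(?n := Suc ?n, Suc ?n := ?n)) (?p l)) f"
   by (rule rename_comp[OF pos_inj _ f]) (auto simp: inj_on_def)
  also have "... = rnm (pos (xs @ j # i # ys)) f"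
  proof (rule rename_cong[OF pos_inj _ f2, symmetric])
   fix l assume l: "l : set (xs @ j # i # ys)"
   show "pos (xs @ j # i # ys) l = (id(?n := Suc ?n, Suc ?n := ?n)) (?p l)"
    using pos_less[of l xs] ij by (auto simp: pos_append pos_Cons)
  qed
  finally show ?thesis .
 qed
 have coeff: "expand_at_var ?n (Suc ?n) ?g $$ k = rnm (pos (xs @ j # ys)) (expat i (Some j) f $$ k)" for k
 proof -
  have "expand_at_var ?n (Suc ?n) ?g $$ k = rnm (drop_var ?n) (expat ?n (Some (Suc ?n)) ?g $$ k)"
   by (rule expand_at_eq(2)[OF g[unfolded conf_ring_eq]]) auto
  also have "expat ?n (Some (Suc ?n)) ?g $$ k = rnm ?p (expat i (Some j) f $$ k)"
   using expat_rename[OF pos_inj f, of i "Some j" j k] ij by (simp add: pij)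
  also have "rnm (drop_var ?n) ... = rnm (%l. drop_var ?n (?p l)) (expat i (Some j) f $$ k)"
  proof (rule rename_comp[OF _ _ ex])
   show "inj_on ?p (set (xs @ j # ys))" by (rule inj_on_subset[OF pos_inj]) auto
   show "inj_on (drop_var ?n) (?p ` set (xs @ j # ys))"
   proof (rule inj_drop_var)
    have "?p l ~= ?n" if "l : set (xs @ j # ys)" for l
     using that pos_less[of l xs] ij by (auto simp: pos_append pos_Cons)
    thus "?n ~: ?p ` set (xs @ j # ys)" by (simp only: image_iff) metis
   qed
  qed
  also have "... = rnm (pos (xs @ j # ys)) (expat i (Some j) f $$ k)"
  proof (rule rename_cong[OF pos_inj _ ex, symmetric])
   fix l assume "l : set (xs @ j # ys)"
   thus "pos (xs @ j # ys) l = drop_var ?n (?p l)"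
    using pos_less[of l xs] ij by (auto simp: pos_append pos_Cons drop_var_def)
  qed
  finally show ?thesis .
 qed
 have upd: "map (A(j := c)) (xs @ j # ys) = map A xs @ c # map A ys" for c using ij by auto
 have Mk: "M (xs @ j # ys) (A(j := c)) h = mode (map A xs @ c # map A ys) (rnm (pos (xs @ j # ys)) h)"
  if "h : conf (set (xs @ j # ys))" for c h
  unfolding M_eq[OF that] upd ..
 have m: "map A (xs @ i # j # ys) = map A xs @ A i # A j # map A ys"
  "map A (xs @ j # i # ys) = map A xs @ A j # A i # map A ys" by simp_all
 show "M (xs @ i # j # ys) A f = M (xs @ j # i # ys) A f
    + Sum_any (%k. M (xs @ j # ys) (A(j := nprod k (A i) (A j))) (expat i (Some j) f $$ k))"
  unfolding M_eq[OF f] M_eq[OF f2] Mk[OF ex] m using mode_commutator[OF g] unfolding length_map swap coeff .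
next
 fix xs :: "nat list" and i f and A :: "nat => 'v"
 assume d: "distinct (xs @ [i])" and A: "A i = vac" and f: "f : conf (set (xs @ [i]))"
 let ?n = "length xs" and ?p = "pos (xs @ [i])"
 let ?g = "rnm ?p f"
 have i: "i ~: set xs" using d by simp
 have pi: "?p i = ?n" using i by (auto simp: pos_append pos_Cons)
 have g: "?g : conf_ring (length (map A xs) + 1 + length ([] :: 'v list))" using rename_pos_in[OF f] by simp
 have set: "set (xs @ [i]) - {i} = set xs" using i by auto
 have ex: "expat i None f $$ k : conf (set xs)" for k
  unfolding set[symmetric] by (rule expat_conf[OF f]) auto
 have "vacuum_residue (length (map A xs) + 1 + length ([] :: 'v list)) (length (map A xs)) ?g = expand_at_zero ?n ?g $$ (- 1)"
  by (simp add: vacuum_residue_def)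
 also have "... = rnm (drop_var ?n) (expat ?n None ?g $$ (- 1))"
  by (rule expand_at_eq(1)[OF g[unfolded conf_ring_eq]]) auto
 also have "expat ?n None ?g $$ (- 1) = rnm ?p (expat i None f $$ (- 1))"
  using expat_rename[OF pos_inj f, of i None undefined "-1"] by (simp add: pi)
 also have "rnm (drop_var ?n) ... = rnm (%l. drop_var ?n (?p l)) (expat i None f $$ (- 1))"
 proof (rule rename_comp[OF _ _ ex])
  show "inj_on ?p (set xs)" by (rule inj_on_subset[OF pos_inj]) auto
  show "inj_on (drop_var ?n) (?p ` set xs)"
  proof (rule inj_drop_var)
   have "?p l ~= ?n" if "l : set xs" for l
    using that pos_less[of l xs] by (auto simp: pos_append)
   thus "?n ~: ?p ` set xs" by (simp only: image_iff) metis
  qed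
 qed
 also have "... = rnm (pos xs) (expat i None f $$ (- 1))"
 proof (rule rename_cong[OF pos_inj _ ex, symmetric])
  fix l assume "l : set xs"
  thus "pos xs l = drop_var ?n (?p l)"
   using pos_less[of l xs] by (auto simp: pos_append drop_var_def)
 qed
 finally have vr: "vacuum_residue (length (map A xs) + 1 + length ([] :: 'v list)) (length (map A xs)) ?g = rnm (pos xs) (expat i None f $$ (- 1))" .
 have m: "map A (xs @ [i]) = map A xs @ vac # []" using A by simp
 show "M (xs @ [i]) A f = M xs A (expat i None f $$ (- 1))"
  unfolding M_eq[OF f] M_eq[OF ex] m mode_vacuum[OF g] vr by simp
qed

lemma mode_span: "x : cspan {mode A f | A f. A ~= [] & f : conf_ring (length A)}"
proof (induction x rule: mode_algebra.abs_induct)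
 fix y :: "'a::graded_vertex_algebra mode_space"
 show "abs_mode_algebra y : cspan {mode A f | A f. A ~= [] & f : conf_ring (length A)}"
 proof (induction y rule: mode_space.abs_induct)
  fix p :: "'a symbol \<Rightarrow>\<^sub>0 complex"
  show "abs_mode_algebra (abs_mode_space p) : cspan {mode A f | A f. A ~= [] & f : conf_ring (length A)}"
  proof (rule lin_span_in[OF lin_comp[OF lin_absU lin_absF] single_span])
   fix x :: "'a symbol \<Rightarrow>\<^sub>0 complex" assume "x : range (%k. sgl k 1)"
   then obtain s where x: "x = sgl s 1" by blast
   obtain A f where s: "Rep_symbol s = (A, f)" by fastforce
   with Rep_symbol[of s] have Af: "A ~= []" "f : conf_ring (length A)" by auto
   have "x = free_symbol A f" unfolding x free_symbol_def s[symmetric] Rep_symbol_inverse ..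
   hence "abs_mode_algebra (abs_mode_space x) = mode A f"
    using Af by (simp add: mode_abs mode_symbol_def nonempty_symbol_abs)
   thus "abs_mode_algebra (abs_mode_space x) : cspan {mode A f | A f. A ~= [] & f : conf_ring (length A)}"
    using Af by (auto intro!: cv_span_base)
  qed
 qed
qed

lemma mode_Nil: "mode [] (ratC c) = c *. mode_unit"
 by (simp add: mode_abs mode_unit_def mode_symbol_def lin_scale[OF lin_absU])

lemma lin_Rep: "clinear RepU"
 by (rule clinearI) (simp_all add: plus_mode_algebra_plus.rep_eq scaleC_mode_algebra_plus.rep_eq)

lemma inj_Rep: "inj RepU"
 by (rule injI) (simp add: Rep_mode_algebra_plus_inject)

text \<open>A chosen linear projection onto U_+. Statements about positive modes are obtained by
  applying it to statements in U(V).\<close>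

definition retract :: "'v::graded_vertex_algebra mode_algebra => 'v mode_algebra_plus"
 where "retract = (SOME g. clinear g & (ALL x. g (RepU x) = x))"

lemma lin_retract: "clinear (retract :: 'v::graded_vertex_algebra mode_algebra => _)"
 and retract_Rep [simp]: "retract (RepU (x :: 'v mode_algebra_plus)) = x"
proof -
 have "EX g :: 'v mode_algebra => _. clinear g & (ALL x. g (RepU x) = x)"
  by (rule lin_left_inverse[OF lin_Rep inj_Rep]) blast
 from someI_ex[OF this, folded retract_def] show "clinear (retract :: 'v mode_algebra => _)" "retract (RepU x) = x"
  by blast+
qed

lemma mode_in_plus:
 assumes "f : conf_ring_plus (length A)"
 shows "mode A f : cspan (insert mode_unit
   {mode A f | A f. A ~= [] & f : conf_ring_plus (length A)})"
proof (cases "A = []")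
 case True
 hence "f : conf {}" using assms confp_conf by (auto simp: conf_ring_plus_eq)
 then obtain c where "f = ratC c" using conf_empty by blast
 thus ?thesis using True by (simp add: mode_Nil cv_span_scale cv_span_base)
next
 case False thus ?thesis using assms by (auto intro!: cv_span_base)
qed

lemma Rep_mode_plus: "f : conf_ring_plus (length A) ==> RepU (mode_plus A f) = mode A f"
 unfolding mode_plus_def by (rule Abs_mode_algebra_plus_inverse[OF mode_in_plus])

lemma Rep_mode_unit_plus: "RepU mode_unit_plus = mode_unit"
 unfolding mode_unit_plus_def by (rule Abs_mode_algebra_plus_inverse) (simp add: cv_span_base)

lemma plus_span: "(x :: 'v::graded_vertex_algebra mode_algebra_plus) : cspan (insert mode_unit_plus {mode_plus A f | A f. A ~= [] & f : conf_ring_plus (length A)})"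
proof -
 have "retract (RepU x) : cspan (insert mode_unit_plus {mode_plus A f | A f. A ~= [] & f : conf_ring_plus (length A)})"
 proof (rule lin_span_in[OF lin_retract RepU])
  fix y :: "'v mode_algebra" assume "y : insert mode_unit {mode A f | A f. A ~= [] & f : conf_ring_plus (length A)}"
  then consider "y = mode_unit" | A f where "y = mode A f" "A ~= []" "f : conf_ring_plus (length A)" by blast
  thus "retract y : cspan (insert mode_unit_plus {mode_plus A f | A f. A ~= [] & f : conf_ring_plus (length A)})"
  proof cases
   case 1
   have "retract y = mode_unit_plus" unfolding 1 using retract_Rep[of "mode_unit_plus :: 'v mode_algebra_plus"] by (simp add: Rep_mode_unit_plus)
   thus ?thesis by (simp add: cv_span_base)
  next
   case 2
   have "retract y = mode_plus A f" unfolding 2(1) using retract_Rep[of "mode_plus A f"] Rep_mode_plus[OF 2(3)] by simp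
   thus ?thesis using 2 by (auto intro!: cv_span_base)
  qed
 qed
 thus ?thesis by simp
qed

text \<open>As a linear image of \<open>M\<close> it inherits all relations; on functions in
  \<open>confp\<close> it is the positive mode.\<close>

definition Mp :: "nat list => (nat => 'v::graded_vertex_algebra) => ratfun => 'v mode_algebra_plus"
 where "Mp ls A f = retract (M ls A f)"

lemma lin_Mp: "clinear (Mp ls A)"
 unfolding Mp_def[abs_def] by (rule lin_comp[OF lin_retract lin_M])

lemma Mp_eq: "f : confp (set ls) ==> Mp ls A f = mode_plus (map A ls) (rnm (pos ls) f)"
 using Rep_mode_plus[of "rnm (pos ls) f" "map A ls"] rename_pos_in_plus[of f ls] M_eq[of f ls A] confp_conf
 by (metis Mp_def length_map retract_Rep subsetD)

lemma Rep_Mp: "f : confp (set ls) ==> RepU (Mp ls A f) = M ls A f"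
 using Rep_mode_plus[of "rnm (pos ls) f" "map A ls"] rename_pos_in_plus[of f ls] M_eq[of f ls A] confp_conf[of "set ls"]
 by (auto simp: Mp_eq)

lemma Mp_cong: "(!!i. i : set ls ==> A i = B i) ==> Mp ls A = Mp ls B"
 using M_cong[of ls A B] by (auto simp: Mp_def fun_eq_iff)

lemma M_Nil: "M [] A (ratC c) = c *. mode_unit"
 by (simp add: M_eq mode_Nil)

lemma Mp_Nil: "Mp [] A (ratC c) = c *. mode_unit_plus"
 by (metis Mp_def M_Nil Rep_mode_unit_plus lin_retract lin_scale retract_Rep)

section \<open>Products of functions of disjoint variables\<close>

lemma span_induct_in_span [consumes 1, case_names base step]:
 assumes "x : cspan S" "P 0"
  "!!c x y. x : S ==> y : cspan S ==> P y ==> P (c *. x + y)"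
 shows "P x"
proof -
 have "x : cspan S & P x"
  using assms(1)
 proof (induction rule: cv_span_induct_alt)
  case base thus ?case using assms(2) by (simp add: cv_span_zero)
 next
  case (step c x y) thus ?case
   using assms(3) by (simp add: cv_span_add cv_span_scale cv_span_base)
 qed
 thus ?thesis by simp
qed

definition prods :: "ratfun set => ratfun set => ratfun set"
 where "prods P Q = {p * q | p q. p : P & q : Q}"

lemma prodsI: "p : P ==> q : Q ==> p * q : prods P Q"
 by (auto simp: prods_def)

lemma span_mult_closed:
 assumes "!!x y. x : X ==> y : X ==> x * y : (X :: ratfun set)" "x : cspan X" "y : cspan X"
 shows "x * y : cspan X"
proof (rule lin_span_in[OF lin_times(1) assms(2)])
 fix x assume x: "x : X"
 show "x * y : cspan X"
  by (rule lin_span_in[OF lin_times(2) assms(3)]) (use assms(1) x in "auto intro: cv_span_base")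
qed

text \<open>The span of the products is closed under multiplication and contains the generators of
  both rings.\<close>

lemma cring_in_span_prods:
 assumes P: "P = cring S Z D" and Q: "Q = cring S' Z' D'" and f: "f : cring (S Un S') (Z Un Z') (D Un D')"
 shows "f : cspan (prods P Q)"
proof -
 have cl: "x * y : prods P Q" if "x : prods P Q" "y : prods P Q" for x y
 proof -
  obtain p q p' q' where "x = p * q" "y = p' * q'" "p : P" "q : Q" "p' : P" "q' : Q"
   using \<open>x : _\<close> \<open>y : _\<close> by (auto simp: prods_def)
  hence "x * y = (p * p') * (q * q')" "p * p' : P" "q * q' : Q" using P Q by (auto intro: cring_mult)
  thus ?thesis by (auto simp: prods_def)
 qed
 have l: "p : cspan (prods P Q)" if "p : P" for p
  using prodsI[of p P 1 Q] that Q by (auto intro: cv_span_base)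
 have r: "q : cspan (prods P Q)" if "q : Q" for q
  using prodsI[of 1 P q Q] that P by (auto intro: cv_span_base)
 show ?thesis using f
 proof (induction rule: cring_induct)
  case (const c) show ?case by (rule l) (simp add: P)
 next
  case (var i) thus ?case using l[of "var i"] r[of "var i"] by (auto simp: P Q intro: cring_var)
 next
  case (inv i) thus ?case using l[of "inverse (var i)"] r[of "inverse (var i)"] by (auto simp: P Q intro: cring_inv)
 next
  case (diff i j) thus ?case using l[of "inverse (var i - var j)"] r[of "inverse (var i - var j)"]
   by (auto simp: P Q intro: cring_invdiff)
 next
  case (mult f g) thus ?case by (intro span_mult_closed cl) auto
 qed (auto intro: cv_span_add)
qed

abbreviation mixs :: "nat set => nat set => ratfun set"
 where "mixs I J == cspan (prods (conf I) (confp J))"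

lemma prods_conf: "x : prods (conf I) (confp J) ==> x : conf (I Un J)"
 using conf_mono[of I "I Un J"] conf_mono[of J "I Un J"] confp_conf[of J]
 by (auto simp: prods_def intro!: conf_mult)

lemma mixs_conf: "x : mixs I J ==> x : conf (I Un J)"
 using cv_span_mono[of "prods (conf I) (confp J)" "conf (I Un J)"] prods_conf conf_subspace(1) by blast

text \<open>The coefficients keep no pole between the two groups and none at z_j = 0 for j in
  \<open>J\<close>. This is why the second tensor factor of the coproduct lies in U_+.\<close>

lemma xsh_mixs:
 assumes "f : conf S" "J <= S"
 shows "xsh J f $$ s : mixs (S - J) J"
proof (rule cring_in_span_prods[OF conf_def confp_def])
 have "xsh J f $$ s : cring S (S - J) {(i, j) : offdiag S. (i : J) = (j : J)}"
  by (rule coeffs_inD[OF xsh_coeffs[OF cwf_conf(1) assms(1)[unfolded conf_def]]])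
 also have "... <= cring (S - J Un J) (S - J Un {}) (offdiag (S - J) Un offdiag J)"
  by (rule cring_mono) (auto simp: offdiag_def)
 finally show "xsh J f $$ s : cring (S - J Un J) (S - J Un {}) (offdiag (S - J) Un offdiag J)" .
qed

lemma xsh_confp_mixs:
 assumes "f : confp S" "J <= S"
 shows "xsh J f $$ s : cspan (prods (confp (S - J)) (confp J))"
proof (rule cring_in_span_prods[OF confp_def confp_def])
 have "xsh J f $$ s : cring S ({} - J) {(i, j) : offdiag S. (i : J) = (j : J)}"
  by (rule coeffs_inD[OF xsh_coeffs[OF cwf_conf(2) assms(1)[unfolded confp_def]]])
 also have "... <= cring (S - J Un J) ({} Un {}) (offdiag (S - J) Un offdiag J)"
  by (rule cring_mono) (use assms(2) in "auto simp: offdiag_def")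
 finally show "xsh J f $$ s : cring (S - J Un J) ({} Un {}) (offdiag (S - J) Un offdiag J)" .
qed

lemma expat_times_const:
 assumes "p : conf S" "q : conf T" "i ~: T" "po ~= Some i"
 shows "expat i po (p * q) $$ k = expat i po p $$ k * q" "expat i po (q * p) $$ k = q * expat i po p $$ k"
proof -
 have "expat i po (p * q) = expat i po p * expat i po q"
  unfolding expat_def by (rule lau_hom(2)[OF adm_exp[OF assms(4)] conf_CU[OF assms(1)] conf_CU[OF assms(2)]])
 thus "expat i po (p * q) $$ k = expat i po p $$ k * q" by (simp add: expat_id[OF assms(2-4)])
 thus "expat i po (q * p) $$ k = q * expat i po p $$ k" by (simp add: mult.commute)
qed

lemma expat_linear:
 assumes "x : conf S" "y : conf S" "po ~= Some i"
 shows "expat i po (c *. x + y) $$ k = c *. expat i po x $$ k + expat i po y $$ k"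
proof -
 note hom = lau_hom_conf[OF adm_exp[OF assms(3)]]
 have "expat i po (c *. x + y) = fls_const (ratC c) * expat i po x + expat i po y"
  unfolding expat_def scaleC_ratfun hom(1)[OF conf_mult[OF conf_closed(1) assms(1)] assms(2)] hom(2)[OF conf_closed(1) assms(1)]
  by simp
 thus ?thesis by (simp add: scaleC_ratfun)
qed

lemma xsh_linear:
 assumes "x : conf S" "y : conf S"
 shows "xsh J (c *. x + y) $$ k = c *. xsh J x $$ k + xsh J y $$ k"
proof -
 note hom = lau_hom_conf[OF adm_shift]
 have "xsh J (c *. x + y) = fls_const (ratC c) * xsh J x + xsh J y"
  unfolding xsh_eq scaleC_ratfun hom(1)[OF conf_mult[OF conf_closed(1) assms(1)] assms(2)] hom(2)[OF conf_closed(1) assms(1)]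
  by simp
 thus ?thesis by (simp add: scaleC_ratfun)
qed

lemma xsh_0 [simp]: "xsh J 0 = 0" "xsh J 1 = 1"
 by (simp_all add: xsh_eq)

lemma expat_0 [simp]: "expat i po 0 = 0"
 by (simp add: expat_def)

lemma xsh_add: "x : conf S ==> y : conf S ==> xsh J (x + y) $$ k = xsh J x $$ k + xsh J y $$ k"
 using xsh_linear[of x S y J 1 k] by (simp add: scaleC_one)

lemma xsh_scale: "x : conf S ==> xsh J (c *. x) $$ k = c *. xsh J x $$ k"
 using xsh_linear[of x S 0 J c k] by simp

lemma pd_zero: "f : conf S ==> i ~: S ==> pdv i f = 0"
 by (rule derivation_unique[where S = S and Z = S and D = "offdiag S" and Ph = "%f. f" and e = "%f. 0"])
   (auto simp: conf_def offdiag_def derivation_along_def pd_add pd_mult)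

lemma pd_xsh: "f : conf S ==> xsh J (pdv i f) $$ n = pdv i (xsh J f $$ n)"
 unfolding xsh_eq
 by (rule pd_coefficient[OF adm_shift cwf_conf(1)[of S]])
   (auto simp: conf_def shift_pt_def pd_add intro!: fls_eqI)

section \<open>The coproduct on labelled modes\<close>

lemma comm_finite:
 assumes "!!k. G 0 (F $$ k) = 0" "!!a. G a 0 = 0"
 shows "finite {k. G (nprod k a b) (F $$ k) ~= 0}"
proof -
 obtain N where N: "!!k. k >= N ==> nprod k a b = 0" using truncation by blast
 have "{k. G (nprod k a b) (F $$ k) ~= 0} <= {fsubdeg F..N}"
 proof (rule subsetI, rule ccontr)
  fix k assume k: "k : {k. G (nprod k a b) (F $$ k) ~= 0}" "k ~: {fsubdeg F..N}"
  hence "nprod k a b = 0 | F $$ k = 0" using N by force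
  thus False using k(1) assms by auto
 qed
 thus ?thesis by (rule finite_subset) simp
qed

lemma (in labelled_functional) commutator_finite:
 assumes "distinct (xs @ i # j # ys)" "f : conf (set (xs @ i # j # ys))"
 shows "finite {k. Ps (xs @ j # ys) (A(j := nprod k a b)) (expat i (Some j) f $$ k) ~= 0}"
proof (rule comm_finite[where G = "%a. Ps (xs @ j # ys) (A(j := a))"])
 have set: "set (xs @ i # j # ys) - {i} = set (xs @ j # ys)" using assms(1) by auto
 have "expat i (Some j) f $$ k : conf (set (xs @ j # ys))" for k
  unfolding set[symmetric] by (rule expat_conf[OF assms(2), where j = j]) (use assms(1) in auto)
 thus "Ps (xs @ j # ys) (A(j := 0)) (expat i (Some j) f $$ k) = 0" for k
  by (intro vec_zero) (use assms(1) in auto)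
qed (rule lin_zero[OF linear])

lemma labelled_functional_comp:
 assumes "labelled_functional Ps" "clinear rh"
 shows "labelled_functional (%ls A f. rh (Ps ls A f))"
proof -
 interpret labelled_functional Ps by (rule assms(1))
 show ?thesis
 proof (rule labelled_functional.intro)
  fix ls A show "clinear (%f. rh (Ps ls A f))" by (rule lin_comp[OF assms(2) linear])
 next
  fix ls :: "nat list" and A B :: "nat => 'a" and f
  assume "!!i. i : set ls ==> A i = B i" "f : conf (set ls)"
  from cong[OF this] show "rh (Ps ls A f) = rh (Ps ls B f)" by simp
 next
  fix xs ys i j f and A :: "nat => 'a"
  assume *: "distinct (xs @ i # j # ys)" "f : conf (set (xs @ i # j # ys))"
  show "rh (Ps (xs @ i # j # ys) A f) = rh (Ps (xs @ j # i # ys) A f)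
    + Sum_any (%k. rh (Ps (xs @ j # ys) (A(j := nprod k (A i) (A j))) (expat i (Some j) f $$ k)))"
   unfolding commutator[OF *] lin_add[OF assms(2)] lin_Sum_any[OF assms(2) commutator_finite[OF *]] ..
 qed (simp_all add: rename vec_add vec_scale translation vacuum_last lin_add[OF assms(2)] lin_scale[OF assms(2)] lin_neg[OF assms(2)])
qed

interpretation Mp: labelled_functional "Mp :: nat list => (nat => 'v::graded_vertex_algebra) => _"
 using labelled_functional_comp[OF M.labelled_functional_axioms lin_retract] by (simp add: Mp_def[abs_def])

text \<open>The labelled counterpart of \<open>split_mode\<close>, total and linear in the function;
  it exists by \<open>bilinear_extension\<close>.\<close>

definition Split :: "nat list => nat list => (nat => 'v::graded_vertex_algebra) => ratfun => 'v mode_algebra \<otimes> 'v mode_algebra_plus"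
 where "Split is js A = (SOME L. clinear L & (ALL p:conf (set is). ALL q:confp (set js). L (p * q) = M is A p \<otimes> Mp js A q))"

lemma Split:
 assumes "set is Int set js = {}"
 shows "clinear (Split is js A)"
  "p : conf (set is) ==> q : confp (set js) ==> Split is js A (p * q) = M is A p \<otimes> Mp js A q"
proof -
 have "cbilinear (%p q. M is A p \<otimes> Mp js A q)" by (rule cbilinear_tmap[OF lin_M lin_Mp])
 from bilinear_extension[OF assms conf_rats confp_rats this]
 have "EX L. clinear L & (ALL p:conf (set is). ALL q:confp (set js). L (p * q) = M is A p \<otimes> Mp js A q)" by metis
 from someI_ex[OF this] show "clinear (Split is js A)"
  "p : conf (set is) ==> q : confp (set js) ==> Split is js A (p * q) = M is A p \<otimes> Mp js A q"
  unfolding Split_def by blast+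
qed

lemma Split_cong: "(!!i. i : set is Un set js ==> A i = B i) ==> Split is js A = Split is js B"
proof -
 assume "!!i. i : set is Un set js ==> A i = B i"
 hence "M is A = M is B" "Mp js A = Mp js B" by (auto intro: M_cong Mp_cong)
 thus ?thesis by (simp only: Split_def)
qed

lemma prods_ext:
 assumes "clinear L" "clinear L'" "!!p q. p : P ==> q : Q ==> L (p * q) = L' (p * q)"
  "h : cspan (prods P Q)"
 shows "L h = L' h"
 by (rule lin_eq_on_span[OF assms(1,2) _ assms(4)]) (auto simp: prods_def assms(3))

text \<open>The relation is linear in h, but \<open>Sum_any\<close> is additive only on finite
  supports. The span of \<open>R\<close> contains the coefficients of the expansions, and
  \<open>G 0\<close> vanishes on it; together with truncation this bounds the supports.\<close>

lemma commutator_extend: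
 assumes "clinear L1" "clinear L2" "!!a. clinear (G a)" "po ~= Some i" "X <= conf S"
  "!!f. f : cspan R ==> G 0 f = 0"
  "!!x k. x : X ==> expat i po x $$ k : cspan R"
  "!!x. x : X ==> L1 x = L2 x + Sum_any (%k. G (nprod k a b) (expat i po x $$ k))"
  "h : cspan X"
 shows "L1 h = L2 h + Sum_any (%k. G (nprod k a b) (expat i po h $$ k))"
proof -
 have XS: "cspan X <= conf S"
  using cv_span_mono[OF assms(5)] conf_subspace(1) by auto
 have R: "expat i po x $$ k : cspan R" if "x : cspan X" for x k
  using that
 proof (induction rule: span_induct_in_span)
  case base thus ?case by (simp add: cv_span_zero)
 next
  case (step c x y)
  hence "x : conf S" "y : conf S" using assms(5) XS by auto
  from expat_linear[OF this assms(4)] step assms(7) show ?case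
   by (simp add: cv_span_add cv_span_scale)
 qed
 have fin: "finite {k. G (nprod k a b) (expat i po x $$ k) ~= 0}" if "x : cspan X" for x
  by (rule comm_finite) (use assms(6) R[OF that] lin_zero[OF assms(3)] in auto)
 show ?thesis using assms(9)
 proof (induction rule: span_induct_in_span)
  case base show ?case
   by (simp add: lin_zero[OF assms(1)] lin_zero[OF assms(2)] lin_zero[OF assms(3)])
 next
  case (step c x y)
  have xs: "x : cspan X" using step by (simp add: cv_span_base)
  have xy: "x : conf S" "y : conf S" using step assms(5) XS by auto
  let ?g = "%x k. G (nprod k a b) (expat i po x $$ k)"
  have "Sum_any (?g (c *. x + y)) = Sum_any (%k. c *. ?g x k + ?g y k)"
   by (simp add: expat_linear[OF xy assms(4)] lin_add[OF assms(3)] lin_scale[OF assms(3)])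
  also have "... = Sum_any (%k. c *. ?g x k) + Sum_any (?g y)"
   by (rule Sum_any.distrib) (use fin[OF xs] fin[OF step(2)] in "auto elim: rev_finite_subset")
  also have "Sum_any (%k. c *. ?g x k) = c *. Sum_any (?g x)"
   by (rule lin_Sum_any[OF lin_scaled[OF lin_id(2)] fin[OF xs], symmetric])
  finally show ?case using step assms(8)[OF step(1)]
   by (simp add: lin_add[OF assms(1)] lin_scale[OF assms(1)] lin_add[OF assms(2)] lin_scale[OF assms(2)]
     scaleC_add_right add_ac)
 qed
qed

lemma Split_vec:
 assumes "distinct is" "distinct js" "set is Int set js = {}" "i : set is Un set js" "h : mixs (set is) (set js)"
 shows "Split is js (A(i := a + b)) h = Split is js (A(i := a)) h + Split is js (A(i := b)) h"
  "Split is js (A(i := c *. a)) h = c *. Split is js (A(i := a)) h"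
  "Split is js (A(i := transl a)) h = - Split is js (A(i := a)) (pdv i h)"
proof -
 note S = Split[OF assms(3)]
 have c: "confp (set js) <= conf (set js)" by (rule confp_conf)
 have Mi: "M is (A(i := x)) = M is A" if "i : set js" for x using that assms(3) by (intro M_cong) auto
 have Mj: "Mp js (A(i := x)) = Mp js A" if "i : set is" for x using that assms(3) by (intro Mp_cong) auto
 have iv: "i ~: set js" if "i : set is" using that assms(3) by auto
 have jv: "i ~: set is" if "i : set js" using that assms(3) by auto
 show "Split is js (A(i := a + b)) h = Split is js (A(i := a)) h + Split is js (A(i := b)) h"
 proof (rule prods_ext[OF S(1) lin_plus[OF S(1) S(1)] _ assms(5)])
  fix p q assume "p : conf (set is)" "q : confp (set js)"
  thus "Split is js (A(i := a + b)) (p * q) = Split is js (A(i := a)) (p * q) + Split is js (A(i := b)) (p * q)"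
   using assms(1,2,4) c by (auto simp: S(2) Mi Mj M.vec_add Mp.vec_add tensor_add_left tensor_add_right subset_iff)
 qed
 show "Split is js (A(i := c *. a)) h = c *. Split is js (A(i := a)) h"
 proof (rule prods_ext[OF S(1) lin_scaled[OF S(1)] _ assms(5)])
  fix p q assume "p : conf (set is)" "q : confp (set js)"
  thus "Split is js (A(i := c *. a)) (p * q) = c *. Split is js (A(i := a)) (p * q)"
   using assms(1,2,4) c by (auto simp: S(2) Mi Mj M.vec_scale Mp.vec_scale tensor_scale_left tensor_scale_right subset_iff)
 qed
 show "Split is js (A(i := transl a)) h = - Split is js (A(i := a)) (pdv i h)"
 proof (rule prods_ext[OF S(1) _ _ assms(5)])
  show "clinear (%h. - Split is js (A(i := a)) (pdv i h))"
   using lin_scaled[OF lin_comp[OF S(1) lin_pd], of "- 1"] by (simp add: scaleC_one)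
  fix p q assume p: "p : conf (set is)" and q: "q : confp (set js)"
  hence q': "q : conf (set js)" using c by blast
  show "Split is js (A(i := transl a)) (p * q) = - Split is js (A(i := a)) (pdv i (p * q))"
  proof (cases "i : set is")
   case True
   hence "pdv i (p * q) = pdv i p * q" using pd_zero[OF q' iv] by (simp add: pd_mult)
   thus ?thesis using True p q assms(1) conf_pd[OF p]
    by (simp add: S(2) Mj M.translation lin_neg[OF lin_tensor_left])
  next
   case False
   hence j: "i : set js" using assms(4) by auto
   hence "pdv i (p * q) = p * pdv i q" using pd_zero[OF p jv] by (simp add: pd_mult)
   thus ?thesis using j p q q' assms(2) confp_pd[OF q]
    by (simp add: S(2) Mi Mp.translation lin_neg[OF clinear_tensor_right])
  qed
 qed
qed

lemma Split_vec_zero: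
 assumes "distinct is" "distinct js" "set is Int set js = {}" "i : set is Un set js" "h : mixs (set is) (set js)"
 shows "Split is js (A(i := 0)) h = 0"
 using Split_vec(2)[OF assms, of A 0 0] by simp

lemma Split_rename:
 assumes "distinct is" "distinct js" "set is Int set js = {}" "inj_on pqi (set is Un set js)" "h : mixs (set is) (set js)"
 shows "Split (map pqi is) (map pqi js) A (rnm pqi h) = Split is js (%i. A (pqi i)) h"
 using assms(5)
proof (induction rule: span_induct_in_span)
 have d: "set (map pqi is) Int set (map pqi js) = {}" using assms(3,4) by (auto simp: inj_on_def)
 note S = Split[OF assms(3)] and S' = Split[OF d]
 case base show ?case by (simp add: lin_zero[OF S(1)] lin_zero[OF S'(1)])
 case (step c x y)
 have inj: "inj_on pqi (set is)" "inj_on pqi (set js)" using assms(4) by (auto simp: inj_on_def)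
 obtain p q where x: "x = p * q" "p : conf (set is)" "q : confp (set js)" using step(1) by (auto simp: prods_def)
 have q: "q : conf (set js)" using x(3) confp_conf by blast
 have xc: "x : conf (set is Un set js)" using prods_conf[OF step(1)] .
 have yc: "y : conf (set is Un set js)" using mixs_conf[OF step(2)] .
 have pq: "p : conf (set is Un set js)" "q : conf (set is Un set js)"
  using x(2) q conf_mono[of "set is" "set is Un set js"] conf_mono[of "set js" "set is Un set js"] by auto
 have r: "rnm pqi (c *. x + y) = c *. rnm pqi x + rnm pqi y"
  by (simp add: rename_hom[OF assms(4)] rename_scaleC[OF assms(4)] conf_scaleC xc yc)
 have "Split (map pqi is) (map pqi js) A (rnm pqi x) = Split is js (%i. A (pqi i)) x"
  unfolding x(1) rename_hom(2)[OF assms(4) pq] S(2)[OF x(2,3)]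
  using rename_conf[OF inj(1) x(2)] rename_confp[OF inj(2) x(3)]
  by (subst S'(2)) (simp_all add: M.rename[OF assms(1) inj(1) x(2)] Mp.rename[OF assms(2) inj(2) q])
 thus ?case unfolding r using step(3)
  by (simp add: lin_add[OF S(1)] lin_scale[OF S(1)] lin_add[OF S'(1)] lin_scale[OF S'(1)])
qed

lemma Split_commutator_left:
 assumes "distinct (xs @ i # j # ys)" "distinct js" "set (xs @ i # j # ys) Int set js = {}" "h : mixs (set (xs @ i # j # ys)) (set js)"
 shows "Split (xs @ i # j # ys) js A h = Split (xs @ j # i # ys) js A h
  + Sum_any (%k. Split (xs @ j # ys) js (A(j := nprod k (A i) (A j))) (expat i (Some j) h $$ k))"
proof -
 let ?ls = "xs @ i # j # ys"
 have d: "set (xs @ j # i # ys) Int set js = {}" "set (xs @ j # ys) Int set js = {}" using assms(3) by auto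
 note S = Split[OF assms(3)] Split[OF d(1)] Split[OF d(2)]
 have ij: "Some j ~= Some i" "i ~: set js" "j ~: set js" "distinct (xs @ j # ys)" using assms(1,3) by auto
 have set: "set ?ls - {i} = set (xs @ j # ys)" "set (xs @ j # i # ys) = set ?ls" using assms(1) by auto
 have ex: "expat i (Some j) p $$ k : conf (set (xs @ j # ys))" if "p : conf (set ?ls)" for p k
  unfolding set(1)[symmetric] by (rule expat_conf[OF that, where j = j]) (use assms(1) in auto)
 have qc: "q : conf (set js)" if "q : confp (set js)" for q using that confp_conf by blast
 show ?thesis
 proof (rule commutator_extend[where G = "%a. Split (xs @ j # ys) js (A(j := a))" and R = "prods (conf (set (xs @ j # ys))) (confp (set js))",
   OF S(1) S(3) S(5) ij(1) _ _ _ _ assms(4)])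
  show "prods (conf (set ?ls)) (confp (set js)) <= conf (set ?ls Un set js)" using prods_conf by blast
  show "Split (xs @ j # ys) js (A(j := 0)) f = 0" if "f : mixs (set (xs @ j # ys)) (set js)" for f
   by (rule Split_vec_zero[OF ij(4) assms(2) d(2) _ that]) auto
 next
  fix x k assume "x : prods (conf (set ?ls)) (confp (set js))"
  then obtain p q where x: "x = p * q" "p : conf (set ?ls)" "q : confp (set js)" by (auto simp: prods_def)
  have e: "expat i (Some j) x $$ k = expat i (Some j) p $$ k * q" for k
   unfolding x(1) by (rule expat_times_const(1)[OF x(2) qc[OF x(3)] ij(2,1)])
  show "expat i (Some j) x $$ k : mixs (set (xs @ j # ys)) (set js)"
   unfolding e by (intro cv_span_base prodsI ex x)
  have Mq: "Mp js (A(j := c)) = Mp js A" for c using ij(3) by (intro Mp_cong) auto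
  have "Split ?ls js A x = (M (xs @ j # i # ys) A p + Sum_any (%k. M (xs @ j # ys) (A(j := nprod k (A i) (A j))) (expat i (Some j) p $$ k))) \<otimes> Mp js A q"
   unfolding x(1) S(2)[OF x(2,3)] M.commutator[OF assms(1) x(2)] ..
  also have "... = M (xs @ j # i # ys) A p \<otimes> Mp js A q + Sum_any (%k. M (xs @ j # ys) (A(j := nprod k (A i) (A j))) (expat i (Some j) p $$ k) \<otimes> Mp js A q)"
   unfolding tensor_add_left lin_Sum_any[OF lin_tensor_left M.commutator_finite[OF assms(1) x(2)]] ..
  also have "... = Split (xs @ j # i # ys) js A x + Sum_any (%k. Split (xs @ j # ys) js (A(j := nprod k (A i) (A j))) (expat i (Some j) x $$ k))"
   unfolding e unfolding x(1) S(4)[OF x(2)[folded set(2)] x(3)] S(6)[OF ex[OF x(2)] x(3)] Mq ..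
  finally show "Split ?ls js A x = Split (xs @ j # i # ys) js A x + Sum_any (%k. Split (xs @ j # ys) js (A(j := nprod k (A i) (A j))) (expat i (Some j) x $$ k))" .
 qed
qed

lemma Split_commutator_right:
 assumes "distinct (xs @ i # j # ys)" "distinct is" "set is Int set (xs @ i # j # ys) = {}" "h : mixs (set is) (set (xs @ i # j # ys))"
 shows "Split is (xs @ i # j # ys) A h = Split is (xs @ j # i # ys) A h
  + Sum_any (%k. Split is (xs @ j # ys) (A(j := nprod k (A i) (A j))) (expat i (Some j) h $$ k))"
proof -
 let ?ls = "xs @ i # j # ys"
 have d: "set is Int set (xs @ j # i # ys) = {}" "set is Int set (xs @ j # ys) = {}" using assms(3) by auto
 note S = Split[OF assms(3)] Split[OF d(1)] Split[OF d(2)]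
 have ij: "Some j ~= Some i" "i ~: set is" "j ~: set is" "distinct (xs @ j # ys)" using assms(1,3) by auto
 have set: "set ?ls - {i} = set (xs @ j # ys)" "set (xs @ j # i # ys) = set ?ls" using assms(1) by auto
 have ex: "expat i (Some j) q $$ k : confp (set (xs @ j # ys))" if "q : confp (set ?ls)" for q k
  unfolding set(1)[symmetric] by (rule expat_confp[OF that]) (use assms(1) in auto)
 have qc: "q : conf (set ?ls)" if "q : confp (set ?ls)" for q using that confp_conf by blast
 show ?thesis
 proof (rule commutator_extend[where G = "%a. Split is (xs @ j # ys) (A(j := a))" and R = "prods (conf (set is)) (confp (set (xs @ j # ys)))",
   OF S(1) S(3) S(5) ij(1) _ _ _ _ assms(4)])
  show "prods (conf (set is)) (confp (set ?ls)) <= conf (set is Un set ?ls)" using prods_conf by blast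
  show "Split is (xs @ j # ys) (A(j := 0)) f = 0" if "f : mixs (set is) (set (xs @ j # ys))" for f
   by (rule Split_vec_zero[OF assms(2) ij(4) d(2) _ that]) auto
 next
  fix x k assume "x : prods (conf (set is)) (confp (set ?ls))"
  then obtain p q where x: "x = p * q" "p : conf (set is)" "q : confp (set ?ls)" by (auto simp: prods_def)
  have e: "expat i (Some j) x $$ k = p * expat i (Some j) q $$ k" for k
   unfolding x(1) by (rule expat_times_const(2)[OF qc[OF x(3)] x(2) ij(2,1)])
  show "expat i (Some j) x $$ k : mixs (set is) (set (xs @ j # ys))"
   unfolding e by (intro cv_span_base prodsI ex x)
  have Mq: "M is (A(j := c)) = M is A" for c using ij(3) by (intro M_cong) auto
  have "Split is ?ls A x = M is A p \<otimes> (Mp (xs @ j # i # ys) A q + Sum_any (%k. Mp (xs @ j # ys) (A(j := nprod k (A i) (A j))) (expat i (Some j) q $$ k)))"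
   unfolding x(1) S(2)[OF x(2,3)] Mp.commutator[OF assms(1) qc[OF x(3)]] ..
  also have "... = M is A p \<otimes> Mp (xs @ j # i # ys) A q + Sum_any (%k. M is A p \<otimes> Mp (xs @ j # ys) (A(j := nprod k (A i) (A j))) (expat i (Some j) q $$ k))"
   unfolding tensor_add_right lin_Sum_any[OF clinear_tensor_right Mp.commutator_finite[OF assms(1) qc[OF x(3)]]] ..
  also have "... = Split is (xs @ j # i # ys) A x + Sum_any (%k. Split is (xs @ j # ys) (A(j := nprod k (A i) (A j))) (expat i (Some j) x $$ k))"
   unfolding e unfolding x(1) S(4)[OF x(2) x(3)[folded set(2)]] S(6)[OF x(2) ex[OF x(3)]] Mq ..
  finally show "Split is ?ls A x = Split is (xs @ j # i # ys) A x + Sum_any (%k. Split is (xs @ j # ys) (A(j := nprod k (A i) (A j))) (expat i (Some j) x $$ k))" .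
 qed
qed

section \<open>The sum over all splittings of the labels\<close>

abbreviation "outl J ls == filter (%i. i ~: J) ls"
abbreviation "inl J ls == filter (%i. i : J) ls"

lemma shift_mixs:
 assumes "f : conf (set ls)" "J <= set ls"
 shows "xsh J f $$ s : mixs (set (outl J ls)) (set (inl J ls))"
proof -
 have "set (outl J ls) = set ls - J" "set (inl J ls) = J" using assms(2) by auto
 thus ?thesis using xsh_mixs[OF assms] by simp
qed

lemma oi_disj: "set (outl J ls) Int set (inl J ls) = {}"
 by auto

text \<open>The value that the coefficient of \<open>w^-s\<close> in the coproduct must take; that
  it respects the relations is the content of the interpretation that follows.\<close>

definition Psi :: "int => nat list => (nat => 'v::graded_vertex_algebra) => ratfun => 'v mode_algebra \<otimes> 'v mode_algebra_plus"
 where "Psi s ls A = linext (conf (set ls))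
  (%f. SUM J:Pow (set ls). Split (outl J ls) (inl J ls) A (xsh J f $$ s))"

lemma lin_Psi: "clinear (Psi s ls A)"
 and Psi_eq: "f : conf (set ls) ==> Psi s ls A f = (SUM J:Pow (set ls). Split (outl J ls) (inl J ls) A (xsh J f $$ s))"
proof -
 let ?ph = "%f. SUM J:Pow (set ls). Split (outl J ls) (inl J ls) A (xsh J f $$ s)"
 note S = Split(1)[OF oi_disj]
 have 1: "?ph (f + g) = ?ph f + ?ph g" if "f : conf (set ls)" "g : conf (set ls)" for f g
  by (simp add: xsh_add[OF that] lin_add[OF S] sum.distrib)
 have 2: "?ph (c *. f) = c *. ?ph f" if "f : conf (set ls)" for f c
  by (simp add: xsh_scale[OF that] lin_scale[OF S] cv_scale_sum_right)
 show "clinear (Psi s ls A)" unfolding Psi_def by (rule linext(1)[OF conf_subspace(1) 1 2])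
 show "f : conf (set ls) ==> Psi s ls A f = ?ph f" unfolding Psi_def by (rule linext(2)[OF conf_subspace(1) 1 2])
qed

lemma Sum_any_sum:
 assumes "finite B" "!!x. x : B ==> finite {k. g x k ~= (0 :: 'a::comm_monoid_add)}"
 shows "Sum_any (%k. SUM x:B. g x k) = (SUM x:B. Sum_any (g x)) & finite {k. (SUM x:B. g x k) ~= 0}"
 using assms
proof (induction B rule: finite_induct)
 case (insert x B)
 hence fin: "finite {k. (SUM x:B. g x k) ~= 0}" "finite {k. g x k ~= 0}" by auto
 have "Sum_any (%k. g x k + (SUM x:B. g x k)) = Sum_any (g x) + Sum_any (%k. SUM x:B. g x k)"
  by (rule Sum_any.distrib[OF fin(2,1)])
 moreover have "{k. g x k + (SUM x:B. g x k) ~= 0} <= {k. g x k ~= 0} Un {k. (SUM x:B. g x k) ~= 0}" by auto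
 hence "finite {k. g x k + (SUM x:B. g x k) ~= 0}" by (rule finite_subset) (use fin in simp)
 ultimately show ?case using insert by simp
qed simp

text \<open>Subsets that contain both or neither of i and j correspond to subsets of the remaining
  labels, and there the commutator takes place inside one tensor factor. The Laurent coefficients at
  z_i = z_j commute with the shift, as z_i and z_j are shifted alike.\<close>

lemma Psi_commutator:
 assumes d: "distinct (xs @ i # j # ys)" and f: "f : conf (set (xs @ i # j # ys))"
 shows "Psi s (xs @ i # j # ys) A f = Psi s (xs @ j # i # ys) A f
    + Sum_any (%k. Psi s (xs @ j # ys) (A(j := nprod k (A i) (A j))) (expat i (Some j) f $$ k))"
proof -
 let ?ls = "xs @ i # j # ys" and ?ls2 = "xs @ j # i # ys" and ?ls' = "xs @ j # ys"
 let ?S = "set ?ls" and ?S' = "set ?ls'"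
 let ?h = "%J. xsh J f $$ s"
 \<comment> \<open>\<open>e\<close> restores i to the group of j; it inverts the removal of i on the
   subsets that do not separate the two labels.\<close>
 define e where "e J = (if j : J then insert i J else J)" for J :: "nat set"
 have ij: "i ~= j" "i ~: set xs" "i ~: set ys" "j ~: set xs" "j ~: set ys" using d by auto
 have sets: "?S' = ?S - {i}" "set ?ls2 = ?S" using ij by auto
 have f2: "f : conf (set ?ls2)" using f sets by simp
 have ex: "expat i (Some j) f $$ k : conf ?S'" for k
  unfolding sets(1) by (rule expat_conf[OF f, where j = j]) (use ij in auto)
 define D where "D J = Split (outl J ?ls) (inl J ?ls) A (?h J) - Split (outl J ?ls2) (inl J ?ls2) A (?h J)" for J
 define G where "G J a g = Split (outl J ?ls') (inl J ?ls') (A(j := a)) g" for J a g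
 \<comment> \<open>If i and j fall into different factors, their relative order is not visible in
   the two filtered lists.\<close>
 have zero: "D J = 0" if "J <= ?S" "(i : J) ~= (j : J)" for J
 proof -
  have "outl J ?ls = outl J ?ls2" "inl J ?ls = inl J ?ls2" using that(2) by auto
  thus ?thesis by (simp only: D_def diff_self)
 qed
 have comm: "expat i (Some j) (?h (e J)) $$ k = xsh J (expat i (Some j) f $$ k) $$ s" if "J <= ?S'" for J k
 proof -
  have "xsh (e J) (expat i (Some j) f $$ k) $$ s = expat i (Some j) (?h (e J)) $$ k"
   by (rule expat_shift_commute[OF f]) (use ij that in "auto simp: e_def")
  moreover have "xsh (e J) (expat i (Some j) f $$ k) = xsh J (expat i (Some j) f $$ k)"
   by (rule xsh_cong[OF ex]) (use ij in "auto simp: e_def")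
  ultimately show ?thesis by simp
 qed
 have eS: "e J <= ?S" if "J <= ?S'" for J using that by (auto simp: e_def)
 have main: "D (e J) = Sum_any (%k. G J (nprod k (A i) (A j)) (expat i (Some j) (?h (e J)) $$ k))" if J: "J <= ?S'" for J
 proof (cases "j : J")
  case True
  have iJ: "i ~: J" using J sets ij by auto
  have eJ: "inl (e J) xs = inl J xs" "inl (e J) ys = inl J ys" "outl (e J) xs = outl J xs" "outl (e J) ys = outl J ys"
   using ij by (auto simp: e_def intro!: filter_cong)
  have ie: "i : e J" "j : e J" using True by (auto simp: e_def)
  have o: "outl (e J) ?ls = outl J ?ls'" "outl (e J) ?ls2 = outl J ?ls'"
   using True ie by (simp_all add: eJ)
  have n: "inl (e J) ?ls = inl J xs @ i # j # inl J ys" "inl (e J) ?ls2 = inl J xs @ j # i # inl J ys" "inl J ?ls' = inl J xs @ j # inl J ys"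
   using True ie by (simp_all add: eJ)
  have "Split (outl J ?ls') (inl J xs @ i # j # inl J ys) A (?h (e J)) = Split (outl J ?ls') (inl J xs @ j # i # inl J ys) A (?h (e J))
    + Sum_any (%k. Split (outl J ?ls') (inl J xs @ j # inl J ys) (A(j := nprod k (A i) (A j))) (expat i (Some j) (?h (e J)) $$ k))"
  proof (rule Split_commutator_right)
   show "?h (e J) : mixs (set (outl J ?ls')) (set (inl J xs @ i # j # inl J ys))"
    using shift_mixs[OF f eS[OF J], of s] unfolding o n .
   show "distinct (inl J xs @ i # j # inl J ys)" using d by auto
   show "distinct (outl J ?ls')" using d by (intro distinct_filter) auto
   show "set (outl J ?ls') Int set (inl J xs @ i # j # inl J ys) = {}" using ij True by auto
  qed
  thus ?thesis unfolding D_def G_def o n by simp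
 next
  case False
  have iJ: "i ~: J" using J sets ij by auto
  have o: "inl (e J) ?ls = inl J ?ls'" "inl (e J) ?ls2 = inl J ?ls'"
   using False ij iJ by (auto simp: e_def intro!: filter_cong)
  have n: "outl (e J) ?ls = outl J xs @ i # j # outl J ys" "outl (e J) ?ls2 = outl J xs @ j # i # outl J ys" "outl J ?ls' = outl J xs @ j # outl J ys"
   using False ij iJ by (auto simp: e_def intro!: filter_cong)
  have "Split (outl J xs @ i # j # outl J ys) (inl J ?ls') A (?h (e J)) = Split (outl J xs @ j # i # outl J ys) (inl J ?ls') A (?h (e J))
    + Sum_any (%k. Split (outl J xs @ j # outl J ys) (inl J ?ls') (A(j := nprod k (A i) (A j))) (expat i (Some j) (?h (e J)) $$ k))"
  proof (rule Split_commutator_left)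
   show "?h (e J) : mixs (set (outl J xs @ i # j # outl J ys)) (set (inl J ?ls'))"
    using shift_mixs[OF f eS[OF J], of s] unfolding o n .
   show "distinct (outl J xs @ i # j # outl J ys)" using d by auto
   show "distinct (inl J ?ls')" using d by (intro distinct_filter) auto
   show "set (outl J xs @ i # j # outl J ys) Int set (inl J ?ls') = {}" using ij False iJ by auto
  qed
  thus ?thesis unfolding D_def G_def o n by simp
 qed
 have fin: "finite {k. G J (nprod k (A i) (A j)) (expat i (Some j) (?h (e J)) $$ k) ~= 0}" if J: "J <= ?S'" for J
 proof (rule comm_finite)
  fix k show "G J 0 (expat i (Some j) (?h (e J)) $$ k) = 0"
   unfolding G_def comm[OF J]
  proof (rule Split_vec_zero[OF _ _ oi_disj _ shift_mixs[OF ex J]])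
   show "distinct (outl J ?ls')" "distinct (inl J ?ls')" using d by (intro distinct_filter; auto)+
   show "j : set (outl J ?ls') Un set (inl J ?ls')" by auto
  qed
 qed (unfold G_def, rule lin_zero[OF Split(1)[OF oi_disj]])
 have inj: "inj_on e (Pow ?S')"
 proof (rule inj_onI)
  fix J K assume "J : Pow ?S'" "K : Pow ?S'" "e J = e K"
  hence "e J - {i} = e K - {i}" "i ~: J" "i ~: K" using sets(1) by auto
  thus "J = K" by (auto simp: e_def split: if_splits)
 qed
 have img: "D J = 0" if "J : Pow ?S - e ` Pow ?S'" for J
 proof (rule zero)
  show "J <= ?S" using that by simp
  show "(i : J) ~= (j : J)"
  proof
   assume "(i : J) = (j : J)"
   hence "J = e (J - {i})" using ij(1) by (auto simp: e_def)
   moreover have "J - {i} : Pow ?S'" using that sets(1) by auto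
   ultimately show False using that by blast
  qed
 qed
 have "(SUM J:Pow ?S. D J) = (SUM J:e ` Pow ?S'. D J)"
  
 proof (rule sum.mono_neutral_right)
  show "e ` Pow ?S' <= Pow ?S" by (rule image_subsetI) (rule PowI, rule eS, rule PowD)
 qed (use img in "simp_all only: set_append finite_Pow_iff, simp_all")
 also have "... = (SUM J:Pow ?S'. D (e J))" by (rule sum.reindex_cong[OF inj]) auto
 also have "... = (SUM J:Pow ?S'. Sum_any (%k. G J (nprod k (A i) (A j)) (expat i (Some j) (?h (e J)) $$ k)))"
  by (rule sum.cong) (simp_all only: main Pow_iff)
 also have "... = Sum_any (%k. SUM J:Pow ?S'. G J (nprod k (A i) (A j)) (expat i (Some j) (?h (e J)) $$ k))"
  by (rule Sum_any_sum[THEN conjunct1, symmetric]) (simp_all only: fin Pow_iff, simp)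
 also have "... = Sum_any (%k. Psi s ?ls' (A(j := nprod k (A i) (A j))) (expat i (Some j) f $$ k))"
  by (rule Sum_any.cong) (simp only: Psi_eq[OF ex], rule sum.cong, simp_all only: G_def comm Pow_iff)
 finally have "(SUM J:Pow ?S. D J) = ..." .
 moreover have "(SUM J:Pow ?S. D J) = Psi s ?ls A f - Psi s ?ls2 A f"
  unfolding Psi_eq[OF f] Psi_eq[OF f2] sets(2) D_def by (rule sum_subtractf)
 ultimately show ?thesis by (simp add: algebra_simps)
qed

text \<open>For i in \<open>J\<close> the function of z_J is regular at z_i = 0 and its residue
  vanishes, so these subsets drop out. For the others z_i is not shifted, and the residue commutes
  with the shift.\<close>

lemma Psi_vacuum_last:
 assumes d: "distinct (xs @ [i])" and A: "A i = vac" and f: "f : conf (set (xs @ [i]))"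
 shows "Psi s (xs @ [i]) A f = Psi s xs A (expat i None f $$ (- 1))"
proof -
 let ?ls = "xs @ [i]"
 let ?h = "%J. xsh J f $$ s"
 have i: "i ~: set xs" using d by simp
 have sets: "set ?ls - {i} = set xs" using i by auto
 have ex: "expat i None g $$ k : conf (set ys)" if "g : conf (set (ys @ [i]))" "i ~: set ys" for g k ys
  using expat_conf[OF that(1), of None undefined i k] that(2) by simp
 have zero: "Split (outl J ?ls) (inl J ?ls) A (?h J) = 0" if J: "J : Pow (set ?ls) - Pow (set xs)" for J
 proof -
  have iJ: "i : J" using J by auto
  have o: "inl J ?ls = inl J xs @ [i]" using iJ by simp
  have di: "set (outl J ?ls) Int set (inl J xs @ [i]) = {}" using iJ by auto
  have "Split (outl J ?ls) (inl J xs @ [i]) A (?h J) = (%_. 0) (?h J)"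
  proof (rule prods_ext[OF Split(1)[OF di] lin_0])
   show "?h J : mixs (set (outl J ?ls)) (set (inl J xs @ [i]))"
    using shift_mixs[OF f, of J s] J unfolding o by blast
   fix p q assume p: "p : conf (set (outl J ?ls))" and q: "q : confp (set (inl J xs @ [i]))"
   have q': "q : conf (set (inl J xs @ [i]))" using q confp_conf by blast
   have "expat i None q $$ (- 1) = 0"
    by (rule expat_regular(1)[OF cwf_conf(2) q[unfolded confp_def]]) (auto simp: avoids_def)
   hence "Mp (inl J xs @ [i]) A q = 0"
    using Mp.vacuum_last[of "inl J xs" i A q] d A q' by (simp add: lin_zero[OF lin_Mp])
   thus "Split (outl J ?ls) (inl J xs @ [i]) A (p * q) = 0" unfolding Split(2)[OF di p q] by (simp only: lin_zero[OF clinear_tensor_right])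
  qed
  thus ?thesis unfolding o .
 qed
 have main: "Split (outl J ?ls) (inl J ?ls) A (?h J) = Split (outl J xs) (inl J xs) A (xsh J (expat i None f $$ (- 1)) $$ s)"
  if J: "J : Pow (set xs)" for J
 proof -
  have iJ: "i ~: J" using J i by auto
  have o: "outl J ?ls = outl J xs @ [i]" "inl J ?ls = inl J xs" using iJ by simp_all
  have di: "set (outl J xs @ [i]) Int set (inl J xs) = {}" using i by auto
  \<comment> \<open>The residue is made a total linear map, since \<open>prods_ext\<close> compares
    linear maps.\<close>
  have cl: "clinear (linext (conf (set ?ls)) (%h. expat i None h $$ (- 1)))"
   and le: "h : conf (set ?ls) ==> linext (conf (set ?ls)) (%h. expat i None h $$ (- 1)) h = expat i None h $$ (- 1)" for h
   by (rule linext[OF conf_subspace(1)]; use expat_linear[of _ "set ?ls" _ None i 1 "- 1"] expat_linear[of _ "set ?ls" 0 None i _ "- 1"] in "simp add: scaleC_one")+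
  have hm: "?h J : mixs (set (outl J xs @ [i])) (set (inl J xs))"
   using shift_mixs[OF f, of J s] J unfolding o by auto
  have sub: "set (outl J xs @ [i]) Un set (inl J xs) <= set ?ls" by auto
  have "Split (outl J xs @ [i]) (inl J xs) A (?h J) = (%h. Split (outl J xs) (inl J xs) A (linext (conf (set ?ls)) (%h. expat i None h $$ (- 1)) h)) (?h J)"
  proof (rule prods_ext[OF Split(1)[OF di] lin_comp[OF Split(1)[OF oi_disj] cl] _ hm])
   fix p q assume p: "p : conf (set (outl J xs @ [i]))" and q: "q : confp (set (inl J xs))"
   have q': "q : conf (set (inl J xs))" using q confp_conf by blast
   have ip: "expat i None p $$ (- 1) : conf (set (outl J xs))" by (rule ex[OF p]) (use i in auto)
   have pq: "p * q : conf (set ?ls)" using prods_conf[OF prodsI[OF p q]] conf_mono[OF sub] by blast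
   have "linext (conf (set ?ls)) (%h. expat i None h $$ (- 1)) (p * q) = expat i None p $$ (- 1) * q"
    unfolding le[OF pq] by (rule expat_times_const(1)[OF p q']) (use i in auto)
   thus "Split (outl J xs @ [i]) (inl J xs) A (p * q) = Split (outl J xs) (inl J xs) A (linext (conf (set ?ls)) (%h. expat i None h $$ (- 1)) (p * q))"
    using M.vacuum_last[of "outl J xs" i A p] d A p
    by (simp only: Split(2)[OF di p q] Split(2)[OF oi_disj ip q] distinct_append distinct_filter) auto
  qed
  also have "linext (conf (set ?ls)) (%h. expat i None h $$ (- 1)) (?h J) = expat i None (?h J) $$ (- 1)"
   by (rule le[OF xsh_conf[OF f]])
  also have "... = xsh J (expat i None f $$ (- 1)) $$ s"
   by (rule expat_shift_commute[OF f, symmetric]) (use iJ in auto)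
  finally show ?thesis unfolding o .
 qed
 have "Psi s ?ls A f = (SUM J:Pow (set xs). Split (outl J ?ls) (inl J ?ls) A (?h J))"
  unfolding Psi_eq[OF f] by (rule sum.mono_neutral_right) (use zero in auto)
 also have "... = Psi s xs A (expat i None f $$ (- 1))"
  unfolding Psi_eq[OF ex[OF f i]] by (rule sum.cong[OF refl main])
 finally show ?thesis .
qed

interpretation Psi: labelled_functional "Psi s :: nat list => (nat => 'v::graded_vertex_algebra) => _" for s
proof (rule labelled_functional.intro)
 fix ls :: "nat list" and A B :: "nat => 'v"
 show "clinear (Psi s ls A)" by (rule lin_Psi)
next
 fix ls :: "nat list" and A B :: "nat => 'v" and f :: ratfun
 assume eq: "!!i. i : set ls ==> A i = B i" and f: "f : conf (set ls)"
 have "Split (outl J ls) (inl J ls) A = Split (outl J ls) (inl J ls) B" for J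
  by (rule Split_cong) (use eq in auto)
 thus "Psi s ls A f = Psi s ls B f" by (simp only: Psi_eq[OF f])
next
 fix ls :: "nat list" and A :: "nat => 'v" and f and pqi :: "nat => nat"
 assume d: "distinct ls" and inj: "inj_on pqi (set ls)" and f: "f : conf (set ls)"
 have f': "rnm pqi f : conf (set (map pqi ls))" using rename_conf[OF inj f] by simp
 have injp: "inj_on ((`) pqi) (Pow (set ls))" by (rule inj_on_image_Pow[OF inj])
 have t: "Split (outl (pqi ` J) (map pqi ls)) (inl (pqi ` J) (map pqi ls)) A (xsh (pqi ` J) (rnm pqi f) $$ s)
  = Split (outl J ls) (inl J ls) (%i. A (pqi i)) (xsh J f $$ s)" if J: "J : Pow (set ls)" for J
 proof -
  have mem: "pqi i : pqi ` J \<longleftrightarrow> i : J" if "i : set ls" for i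
   using inj J that by (auto simp: inj_on_def)
  have o: "outl (pqi ` J) (map pqi ls) = map pqi (outl J ls)" "inl (pqi ` J) (map pqi ls) = map pqi (inl J ls)"
   unfolding filter_map by (auto simp: mem intro!: arg_cong[of _ _ "map pqi"] filter_cong)
  have inj': "inj_on pqi (set (outl J ls) Un set (inl J ls))" by (rule inj_on_subset[OF inj]) auto
  show ?thesis unfolding o using J
   by (subst xsh_rename[OF inj f]) (auto intro!: Split_rename[OF _ _ oi_disj inj' shift_mixs[OF f]] simp: d)
 qed
 show "Psi s (map pqi ls) A (rnm pqi f) = Psi s ls (%i. A (pqi i)) f"
  unfolding Psi_eq[OF f'] Psi_eq[OF f] set_map image_Pow_surj[OF refl, symmetric] sum.reindex[OF injp]
  by (rule sum.cong) (simp_all only: comp_def t)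
next
 fix ls :: "nat list" and A :: "nat => 'v" and i f and a b :: 'v and c
 assume d: "distinct ls" and i: "i : set ls" and f: "f : conf (set ls)"
 have dd: "distinct (outl J ls)" "distinct (inl J ls)" for J using d by simp_all
 have im: "i : set (outl J ls) Un set (inl J ls)" for J using i by auto
 note V = Split_vec[OF dd oi_disj im shift_mixs[OF f]]
 show "Psi s ls (A(i := a + b)) f = Psi s ls (A(i := a)) f + Psi s ls (A(i := b)) f"
  unfolding Psi_eq[OF f] sum.distrib[symmetric] by (rule sum.cong) (auto intro: V(1))
 show "Psi s ls (A(i := c *. a)) f = c *. Psi s ls (A(i := a)) f"
  unfolding Psi_eq[OF f] cv_scale_sum_right by (rule sum.cong) (auto intro: V(2))
 show "Psi s ls (A(i := transl a)) f = - Psi s ls (A(i := a)) (pdv i f)"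
  unfolding Psi_eq[OF f] Psi_eq[OF conf_pd[OF f]] sum_negf[symmetric] pd_xsh[OF f]
  by (rule sum.cong[OF refl], rule V(3)) auto
next
 fix xs ys :: "nat list" and i j f and A :: "nat => 'v"
 assume "distinct (xs @ i # j # ys)" "f : conf (set (xs @ i # j # ys))"
 thus "Psi s (xs @ i # j # ys) A f = Psi s (xs @ j # i # ys) A f
    + Sum_any (%k. Psi s (xs @ j # ys) (A(j := nprod k (A i) (A j))) (expat i (Some j) f $$ k))"
  by (rule Psi_commutator)
next
 fix xs :: "nat list" and i f and A :: "nat => 'v"
 assume "distinct (xs @ [i])" "A i = vac" "f : conf (set (xs @ [i]))"
 thus "Psi s (xs @ [i]) A f = Psi s xs A (expat i None f $$ (- 1))" by (rule Psi_vacuum_last)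
qed

subsection \<open>The coproduct of the definition\<close>

lemma filter_upt_sorted: "I <= {..<n} ==> filter (%i. i : I) [0..<n] = slist I"
proof -
 assume I: "I <= {..<n}"
 have "set (filter (%i. i : I) [0..<n]) = I" using I by auto
 moreover have "sorted (filter (%i. i : I) [0..<n])" "distinct (filter (%i. i : I) [0..<n])"
  by (simp_all add: sorted_wrt_filter)
 ultimately show ?thesis by (metis sorted_list_of_set.idem_if_sorted_distinct)
qed

lemma nths_eq_map: "I <= {..<length A} ==> nths A I = map (%i. A ! i) (slist I)"
proof -
 assume I: "I <= {..<length A}"
 have z: "zip A [0..<length A] = map (%i. (A ! i, i)) [0..<length A]" by (rule nth_equalityI) auto
 have "nths A I = map (%i. A ! i) (filter (%i. i : I) [0..<length A])"
  unfolding nths_def z filter_map by (simp add: comp_def)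
 thus ?thesis by (simp add: filter_upt_sorted[OF I])
qed

lemma sorted_pos:
 assumes "finite I"
 shows "inj_on (%k. slist I ! k) {..<card I}" "(%k. slist I ! k) ` {..<card I} = I"
  "k < card I ==> pos (slist I) (slist I ! k) = k"
proof -
 let ?s = "slist I"
 have len: "length ?s = card I" and d: "distinct ?s" and set: "set ?s = I" using assms by simp_all
 show "inj_on (%k. ?s ! k) {..<card I}" using d len by (auto simp: inj_on_def nth_eq_iff_index_eq)
 show "(%k. ?s ! k) ` {..<card I} = I" 
 proof -
  have "(%k. ?s ! k) ` {..<length ?s} = set ?s" unfolding set_conv_nth by auto
  thus ?thesis unfolding len set .
 qed
 assume k: "k < card I"
 hence m: "?s ! k : set ?s" using len by simp
 thus "pos ?s (?s ! k) = k" using nth_pos[OF m] pos_less[OF m] d k len nth_eq_iff_index_eq by metis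
qed

lemma mode_nths:
 assumes I: "I <= {..<length A}" and p: "p : conf_ring (card I)"
 shows "M (slist I) (%i. A ! i) (rnm (%k. slist I ! k) p) = mode (nths A I) p"
  "rnm (%k. slist I ! k) p : conf I"
  "p : conf_ring_plus (card I) ==> Mp (slist I) (%i. A ! i) (rnm (%k. slist I ! k) p) = mode_plus (nths A I) p"
  "p : conf_ring_plus (card I) ==> rnm (%k. slist I ! k) p : confp I"
proof -
 let ?s = "slist I"
 have fin: "finite I" using I finite_subset by blast
 note sp = sorted_pos[OF fin]
 have p': "p : conf {..<card I}" using p by (simp add: conf_ring_eq)
 have set: "set ?s = I" using fin by simp
 show c: "rnm (%k. ?s ! k) p : conf I" using rename_conf[OF sp(1) p'] sp(2) by simp
 have c': "rnm (%k. ?s ! k) p : conf (set ?s)" using c set by simp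
 have inj2: "inj_on (pos ?s) ((%k. ?s ! k) ` {..<card I})" using pos_inj[of ?s] unfolding sp(2) set .
 have "rnm (pos ?s) (rnm (%k. ?s ! k) p) = rnm (%k. pos ?s (?s ! k)) p"
  by (rule rename_comp[OF sp(1) inj2 p'])
 also have "... = p" by (rule rename_id[OF p']) (simp add: sp(3))
 finally have r: "rnm (pos ?s) (rnm (%k. ?s ! k) p) = p" .
 show "M ?s (%i. A ! i) (rnm (%k. ?s ! k) p) = mode (nths A I) p"
  unfolding M_eq[OF c'] r nths_eq_map[OF I] ..
 assume pp: "p : conf_ring_plus (card I)"
 thus cp: "rnm (%k. ?s ! k) p : confp I" using rename_confp[OF sp(1)] sp(2) by (simp add: conf_ring_plus_eq)
 have cp': "rnm (%k. ?s ! k) p : confp (set ?s)" using cp set by simp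
 show "Mp ?s (%i. A ! i) (rnm (%k. ?s ! k) p) = mode_plus (nths A I) p"
  unfolding Mp_eq[OF cp'] r nths_eq_map[OF I] ..
qed

lemma rename_sorted_surj:
 assumes fin: "finite I" and p: "p : conf I"
 shows "rnm (%k. slist I ! k) (rnm (pos (slist I)) p) = p"
  "rnm (pos (slist I)) p : conf_ring (card I)"
  "p : confp I ==> rnm (pos (slist I)) p : conf_ring_plus (card I)"
proof -
 let ?s = "slist I"
 have set: "set ?s = I" and len: "length ?s = card I" using fin by simp_all
 have p': "p : conf (set ?s)" using p set by simp
 have "inj_on (%k. ?s ! k) (pos ?s ` set ?s)"
  by (rule inj_on_subset[OF sorted_pos(1)[OF fin]]) (use pos_image[of ?s] len in simp)
 from rename_comp[OF pos_inj this p']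
 have "rnm (%k. ?s ! k) (rnm (pos ?s) p) = rnm (%i. ?s ! pos ?s i) p" .
 also have "... = p" by (rule rename_id[OF p']) (rule nth_pos)
 finally show "rnm (%k. ?s ! k) (rnm (pos ?s) p) = p" .
 show "rnm (pos ?s) p : conf_ring (card I)" using rename_pos_in[OF p'] len by simp
 show "p : confp I ==> rnm (pos ?s) p : conf_ring_plus (card I)" using rename_pos_in_plus[of p ?s] len set by simp
qed

text \<open>Every admissible splitting evaluates to the same linear map \<open>Split\<close>, so the
  \<open>THE\<close> in the definition is met; a splitting exists by induction over the
  span.\<close>

lemma split_mode_eq:
 assumes IJ: "I Un J = {..<length A}" "I Int J = {}" and h: "h : mixs I J"
 shows "split_mode A I J h = Split (slist I) (slist J) (%i. A ! i) h"
proof -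
 let ?sI = "slist I" and ?sJ = "slist J"
 have sub: "I <= {..<length A}" "J <= {..<length A}" using IJ by auto
 have fin: "finite I" "finite J" using sub finite_subset by blast+
 have di: "set ?sI Int set ?sJ = {}" using fin IJ by simp
 note S = Split[OF di, where A = "%i. A ! i"]
 have ex: "EX ps. splits I J h ps"
  using h
 proof (induction rule: cv_span_induct_alt)
  case base show ?case by (rule exI[of _ "[]"]) (simp add: splits_def)
 next
  case (step c x y)
  obtain p q where x: "x = p * q" "p : conf I" "q : confp J" using step(1) by (auto simp: prods_def)
  obtain ps where ps: "splits I J y ps" using step(2) by blast
  let ?p = "rnm (pos ?sI) (c *. p)" and ?q = "rnm (pos ?sJ) q"
  have cp: "c *. p : conf I" using x(2) by (rule conf_scaleC)
  have qc: "q : conf J" using x(3) confp_conf by blast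
  have "splits I J (c *. x + y) ((?p, ?q) # ps)"
   using ps rename_sorted_surj(1,2)[OF fin(1) cp] rename_sorted_surj(1,3)[OF fin(2) qc] x(3)
   by (auto simp: splits_def x(1) scaleC_ratfun mult.assoc)
  thus ?case by blast
 qed
 have un: "(SUM (p, q)<-ps. mode (nths A I) p \<otimes> mode_plus (nths A J) q) = Split ?sI ?sJ (%i. A ! i) h" if "splits I J h ps" for ps
 proof -
  have el: "mode (nths A I) p \<otimes> mode_plus (nths A J) q = Split ?sI ?sJ (%i. A ! i) (rnm (%k. ?sI ! k) p * rnm (%k. ?sJ ! k) q)"
   if "(p, q) : set ps" for p q
  proof -
   have pq: "p : conf_ring (card I)" "q : conf_ring_plus (card J)" using that \<open>splits I J h ps\<close> by (auto simp: splits_def)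
   have qc: "q : conf_ring (card J)" using pq(2) confp_conf by (auto simp: conf_ring_eq conf_ring_plus_eq)
   note 1 = mode_nths(1,2)[OF sub(1) pq(1)] and 2 = mode_nths(3,4)[OF sub(2) qc pq(2)]
   have set: "set ?sI = I" "set ?sJ = J" using fin by simp_all
   show ?thesis unfolding S(2)[unfolded set, OF 1(2) 2(2)] 1(1) 2(1) ..
  qed
  have h: "h = (SUM (p, q)<-ps. rnm (%k. ?sI ! k) p * rnm (%k. ?sJ ! k) q)" using that by (simp add: splits_def)
  have "map (%(p, q). mode (nths A I) p \<otimes> mode_plus (nths A J) q) ps
   = map (%x. Split ?sI ?sJ (%i. A ! i) (case x of (p, q) => rnm (%k. ?sI ! k) p * rnm (%k. ?sJ ! k) q)) ps"
   by (rule map_cong[OF refl]) (use el in auto)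
  thus ?thesis unfolding h lin_sum_list[OF S(1)] map_map comp_def by (rule arg_cong)
 qed
 show ?thesis unfolding split_mode_def
 proof (rule the_equality)
  show "EX ps. splits I J h ps & Split ?sI ?sJ (%i. A ! i) h = (SUM (p, q)<-ps. mode (nths A I) p \<otimes> mode_plus (nths A J) q)"
   using ex un by metis
 qed (use un in auto)
qed

lemma positional_Psi:
 assumes f: "f : conf_ring (length A)"
 shows "Psi.positional s A f = (SUM I:Pow {..<length A}.
    let J = {..<length A} - I in split_mode A I J (xsh J f $$ s))"
proof -
 let ?n = "length A"
 have f': "f : conf {..<?n}" "f : conf (set [0..<?n])" using f by (simp_all only: conf_ring_eq set_upt atLeast0LessThan)
 have "Psi.positional s A f = (SUM J:Pow {..<?n}. Split (outl J [0..<?n]) (inl J [0..<?n]) (%i. A ! i) (xsh J f $$ s))"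
  unfolding Psi.positional_def Psi_eq[OF f'(2)] by (simp only: set_upt atLeast0LessThan)
 also have "... = (SUM J:Pow {..<?n}. split_mode A ({..<?n} - J) J (xsh J f $$ s))"
 proof (rule sum.cong[OF refl])
  fix J assume J: "J : Pow {..<?n}"
  have "outl J [0..<?n] = filter (%i. i : {..<?n} - J) [0..<?n]" by (rule filter_cong) auto
  hence 1: "outl J [0..<?n] = slist ({..<?n} - J)" using filter_upt_sorted[of "{..<?n} - J" ?n] by simp
  have 2: "inl J [0..<?n] = slist J" using filter_upt_sorted[of J ?n] J by simp
  show "Split (outl J [0..<?n]) (inl J [0..<?n]) (%i. A ! i) (xsh J f $$ s) = split_mode A ({..<?n} - J) J (xsh J f $$ s)"
   unfolding 1 2 by (rule split_mode_eq[symmetric]) (use J xsh_mixs[OF f'(1), of J s] in auto)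
 qed
 also have "... = (SUM I:Pow {..<?n}. let J = {..<?n} - I in split_mode A I J (xsh J f $$ s))"
  by (rule sum.reindex_bij_witness[of _ "%J. {..<?n} - J" "%J. {..<?n} - J"]) (auto simp: double_diff)
 finally show ?thesis .
qed

text \<open>The universal property gives one linear map per power of w. Their values at a fixed
  element form a Laurent series, because finitely many symbols and subsets are involved and each
  expansion is bounded below. Uniqueness follows from spanning.\<close>

lemma coproduct_spec:
 "clinear (coeff_map (coproduct :: 'v::graded_vertex_algebra mode_algebra => _) s)"
 "f : conf_ring (length A) ==> coproduct (mode A f :: 'v mode_algebra) $$ s = Psi.positional s A f"
proof -
 have "ALL s. EX L. clinear L & (ALL A f. f : conf_ring (length A) --> L (mode A f :: 'v mode_algebra) = Psi.positional s A f)"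
  using Psi.linear_map_exists by metis
 then obtain L where L: "!!s. clinear (L s)" "!!s A f. f : conf_ring (length A) ==> L s (mode A f :: 'v mode_algebra) = Psi.positional s A f"
  by metis
 have bound: "EX N. ALL s<N. L s x = 0" for x
  using mode_span[of x]
 proof (induction rule: cv_span_induct_alt)
  case base show ?case by (simp add: lin_zero[OF L(1)])
 next
  case (step c x y)
  obtain A f where x: "x = mode A f" "f : conf_ring (length A)" using step(1) by blast
  obtain N1 where N1: "!!s. s < N1 ==> L s y = 0" using step(2) by blast
  have f': "f : conf (set [0..<length A])" using x(2) by (simp only: conf_ring_eq set_upt atLeast0LessThan)
  define N2 where "N2 = Min (insert 0 ((%J. fsubdeg (xsh J f)) ` Pow (set [0..<length A])))"
  have "L s x = 0" if "s < N2" for s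
  proof -
   have "xsh J f $$ s = 0" if "J : Pow (set [0..<length A])" for J
   proof (rule fls_eq0_below_subdegree)
    have "N2 <= fsubdeg (xsh J f)" unfolding N2_def by (rule Min_le) (use that in auto)
    thus "s < fsubdeg (xsh J f)" using \<open>s < N2\<close> by simp
   qed
   thus ?thesis unfolding x(1) L(2)[OF x(2)] Psi.positional_def Psi_eq[OF f']
    by (intro sum.neutral ballI) (simp add: lin_zero[OF Split(1)[OF oi_disj]])
  qed
  hence "ALL s<min N1 N2. L s (c *. x + y) = 0" using N1 by (simp add: lin_add[OF L(1)] lin_scale[OF L(1)])
  thus ?case by blast
 qed
 define De where "De x = Abs_fls (%s. L s x)" for x
 have De: "De x $$ s = L s x" for x s
 proof -
  obtain N where "ALL s<N. L s x = 0" using bound by blast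
  thus ?thesis unfolding De_def by (intro nth_Abs_fls_lower_bound[of N]) auto
 qed
 have P: "(ALL s. clinear (coeff_map De s)) &
  (ALL A f s. A ~= [] --> f : conf_ring (length A) -->
   De (mode A f) $$ s = (SUM I:Pow {..<length A}.
    let J = {..<length A} - I in split_mode A I J (xsh J f $$ s)))"
  using L by (simp add: coeff_map_def[abs_def] De positional_Psi)
 have "coproduct = De" unfolding coproduct_def
 proof (rule the_equality, rule P)
  fix De' assume P': "(ALL s. clinear (coeff_map De' s)) &
  (ALL A f s. A ~= [] --> f : conf_ring (length A) -->
   De' (mode A f :: 'v mode_algebra) $$ s = (SUM I:Pow {..<length A}.
    let J = {..<length A} - I in split_mode A I J (xsh J f $$ s)))"
  show "De' = De"
  proof (rule ext, rule fls_eqI)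
   fix x :: "'v mode_algebra" and s
   have "coeff_map De' s x = coeff_map De s x"
   proof (rule lin_eq_on_span[OF _ _ _ mode_span])
    show "clinear (coeff_map De' s)" "clinear (coeff_map De s)" using P P' by blast+
    fix y :: "'v mode_algebra" assume "y : {mode A f | A f. A ~= [] & f : conf_ring (length A)}"
    thus "coeff_map De' s y = coeff_map De s y"
     using conjunct2[OF P] conjunct2[OF P'] unfolding coeff_map_def by auto
   qed
   thus "De' x $$ s = De x $$ s" by (simp add: coeff_map_def)
  qed
 qed
 note eq = this
 show "clinear (coeff_map (coproduct :: 'v mode_algebra => _) s)" unfolding eq using P by blast
 show "f : conf_ring (length A) ==> coproduct (mode A f :: 'v mode_algebra) $$ s = Psi.positional s A f"
  unfolding eq De by (rule L(2))
qed

lemma coproduct_M: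
 assumes d: "distinct ls" and f: "f : conf (set ls)"
 shows "coproduct (M ls A f) $$ s = (SUM J:Pow (set ls). Split (outl J ls) (inl J ls) A (xsh J f $$ s))"
proof -
 have "coproduct (M ls A f) $$ s = Psi.positional s (map A ls) (rnm (pos ls) f)"
  unfolding M_eq[OF f] by (rule coproduct_spec(2)) (use rename_pos_in[OF f] in simp)
 also have "... = Psi s (map (pos ls) ls) (%i. map A ls ! i) (rnm (pos ls) f)"
  unfolding Psi.positional_def map_pos[OF d] by simp
 also have "... = Psi s ls (%i. map A ls ! pos ls i) f" by (rule Psi.rename[OF d pos_inj f])
 also have "... = Psi s ls A f" by (rule Psi.cong[OF _ f]) (simp add: pos_less nth_pos)
 finally show ?thesis by (simp only: Psi_eq[OF f])
qed

section \<open>The action of modes on the vertex algebra\<close>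

subsection \<open>Finite double sums\<close>

lemma Sum_any_reindex:
 assumes "!!a. g a ~= 0 ==> i (j a) = a & h (j a) = g a" "!!b. h b ~= 0 ==> j (i b) = b & g (i b) = h b"
 shows "Sum_any g = Sum_any h"
 unfolding Sum_any.expand_set by (rule sum.reindex_bij_witness[of _ i j]) (use assms in auto)

lemma Sum_any_pair:
 assumes "finite {x. g (fst x) (snd x) ~= 0}"
 shows "Sum_any (%a. Sum_any (g a)) = Sum_any (%(a, b). g a b)"
proof (rule Sum_any.cartesian_product)
 let ?S = "{x. g (fst x) (snd x) ~= 0}"
 show "finite (fst ` ?S \<times> snd ` ?S)" using assms by simp
 show "{a. EX b. g a b ~= 0} \<times> {b. EX a. g a b ~= 0} <= fst ` ?S \<times> snd ` ?S"
  by (force simp: image_iff)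
qed

lemma Sum_any_pair_swap:
 assumes "finite {x. g (fst x) (snd x) ~= 0}"
 shows "Sum_any (%b. Sum_any (%a. g a b)) = Sum_any (%(a, b). g a b)"
proof -
 have "{x. g (snd x) (fst x) ~= 0} = prod.swap ` {x. g (fst x) (snd x) ~= 0}" by (force simp: image_iff)
 hence "Sum_any (%b. Sum_any (%a. g a b)) = Sum_any (%(b, a). g a b)"
  using assms by (intro Sum_any_pair) simp
 also have "... = Sum_any (%(a, b). g a b)"
  by (rule Sum_any_reindex[of _ prod.swap prod.swap]) auto
 finally show ?thesis .
qed

lemma Sum_any_diff:
 fixes g h :: "'a => 'b::ab_group_add"
 assumes "finite {x. g x ~= 0}" "finite {x. h x ~= 0}"
 shows "Sum_any (%x. g x - h x) = Sum_any g - Sum_any h"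
proof -
 have "finite {x. g x - h x ~= 0}"
  by (rule finite_subset[of _ "{x. g x ~= 0} Un {x. h x ~= 0}"]) (use assms in auto)
 from Sum_any.distrib[OF this assms(2)] show ?thesis by (simp add: algebra_simps)
qed

text \<open>The support of an iterated expansion: bounded below in m, and in n by a bound that
  depends on m. The mirror condition \<open>upb\<close> holds for a product of two fields applied to
  a vector, and the two together make double residues finite.\<close>

definition lowb :: "(int => int => 'a::zero) => bool"
 where "lowb E \<longleftrightarrow> (EX m0. ALL m<m0. ALL n. E n m = 0) & (ALL m. EX n0. ALL n<n0. E n m = 0)"

definition upb :: "(int => int => 'a::zero) => bool"
 where "upb X \<longleftrightarrow> (EX K. ALL m>=K. ALL n. X n m = 0) & (ALL m. EX N. ALL n>=N. X n m = 0)"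

lemma upbI: "(!!m n. m >= K ==> X n m = 0) ==> (!!m n. n >= N m ==> X n m = 0) ==> upb X"
 and lowbI: "(!!m n. m < K ==> E n m = 0) ==> (!!m n. n < N m ==> E n m = 0) ==> lowb E"
 unfolding upb_def lowb_def by blast+

lemma lowb_upb_finite:
 assumes "lowb E" "upb X"
 shows "finite {x. E (fst x) (snd x) ~= 0 & X (fst x) (snd x) ~= 0}"
proof -
 obtain m0 n0 where E: "!!m n. m < m0 ==> E n m = 0" "!!m n. n < n0 m ==> E n m = 0"
  using assms(1) unfolding lowb_def by metis
 obtain K N where X: "!!m n. m >= K ==> X n m = 0" "!!m n. n >= N m ==> X n m = 0"
  using assms(2) unfolding upb_def by metis
 have "{x. E (fst x) (snd x) ~= 0 & X (fst x) (snd x) ~= 0} <= prod.swap ` (SIGMA m:{m0..K}. {n0 m..N m})"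
 proof
  fix x assume "x : {x. E (fst x) (snd x) ~= 0 & X (fst x) (snd x) ~= 0}"
  hence nz: "E (fst x) (snd x) ~= 0" "X (fst x) (snd x) ~= 0" by simp_all
  have "~ snd x < m0" "~ fst x < n0 (snd x)" "~ K <= snd x" "~ N (snd x) <= fst x"
   using nz E X by metis+
  hence "prod.swap x : (SIGMA m:{m0..K}. {n0 m..N m})" by (cases x) simp
  thus "x : prod.swap ` (SIGMA m:{m0..K}. {n0 m..N m})" by (metis image_eqI swap_swap)
 qed
 thus ?thesis by (rule finite_subset) auto
qed

lemma upb_shift: "upb X ==> upb (%n m. X (n + i) (m + j))"
proof -
 assume "upb X"
 then obtain K N where X: "!!m n. m >= K ==> X n m = 0" "!!m n. n >= N m ==> X n m = 0"
  unfolding upb_def by metis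
 show ?thesis by (rule upbI[of "K - j" _ "%m. N (m + j) - i"]) (simp_all add: X)
qed

lemma upb_diff: "upb X ==> upb Y ==> upb (%n m. X n m - Y n m :: 'a::ab_group_add)"
proof -
 assume "upb X" "upb Y"
 then obtain K N K' N' where X: "!!m n. m >= K ==> X n m = 0" "!!m n. n >= N m ==> X n m = 0"
  "!!m n. m >= K' ==> Y n m = 0" "!!m n. n >= N' m ==> Y n m = 0"
  unfolding upb_def by metis
 show ?thesis by (rule upbI[of "max K K'" _ "%m. max (N m) (N' m)"]) (simp_all add: X)
qed

lemma upb_d2: "upb X ==> upb (d2 X)"
 using upb_diff[OF upb_shift[of X 1 0] upb_shift[of X 0 1]] by (simp add: d2_def[abs_def])

lemma upb_bounded_right: "upb X ==> bounded_right X"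
 unfolding upb_def bounded_right_def by blast

lemma upb_xdf: assumes "upb X" shows "upb (expand_diff X r)"
proof -
 obtain K N where X: "!!m n. m >= K ==> X n m = 0" "!!m n. n >= N m ==> X n m = 0"
  using assms unfolding upb_def by metis
 have "EX B. ALL n>=B. expand_diff X r n m = 0" for m
 proof -
  define T where "T = nat (K - m)"
  define B where "B = Max (insert 0 ((%t. N (m + int t) - r + int t) ` {..<T}))"
  have "X (n + r - int t) (m + int t) = 0" if "n >= B" "t < T" for n t
  proof (rule X(2))
   have "N (m + int t) - r + int t <= B" unfolding B_def by (rule Max_ge) (use that in auto)
   thus "N (m + int t) <= n + r - int t" using that by simp
  qed
  hence "ALL n>=B. expand_diff X r n m = 0"
   using xdf_eq[of K X m T r, OF X(1)] by (simp add: T_def)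
  thus ?thesis by blast
 qed
 moreover have "ALL m>=K. ALL n. expand_diff X r n m = 0"
  using xdf_eq[of K X _ 0 r, OF X(1)] by simp
 ultimately show ?thesis unfolding upb_def by blast
qed

lemma d2_xdf:
 assumes "upb X"
 shows "(d2 ^^ r) (expand_diff X (- int r)) = X"
proof -
 have "d2 (expand_diff X s) = expand_diff X (s + 1)" for s
  by (intro ext) (simp add: d2_def xdf_step[OF upb_bounded_right[OF assms]])
 hence "(d2 ^^ r) (expand_diff X s) = expand_diff X (s + int r)" for s
  by (induction r arbitrary: s) (simp_all add: funpow_swap1 add_ac)
 from this[of "- int r"] show ?thesis by (simp add: fun_eq_iff xdf_0)
qed

subsection \<open>Double expansions\<close>

lemma expat_mult: "f : conf S ==> g : conf S ==> p ~= Some i ==> expat i p (f * g) = expat i p f * expat i p g"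
 unfolding expat_def by (rule lau_hom_conf(2)[OF adm_exp])

text \<open>Expansion in z_j, and then of the coefficients in z_i: this is the expansion for z_i
  large compared with z_j, in powers \<open>z_i^n z_j^m\<close>.\<close>

definition E1 :: "nat => nat => ratfun => int => int => ratfun"
 where "E1 i j f n m = expat i None (expat j None f $$ m) $$ n"

lemma E1_lowb: "lowb (E1 i j f)"
 by (rule lowbI[of "fsubdeg (expat j None f)" _ "%m. fsubdeg (expat i None (expat j None f $$ m))"]) (simp_all add: E1_def)

context
 fixes S :: "nat set" and i j :: nat
 assumes ij: "i ~= j" "i ~: S" "j ~: S"
begin

lemma expat_j_conf: "f : conf (insert i (insert j S)) ==> expat j None f $$ m : conf (insert i S)"
 using expat_conf[of f "insert i (insert j S)" None j j m] ij by (simp add: insert_Diff_if)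

lemma expat_i_conf: "f : conf (insert i S) ==> expat i None f $$ m : conf S"
 using expat_conf[of f "insert i S" None i i m] ij by simp

lemma E1_conf: "f : conf (insert i (insert j S)) ==> E1 i j f n m : conf S"
 unfolding E1_def by (intro expat_i_conf expat_j_conf)

lemma E1_linear:
 assumes "f : conf (insert i (insert j S))" "g : conf (insert i (insert j S))"
 shows "E1 i j (c *. f + g) n m = c *. E1 i j f n m + E1 i j g n m"
 unfolding E1_def expat_linear[OF assms, of None j, simplified]
 by (rule expat_linear[OF expat_j_conf expat_j_conf]) (use assms in auto)

lemma E1_var_i:
 assumes f: "f : conf (insert i (insert j S))"
 shows "E1 i j (var i * f) n m = E1 i j f (n - 1) m"
proof -
 have "expat j None (var i * f) $$ m = var i * (expat j None f $$ m)"
  using expat_times_const(2)[OF f conf_var[of i "{i}"], of j None m] ij by simp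
 moreover have "expat i None (var i * g) = fls_X * expat i None g" if "g : conf (insert i S)" for g
  using expat_mult[OF conf_var[of i "insert i S"] that, of None i] by (simp add: expat_def exp_pt_def)
 ultimately show ?thesis by (simp add: E1_def expat_j_conf[OF f] fls_X_times_conv_shift)
qed

lemma E1_var_j:
 assumes f: "f : conf (insert i (insert j S))"
 shows "E1 i j (var j * f) n m = E1 i j f n (m - 1)"
proof -
 have "expat j None (var j * f) = fls_X * expat j None f"
  using expat_mult[OF conf_var[of j "insert i (insert j S)"] f, of None j] by (simp add: expat_def exp_pt_def)
 thus ?thesis by (simp add: E1_def fls_X_times_conv_shift)
qed

lemma E1_u:
 assumes f: "f : conf (insert i (insert j S))"
 shows "E1 i j ((var i - var j) * f) n m = E1 i j f (n - 1) m - E1 i j f n (m - 1)"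
proof -
 have m: "var i * f : conf (insert i (insert j S))" "var j * f : conf (insert i (insert j S))"
  by (auto intro!: conf_mult conf_var f)
 have "(var i - var j) * f = (- 1) *. (var j * f) + var i * f"
  by (simp add: scaleC_ratfun ratC_uminus algebra_simps)
 thus ?thesis
  using E1_linear[OF m(2,1), of "- 1" n m] by (simp add: E1_var_i[OF f] E1_var_j[OF f] scaleC_ratfun ratC_uminus)
qed

lemma E1_prod:
 assumes p: "p : conf (insert i S)" and q: "q : conf (insert j S)"
 shows "E1 i j (p * q) n m = expat i None p $$ n * expat j None q $$ m"
proof -
 have qm: "expat j None q $$ m : conf S" using expat_conf[OF q, of None j j m] ij by simp
 have "expat j None (p * q) $$ m = p * expat j None q $$ m"
  by (rule expat_times_const(2)[OF q p]) (use ij in auto)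
 thus ?thesis using expat_times_const(1)[OF p qm, of i None n] ij by (simp add: E1_def)
qed

end

lemma pole_cancel:
 assumes ij: "i ~= j" and p: "p : conf (insert i S)" and q: "q : conf (insert j S)"
 shows "inverse (var i - var j) ^ r * (p * q) : conf (insert i (insert j S))"
  "(var i - var j) ^ r * (inverse (var i - var j) ^ r * (p * q)) = p * q"
proof -
 have u: "inverse (var i - var j) : conf (insert i (insert j S))"
  unfolding conf_def by (rule cring_invdiff) (use ij in "auto simp: offdiag_def")
 have "inverse (var i - var j) ^ r : conf (insert i (insert j S))" by (induction r) (auto intro: conf_mult u)
 thus "inverse (var i - var j) ^ r * (p * q) : conf (insert i (insert j S))"
  using p q conf_mono[of "insert i S" "insert i (insert j S)"] conf_mono[of "insert j S" "insert i (insert j S)"] by (intro conf_mult) auto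
 have "var i - var j ~= 0" using ij by simp
 note u1 = right_inverse[OF this]
 show "(var i - var j) ^ r * (inverse (var i - var j) ^ r * (p * q)) = p * q"
  by (simp only: mult.assoc[symmetric] power_mult_distrib[symmetric] u1 power_one mult_1_left)
qed

subsection \<open>Pairings\<close>

text \<open>\<open>G f v\<close> stands for the modes that remain to act after two adjacent ones
  have acted, with coefficient function f. The commutator uses its linearity in both
  arguments.\<close>

locale pairing =
 fixes S :: "nat set" and G :: "ratfun => 'v::graded_vertex_algebra => 'v"
 assumes G_left: "f : conf S ==> g : conf S ==> G (c *. f + g) v = c *. G f v + G g v"
  and G_right: "f : conf S ==> G f (c *. v + w) = c *. G f v + G f w"
begin

lemma G_0 [simp]: "G 0 v = 0"
 using G_left[of 0 0 "- 1" v] by (simp add: scaleC_one)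

lemma G_add: "f : conf S ==> g : conf S ==> G (f + g) v = G f v + G g v"
 using G_left[of f g 1 v] by (simp add: scaleC_one)

lemma G_scale: "f : conf S ==> G (c *. f) v = c *. G f v"
 using G_left[of f 0 c v] by simp

lemma G_diff: "f : conf S ==> g : conf S ==> G (f - g) v = G f v - G g v"
 using G_left[of g f "- 1" v] by (simp add: scaleC_one)

lemma G_sum: "(!!x. x : A ==> f x : conf S) ==> G (sum f A) v = (SUM x:A. G (f x) v)"
 by (induction A rule: infinite_finite_induct) (simp_all add: G_add conf_sum)

lemma clinear_G: "f : conf S ==> clinear (G f)"
 using G_right[of f 1] G_right[of f _ _ 0] G_right[of f "- 1" 0 0] by (intro clinearI) (simp_all add: scaleC_one)

definition dsum :: "(int => int => ratfun) => (int => int => 'v) => 'v"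
 where "dsum E X = Sum_any (%(n, m). G (E n m) (X n m))"

lemma dsum_finite:
 assumes "lowb E" "upb X" "!!n m. E n m : conf S"
 shows "finite {x. G (E (fst x) (snd x)) (X (fst x) (snd x)) ~= 0}"
 by (rule finite_subset[OF _ lowb_upb_finite[OF assms(1,2)]]) (use lin_zero[OF clinear_G[OF assms(3)]] in force)

lemma dsum_iterated:
 assumes "lowb E" "upb X" "!!n m. E n m : conf S"
 shows "Sum_any (%m. Sum_any (%n. G (E n m) (X n m))) = dsum E X"
 unfolding dsum_def by (rule Sum_any_pair_swap[OF dsum_finite[OF assms]])

text \<open>A shift of the summation indices moves the factor z_i - z_j from the function to the
  fields, where it becomes x - y.\<close>

lemma dsum_d2:
 assumes E: "lowb E" "!!n m. E n m : conf S" and X: "upb X"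
 shows "dsum (%n m. E (n - 1) m - E n (m - 1)) X = dsum E (d2 X)"
proof -
 have sh: "finite {x. (%(n, m). G (E n m) (X (n + a) (m + b))) x ~= 0}" for a b
  using dsum_finite[OF E(1) upb_shift[OF X, of a b] E(2)] by (simp add: case_prod_beta)
 have re: "Sum_any (%(n, m). G (E (n - a) (m - b)) (X n m)) = Sum_any (%(n, m). G (E n m) (X (n + a) (m + b)))" for a b
  by (rule Sum_any_reindex[of _ "%(n, m). (n + a, m + b)" "%(n, m). (n - a, m - b)"]) auto
 have sh': "finite {x. (%(n, m). G (E (n - a) (m - b)) (X n m)) x ~= 0}" for a b
 proof -
  have "{x. (%(n, m). G (E (n - a) (m - b)) (X n m)) x ~= 0} <= (%(n, m). (n + a, m + b)) ` {x. (%(n, m). G (E n m) (X (n + a) (m + b))) x ~= 0}"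
  proof (rule subsetI)
   fix x assume "x : {x. (%(n, m). G (E (n - a) (m - b)) (X n m)) x ~= 0}"
   thus "x : (%(n, m). (n + a, m + b)) ` {x. (%(n, m). G (E n m) (X (n + a) (m + b))) x ~= 0}"
    by (intro image_eqI[of _ _ "(fst x - a, snd x - b)"]) (auto split: prod.splits)
  qed
  thus ?thesis by (rule finite_subset) (use sh in simp)
 qed
 have "dsum (%n m. E (n - 1) m - E n (m - 1)) X
  = Sum_any (%x. (%(n, m). G (E (n - 1) (m - 0)) (X n m)) x - (%(n, m). G (E (n - 0) (m - 1)) (X n m)) x)"
  unfolding dsum_def by (rule Sum_any.cong) (simp add: G_diff E(2) split: prod.split)
 also have "... = Sum_any (%x. (%(n, m). G (E n m) (X (n + 1) (m + 0))) x - (%(n, m). G (E n m) (X (n + 0) (m + 1))) x)"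
  unfolding Sum_any_diff[OF sh' sh'] Sum_any_diff[OF sh sh] re ..
 also have "... = dsum E (d2 X)"
  unfolding dsum_def
  by (rule Sum_any.cong) (simp add: d2_def lin_diff[OF clinear_G[OF E(2)]] split: prod.split)
 finally show ?thesis .
qed

lemma dsum_E1_power:
 assumes ij: "i ~= j" "i ~: S" "j ~: S" and f: "f : conf (insert i (insert j S))" and X: "upb X"
 shows "dsum (E1 i j ((var i - var j) ^ r * f)) X = dsum (E1 i j f) ((d2 ^^ r) X)"
 using X
proof (induction r arbitrary: X)
 case (Suc r)
 have m: "(var i - var j) ^ k * f : conf (insert i (insert j S))" for k
  by (induction k) (auto simp: mult.assoc intro!: conf_mult conf_diff conf_var f)
 have "dsum (E1 i j ((var i - var j) ^ Suc r * f)) X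
  = dsum (%n k. E1 i j ((var i - var j) ^ r * f) (n - 1) k - E1 i j ((var i - var j) ^ r * f) n (k - 1)) X"
  unfolding power_Suc mult.assoc by (intro arg_cong2[of _ _ _ _ dsum] ext refl E1_u[OF ij m])
 also have "... = dsum (E1 i j f) ((d2 ^^ r) (d2 X))"
  unfolding dsum_d2[OF E1_lowb E1_conf[OF ij m] Suc.prems] by (rule Suc.IH[OF upb_d2[OF Suc.prems]])
 finally show ?case by (simp add: funpow_swap1)
qed simp

text \<open>The pole is moved onto the product of fields: \<open>X\<close> is (x - y)^r times its
  own product with (x - y)^(-r), and those r factors, moved back, cancel the pole of the
  function.\<close>

lemma dsum_E1_pole:
 assumes ij: "i ~= j" "i ~: S" "j ~: S" and p: "p : conf (insert i S)" and q: "q : conf (insert j S)" and X: "upb X"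
 shows "dsum (E1 i j (inverse (var i - var j) ^ r * (p * q))) X
  = dsum (%n m. expat i None p $$ n * expat j None q $$ m) (expand_diff X (- int r))"
proof -
 have e: "E1 i j (p * q) = (%n m. expat i None p $$ n * expat j None q $$ m)"
  by (intro ext E1_prod[OF ij p q])
 show ?thesis
  using dsum_E1_power[OF ij pole_cancel(1)[OF ij(1) p q] upb_xdf[OF X], of r r "- int r"] unfolding d2_xdf[OF X] pole_cancel(2)[OF ij(1) p q] e by (rule sym)
qed

lemma dsum_linear:
 assumes "lowb E" "lowb E'" "!!n m. E n m : conf S" "!!n m. E' n m : conf S" "upb X"
 shows "dsum (%n m. c *. E n m + E' n m) X = c *. dsum E X + dsum E' X"
proof -
 note f = dsum_finite[OF assms(1,5,3)] and f' = dsum_finite[OF assms(2,5,4)]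
 have f1: "finite {x. c *. (%(n, m). G (E n m) (X n m)) x ~= 0}"
  by (rule finite_subset[OF _ f]) (auto split: prod.splits)
 have "dsum (%n m. c *. E n m + E' n m) X
  = Sum_any (%x. c *. (%(n, m). G (E n m) (X n m)) x + (%(n, m). G (E' n m) (X n m)) x)"
  unfolding dsum_def by (rule Sum_any.cong) (simp add: G_left assms split: prod.split)
 also have "... = Sum_any (%x. c *. (%(n, m). G (E n m) (X n m)) x) + dsum E' X"
  unfolding dsum_def by (rule Sum_any.distrib[OF f1]) (use f' in "simp add: case_prod_beta")
 also have "Sum_any (%x. c *. (%(n, m). G (E n m) (X n m)) x) = c *. dsum E X"
  unfolding dsum_def by (rule lin_Sum_any[OF lin_scaled[OF lin_id(2)], symmetric]) (use f in "simp add: case_prod_beta")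
 finally show ?thesis .
qed

end

subsection \<open>Expansion at a diagonal, then at zero\<close>

lemma expat_pd_funpow:
 assumes "p : conf S"
 shows "expat i None ((pdv i ^^ t) p) $$ l = (fact t * ((of_int (int t + l) :: complex) gchoose t)) *. expat i None p $$ (int t + l)"
proof (induction t arbitrary: l)
 case 0 show ?case by (simp add: scaleC_one)
next
 case (Suc t)
 have c: "(pdv i ^^ t) p : conf UNIV"
  using conf_CU[OF assms] unfolding conf_def by (rule pd_funpow_cring)
 have "expat i None ((pdv i ^^ Suc t) p) $$ l = of_int (l + 1) * expat i None ((pdv i ^^ t) p) $$ (l + 1)"
  using arg_cong[OF expat_deriv[OF c, of None i, simplified], of "%F. F $$ l"] by simp
 also have "... = (of_int (l + 1) * (fact t * ((of_int (int t + (l + 1)) :: complex) gchoose t))) *. expat i None p $$ (int t + (l + 1))"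
  unfolding Suc.IH by (simp add: scaleC_ratfun ratC_mult ratC_add ratC_of_int mult.assoc)
 also have "of_int (l + 1) * (fact t * ((of_int (int t + (l + 1)) :: complex) gchoose t)) = fact (Suc t) * ((of_int (int (Suc t) + l) :: complex) gchoose Suc t)"
  unfolding gbinomial_mult_fact by (simp add: algebra_simps)
 finally show ?case by (simp add: add_ac)
qed

text \<open>The coefficient of \<open>(z_i - z_j)^k z_j^l\<close>, from the expansion at the
  diagonal followed by that at 0.\<close>

definition E3 :: "nat => nat => ratfun => int => int => ratfun"
 where "E3 i j f l k = expat j None (expat i (Some j) f $$ k) $$ l"

lemma E3_lowb: "lowb (E3 i j f)"
 by (rule lowbI[of "fsubdeg (expat i (Some j) f)" _ "%k. fsubdeg (expat j None (expat i (Some j) f $$ k))"]) (simp_all add: E3_def)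

context
 fixes S :: "nat set" and i j :: nat
 assumes ij: "i ~= j" "i ~: S" "j ~: S"
begin

lemma expat_ij_conf: "f : conf (insert i (insert j S)) ==> expat i (Some j) f $$ k : conf (insert j S)"
 using expat_conf[of f "insert i (insert j S)" "Some j" j i k] ij by (simp add: insert_Diff_if)

lemma E3_conf: "f : conf (insert i (insert j S)) ==> E3 i j f l k : conf S"
 unfolding E3_def using expat_conf[OF expat_ij_conf, of f None j j k l] ij by simp

lemma E3_linear:
 assumes "f : conf (insert i (insert j S))" "g : conf (insert i (insert j S))"
 shows "E3 i j (c *. f + g) n m = c *. E3 i j f n m + E3 i j g n m"
proof -
 have s: "Some j ~= Some i" using ij by simp
 show ?thesis unfolding E3_def expat_linear[OF assms s]
  by (rule expat_linear[OF expat_ij_conf expat_ij_conf]) (use assms in auto)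
qed

lemma E3_pole:
 assumes f: "f : conf (insert i (insert j S))"
 shows "E3 i j ((var i - var j) ^ r * f) l (k + int r) = E3 i j f l k"
proof (induction r)
 case (Suc r)
 have m: "(var i - var j) ^ r * f : conf (insert i (insert j S))" for r
  by (induction r) (auto simp: mult.assoc intro!: conf_mult conf_diff conf_var f)
 have u: "var i - var j : conf (insert i (insert j S))" by (intro conf_diff conf_var) auto
 have s: "Some j ~= Some i" using ij by simp
 have "expat i (Some j) ((var i - var j) ^ Suc r * f) = fls_X * expat i (Some j) ((var i - var j) ^ r * f)"
  unfolding power_Suc mult.assoc expat_mult[OF u m s] using expat_sub_self[OF s] by simp
 hence "E3 i j ((var i - var j) ^ Suc r * f) l (k + int (Suc r)) = E3 i j ((var i - var j) ^ r * f) l (k + int r)"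
  by (simp add: E3_def fls_X_times_conv_shift)
 thus ?case using Suc by simp
qed simp

text \<open>Heuristically p is a sum of terms \<open>P_n z_i^n\<close>, and with z_i = z_j + t the
  powers expand binomially. The proof combines Taylor's formula at the diagonal with a renaming of
  z_i to z_j.\<close>

lemma expat_taylor_conf:
 assumes p: "p : conf (insert i S)"
 shows "k < 0 ==> expat i (Some j) p $$ k = 0"
  "expat j None (expat i (Some j) p $$ int t) $$ l = ((of_int (int t + l) :: complex) gchoose t) *. expat i None p $$ (int t + l)"
proof -
 let ?pqi = "id(i := j)" and ?g = "(pdv i ^^ t) p"
 have av: "avoids i (Some j) (insert i S) (offdiag (insert i S))" using ij by (auto simp: avoids_def offdiag_def)
 show "k < 0 ==> expat i (Some j) p $$ k = 0"
  by (rule expat_regular(1)[OF cwf_conf(1) p[unfolded conf_def] av])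
 have g: "?g : conf (insert i S)" using p unfolding conf_def by (rule pd_funpow_cring)
 have "sub_pt i (Some j) = (%l. var (?pqi l))" by (auto simp: sub_pt_def fun_eq_iff)
 hence "sub i (Some j) = rnm ?pqi" by (simp only: sub_def rename_vars_def)
 hence "expat i (Some j) p $$ int t = (1 / fact t) *. rnm ?pqi ?g"
  unfolding expat_taylor[OF cwf_conf(1) p[unfolded conf_def] av] scaleC_ratfun by simp
 moreover have inj: "inj_on ?pqi (insert i S)" using ij by (auto simp: inj_on_def)
 have rg: "rnm ?pqi ?g : conf (?pqi ` insert i S)" by (rule rename_conf[OF inj g])
 have "expat j None ((1 / fact t) *. rnm ?pqi ?g) $$ l = (1 / fact t) *. expat j None (rnm ?pqi ?g) $$ l"
  using expat_linear[OF rg conf_closed(2), of None j "1 / fact t" l] by simp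
 moreover have "expat j None (rnm ?pqi ?g) $$ l = rnm ?pqi (expat i None ?g $$ l)"
  using expat_rename[OF inj g, of i None undefined l] by simp
 moreover have "... = expat i None ?g $$ l"
  by (rule rename_id[of _ S]) (use expat_conf[OF g, of None undefined i l] ij in auto)
 ultimately show "expat j None (expat i (Some j) p $$ int t) $$ l = ((of_int (int t + l) :: complex) gchoose t) *. expat i None p $$ (int t + l)"
  by (simp add: expat_pd_funpow[OF p])
qed

lemma E3_prod:
 assumes p: "p : conf (insert i S)" and q: "q : conf (insert j S)"
 shows "E3 i j (p * q) l k = (if k < 0 then 0 else
  (SUM n = fsubdeg (expat i None p) - k..l - fsubdeg (expat j None q).
   ((of_int (k + n) :: complex) gchoose nat k) *. (expat i None p $$ (k + n) * expat j None q $$ (l - n))))"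
proof -
 have p': "p : conf (insert i (insert j S))" using p conf_mono[of "insert i S" "insert i (insert j S)"] by blast
 have e: "expat i (Some j) (p * q) $$ k = expat i (Some j) p $$ k * q"
  by (rule expat_times_const(1)[OF p q]) (use ij in auto)
 show ?thesis
 proof (cases "k < 0")
  case True thus ?thesis unfolding E3_def e expat_taylor_conf(1)[OF p True] by simp
 next
  case False
  hence k: "k = int (nat k)" by simp
  have co: "expat j None (expat i (Some j) p $$ k) $$ n = ((of_int (k + n) :: complex) gchoose nat k) *. expat i None p $$ (k + n)" for n
   using expat_taylor_conf(2)[OF p, of "nat k" n] k by simp
  have "E3 i j (p * q) l k = (expat j None (expat i (Some j) p $$ k) * expat j None q) $$ l"
   unfolding E3_def e expat_mult[OF expat_ij_conf[OF p'] q option.distinct(1)] ..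
  also have "... = (SUM n = fsubdeg (expat i None p) - k..l - fsubdeg (expat j None q).
    expat j None (expat i (Some j) p $$ k) $$ n * expat j None q $$ (l - n))"
   by (rule fls_mult_nth) (simp_all add: co)
  finally show ?thesis using False by (simp add: co scaleC_ratfun mult.assoc)
 qed
qed

end

subsection \<open>The commutator of two adjacent modes\<close>

lemma upb_nprod_nested: "upb (%n m. nprod n a (nprod m b v))" and upb_nprod_iterate: "upb (%l k. nprod l (nprod (k + c) a b) v)"
proof -
 obtain K where K: "!!m. m >= K ==> nprod m b v = 0" using truncation by blast
 have "ALL m. EX N. ALL n>=N. nprod n a (nprod m b v) = 0" using truncation by blast
 then obtain N where N: "!!m n. n >= N m ==> nprod n a (nprod m b v) = 0" by metis
 show "upb (%n m. nprod n a (nprod m b v))" by (rule upbI[of K _ N]) (simp_all add: K N)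
 obtain K' where K': "!!m. m >= K' ==> nprod m a b = 0" using truncation by blast
 have "ALL m. EX N. ALL n>=N. nprod n (nprod (m + c) a b) v = 0" using truncation by blast
 then obtain N' where N': "!!m n. n >= N' m ==> nprod n (nprod (m + c) a b) v = 0" by metis
 show "upb (%l k. nprod l (nprod (k + c) a b) v)" by (rule upbI[of "K' - c" _ N']) (simp_all add: K' N')
qed

lemma ratC_power: "ratC (c ^ n) = ratC c ^ n"
 by (induction n) (simp_all add: ratC_mult)

context pairing begin

text \<open>The diagonal contribution of p(z_i) q(z_j) (z_i - z_j)^(-r) pairs the separate
  expansions of p and q with the right-hand side of the Borcherds identity for exponent -r.\<close>

lemma dsum_E3_prod:
 assumes ij: "i ~= j" "i ~: S" "j ~: S" and p: "p : conf (insert i S)" and q: "q : conf (insert j S)"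
 shows "dsum (E3 i j (inverse (var i - var j) ^ r * (p * q))) (%l k. nprod l (nprod k a b) v)
  = dsum (%n m. expat i None p $$ n * expat j None q $$ m) (%n m. iterate_sum a b (- int r) n m v)"
proof -
 let ?f = "inverse (var i - var j) ^ r * (p * q)"
 define P where "P n = expat i None p $$ n" for n
 define Q where "Q m = expat j None q $$ m" for m
 define p0 where "p0 = fsubdeg (expat i None p)"
 define q0 where "q0 = fsubdeg (expat j None q)"
 have P0: "n < p0 ==> P n = 0" and Q0: "n < q0 ==> Q n = 0" for n by (simp_all add: P_def Q_def p0_def q0_def)
 have Pc: "P n : conf S" for n unfolding P_def using expat_conf[OF p, of None i i n] ij by simp
 have Qc: "Q n : conf S" for n unfolding Q_def using expat_conf[OF q, of None j j n] ij by simp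
 have PQ: "P n * Q m : conf S" for n m by (rule conf_mult[OF Pc Qc])
 obtain T where T: "!!t. t >= T ==> nprod t a b = 0" using truncation by blast
 define T' where "T' = nat (T + int r)"
 have T': "nprod (- int r + int t) a b = 0" if "t >= T'" for t by (rule T) (use that in "simp add: T'_def")
 \<comment> \<open>The common summand: n and m are the powers of z_i and z_j, and t is the summation
   index of \<open>iterate_sum\<close>.\<close>
 define h where "h n m t = ((of_int n :: complex) gchoose t) *. G (P n * Q m) (nprod (n + m - int t) (nprod (- int r + int t) a b) v)" for n m t
 have "ALL t. EX N. ALL n>=N. nprod n (nprod (- int r + int t) a b) v = 0" using truncation by blast
 then obtain N where N: "!!t n. n >= N t ==> nprod n (nprod (- int r + int t) a b) v = 0" by metis
 define B where "B = Max (insert 0 ((%t. N t + int t) ` {..<T'}))"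
 have B: "N t + int t <= B" if "t < T'" for t unfolding B_def by (rule Max_ge) (use that in auto)
 have Gz: "G (P n * Q m) 0 = 0" for n m by (rule lin_zero[OF clinear_G[OF PQ]])
 have h0: "h n m t = 0" if out: "t >= T' | n < p0 | m < q0 | n + m >= B" for n m t
 proof (cases "t >= T'")
  case True thus ?thesis using T'[OF True] by (simp add: h_def Gz)
 next
  case False
  then consider "n < p0" | "m < q0" | "n + m - int t >= N t" using out B[of t] by linarith
  thus ?thesis by cases (use N[of t "n + m - int t"] in "simp_all add: h_def P0 Q0 Gz")
 qed
 have hfin: "finite {x. h (fst (fst x)) (snd (fst x)) (snd x) ~= 0}"
 proof (rule finite_subset)
  show "{x. h (fst (fst x)) (snd (fst x)) (snd x) ~= 0} <= ({p0..B - q0} \<times> {q0..B - p0}) \<times> {..<T'}"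
  proof
   fix x assume "x : {x. h (fst (fst x)) (snd (fst x)) (snd x) ~= 0}"
   hence "~ (snd x >= T' | fst (fst x) < p0 | snd (fst x) < q0 | fst (fst x) + snd (fst x) >= B)" using h0 by blast
   thus "x : ({p0..B - q0} \<times> {q0..B - p0}) \<times> {..<T'}" by (cases x) auto
  qed
 qed simp
 define g where "g x n = (if snd x + int r < 0 then 0 else h (snd x + int r + n) (fst x - n) (nat (snd x + int r)))" for x :: "int \<times> int" and n
 \<comment> \<open>The change of indices between the two orders of summation: t = k + r, with power
   k + r + n of z_i and power l - n of z_j.\<close>
 define to where "to = (%((l, k), n). ((k + int r + n, l - n), nat (k + int r)) :: (int \<times> int) \<times> nat)"
 define fro where "fro = (%((n, m), t). ((n + m - int t, int t - int r), n - int t) :: (int \<times> int) \<times> int)"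
 have to: "fro (to y) = y & (%(x, t). h (fst x) (snd x) t) (to y) = (%(x, n). g x n) y" if "(%(x, n). g x n) y ~= 0" for y
  using that by (cases y) (auto simp: g_def to_def fro_def split: if_splits)
 have fro: "to (fro y) = y & (%(x, n). g x n) (fro y) = (%(x, t). h (fst x) (snd x) t) y" for y
  by (cases y) (auto simp: g_def to_def fro_def)
 have gfin: "finite {y. g (fst y) (snd y) ~= 0}"
 proof (rule finite_subset)
  show "{y. g (fst y) (snd y) ~= 0} <= fro ` {x. h (fst (fst x)) (snd (fst x)) (snd x) ~= 0}"
  proof
   fix y assume y: "y : {y. g (fst y) (snd y) ~= 0}"
   hence "(%(x, n). g x n) y ~= 0" by (simp add: case_prod_beta)
   from to[OF this] this show "y : fro ` {x. h (fst (fst x)) (snd (fst x)) (snd x) ~= 0}"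
    by (intro image_eqI[of _ _ "to y"]) (auto simp: case_prod_beta)
  qed
 qed (use hfin in simp)
 have E: "E3 i j ?f l k = E3 i j (p * q) l (k + int r)" for l k
  using E3_pole[OF ij pole_cancel(1)[OF ij(1) p q], of r r l k] unfolding pole_cancel(2)[OF ij(1) p q] by (rule sym)
 have third: "G (E3 i j ?f l k) (nprod l (nprod k a b) v) = Sum_any (g (l, k))" for l k
 proof (cases "k + int r < 0")
  case True thus ?thesis unfolding E E3_prod[OF ij p q] by (simp add: g_def[abs_def])
 next
  case False
  define t where "t = nat (k + int r)"
  have k: "k = int t - int r" using False by (simp add: t_def)
  have "E3 i j ?f l k = (SUM n = p0 - int t..l - q0. ((of_int (int t + n) :: complex) gchoose t) *. (P (int t + n) * Q (l - n)))"
   unfolding E E3_prod[OF ij p q] P_def Q_def p0_def q0_def by (simp add: k)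
  hence "G (E3 i j ?f l k) (nprod l (nprod k a b) v) = (SUM n = p0 - int t..l - q0. h (int t + n) (l - n) t)"
   by (simp add: G_sum conf_scaleC[OF PQ] G_scale[OF PQ] h_def k)
  also have "... = (SUM n = p0 - int t..l - q0. g (l, k) n)"
   by (rule sum.cong) (simp_all add: g_def k)
  also have "... = Sum_any (g (l, k))"
  proof (rule Sum_any_superset[symmetric])
   fix n assume "n ~: {p0 - int t..l - q0}"
   hence "h (int t + n) (l - n) t = 0" by (intro h0) auto
   thus "g (l, k) n = 0" by (simp add: g_def k)
  qed simp
  finally show ?thesis .
 qed
 have "dsum (E3 i j ?f) (%l k. nprod l (nprod k a b) v) = Sum_any (%x. Sum_any (g x))"
  unfolding dsum_def by (rule Sum_any.cong) (simp add: third split: prod.split)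
 also have "... = Sum_any (%(x, n). g x n)" by (rule Sum_any_pair[OF gfin])
 also have "... = Sum_any (%(x, t). h (fst x) (snd x) t)"
  by (rule Sum_any_reindex[of _ fro to]) (use to fro in blast)+
 also have "... = Sum_any (%x. Sum_any (h (fst x) (snd x)))" by (rule Sum_any_pair[OF hfin, symmetric])
 also have "... = dsum (%n m. P n * Q m) (%n m. iterate_sum a b (- int r) n m v)"
  unfolding dsum_def
 proof (rule Sum_any.cong)
  fix x :: "int \<times> int"
  obtain n m where x: "x = (n, m)" by (cases x)
  have "finite {t. ((of_int n :: complex) gchoose t) *. nprod (n + m - int t) (nprod (- int r + int t) a b) v ~= 0}"
  proof (rule finite_subset)
   show "{t. ((of_int n :: complex) gchoose t) *. nprod (n + m - int t) (nprod (- int r + int t) a b) v ~= 0} <= {..<T'}"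
   proof (rule subsetI, rule ccontr)
    fix t assume "t : {t. ((of_int n :: complex) gchoose t) *. nprod (n + m - int t) (nprod (- int r + int t) a b) v ~= 0}" "t ~: {..<T'}"
    thus False using T'[of t] by simp
   qed
  qed simp
  from lin_Sum_any[OF clinear_G[OF PQ] this, of n m]
  show "Sum_any (h (fst x) (snd x)) = (case x of (n, m) => G (P n * Q m) (iterate_sum a b (- int r) n m v))"
   by (simp add: x iterate_sum_def h_def[abs_def] lin_scale[OF clinear_G[OF PQ]])
 qed
 finally show ?thesis by (simp only: P_def Q_def)
qed

text \<open>By linearity f may be taken as p(z_i) q(z_j) (z_i - z_j)^(-r). Moving the pole onto the
  fields turns the three terms into the two halves of \<open>bprod\<close> and into
  \<open>iterate_sum\<close>, so the Borcherds identity applies coefficient by coefficient.\<close>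

lemma commutator_base:
 assumes ij: "i ~= j" "i ~: S" "j ~: S" and f: "f : conf (insert i (insert j S))"
 shows "dsum (E1 i j f) (%n m. nprod n a (nprod m b v))
  = dsum (E1 j i f) (%m n. nprod m b (nprod n a v)) + dsum (E3 i j f) (%l k. nprod l (nprod k a b) v)"
proof -
 let ?X = "%n m. nprod n a (nprod m b v)" and ?Y = "%m n. nprod m b (nprod n a v)" and ?Z = "%l k. nprod l (nprod k a b) v"
 let ?S = "insert i (insert j S)"
 have ji: "j ~= i" "j ~: S" "i ~: S" and swap: "insert j (insert i S) = ?S" using ij by auto
 have upb: "upb ?X" "upb ?Y" "upb ?Z" using upb_nprod_nested upb_nprod_iterate[of 0] by auto
 have u: "inverse (var i - var j) : conf ?S" unfolding conf_def by (rule cring_invdiff) (use ij in "auto simp: offdiag_def")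
 have ur: "inverse (var i - var j) ^ r : conf ?S" for r by (induction r) (auto intro: conf_mult u)
 have pc: "p * q : conf ?S" if "p : conf (insert i S)" "q : conf (insert j S)" for p q
  using that conf_mono[of "insert i S" ?S] conf_mono[of "insert j S" ?S] by (intro conf_mult) auto
 have base: "dsum (E1 i j f) ?X = dsum (E1 j i f) ?Y + dsum (E3 i j f) ?Z"
  if p: "p : conf (insert i S)" and q: "q : conf (insert j S)" and f: "f = inverse (var i - var j) ^ r * (p * q)" for p q r f
 proof -
  let ?P = "%n. expat i None p $$ n" and ?Q = "%m. expat j None q $$ m"
  let ?XX = "expand_diff ?X (- int r)" and ?YY = "expand_diff ?Y (- int r)"
  let ?s = "(- 1) ^ r :: complex"
  \<comment> \<open>The same function up to the sign (-1)^r, with the roles of i and j exchanged, as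
    \<open>dsum_E1_pole\<close> requires for the opposite order.\<close>
  define f' where "f' = inverse (var j - var i) ^ r * (q * p)"
  have "inverse (var i - var j) = - inverse (var j - var i)" by (metis inverse_minus_eq minus_diff_eq)
  hence f': "f = ?s *. f' + 0"
   unfolding f f'_def by (simp add: scaleC_ratfun power_minus[of "inverse (var j - var i)"] ratC_power ratC_uminus mult_ac)
  have fc: "f' : conf (insert j (insert i S))"
  proof -
   have "f' = ?s *. f"
    unfolding f' by (simp add: scaleC_scaleC power_mult_distrib[symmetric] scaleC_one)
   thus ?thesis unfolding swap f using ur pc[OF p q] by (auto intro!: conf_scaleC conf_mult)
  qed
  have PQc: "?P n * ?Q m : conf S" for n m
   using expat_conf[OF p, of None i i n] expat_conf[OF q, of None j j m] ij by (intro conf_mult) simp_all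
  have PQl: "lowb (%n m. ?P n * ?Q m)"
   by (rule lowbI[of "fsubdeg (expat j None q)" _ "%_. fsubdeg (expat i None p)"]) simp_all
  have QPl: "lowb (%m n. ?Q m * ?P n)"
   by (rule lowbI[of "fsubdeg (expat i None p)" _ "%_. fsubdeg (expat j None q)"]) simp_all
  have bl: "bprod a b (- int r) n m v = ?XX n m - ?s *. ?YY m n" for n m
   unfolding bprod_def by simp
  have f1: "finite {x. (%(n, m). G (?P n * ?Q m) (?XX n m)) x ~= 0}"
   using dsum_finite[OF PQl upb_xdf[OF upb(1)] PQc, of "- int r"] by (simp add: case_prod_beta)
  have f2': "finite {x. (%(m, n). G (?Q m * ?P n) (?YY m n)) x ~= 0}"
   using dsum_finite[OF QPl upb_xdf[OF upb(2)], of "- int r"] PQc by (simp add: case_prod_beta mult.commute)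
  have f2: "finite {x. ?s *. (%(n, m). G (?P n * ?Q m) (?YY m n)) x ~= 0}"
  proof (rule finite_subset)
   show "{x. ?s *. (%(n, m). G (?P n * ?Q m) (?YY m n)) x ~= 0} <= prod.swap ` {x. (%(m, n). G (?Q m * ?P n) (?YY m n)) x ~= 0}"
    by (force simp: mult.commute image_iff)
  qed (use f2' in simp)
  have f2s: "finite {x. (%(n, m). G (?P n * ?Q m) (?YY m n)) x ~= 0}"
   by (rule finite_subset[OF _ f2]) auto
  have "dsum (E1 j i f) ?Y = ?s *. dsum (E1 j i f') ?Y"
  proof -
   have "E1 j i f = (%n m. ?s *. E1 j i f' n m + 0)"
    unfolding f' using E1_linear[OF ji fc conf_closed(2)] by (auto simp: fun_eq_iff E1_def)
   thus ?thesis using dsum_linear[OF E1_lowb _ E1_conf[OF ji fc] _ upb(2), where E' = "%_ _. 0" and c = "?s"]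
    by (simp add: lowb_def dsum_def)
  qed
  also have "dsum (E1 j i f') ?Y = dsum (%m n. ?Q m * ?P n) ?YY"
   unfolding f'_def by (rule dsum_E1_pole[OF ji q p upb(2)])
  also have "... = Sum_any (%(n, m). G (?P n * ?Q m) (?YY m n))"
   unfolding dsum_def by (rule Sum_any_reindex[of _ prod.swap prod.swap]) (auto simp: mult.commute)
  finally have 2: "dsum (E1 j i f) ?Y = Sum_any (%x. ?s *. (%(n, m). G (?P n * ?Q m) (?YY m n)) x)"
   using lin_Sum_any[OF lin_scaled[OF lin_id(2)] f2s, of ?s] by simp
  have 1: "dsum (E1 i j f) ?X = Sum_any (%(n, m). G (?P n * ?Q m) (?XX n m))"
   unfolding f dsum_E1_pole[OF ij p q upb(1)] by (simp only: dsum_def)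
  have "dsum (E3 i j f) ?Z = dsum (%n m. ?P n * ?Q m) (%n m. bprod a b (- int r) n m v)"
   unfolding f dsum_E3_prod[OF ij p q] borcherds_identity ..
  also have "... = Sum_any (%x. (%(n, m). G (?P n * ?Q m) (?XX n m)) x - ?s *. (%(n, m). G (?P n * ?Q m) (?YY m n)) x)"
   unfolding dsum_def bl
   by (rule Sum_any.cong) (simp add: lin_diff[OF clinear_G[OF PQc]] lin_scale[OF clinear_G[OF PQc]] split: prod.split)
  also have "... = dsum (E1 i j f) ?X - dsum (E1 j i f) ?Y"
   unfolding Sum_any_diff[OF f1 f2] 1 2 ..
  finally show ?thesis by simp
 qed
 obtain r g where g: "g : cring ?S ?S (offdiag ?S - {(i, j), (j, i)})" "f = inverse (var i - var j) ^ r * g"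
 proof -
  have "Some j = None | Some j = Some j & j : ?S & j ~= i" using ij by simp
  from pole_decomposition[OF f _ this] show thesis using that by auto
 qed
 have "g : cring (insert i S Un insert j S) (insert i S Un insert j S) (offdiag (insert i S) Un offdiag (insert j S))"
  by (rule subsetD[OF cring_mono g(1)]) (auto simp: offdiag_def)
 hence "g : cspan (prods (conf (insert i S)) (conf (insert j S)))"
  by (rule cring_in_span_prods[OF conf_def conf_def])
 hence "g : conf ?S & dsum (E1 i j (inverse (var i - var j) ^ r * g)) ?X
  = dsum (E1 j i (inverse (var i - var j) ^ r * g)) ?Y + dsum (E3 i j (inverse (var i - var j) ^ r * g)) ?Z"
 proof (induction rule: cv_span_induct_alt)
  case base show ?case by (simp add: dsum_def E1_def E3_def)
 next
  case (step c x y)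
  let ?w = "inverse (var i - var j) ^ r"
  obtain p q where x: "x = p * q" and p: "p : conf (insert i S)" and q: "q : conf (insert j S)"
   using step(1) by (auto simp: prods_def)
  have xc: "?w * x : conf ?S" and yc: "?w * y : conf ?S" and cc: "c *. x + y : conf ?S"
   using ur pc[OF p q] step(2) unfolding x by (auto intro!: conf_mult conf_add conf_scaleC)
  have xc': "?w * x : conf (insert j (insert i S))" and yc': "?w * y : conf (insert j (insert i S))"
   using xc yc unfolding swap .
  have eq: "?w * (c *. x + y) = c *. (?w * x) + ?w * y" by (simp add: scaleC_ratfun algebra_simps)
  have "dsum (E1 i j (?w * (c *. x + y))) ?X = c *. dsum (E1 i j (?w * x)) ?X + dsum (E1 i j (?w * y)) ?X"
   unfolding eq E1_linear[OF ij xc yc, abs_def] by (rule dsum_linear[OF E1_lowb E1_lowb E1_conf[OF ij xc] E1_conf[OF ij yc] upb(1)])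
  moreover have "dsum (E1 j i (?w * (c *. x + y))) ?Y = c *. dsum (E1 j i (?w * x)) ?Y + dsum (E1 j i (?w * y)) ?Y"
   unfolding eq E1_linear[OF ji xc' yc', abs_def] by (rule dsum_linear[OF E1_lowb E1_lowb E1_conf[OF ji xc'] E1_conf[OF ji yc'] upb(2)])
  moreover have "dsum (E3 i j (?w * (c *. x + y))) ?Z = c *. dsum (E3 i j (?w * x)) ?Z + dsum (E3 i j (?w * y)) ?Z"
   unfolding eq E3_linear[OF ij xc yc, abs_def] by (rule dsum_linear[OF E3_lowb E3_lowb E3_conf[OF ij xc] E3_conf[OF ij yc] upb(3)])
  ultimately show ?case
   using base[OF p q, of "?w * x" r] step(2) cc by (simp add: x scaleC_add_right)
 qed
 thus ?thesis by (simp add: g(2))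
qed

end

subsection \<open>The action of labelled modes\<close>

text \<open>The last mode of a product acts first, so that the list of labels is reversed here.\<close>

primrec act :: "nat list => (nat => 'v) => ratfun => 'v => 'v::graded_vertex_algebra" where
 "act [] A f v = (THE c. f = ratC c) *. v"
| "act (i # rs) A f v = Sum_any (%k. act rs A (expat i None f $$ k) (nprod k (A i) v))"

lemma act_0_left [simp]: "act rs A 0 v = 0"
proof (induction rs arbitrary: v)
 case Nil show ?case using ratC_the[of 0] by simp
qed simp

lemma act_0_right [simp]: "act rs A f 0 = 0"
 by (induction rs arbitrary: f) simp_all

lemma act_finite: "finite {k. act rs A (expat i None f $$ k) (nprod k a v) ~= 0}"
 by (rule comm_finite[where G = "%v f. act rs A f v"]) simp_all

lemma Sum_any_linear:
 assumes "finite {k. g k ~= 0}" "finite {k. h k ~= 0}"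
 shows "Sum_any (%k. c *. g k + h k) = c *. Sum_any g + Sum_any h"
proof -
 have "finite {k. c *. g k ~= 0}" by (rule finite_subset[OF _ assms(1)]) auto
 from Sum_any.distrib[OF this assms(2)] show ?thesis
  by (simp add: lin_Sum_any[OF lin_scaled[OF lin_id(2)] assms(1)])
qed

lemma conf_expat_None: "f : conf (set (i # rs)) ==> distinct (i # rs) ==> expat i None f $$ k : conf (set rs)"
 using expat_conf[of f "set (i # rs)" None undefined i k] by simp

lemma act_linear:
 assumes "distinct rs"
 shows "f : conf (set rs) ==> g : conf (set rs) ==> act rs A (c *. f + g) v = c *. act rs A f v + act rs A g v"
  "f : conf (set rs) ==> act rs A f (c *. v + w) = c *. act rs A f v + act rs A f w"
 using assms
proof (induction rs arbitrary: f g c v w)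
 case Nil
 { case 1
  then obtain a b where "f = ratC a" "g = ratC b" using conf_empty[of f] conf_empty[of g] by auto
  moreover from this have "c *. f + g = ratC (c * a + b)" by (simp add: scaleC_ratfun ratC_add ratC_mult)
  ultimately show ?case by (simp only: act.simps ratC_the) (simp add: scaleC_add_left scaleC_scaleC)
 next
  case 2 show ?case by (simp add: scaleC_add_right scaleC_scaleC mult.commute)
 }
next
 case (Cons i rs)
 { case 1
  thus ?case
   using Cons.IH(1)[OF conf_expat_None[OF 1(1,3)] conf_expat_None[OF 1(2,3)]]
   by (simp add: expat_linear[OF 1(1,2)] Sum_any_linear[OF act_finite act_finite])
 next
  case 2
  thus ?case
   using Cons.IH(2)[OF conf_expat_None[OF 2(1,2)]]
   by (simp add: nprod_add_right nprod_scaleC_right Sum_any_linear[OF act_finite act_finite])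
 }
qed

lemma pairing_act: "distinct rs ==> pairing (set rs) (act rs A)"
 by (rule pairing.intro) (simp_all add: act_linear)

lemma lin_act: "distinct rs ==> f : conf (set rs) ==> clinear (act rs A f)"
 by (rule pairing.clinear_G[OF pairing_act])

lemma act_cong: "(!!i. i : set rs ==> A i = B i) ==> act rs A = act rs B"
 by (induction rs) (auto simp: fun_eq_iff)

lemma act_vec:
 assumes "distinct rs" "i : set rs" "f : conf (set rs)"
 shows "act rs (A(i := c *. a + b)) f v = c *. act rs (A(i := a)) f v + act rs (A(i := b)) f v"
 using assms
proof (induction rs arbitrary: f v)
 case (Cons l rs)
 note c = conf_expat_None[OF Cons.prems(3,1)]
 show ?case
 proof (cases "l = i")
  case True
  hence A: "act rs (A(i := x)) = act rs A" for x using Cons.prems(1) by (intro act_cong) auto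
  have "act rs A (expat i None f $$ k) (nprod k (c *. a + b) v)
   = c *. act rs A (expat i None f $$ k) (nprod k a v) + act rs A (expat i None f $$ k) (nprod k b v)" for k
   using act_linear(2)[OF _ c] Cons.prems(1) True by (simp add: nprod_add_left nprod_scaleC_left)
  thus ?thesis using True by (simp add: A Sum_any_linear[OF act_finite act_finite] del: fun_upd_apply add: fun_upd_same)
 next
  case False
  thus ?thesis using Cons.IH[OF _ _ c] Cons.prems by (simp add: Sum_any_linear[OF act_finite act_finite])
 qed
qed simp

lemma act_vec_zero: "distinct rs ==> i : set rs ==> f : conf (set rs) ==> act rs (A(i := 0)) f v = 0"
 using act_vec[of rs i f A "- 1" 0 0 v] by (simp add: scaleC_one)

lemma act_rename:
 assumes "distinct rs" "inj_on pqi (set rs)" "f : conf (set rs)"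
 shows "act (map pqi rs) A (rnm pqi f) v = act rs (%i. A (pqi i)) f v"
 using assms
proof (induction rs arbitrary: f v)
 case Nil thus ?case using conf_empty by force
next
 case (Cons l rs)
 have "expat (pqi l) None (rnm pqi f) $$ k = rnm pqi (expat l None f $$ k)" for k
  using expat_rename[OF Cons.prems(2,3), of l None undefined k] by simp
 thus ?case using Cons.IH[OF _ _ conf_expat_None[OF Cons.prems(3,1)]] Cons.prems by simp
qed

lemma pd_expat:
 assumes "f : conf S" "i ~= l"
 shows "expat l None (pdv i f) $$ k = pdv i (expat l None f $$ k)"
 unfolding expat_def
proof (rule pd_coefficient[OF adm_exp cwf_conf(1) _ assms(1)[unfolded conf_def]])
 show "fls_map (pdv i) (exp_pt l None m) = (if m = i then 1 else 0)" for m
  using assms(2) by (auto intro!: fls_eqI simp: exp_pt_def)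
qed simp

lemma act_translation:
 assumes "distinct rs" "i : set rs" "f : conf (set rs)"
 shows "act rs (A(i := transl a)) f v = - act rs (A(i := a)) (pdv i f) v"
 using assms
proof (induction rs arbitrary: f v)
 case (Cons l rs)
 note c = conf_expat_None[OF Cons.prems(3,1)]
 have neg: "- Sum_any g = Sum_any (%k. - g k)" if "finite {k. g k ~= 0}" for g :: "int => 'a"
  using lin_Sum_any[OF lin_scaled[OF lin_id(2)] that, of "- 1"] by (simp add: scaleC_one)
 show ?case
 proof (cases "l = i")
  case True
  have A: "act rs (A(i := x)) = act rs A" for x using Cons.prems(1) True by (intro act_cong) auto
  have d: "distinct rs" using Cons.prems(1) by simp
  let ?F = "expat i None f"
  have cF: "?F $$ k : conf (set rs)" for k using c[of k] True by simp
  have "expat i None (pdv i f) $$ k = (of_int (k + 1) :: complex) *. ?F $$ (k + 1)" for k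
   using arg_cong[OF expat_deriv[OF conf_CU[OF Cons.prems(3)], of None i, simplified], of "%F. F $$ k"]
   by (simp add: scaleC_ratfun ratC_add ratC_of_int)
  hence r: "act rs A (expat i None (pdv i f) $$ k) w = of_int (k + 1) *. act rs A (?F $$ (k + 1)) w" for k w
   using pairing.G_scale[OF pairing_act[OF d] cF] by simp
  have t: "act rs A (?F $$ k) (nprod k (transl a) v) = - (of_int k *. act rs A (?F $$ k) (nprod (k - 1) a v))" for k
   unfolding nprod_transl lin_scale[OF lin_act[OF d cF]] by simp
  have "act (l # rs) (A(i := transl a)) f v = Sum_any (%k. - (of_int k *. act rs A (?F $$ k) (nprod (k - 1) a v)))"
   using True by (simp add: A t)
  also have "... = Sum_any (%k. - act rs A (expat i None (pdv i f) $$ k) (nprod k a v))"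
   by (rule Sum_any_reindex[of _ "%k. k + 1" "%k. k - 1"]) (simp_all add: r)
  also have "... = - act (l # rs) (A(i := a)) (pdv i f) v"
   using True by (simp add: A neg[OF act_finite])
  finally show ?thesis .
 next
  case False
  hence il: "i ~= l" by simp
  have "act (l # rs) (A(i := transl a)) f v = Sum_any (%k. - act rs (A(i := a)) (expat l None (pdv i f) $$ k) (nprod k (A l) v))"
   using Cons.IH[OF _ _ c] Cons.prems False by (simp add: pd_expat[OF Cons.prems(3) il] del: fun_upd_apply add: fun_upd_other)
  also have "... = - act (l # rs) (A(i := a)) (pdv i f) v"
   unfolding neg[OF act_finite, symmetric] using False by (simp del: fun_upd_apply add: fun_upd_other)
  finally show ?thesis .
 qed
qed simp

text \<open>If the two modes act before all others, this is \<open>commutator_base\<close> with the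
  remaining modes as pairing. A mode l that acts earlier is peeled off: the expansion at z_l = 0
  commutes with that at z_i = z_j, and the two summations are exchanged.\<close>

lemma act_commutator:
 assumes "distinct (ys @ j # i # xs)" "f : conf (set (ys @ j # i # xs))"
 shows "act (ys @ j # i # xs) A f v = act (ys @ i # j # xs) A f v
  + Sum_any (%k. act (ys @ j # xs) (A(j := nprod k (A i) (A j))) (expat i (Some j) f $$ k) v)"
 using assms
proof (induction ys arbitrary: f v)
 case Nil
 have ij: "i ~= j" "i ~: set xs" "j ~: set xs" and d: "distinct xs" using Nil.prems(1) by auto
 have f: "f : conf (insert i (insert j (set xs)))" and f': "f : conf (insert j (insert i (set xs)))"
  using Nil.prems(2) by (simp_all add: insert_commute)
 interpret pairing "set xs" "act xs A" by (rule pairing_act[OF d])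
 have A: "act xs (A(j := x)) = act xs A" for x using ij by (intro act_cong) auto
 have 1: "act (j # i # xs) A f v = dsum (E1 i j f) (%n m. nprod n (A i) (nprod m (A j) v))"
  by (simp only: act.simps E1_def[symmetric] dsum_iterated[OF E1_lowb upb_nprod_nested E1_conf[OF ij f]])
 have 2: "act (i # j # xs) A f v = dsum (E1 j i f) (%m n. nprod m (A j) (nprod n (A i) v))"
  by (simp only: act.simps E1_def[symmetric] dsum_iterated[OF E1_lowb upb_nprod_nested E1_conf[OF ij(1)[symmetric] ij(3,2) f']])
 have u: "upb (%l k. nprod l (nprod k (A i) (A j)) v)" using upb_nprod_iterate[of 0] by simp
 have 3: "Sum_any (%k. act (j # xs) (A(j := nprod k (A i) (A j))) (expat i (Some j) f $$ k) v)
  = dsum (E3 i j f) (%l k. nprod l (nprod k (A i) (A j)) v)"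
  by (simp only: act.simps A fun_upd_same E3_def[symmetric] dsum_iterated[OF E3_lowb u E3_conf[OF ij f]])
 show ?case using commutator_base[OF ij f, of "A i" "A j" v] unfolding append_Nil 1 2 3 .
next
 case (Cons l ys)
 let ?R = "ys @ j # i # xs" and ?R' = "ys @ j # xs" and ?L = "l # ys @ j # i # xs"
 let ?B = "%k. A(j := nprod k (A i) (A j))"
 have d: "distinct ?R'" "distinct ?R" "l ~= j" "l ~= i" "i ~= j" and set: "set ?L - {i} = set (l # ?R')" using Cons.prems(1) by auto
 have f: "f : conf (set ?L)" using Cons.prems(2) by simp
 have F: "expat l None f $$ n : conf (set ?R)" for n
  by (rule conf_expat_None[of f l ?R]) (use Cons.prems in auto)
 have fj: "expat i (Some j) f $$ k : conf (set (l # ?R'))" for k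
  unfolding set[symmetric] by (rule expat_conf[OF f, where j = j]) (use d in auto)
 have fjl: "expat l None (expat i (Some j) f $$ k) $$ n : conf (set ?R')" for k n
  by (rule conf_expat_None[OF fj]) (use Cons.prems(1) in auto)
 have comm: "expat i (Some j) (expat l None f $$ n) $$ k = expat l None (expat i (Some j) f $$ k) $$ n" for n k
  by (rule expat_expat_commute[OF f, symmetric]) (use d in auto)
 define H where "H n k = act ?R' (?B k) (expat l None (expat i (Some j) f $$ k) $$ n) (nprod n (A l) v)" for n k
 obtain K where K: "!!k. k >= K ==> nprod k (A i) (A j) = 0" using truncation by blast
 obtain N where N: "!!n. n >= N ==> nprod n (A l) v = 0" using truncation by blast
 have fin: "finite {x. H (fst x) (snd x) ~= 0}"
 proof (rule finite_subset)
  show "{x. H (fst x) (snd x) ~= 0} <= {fsubdeg (expat l None f)..N} \<times> {fsubdeg (expat i (Some j) f)..K}"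
  proof (rule subsetI, rule ccontr)
   fix x assume x: "x : {x. H (fst x) (snd x) ~= 0}" "x ~: {fsubdeg (expat l None f)..N} \<times> {fsubdeg (expat i (Some j) f)..K}"
   obtain n k where nk: "x = (n, k)" by (cases x)
   have "~ (fsubdeg (expat l None f) <= n & n <= N & fsubdeg (expat i (Some j) f) <= k & k <= K)" using x(2) by (simp add: nk)
   then consider "n < fsubdeg (expat l None f)" | "n >= N" | "k < fsubdeg (expat i (Some j) f)" | "k >= K" by linarith
   hence "H n k = 0"
   proof cases
    case 1 thus ?thesis by (simp add: H_def comm[symmetric])
   next
    case 4 show ?thesis unfolding H_def K[OF 4] by (rule act_vec_zero[OF d(1) _ fjl]) simp
   qed (simp_all add: H_def N)
   thus False using x(1) by (simp add: nk)
  qed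
 qed simp
 have fin1: "finite {n. Sum_any (H n) ~= 0}"
 proof (rule finite_subset)
  show "{n. Sum_any (H n) ~= 0} <= fst ` {x. H (fst x) (snd x) ~= 0}"
   by (rule subsetI) (auto elim!: Sum_any.not_neutral_obtains_not_neutral simp: image_iff)
 qed (use fin in simp)
 have "act ?L A f v = Sum_any (%n. act (ys @ i # j # xs) A (expat l None f $$ n) (nprod n (A l) v) + Sum_any (H n))"
  unfolding act.simps Cons.IH[OF d(2) F] H_def comm ..
 also have "... = act (l # ys @ i # j # xs) A f v + Sum_any (%n. Sum_any (H n))"
  by (simp add: Sum_any.distrib[OF act_finite fin1])
 also have "Sum_any (%n. Sum_any (H n)) = Sum_any (%k. Sum_any (%n. H n k))"
  unfolding Sum_any_pair[OF fin] Sum_any_pair_swap[OF fin] ..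
 also have "... = Sum_any (%k. act (l # ?R') (?B k) (expat i (Some j) f $$ k) v)"
  by (simp only: act.simps H_def fun_upd_other[OF d(3)])
 finally show ?case unfolding append_Cons .
qed

text \<open>The modes applied to the vacuum. The value 0 on lists with repetitions keeps linearity
  unconditional, as \<open>labelled_functional\<close> asks.\<close>

definition Act :: "nat list => (nat => 'v) => ratfun => 'v::graded_vertex_algebra"
 where "Act ls A = (if distinct ls then linext (conf (set ls)) (%f. act (rev ls) A f vac) else (%_. 0))"

lemma Act: "clinear (Act ls A)" "distinct ls ==> f : conf (set ls) ==> Act ls A f = act (rev ls) A f vac"
proof -
 have 1: "act (rev ls) A (f + g) vac = act (rev ls) A f vac + act (rev ls) A g vac"
  "act (rev ls) A (c *. f) vac = c *. act (rev ls) A f vac"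
  if "distinct ls" "f : conf (set ls)" "g : conf (set ls)" for f g c
  using pairing.G_add[OF pairing_act, of "rev ls"] pairing.G_scale[OF pairing_act, of "rev ls"] that by simp_all
 note 2 = linext[OF conf_subspace(1)[of "set ls"], of "%f. act (rev ls) A f vac"]
 show "clinear (Act ls A)"
 proof (cases "distinct ls")
  case True thus ?thesis using 2(1) 1(1)[OF True] 1(2)[OF True _ conf_closed(2)] by (simp add: Act_def)
 next
  case False thus ?thesis unfolding Act_def by (simp add: lin_0)
 qed
 show "distinct ls ==> f : conf (set ls) ==> Act ls A f = act (rev ls) A f vac"
  using 2(2) 1(1) 1(2)[OF _ _ conf_closed(2)] by (simp add: Act_def)
qed

interpretation Act: labelled_functional "Act :: nat list => (nat => 'v::graded_vertex_algebra) => _"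
proof (rule labelled_functional.intro)
 fix ls :: "nat list" and A B :: "nat => 'v"
 show "clinear (Act ls A)" by (rule Act(1))
next
 fix ls :: "nat list" and A B :: "nat => 'v" and f :: ratfun
 assume "!!i. i : set ls ==> A i = B i"
 hence "act (rev ls) A = act (rev ls) B" by (intro act_cong) simp
 thus "Act ls A f = Act ls B f" by (simp add: Act_def)
next
 fix ls :: "nat list" and pqi :: "nat => nat" and f and A :: "nat => 'v"
 assume *: "distinct ls" "inj_on pqi (set ls)" "f : conf (set ls)"
 have "Act (map pqi ls) A (rnm pqi f) = act (map pqi (rev ls)) A (rnm pqi f) vac"
  using Act(2)[of "map pqi ls" "rnm pqi f" A] * rename_conf[OF *(2,3)] by (simp add: distinct_map rev_map)
 thus "Act (map pqi ls) A (rnm pqi f) = Act ls (%i. A (pqi i)) f"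
  using act_rename[of "rev ls" pqi f A vac] * by (simp add: Act(2))
next
 fix ls :: "nat list" and i f c and A :: "nat => 'v" and a b :: 'v
 assume *: "distinct ls" "i : set ls" "f : conf (set ls)"
 show "Act ls (A(i := a + b)) f = Act ls (A(i := a)) f + Act ls (A(i := b)) f"
  using act_vec[of "rev ls" i f A 1 a b vac] * by (simp add: Act(2) scaleC_one)
 show "Act ls (A(i := c *. a)) f = c *. Act ls (A(i := a)) f"
  using act_vec[of "rev ls" i f A c a 0 vac] * by (simp add: Act(2) act_vec_zero)
 show "Act ls (A(i := transl a)) f = - Act ls (A(i := a)) (pdv i f)"
  using act_translation[of "rev ls" i f A a vac] * by (simp add: Act(2) conf_pd)
next
 fix xs ys :: "nat list" and i j f and A :: "nat => 'v"
 assume *: "distinct (xs @ i # j # ys)" "f : conf (set (xs @ i # j # ys))"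
 have "expat i (Some j) f $$ k : conf (set (xs @ i # j # ys) - {i})" for k
  by (rule expat_conf[OF *(2), where j = j]) (use * in auto)
 moreover have "set (xs @ i # j # ys) - {i} = set (xs @ j # ys)" using * by auto
 ultimately have c: "expat i (Some j) f $$ k : conf (set (xs @ j # ys))" for k by simp
 have "distinct (rev ys @ j # i # rev xs)" "f : conf (set (rev ys @ j # i # rev xs))"
  using * by (auto simp: insert_commute Un_commute)
 note com = act_commutator[OF this, of A vac]
 have s: "Sum_any (%k. Act (xs @ j # ys) (A(j := nprod k (A i) (A j))) (expat i (Some j) f $$ k))
  = Sum_any (%k. act (rev ys @ j # rev xs) (A(j := nprod k (A i) (A j))) (expat i (Some j) f $$ k) vac)"
  by (rule Sum_any.cong) (use * Act(2)[OF _ c] in simp)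
 show "Act (xs @ i # j # ys) A f = Act (xs @ j # i # ys) A f
    + Sum_any (%k. Act (xs @ j # ys) (A(j := nprod k (A i) (A j))) (expat i (Some j) f $$ k))"
  unfolding s using com * Act(2)[of "xs @ j # i # ys" f A] Act(2)[OF _ *(2), of A] by (simp add: insert_commute)
next
 fix xs :: "nat list" and i f and A :: "nat => 'v"
 assume *: "distinct (xs @ [i])" "A i = vac" "f : conf (set (xs @ [i]))"
 have c: "expat i None f $$ k : conf (set xs)" for k
  using conf_expat_None[of f i xs k] * by simp
 have "act (rev (xs @ [i])) A f vac = Sum_any (%k::int. if k = - 1 then act (rev xs) A (expat i None f $$ (- 1)) vac else 0)"
  unfolding rev_append rev.simps append.simps act.simps by (rule Sum_any.cong) (simp add: vacuum *(2))
 also have "... = act (rev xs) A (expat i None f $$ (- 1)) vac" by (rule Sum_any.delta)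
 finally show "Act (xs @ [i]) A f = Act xs A (expat i None f $$ (- 1))"
  using * c by (simp only: Act(2) distinct_append)
qed

section \<open>The covacuum\<close>

text \<open>Since a_(-1) vac = a, a zero vacuum forces the vertex algebra, and then U(V), to vanish.
  This settles the case excluded by the premise in \<open>covacuum\<close>.\<close>

lemma vac_eq_0: "(vac :: 'v::graded_vertex_algebra) = 0 ==> (x :: 'v mode_algebra) = 0"
proof -
 assume v: "(vac :: 'v) = 0"
 have z: "a = 0" for a :: 'v using creation(1)[of a] by (simp add: v)
 have "mode A f = 0" if "A ~= []" "f : conf_ring (length A)" for A :: "'v list" and f
 proof -
  have "f : conf (set [0..<length A])" using that(2) by (simp only: conf_ring_eq set_upt atLeast0LessThan)
  from M.vec_zero[OF _ _ this, of 0 "%i. A ! i"] that(1)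
  have "M [0..<length A] ((%i. A ! i)(0 := 0)) f = 0" by simp
  moreover have "((%i. A ! i)(0 := 0)) = (%i. A ! i)" using z by (auto simp: fun_eq_iff)
  ultimately show ?thesis by (simp only: mode_eq_M[OF that(2)])
 qed
 hence "x : cspan {0}"
  using cv_span_mono[of "{mode A f | A f. A ~= [] & f : conf_ring (length A)}" "{0 :: 'v mode_algebra}"] mode_span[of x] by blast
 thus ?thesis by (simp add: complex_vector.span_insert_0)
qed

lemma covacuum_exists:
 "EX C :: 'v::graded_vertex_algebra mode_algebra_plus => complex. clinear C & ((vac :: 'v) ~= 0 --> C mode_unit_plus = 1) &
  (ALL A f. A ~= [] --> f : conf_ring_plus (length A) --> C (mode_plus A f) = 0)"
proof -
 obtain L where L: "clinear L" "!!A f. f : conf_ring (length A) ==> L (mode A f :: 'v mode_algebra) = Act.positional A f"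
  using Act.linear_map_exists by metis
 \<comment> \<open>A functional that detects the vacuum turns the vector-valued action into a
   scalar.\<close>
 obtain ph :: "'v => complex" where ph: "clinear ph" "(vac :: 'v) ~= 0 ==> ph vac = 1"
 proof (cases "(vac :: 'v) = 0")
  case True thus ?thesis using that[OF lin_0] by blast
 next
  case False
  hence "complex_vector.independent {vac :: 'v}" by simp
  from lin_extend[OF this, of "%_. 1"] that show ?thesis by blast
 qed
 let ?C = "%x. ph (L (RepU x))"
 have "clinear ?C" by (rule lin_comp[OF ph(1) lin_comp[OF L(1) lin_Rep]])
 moreover have "L mode_unit = vac"
 proof -
  have "L (mode [] 1) = Act.positional [] 1" by (rule L(2)) (simp add: conf_ring_eq)
  also have "... = vac" using ratC_the[of 1] by (simp add: Act.positional_def Act(2) scaleC_one)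
  finally have "L (mode [] 1) = vac" .
  moreover have "mode [] 1 = (mode_unit :: 'v mode_algebra)" using mode_Nil[of 1] by (simp add: scaleC_one)
  ultimately show ?thesis by simp
 qed
 hence "(vac :: 'v) ~= 0 --> ?C mode_unit_plus = 1" by (simp add: Rep_mode_unit_plus ph(2))
 moreover have "?C (mode_plus A f) = 0" if "A ~= []" "f : conf_ring_plus (length A)" for A :: "'v list" and f
 proof -
  have fp: "f : confp (set [0..<length A])" using that(2) by (simp only: conf_ring_plus_eq set_upt atLeast0LessThan)
  have f: "f : conf (set [0..<length A])" using fp confp_conf by blast
  hence f': "f : conf_ring (length A)" by (simp only: conf_ring_eq set_upt atLeast0LessThan)
  have "rev [0..<length A] ~= []" using that(1) by simp
  then obtain i rs where r: "rev [0..<length A] = i # rs" by (meson neq_Nil_conv)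
  \<comment> \<open>The mode that meets the vacuum has no terms with k < 0, since f is regular at
    z_i = 0, and none with k >= 0, since these modes kill the vacuum.\<close>
  have 0: "act (i # rs) A' f vac = 0" for A' :: "nat => 'v"
  proof -
   have "act rs A' (expat i None f $$ k) (nprod k (A' i) vac) = 0" for k
   proof (cases "k < 0")
    case True
    have "expat i None f $$ k = 0"
     by (rule expat_regular(1)[OF cwf_conf(2) fp[unfolded confp_def] _ True]) (simp add: avoids_def)
    thus ?thesis by simp
   next
    case False thus ?thesis by (simp add: creation(2))
   qed
   thus ?thesis by simp
  qed
  have "L (mode A f) = Act.positional A f" by (rule L(2)[OF f'])
  also have "... = act (i # rs) (%i. A ! i) f vac"
   unfolding Act.positional_def using Act(2)[OF _ f, of "%i. A ! i"] r by simp
  finally show ?thesis by (simp only: Rep_mode_plus[OF that(2)] 0 lin_zero[OF ph(1)])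
 qed
 ultimately show ?thesis by (intro exI[of _ ?C]) blast
qed

lemma covacuum_spec:
 "clinear (covacuum :: 'v::graded_vertex_algebra mode_algebra_plus => complex) &
  ((vac :: 'v) ~= 0 --> covacuum (mode_unit_plus :: 'v mode_algebra_plus) = 1) &
  (ALL (A :: 'v list) f. A ~= [] --> f : conf_ring_plus (length A) --> covacuum (mode_plus A f) = 0)"
proof -
 obtain C :: "'v mode_algebra_plus => complex" where C: "clinear C & ((vac :: 'v) ~= 0 --> C mode_unit_plus = 1) &
  (ALL A f. A ~= [] --> f : conf_ring_plus (length A) --> C (mode_plus A f) = 0)"
  using covacuum_exists by blast
 have "covacuum = C" unfolding covacuum_def
 proof (rule the_equality, rule C)
  fix C' :: "'v mode_algebra_plus => complex"
  assume C': "clinear C' & ((vac :: 'v) ~= 0 --> C' mode_unit_plus = 1) &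
   (ALL A f. A ~= [] --> f : conf_ring_plus (length A) --> C' (mode_plus A f) = 0)"
  have l: "clinear C" "clinear C'" using C C' by blast+
  show "C' = C"
  proof
   fix x
   show "C' x = C x"
   proof (cases "(vac :: 'v) = 0")
    case True
    have "RepU x = RepU 0"
     using vac_eq_0[OF True] by metis
    hence "x = 0" by (simp only: Rep_mode_algebra_plus_inject)
    thus ?thesis by (simp add: lin_zero[OF l(1)] lin_zero[OF l(2)])
   next
    case False
    show ?thesis
     by (rule lin_eq_on_span[OF l(2,1) _ plus_span]) (use C C' False in auto)
   qed
  qed
 qed
 thus ?thesis using C by simp
qed

lemmas lin_covacuum = covacuum_spec[THEN conjunct1]

lemma covacuum_mode_plus: "A ~= [] ==> f : conf_ring_plus (length A) ==> covacuum (mode_plus A f) = 0"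
 using covacuum_spec by blast

lemma covacuum_Mp: "ls ~= [] ==> f : confp (set ls) ==> covacuum (Mp ls A f) = 0"
 by (simp add: Mp_eq covacuum_mode_plus rename_pos_in_plus)

text \<open>Stated through scalar multiplication so that it remains true for the zero vertex
  algebra, where \<open>covacuum\<close> takes the value 0 on the unit.\<close>

lemma covacuum_unit:
 "covacuum (mode_unit_plus :: 'v::graded_vertex_algebra mode_algebra_plus) *. (x :: 'v mode_algebra) = x"
 "covacuum (mode_unit_plus :: 'v mode_algebra_plus) *. (y :: 'v mode_algebra_plus) = y"
proof -
 show 1: "covacuum (mode_unit_plus :: 'v mode_algebra_plus) *. x = x" for x :: "'v mode_algebra"
 proof (cases "(vac :: 'v) = 0")
  case True thus ?thesis using vac_eq_0[OF True, of x] by simp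
 next
  case False thus ?thesis using covacuum_spec[where 'v = 'v] by (simp add: scaleC_one)
 qed
 have "RepU (covacuum (mode_unit_plus :: 'v mode_algebra_plus) *. y) = RepU y"
  using 1 by (simp add: lin_scale[OF lin_Rep])
 thus "covacuum (mode_unit_plus :: 'v mode_algebra_plus) *. y = y" by (simp only: Rep_mode_algebra_plus_inject)
qed

section \<open>The coproduct on the positive part\<close>

lemma M_unit: "M [] A 1 = mode_unit" and Mp_unit: "Mp [] A 1 = mode_unit_plus"
 using M_Nil[of A 1] Mp_Nil[of A 1] by (simp_all add: scaleC_one)

lemma M_span: "(x :: 'v::graded_vertex_algebra mode_algebra) : cspan {M ls A f | ls A f. distinct ls & f : conf (set ls)}"
proof -
 have "{mode A f | (A :: 'v list) f. A ~= [] & f : conf_ring (length A)} <= {M ls A f | ls A f. distinct ls & f : conf (set ls)}"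
 proof
  fix y assume "y : {mode A f | (A :: 'v list) f. A ~= [] & f : conf_ring (length A)}"
  then obtain A :: "'v list" and f where y: "y = mode A f" "f : conf_ring (length A)" by blast
  hence "y = M [0..<length A] (%i. A ! i) f" "distinct [0..<length A]" "f : conf (set [0..<length A])"
   by (simp_all only: mode_eq_M conf_ring_eq set_upt atLeast0LessThan distinct_upt)
  thus "y : {M ls A f | ls A f. distinct ls & f : conf (set ls)}" by blast
 qed
 thus ?thesis using cv_span_mono mode_span by blast
qed

lemma Mp_span: "(x :: 'v::graded_vertex_algebra mode_algebra_plus) : cspan {Mp ls A f | ls A f. distinct ls & f : confp (set ls)}"
proof -
 have "insert mode_unit_plus {mode_plus A f | (A :: 'v list) f. A ~= [] & f : conf_ring_plus (length A)}
  <= {Mp ls A f | ls A f. distinct ls & f : confp (set ls)}"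
 proof
  fix y assume "y : insert mode_unit_plus {mode_plus A f | (A :: 'v list) f. A ~= [] & f : conf_ring_plus (length A)}"
  then consider "y = Mp [] undefined 1" | A f where "y = mode_plus A f" "f : conf_ring_plus (length A)"
   by (auto simp: Mp_unit)
  thus "y : {Mp ls A f | ls A f. distinct ls & f : confp (set ls)}"
  proof cases
   case 1
   moreover have "distinct ([] :: nat list)" "1 : confp (set [])" by simp_all
   ultimately show ?thesis by blast
  next
   case 2
   have f: "f : confp (set [0..<length A])" using 2(2) by (simp only: conf_ring_plus_eq set_upt atLeast0LessThan)
   hence f': "f : conf (set [0..<length A])" using confp_conf by blast
   hence "mode A f = M [0..<length A] (%i. A ! i) f" by (intro mode_eq_M) (simp only: conf_ring_eq set_upt atLeast0LessThan)
   hence "y = Mp [0..<length A] (%i. A ! i) f"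
    unfolding 2(1) Mp_def using Rep_mode_plus[OF 2(2)] retract_Rep[of "mode_plus A f"] by simp
   moreover have "distinct [0..<length A]" by simp
   ultimately show ?thesis using f by blast
  qed
 qed
 thus ?thesis using cv_span_mono plus_span by blast
qed

lemma lin_coproduct: "clinear (%x. coproduct x $$ s)"
 using coproduct_spec(1)[of s] by (simp add: coeff_map_def[abs_def])

definition Splitp :: "nat list => nat list => (nat => 'v::graded_vertex_algebra) => ratfun => 'v mode_algebra_plus \<otimes> 'v mode_algebra_plus"
 where "Splitp is js A h = tensor_map retract id (Split is js A h)"

lemma Splitp:
 assumes "set is Int set js = {}"
 shows "clinear (Splitp is js A)"
  "p : conf (set is) ==> q : confp (set js) ==> Splitp is js A (p * q) = Mp is A p \<otimes> Mp js A q"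
 unfolding Splitp_def[abs_def]
 by (rule lin_comp[OF lin_tmap[OF lin_retract lin_id(1)] Split(1)[OF assms]])
   (simp add: Split(2)[OF assms] tensor_map[OF lin_retract lin_id(1)] Mp_def)

lemma Rep_Splitp:
 assumes "set is Int set js = {}" "h : cspan (prods (confp (set is)) (confp (set js)))"
 shows "tensor_map RepU id (Splitp is js A h) = Split is js A h"
proof (rule prods_ext[OF lin_comp[OF lin_tmap[OF lin_Rep lin_id(1)] Splitp(1)[OF assms(1)]] Split(1)[OF assms(1)] _ assms(2)])
 fix p q assume p: "p : confp (set is)" and q: "q : confp (set js)"
 hence "p : conf (set is)" using confp_conf by blast
 thus "tensor_map RepU id (Splitp is js A (p * q)) = Split is js A (p * q)"
  using q by (simp add: Split(2)[OF assms(1)] Splitp(2)[OF assms(1)] tensor_map[OF lin_Rep lin_id(1)] Rep_Mp[OF p])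
qed

lemma shift_mixs_plus:
 assumes "f : confp (set ls)" "J <= set ls"
 shows "xsh J f $$ s : cspan (prods (confp (set (outl J ls))) (confp (set (inl J ls))))"
proof -
 have "set (outl J ls) = set ls - J" "set (inl J ls) = J" using assms(2) by auto
 thus ?thesis using xsh_confp_mixs[OF assms] by simp
qed

lemma tmap_comp:
 assumes "clinear f" "clinear g" "clinear f'" "clinear g'"
 shows "tensor_map f g (tensor_map f' g' x) = tensor_map (%a. f (f' a)) (%b. g (g' b)) x"
 by (rule tensor_ext[OF lin_comp[OF lin_tmap[OF assms(1,2)] lin_tmap[OF assms(3,4)]]
    lin_tmap[OF lin_comp[OF assms(1,3)] lin_comp[OF assms(2,4)]]])
   (simp add: assms lin_comp[OF assms(1,3)] lin_comp[OF assms(2,4)])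

lemma retract_Rep_tensor: "tensor_map retract id (tensor_map RepU id x) = x"
 unfolding tmap_comp[OF lin_retract lin_id(1) lin_Rep lin_id(1)] retract_Rep id_apply
 by (rule tensor_ext[OF lin_tmap[OF lin_id(2) lin_id(2)] lin_id(2)]) simp

text \<open>For a function in \<open>confp\<close> both factors of each splitting are positive. On
  such elements the projection in the left factor changes nothing, so the coproduct lands in the
  image of the tensor square of U_+.\<close>

lemma coproduct_Rep_in_image:
 fixes x :: "'v::graded_vertex_algebra mode_algebra_plus"
 shows "tensor_map RepU id (tensor_map retract id (coproduct (RepU x) $$ s)) = coproduct (RepU x) $$ s"
proof (rule lin_eq_on_span[OF _ _ _ Mp_span[of x]])
 have c: "clinear (%x. coproduct (RepU x) $$ s)" by (rule lin_comp[OF lin_coproduct lin_Rep])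
 show "clinear (%x :: 'v mode_algebra_plus. coproduct (RepU x) $$ s)" by (rule c)
 show "clinear (%x :: 'v mode_algebra_plus. tensor_map RepU id (tensor_map retract id (coproduct (RepU x) $$ s)))"
  by (rule lin_comp[OF lin_tmap[OF lin_Rep lin_id(1)] lin_comp[OF lin_tmap[OF lin_retract lin_id(1)] c]])
 fix y :: "'v mode_algebra_plus" assume "y : {Mp ls A f | ls A f. distinct ls & f : confp (set ls)}"
 then obtain ls A f where y: "y = Mp ls A f" "distinct ls" "f : confp (set ls)" by blast
 have f: "f : conf (set ls)" using y(3) confp_conf by blast
 have "tensor_map RepU id (tensor_map retract id (Split (outl J ls) (inl J ls) A (xsh J f $$ s)))
  = Split (outl J ls) (inl J ls) A (xsh J f $$ s)" if "J : Pow (set ls)" for J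
  using Rep_Splitp[OF oi_disj shift_mixs_plus[OF y(3)]] that by (simp add: Splitp_def)
 thus "tensor_map RepU id (tensor_map retract id (coproduct (RepU y) $$ s)) = coproduct (RepU y) $$ s"
  by (simp add: y(1) Rep_Mp[OF y(3)] coproduct_M[OF y(2) f] lin_sum[OF lin_tmap[OF lin_retract lin_id(1)]]
    lin_sum[OF lin_tmap[OF lin_Rep lin_id(1)]])
qed

text \<open>The inclusion in the left factor has a left inverse on tensors, so the solution required
  by the \<open>THE\<close> is unique; it is obtained by projecting.\<close>

lemma copp_nth: "copU x $$ s = tensor_map retract id (coproduct (RepU x) $$ s)"
proof -
 let ?R = "tensor_map RepU id" and ?c = "%s. coproduct (RepU x) $$ s"
 define y where "y = Abs_fls (%s. tensor_map retract id (?c s))"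
 have y: "y $$ s = tensor_map retract id (?c s)" for s
  unfolding y_def by (rule nth_Abs_fls_lower_bound[of "fsubdeg (coproduct (RepU x))"])
   (simp add: lin_zero[OF lin_tmap[OF lin_retract lin_id(1)]])
 have "copU x = y" unfolding coproduct_plus_def
 proof (rule the_equality)
  show "ALL s. ?R (y $$ s) = ?c s" by (simp add: y coproduct_Rep_in_image)
  fix z assume "ALL s. ?R (z $$ s) = ?c s"
  thus "z = y" by (intro fls_eqI) (metis y retract_Rep_tensor)
 qed
 thus ?thesis by (simp add: y)
qed

lemma Rep_copp: "tensor_map RepU id (copU x $$ s) = coproduct (RepU x) $$ s"
 by (simp add: copp_nth coproduct_Rep_in_image)

lemma lin_copp: "clinear (%x. copU x $$ s)"
 unfolding copp_nth
 by (rule lin_comp[OF lin_tmap[OF lin_retract lin_id(1)] lin_comp[OF lin_coproduct lin_Rep]])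

lemma copp_Mp:
 assumes "distinct ls" "f : confp (set ls)"
 shows "copU (Mp ls A f) $$ s = (SUM J:Pow (set ls). Splitp (outl J ls) (inl J ls) A (xsh J f $$ s))"
proof -
 have f: "f : conf (set ls)" using assms(2) confp_conf by blast
 show ?thesis
  unfolding copp_nth Rep_Mp[OF assms(2)] Splitp_def
  by (simp only: coproduct_M[OF assms(1) f] lin_sum[OF lin_tmap[OF lin_retract lin_id(1)]])
qed

section \<open>Counit, cocreation and translation\<close>

text \<open>\<open>covacuum\<close> kills every positive mode on a nonempty list, so J = {} alone
  contributes, where nothing is shifted.\<close>

lemma counit:
 fixes m :: "'v::graded_vertex_algebra mode_algebra"
 shows "contract_right covacuum (coproduct m $$ s) = (if s = 0 then m else 0)"
proof (rule lin_eq_on_span[OF _ _ _ M_span[of m]])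
 have cl: "clinear (contract_right (covacuum :: 'v mode_algebra_plus => complex))" by (rule lin_contract_right[OF lin_covacuum])
 show "clinear (%m :: 'v mode_algebra. contract_right covacuum (coproduct m $$ s))" by (rule lin_comp[OF cl lin_coproduct])
 show "clinear (%m :: 'v mode_algebra. if s = 0 then m else 0)" by (rule clinearI) auto
 fix y :: "'v mode_algebra" assume "y : {M ls A f | ls A f. distinct ls & f : conf (set ls)}"
 then obtain ls A f where y: "y = M ls A f" "distinct ls" "f : conf (set ls)" by blast
 have z: "contract_right covacuum (Split (outl J ls) (inl J ls) A h) = 0" if "inl J ls ~= []" "h : mixs (set (outl J ls)) (set (inl J ls))" for J h
 proof (rule prods_ext[OF lin_comp[OF cl Split(1)[OF oi_disj]] lin_0 _ that(2)])
  fix p q assume p: "p : conf (set (outl J ls))" and q: "q : confp (set (inl J ls))"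
  show "contract_right covacuum (Split (outl J ls) (inl J ls) A (p * q)) = 0"
   by (simp only: Split(2)[OF oi_disj p q] contract_right[OF lin_covacuum] covacuum_Mp[OF that(1) q]) simp
 qed
 have ne: "inl J ls ~= []" if "J : Pow (set ls) - {{}}" for J
 proof -
  have "J ~= {}" "set (inl J ls) = J" using that by auto
  thus ?thesis by (metis list.set(1))
 qed
 have "contract_right covacuum (coproduct y $$ s) = (SUM J:Pow (set ls). contract_right covacuum (Split (outl J ls) (inl J ls) A (xsh J f $$ s)))"
  unfolding y(1) coproduct_M[OF y(2,3)] lin_sum[OF cl] ..
 also have "... = (SUM J:{{}}. contract_right covacuum (Split (outl J ls) (inl J ls) A (xsh J f $$ s)))"
  by (rule sum.mono_neutral_right) (use z[OF ne shift_mixs[OF y(3)]] in auto)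
 also have "... = contract_right covacuum (Split ls [] A (if s = 0 then f else 0))"
  by (simp add: xsh_id[OF y(3)])
 also have "... = (if s = 0 then y else 0)"
 proof -
  have "Split ls [] A (f * 1) = M ls A f \<otimes> Mp [] A 1" by (rule Split(2)) (use y in auto)
  hence "contract_right covacuum (Split ls [] A f) = y"
   using contract_right[OF lin_covacuum, of "M ls A f" "Mp [] A 1"] by (simp add: Mp_unit covacuum_unit y(1))
  thus ?thesis by (simp add: lin_zero[OF cl] lin_zero[OF Split(1)])
 qed
 finally show "contract_right covacuum (coproduct y $$ s) = (if s = 0 then y else 0)" .
qed

lemma counit_plus: "contract_right covacuum (copU (v :: 'v::graded_vertex_algebra mode_algebra_plus) $$ s) = (if s = 0 then v else 0)"
proof -
 have cl: "clinear (contract_right (covacuum :: 'v mode_algebra_plus => complex) :: 'a::complex_vector \<otimes> _ => _)"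
  by (rule lin_contract_right[OF lin_covacuum])
 have "RepU (contract_right covacuum t) = contract_right covacuum (tensor_map RepU id t)"
  for t :: "'v mode_algebra_plus \<otimes> 'v mode_algebra_plus"
  by (rule tensor_ext[OF lin_comp[OF lin_Rep lin_contract_right[OF lin_covacuum]]
     lin_comp[OF lin_contract_right[OF lin_covacuum] lin_tmap[OF lin_Rep lin_id(1)]]])
    (simp add: contract_right[OF lin_covacuum] tensor_map[OF lin_Rep lin_id(1)] lin_scale[OF lin_Rep])
 hence "RepU (contract_right covacuum (copU v $$ s)) = RepU (if s = 0 then v else 0)"
  by (simp add: Rep_copp counit lin_zero[OF lin_Rep])
 thus ?thesis by (simp only: Rep_mode_algebra_plus_inject)
qed

text \<open>A left factor with a nonempty list is killed, so the full set alone survives: the result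
  is the mode of f with all variables translated by w.\<close>

lemma contract_left_copp:
 assumes "distinct ls" "f : confp (set ls)"
 shows "contract_left covacuum (copU (Mp ls A f) $$ s) = Mp ls A (xsh (set ls) f $$ s)"
proof -
 have cl: "clinear (contract_left covacuum)" by (rule lin_contract_left[OF lin_covacuum])
 have z: "contract_left covacuum (Splitp (outl J ls) (inl J ls) A h) = 0"
  if "outl J ls ~= []" "h : cspan (prods (confp (set (outl J ls))) (confp (set (inl J ls))))" for J h
 proof (rule prods_ext[OF lin_comp[OF cl Splitp(1)[OF oi_disj]] lin_0 _ that(2)])
  fix p q assume p: "p : confp (set (outl J ls))" and q: "q : confp (set (inl J ls))"
  hence "p : conf (set (outl J ls))" using confp_conf by blast
  thus "contract_left covacuum (Splitp (outl J ls) (inl J ls) A (p * q)) = 0"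
   by (simp only: Splitp(2)[OF oi_disj _ q] contract_left[OF lin_covacuum] covacuum_Mp[OF that(1) p]) simp
 qed
 have ne: "outl J ls ~= []" if "J : Pow (set ls) - {set ls}" for J
  using that by (auto simp: filter_empty_conv)
 have "contract_left covacuum (copU (Mp ls A f) $$ s)
  = (SUM J:Pow (set ls). contract_left covacuum (Splitp (outl J ls) (inl J ls) A (xsh J f $$ s)))"
  unfolding copp_Mp[OF assms] lin_sum[OF cl] ..
 also have "... = (SUM J:{set ls}. contract_left covacuum (Splitp (outl J ls) (inl J ls) A (xsh J f $$ s)))"
  by (rule sum.mono_neutral_right) (use z[OF ne shift_mixs_plus[OF assms(2)]] in auto)
 also have "... = contract_left covacuum (Splitp [] ls A (1 * xsh (set ls) f $$ s))"
  by simp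
 also have "... = Mp ls A (xsh (set ls) f $$ s)"
 proof -
  have "xsh (set ls) f $$ s : cring (set ls) ({} - set ls) {(i, j) : offdiag (set ls). (i : set ls) = (j : set ls)}"
   by (rule coeffs_inD[OF xsh_coeffs[OF cwf_conf(2) assms(2)[unfolded confp_def]]])
  hence "xsh (set ls) f $$ s : confp (set ls)"
   unfolding confp_def by (rule subsetD[OF cring_mono, rotated 3]) auto
  thus ?thesis
   by (subst Splitp(2)) (simp_all add: contract_left[OF lin_covacuum] Mp_unit covacuum_unit)
 qed
 finally show ?thesis .
qed

lemma fls_mult_nonpositive:
 fixes F G :: "'a::comm_ring_1 fls"
 assumes "!!k. k > 0 ==> F $$ k = 0" "!!k. k > 0 ==> G $$ k = 0"
 shows "(F * G) $$ n = (SUM i=n..0. F $$ i * G $$ (n - i))"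
proof -
 let ?a = "min n (fsubdeg F)" and ?b = "min n (fsubdeg G)"
 have "(F * G) $$ n = (SUM i=?a..n - ?b. F $$ i * G $$ (n - i))" by (rule fls_mult_nth) auto
 also have "... = (SUM i=n..0. F $$ i * G $$ (n - i))"
  by (rule sum.mono_neutral_cong) (auto simp: assms min_def not_le split: if_splits)
 finally show ?thesis .
qed

text \<open>A common translation by w fixes all differences, so f(z + w) is polynomial in w; index
  -1 is the power w. The terms of degree 0 and 1 are what cocreation and the operator D
  need.\<close>

lemma xsh_all:
 assumes "f : confp S" "finite S"
 shows "(ALL k>0. xsh S f $$ k = 0) & xsh S f $$ 0 = f
  & xsh S f $$ (- 1) = (SUM l:S. pdv l f)"
 using assms(1) unfolding confp_def
proof (induction rule: cring_induct)
 case (const c) thus ?case by (simp add: xsh_eq pd_const)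
next
 case (var i) thus ?case using assms(2) by (auto simp: xsh_eq shift_pt_def pd_var sum.delta)
next
 case (diff i j)
 hence i: "i : S" "j : S" "i ~= j" by (auto simp: offdiag_def)
 have c: "var i - var j : conf UNIV" "inverse (var i - var j) : conf UNIV"
  unfolding conf_def using i by (auto intro!: cring_diff cring_var cring_invdiff simp: offdiag_def)
 have "xsh S (var i - var j) = fls_const (var i - var j)"
  using i lau_hom(3)[OF adm_shift, of "var i" "var j" S]
  by (simp add: xsh_eq shift_pt_def conf_def cring_var) (rule fls_eqI, simp)
 moreover have "xsh S (var i - var j) * xsh S (inverse (var i - var j)) = 1"
  using lau_hom(2)[OF adm_shift c, of S] i by (simp add: xsh_eq)
 ultimately have "xsh S (inverse (var i - var j)) = fls_const (inverse (var i - var j))"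
  using i by (metis fls_const_mult_const fls_const_1 inverse_unique right_inverse right_minus_eq var_inject fls_inverse_const)
 moreover have "(SUM l:S. pdv l (inverse (var i - var j))) = 0"
 proof -
  have "pdv l (inverse (var i - var j)) = - (pdv l (var i) - pdv l (var j)) * inverse (var i - var j) ^ 2" for l
   by (subst pd_inverse) (use i in "auto simp: pd_diff power2_eq_square")
  thus ?thesis using i assms(2)
   by (simp add: sum_distrib_right[symmetric] sum_negf sum_subtractf pd_var sum.delta)
 qed
 ultimately show ?case by simp
next
 case (add f g)
 thus ?case using xsh_add[of f UNIV g S] confp_CU[unfolded confp_def] by (simp add: pd_add sum.distrib)
next
 case (mult f g)
 have "xsh S (f * g) = xsh S f * xsh S g"
  unfolding xsh_eq using mult(1,2) confp_CU[unfolded confp_def] by (intro lau_hom(2)[OF adm_shift]) auto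
 hence e: "xsh S (f * g) $$ n = (SUM i=n..0. xsh S f $$ i * xsh S g $$ (n - i))" for n
  using mult.IH by (simp add: fls_mult_nonpositive)
 have "{- 1..0::int} = {- 1, 0}" by auto
 thus ?case using mult.IH by (simp add: e pd_mult sum.distrib sum_distrib_left sum_distrib_right add.commute mult.commute)
qed simp

lemma cocreation:
 fixes v :: "'v::graded_vertex_algebra mode_algebra_plus"
 shows "s > 0 ==> contract_left covacuum (copU v $$ s) = 0"
  "contract_left covacuum (copU v $$ 0) = v"
proof -
 have l: "clinear (%v :: 'v mode_algebra_plus. contract_left covacuum (copU v $$ s))" for s
  by (rule lin_comp[OF lin_contract_left[OF lin_covacuum] lin_copp])
 show "contract_left covacuum (copU v $$ s) = 0" if "s > 0"
  by (rule lin_eq_on_span[OF l lin_0 _ Mp_span])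
    (use that xsh_all in "auto simp: contract_left_copp lin_zero[OF lin_Mp]")
 show "contract_left covacuum (copU v $$ 0) = v"
  by (rule lin_eq_on_span[OF l lin_id(2) _ Mp_span])
    (use xsh_all in "auto simp: contract_left_copp")
qed

text \<open>The derivatives by z_j, summed over j in \<open>J\<close>, act on the shifted function
  as d/dw.\<close>

lemma shift_derivative:
 assumes "f : conf S" "finite J"
 shows "(SUM j:J. pdv j (xsh J f $$ s)) = of_int (- (s - 1)) * xsh J f $$ (s - 1)"
proof -
 let ?E = "lsub (shift_pt J)"
 define d where "d f = (SUM j:J. ?E (pdv j f))" for f
 \<comment> \<open>d/dw written in the series variable X = \<open>w^-1\<close>: it is -X^2
   d/dX.\<close>
 define e where "e f = - (fls_X * (fls_X * fls_deriv (?E f)))" for f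
 have "d f = e f"
 proof (rule deriv_unique_CU[OF adm_shift conf_CU[OF assms(1)]])
  show "derivation_along (conf UNIV) ?E d"
   using derivation_CU[OF adm_shift, of J] unfolding derivation_along_def d_def
   by (simp add: sum.distrib sum_distrib_left sum_distrib_right)
  show "derivation_along (conf UNIV) ?E e"
   by (simp add: derivation_along_def e_def lau_hom[OF adm_shift] algebra_simps)
  show "d (var i) = e (var i)" for i
   using assms(2) by (auto simp: d_def e_def pd_var if_distrib[of ?E] shift_pt_def sum.delta fls_X_times_conv_shift
     fls_X_inv_def intro!: fls_eqI cong: if_cong)
 qed
 hence "d f $$ s = e f $$ s" by simp
 moreover have "d f $$ s = (SUM j:J. pdv j (xsh J f $$ s))"
  using pd_xsh[OF assms(1), of J _ s] by (simp add: d_def fls_nth_sum xsh_eq[symmetric])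
 ultimately show ?thesis by (simp add: e_def xsh_eq fls_X_times_conv_shift algebra_simps)
qed

definition Dc :: "'v::graded_vertex_algebra mode_algebra_plus => 'v mode_algebra_plus"
 where "Dc v = contract_left covacuum (copU v $$ (- 2 + 1))"

lemma lin_Dc: "clinear Dc"
 unfolding Dc_def by (rule lin_comp[OF lin_contract_left[OF lin_covacuum] lin_copp])

lemma Dc_Mp: "distinct ls ==> f : confp (set ls) ==> Dc (Mp ls A f) = Mp ls A (SUM l:set ls. pdv l f)"
 using xsh_all[of f "set ls"] by (simp add: Dc_def contract_left_copp)

text \<open>D sums the derivatives over all variables. After the splitting, those outside
  \<open>J\<close> make up D on the left factor and those in \<open>J\<close> make up d/dw.\<close>

lemma translation_coproduct:
 fixes v :: "'v::graded_vertex_algebra mode_algebra_plus"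
 shows "of_int (- (s - 1)) *. (copU v $$ (s - 1)) = copU (Dc v) $$ s - tensor_map Dc id (copU v $$ s)"
proof (rule lin_eq_on_span[OF lin_scaled[OF lin_copp] lin_minus[OF lin_comp[OF lin_copp lin_Dc]
   lin_comp[OF lin_tmap[OF lin_Dc lin_id(1)] lin_copp]] _ Mp_span])
 fix y :: "'v mode_algebra_plus" assume "y : {Mp ls A f | ls A f. distinct ls & f : confp (set ls)}"
 then obtain ls A f where y: "y = Mp ls A f" and d: "distinct ls" and f: "f : confp (set ls)" by blast
 have fc: "f : conf (set ls)" using f confp_conf by blast
 have Tf: "(SUM l:set ls. pdv l f) : confp (set ls)"
  using confp_pd[OF f] unfolding confp_def by (intro cring_sum) auto
 have t: "tensor_map Dc id (Splitp (outl J ls) (inl J ls) A h) = Splitp (outl J ls) (inl J ls) A (SUM l:set (outl J ls). pdv l h)"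
  if h: "h : cspan (prods (confp (set (outl J ls))) (confp (set (inl J ls))))" for J h
 proof (rule prods_ext[OF _ _ _ h])
  note S = Splitp[OF oi_disj]
  show "clinear (%h. tensor_map Dc id (Splitp (outl J ls) (inl J ls) A h))"
   by (rule lin_comp[OF lin_tmap[OF lin_Dc lin_id(1)] S(1)])
  show "clinear (%h. Splitp (outl J ls) (inl J ls) A (SUM l:set (outl J ls). pdv l h))"
   by (rule lin_comp[OF S(1) lin_sums[OF lin_pd]])
  fix p q assume p: "p : confp (set (outl J ls))" and q: "q : confp (set (inl J ls))"
  have pc: "p : conf (set (outl J ls))" and qc: "q : conf (set (inl J ls))" using p q confp_conf by blast+
  have s: "(SUM l:set (outl J ls). pdv l p) : conf (set (outl J ls))" by (rule conf_sum) (rule conf_pd[OF pc])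
  have "(SUM l:set (outl J ls). pdv l (p * q)) = (SUM l:set (outl J ls). pdv l p) * q"
   unfolding sum_distrib_right by (rule sum.cong[OF refl]) (simp add: pd_mult pd_zero[OF qc])
  thus "tensor_map Dc id (Splitp (outl J ls) (inl J ls) A (p * q)) = Splitp (outl J ls) (inl J ls) A (SUM l:set (outl J ls). pdv l (p * q))"
   using d by (simp only: S(2)[OF pc q] S(2)[OF s q] tensor_map[OF lin_Dc lin_id(1)] Dc_Mp[OF _ p] distinct_filter id_apply)
 qed
 have main: "of_int (- (s - 1)) *. Splitp (outl J ls) (inl J ls) A (xsh J f $$ (s - 1))
  = Splitp (outl J ls) (inl J ls) A (xsh J (SUM l:set ls. pdv l f) $$ s)
   - tensor_map Dc id (Splitp (outl J ls) (inl J ls) A (xsh J f $$ s))" if J: "J <= set ls" for J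
 proof -
  let ?h = "xsh J f $$ s"
  note cl = Splitp(1)[OF oi_disj, of J ls A]
  have fin: "finite J" using J finite_subset by blast
  have "xsh J (SUM l:B. pdv l f) $$ s = (SUM l:B. pdv l ?h)" if "finite B" for B
   using that
  proof (induction B rule: finite_induct)
   case (insert l B)
   have c: "(SUM l:B. pdv l f) : conf (set ls)" by (rule conf_sum) (rule conf_pd[OF fc])
   from insert show ?case using xsh_add[OF conf_pd[OF fc, of l] c, of J s] by (simp add: pd_xsh[OF fc])
  qed simp
  hence "xsh J (SUM l:set ls. pdv l f) $$ s = (SUM l:set ls. pdv l ?h)" by simp
  also have "... = (SUM l:set (outl J ls). pdv l ?h) + (SUM l:J. pdv l ?h)"
  proof -
   have "set ls = set (outl J ls) Un J" "set (outl J ls) Int J = {}" using J by auto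
   thus ?thesis using fin by (metis sum.union_disjoint finite_set)
  qed
  also have "(SUM l:J. pdv l ?h) = of_int (- (s - 1)) *. xsh J f $$ (s - 1)"
   by (simp only: shift_derivative[OF fc fin] scaleC_ratfun ratC_of_int)
  finally have "xsh J (SUM l:set ls. pdv l f) $$ s
   = (SUM l:set (outl J ls). pdv l ?h) + of_int (- (s - 1)) *. xsh J f $$ (s - 1)" .
  thus ?thesis unfolding t[OF shift_mixs_plus[OF f J]] by (simp only: lin_add[OF cl] lin_scale[OF cl]) simp
 qed
 show "of_int (- (s - 1)) *. (copU y $$ (s - 1)) = copU (Dc y) $$ s - tensor_map Dc id (copU y $$ s)"
  unfolding y Dc_Mp[OF d f] copp_Mp[OF d f] copp_Mp[OF d Tf] cv_scale_sum_right
   lin_sum[OF lin_tmap[OF lin_Dc lin_id(1)]] sum_subtractf[symmetric]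
  by (rule sum.cong[OF refl main]) simp
qed

section \<open>Expansions of rational functions in two variables\<close>

lemma bounded_familyE:
 assumes "bfam c"
 obtains N where "!!i j k. i < - N | j < - N ==> c i j k = 0"
proof -
 obtain N where N: "ALL i j k. c i j k ~= 0 --> - N <= i & - N <= j" using assms unfolding bounded_family_def by blast
 show thesis by (rule that[of N]) (metis N not_le)
qed

lemma bounded_familyI: "(!!i j k. i < - N | j < - N ==> c i j k = 0) ==> bfam c"
 unfolding bounded_family_def by (rule exI[of _ N]) (metis not_le)

lemma expand_z_large_eq:
 assumes "!!i j k. i < - N | j < - N ==> c i j k = 0" "a + N <= int T"
 shows "exz ep c a b = (SUM k<=T. SUM m<=T. (((- of_nat k) gchoose m) * ep ^ m) *. c (a - int k - int m) (b + int m) k)"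
proof -
 have "exz ep c a b = (SUM (k, m):{..T} \<times> {..T}. (((- of_nat k) gchoose m) * ep ^ m) *. c (a - int k - int m) (b + int m) k)"
  unfolding expand_z_large_def
  by (rule Sum_any_superset) (use assms in "auto split: prod.split")
 thus ?thesis by (simp add: sum.cartesian_product)
qed

text \<open>(z + ep w)^(-k) = ep^(-k) (w + z/ep)^(-k) exchanges the roles of z and w, so results for
  one expansion carry over to the other.\<close>

lemma expand_w_large_eq: "exw ep c a b = exz (inverse ep) (%i j k. inverse ep ^ k *. c j i k) b a"
 unfolding expand_w_large_def expand_z_large_def
 by (rule Sum_any.cong) (simp add: scaleC_scaleC power_add mult_ac split: prod.split)

lemma bounded_swap: "bfam c ==> bfam (%i j k. e k *. c j i k)"
proof -
 assume "bfam c"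
 then obtain N where N: "!!i j k. i < - N | j < - N ==> c i j k = 0" by (rule bounded_familyE) blast
 have "c j i k = 0" if "i < - N | j < - N" for i j k by (rule N) (use that in auto)
 thus ?thesis by (intro bounded_familyI[of N]) simp
qed

lemma expand_z_shift:
 "exz ep (%i j k. c (i + r) (j + s) k) a b = exz ep c (a + r) (b + s)"
 unfolding expand_z_large_def by (rule Sum_any.cong) (simp add: algebra_simps split: prod.split)

lemma expand_w_shift:
 "exw ep (%i j k. c (i + r) (j + s) k) a b = exw ep c (a + r) (b + s)"
 unfolding expand_w_large_eq expand_z_shift[of "inverse ep" "%i j k. inverse ep ^ k *. c j i k" s r, symmetric] ..

lemma bounded_combine:
 assumes "bfam c" "bfam d" "!!i j k. c i j k = 0 ==> d i j k = 0 ==> e i j k = 0"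
 shows "bfam e"
proof -
 obtain N where N: "!!i j k. i < - N | j < - N ==> c i j k = 0" using assms(1) by (rule bounded_familyE) blast
 obtain N' where N': "!!i j k. i < - N' | j < - N' ==> d i j k = 0" using assms(2) by (rule bounded_familyE) blast
 show ?thesis by (rule bounded_familyI[of "max N N'"]) (rule assms(3), (rule N, simp, linarith), (rule N', simp, linarith))
qed

lemma bounded_shift: "bfam c ==> bfam (%i j k. c (i + r) (j + s) k)"
proof -
 assume "bfam c"
 then obtain N where N: "!!i j k. i < - N | j < - N ==> c i j k = 0" by (rule bounded_familyE) blast
 show ?thesis by (rule bounded_familyI[of "N + \<bar>r\<bar> + \<bar>s\<bar>"]) (rule N, linarith)
qed

lemma expand_z_linear:
 fixes L :: "'a::complex_vector => 'c::complex_vector" and L' :: "'b::complex_vector => 'c"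
 assumes "clinear L" "clinear L'" "bfam c" "bfam d"
 shows "exz ep (%i j k. L (c i j k) + L' (d i j k)) a b = L (exz ep c a b) + L' (exz ep d a b)"
proof -
 obtain N where N: "!!i j k. i < - N | j < - N ==> c i j k = 0" using assms(3) by (rule bounded_familyE) blast
 obtain N' where N': "!!i j k. i < - N' | j < - N' ==> d i j k = 0" using assms(4) by (rule bounded_familyE) blast
 let ?N = "max N N'" and ?T = "nat (a + max N N')"
 have e: "exz ep c a b = (SUM k<=?T. SUM m<=?T. (((- of_nat k) gchoose m) * ep ^ m) *. c (a - int k - int m) (b + int m) k)"
  "exz ep d a b = (SUM k<=?T. SUM m<=?T. (((- of_nat k) gchoose m) * ep ^ m) *. d (a - int k - int m) (b + int m) k)"
  by (rule expand_z_large_eq[of ?N], (rule N N', linarith), linarith)+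
 have "exz ep (%i j k. L (c i j k) + L' (d i j k)) a b
  = (SUM k<=?T. SUM m<=?T. (((- of_nat k) gchoose m) * ep ^ m) *. (L (c (a - int k - int m) (b + int m) k) + L' (d (a - int k - int m) (b + int m) k)))"
 proof (rule expand_z_large_eq[of ?N])
  fix i j k assume "i < - ?N | j < - ?N"
  hence "c i j k = 0" "d i j k = 0" by (auto intro!: N N')
  thus "L (c i j k) + L' (d i j k) = 0" by (simp add: lin_zero[OF assms(1)] lin_zero[OF assms(2)])
 qed linarith
 thus ?thesis unfolding e
  by (simp add: lin_sum[OF assms(1)] lin_sum[OF assms(2)] lin_scale[OF assms(1)] lin_scale[OF assms(2)]
    scaleC_add_right sum.distrib)
qed

lemma expand_w_linear:
 fixes L :: "'a::complex_vector => 'c::complex_vector" and L' :: "'b::complex_vector => 'c"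
 assumes "clinear L" "clinear L'" "bfam c" "bfam d"
 shows "exw ep (%i j k. L (c i j k) + L' (d i j k)) a b = L (exw ep c a b) + L' (exw ep d a b)"
 unfolding expand_w_large_eq expand_z_linear[OF assms(1,2) bounded_swap[OF assms(3)] bounded_swap[OF assms(4)], symmetric]
 by (simp add: lin_scale[OF assms(1)] lin_scale[OF assms(2)] scaleC_add_right)

lemma pascal_sum:
 fixes x :: "nat => 'a::complex_vector"
 shows "(SUM m<=Suc T. ((r gchoose m) * ep ^ m) *. x m) + ep *. (SUM m<=T. ((r gchoose m) * ep ^ m) *. x (Suc m))
  = (SUM m<=Suc T. (((r + 1) gchoose m) * ep ^ m) *. x m)"
proof -
 have t: "((r gchoose Suc m) * ep ^ Suc m) *. x (Suc m) + ep *. ((r gchoose m) * ep ^ m) *. x (Suc m)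
  = (((r + 1) gchoose Suc m) * ep ^ Suc m) *. x (Suc m)" for m
  unfolding scaleC_scaleC scaleC_add_left[symmetric] gbinomial_Suc_Suc by (simp add: algebra_simps)
 show ?thesis
  unfolding sum.atMost_Suc_shift cv_scale_sum_right add.assoc sum.distrib[symmetric] t by simp
qed

lemma sum_atMost_Suc_zero: "f 0 = 0 ==> sum f {..Suc T} = (SUM k<=T. f (Suc k))"
 for f :: "nat => 'a::comm_monoid_add"
 unfolding sum.atMost_Suc_shift by simp

text \<open>Multiplication by z + ep w lowers k by one, by Pascal's rule; the absence of terms with
  k = 0 keeps k a natural number.\<close>

lemma expand_z_kshift:
 assumes c: "bfam c" and 0: "!!i j. c i j 0 = 0"
 shows "exz ep c (a + 1) b + ep *. exz ep c a (b + 1) = exz ep (%i j k. c i j (Suc k)) a b"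
proof -
 obtain N where N: "!!i j k. i < - N | j < - N ==> c i j k = 0" using c by (rule bounded_familyE) blast
 let ?T = "nat (a + 1 + N)"
 let ?x = "%k m. c (a - int k - int m) (b + int m) (Suc k)"
 have 1: "exz ep c (a + 1) b = (SUM k<=?T. SUM m<=Suc ?T. (((- of_nat (Suc k)) gchoose m) * ep ^ m) *. ?x k m)"
 proof -
  have z: "?x k m = 0" if "m > ?T | k >= ?T" for k m by (rule N) (use that in linarith)
  have "exz ep c (a + 1) b = (SUM k<=Suc ?T. SUM m<=Suc ?T. (((- of_nat k) gchoose m) * ep ^ m) *. c (a + 1 - int k - int m) (b + int m) k)"
   by (rule expand_z_large_eq[of N, OF N]) linarith+
  also have "... = (SUM k<=?T. SUM m<=Suc ?T. (((- of_nat (Suc k)) gchoose m) * ep ^ m) *. c (a + 1 - int (Suc k) - int m) (b + int m) (Suc k))"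
   by (rule sum_atMost_Suc_zero) (simp add: 0 del: sum.atMost_Suc)
  finally show ?thesis by (simp add: algebra_simps del: sum.atMost_Suc)
 qed
 have 2: "exz ep c a (b + 1) = (SUM k<=?T. SUM m<=?T. (((- of_nat (Suc k)) gchoose m) * ep ^ m) *. ?x k (Suc m))"
 proof -
  have "exz ep c a (b + 1) = (SUM k<=Suc ?T. SUM m<=Suc ?T. (((- of_nat k) gchoose m) * ep ^ m) *. c (a - int k - int m) (b + 1 + int m) k)"
   by (rule expand_z_large_eq[of N, OF N]) linarith+
  also have "... = (SUM k<=?T. SUM m<=Suc ?T. (((- of_nat (Suc k)) gchoose m) * ep ^ m) *. c (a - int (Suc k) - int m) (b + 1 + int m) (Suc k))"
   by (rule sum_atMost_Suc_zero) (simp add: 0 del: sum.atMost_Suc)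
  also have "... = (SUM k<=?T. SUM m<=?T. (((- of_nat (Suc k)) gchoose m) * ep ^ m) *. c (a - int (Suc k) - int m) (b + 1 + int m) (Suc k))"
  proof (rule sum.cong[OF refl])
   fix k
   have "c (a - int (Suc k) - int (Suc ?T)) (b + 1 + int (Suc ?T)) (Suc k) = 0" by (rule N) linarith
   thus "(SUM m<=Suc ?T. (((- of_nat (Suc k)) gchoose m) * ep ^ m) *. c (a - int (Suc k) - int m) (b + 1 + int m) (Suc k))
    = (SUM m<=?T. (((- of_nat (Suc k)) gchoose m) * ep ^ m) *. c (a - int (Suc k) - int m) (b + 1 + int m) (Suc k))" by simp
  qed
  finally show ?thesis by (simp add: algebra_simps)
 qed
 have 3: "exz ep (%i j k. c i j (Suc k)) a b = (SUM k<=?T. SUM m<=Suc ?T. (((- of_nat k) gchoose m) * ep ^ m) *. ?x k m)"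
 proof -
  have "exz ep (%i j k. c i j (Suc k)) a b = (SUM k<=?T. SUM m<=?T. (((- of_nat k) gchoose m) * ep ^ m) *. ?x k m)"
   by (rule expand_z_large_eq[of N]) (use N in auto)
  also have "... = (SUM k<=?T. SUM m<=Suc ?T. (((- of_nat k) gchoose m) * ep ^ m) *. ?x k m)"
  proof (rule sum.cong[OF refl])
   fix k
   have "?x k (Suc ?T) = 0" by (rule N) linarith
   thus "(SUM m<=?T. (((- of_nat k) gchoose m) * ep ^ m) *. ?x k m) = (SUM m<=Suc ?T. (((- of_nat k) gchoose m) * ep ^ m) *. ?x k m)" by simp
  qed
  finally show ?thesis .
 qed
 have r: "- of_nat (Suc k) + 1 = (- of_nat k :: complex)" for k by simp
 show ?thesis unfolding 1 2 3 cv_scale_sum_right sum.distrib[symmetric]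
  using pascal_sum[of "- of_nat (Suc k)" ep "?x k" ?T for k, unfolded r] by (simp only: cv_scale_sum_right)
qed

lemma expand_w_kshift:
 assumes c: "bfam c" and 0: "!!i j. c i j 0 = 0" and e: "ep ~= 0"
 shows "exw ep c (a + 1) b + ep *. exw ep c a (b + 1) = exw ep (%i j k. c i j (Suc k)) a b"
proof -
 let ?d = "%i j k. inverse ep ^ k *. c j i k"
 note b = bounded_swap[OF c, of "%k. inverse ep ^ k"]
 have "exw ep c (a + 1) b + ep *. exw ep c a (b + 1)
  = ep *. (exz (inverse ep) ?d (b + 1) a + inverse ep *. exz (inverse ep) ?d b (a + 1))"
  unfolding expand_w_large_eq using e by (simp add: scaleC_add_right scaleC_scaleC scaleC_one)
 also have "... = ep *. exz (inverse ep) (%i j k. ?d i j (Suc k)) b a"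
  by (subst expand_z_kshift[OF b]) (simp_all add: 0)
 also have "... = exz (inverse ep) (%i j k. ep *. ?d i j (Suc k) + 0) b a"
 proof -
  have b': "bfam (%i j k. ?d i j (Suc k))"
   using bounded_familyE[OF b] bounded_familyI by (metis (no_types, lifting))
  have "bfam (%i j k. 0 :: 'a)" by (rule bounded_familyI) simp
  from expand_z_linear[OF lin_scaled[OF lin_id(2)] lin_0 b' this, of "inverse ep" ep b a] show ?thesis by simp
 qed
 also have "... = exw ep (%i j k. c i j (Suc k)) a b"
 proof -
  have r: "ep * (inverse ep * x) = x" for x using e by (simp add: mult.assoc[symmetric])
  show ?thesis unfolding expand_w_large_eq by (simp add: scaleC_scaleC r)
 qed
 finally show ?thesis .
qed

lemma lowb_expand_z: "bfam c ==> lowb (%b a. exz ep c a b)"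
proof -
 assume "bfam c"
 then obtain N where N: "!!i j k. i < - N | j < - N ==> c i j k = 0" by (rule bounded_familyE) blast
 show ?thesis
 proof (rule lowbI[of "- N" _ "%a. - N - \<bar>a + N\<bar>"])
  fix a b assume "a < - N"
  hence "c (a - int k - int m) (b + int m) k = 0" for k m by (intro N) linarith
  thus "exz ep c a b = 0" by (subst expand_z_large_eq[of N c a "nat (a + N)"]) (use N in auto)
 next
  fix a b assume b: "b < - N - \<bar>a + N\<bar>"
  have "c (a - int k - int m) (b + int m) k = 0" for k m by (rule N) (use b in linarith)
  thus "exz ep c a b = 0" by (subst expand_z_large_eq[of N c a "nat (a + N)"]) (use N in auto)
 qed
qed

lemma lowb_expand_w: "bfam c ==> lowb (%a b. exw ep c a b)"
 unfolding expand_w_large_eq by (rule lowb_expand_z[OF bounded_swap])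

subsection \<open>Multiplication by a linear form\<close>

text \<open>Multiplication by the linear form al + p z + q w, where the coefficient of
  \<open>z^-a w^-b\<close> is \<open>F a b\<close>.\<close>

definition lform :: "ratfun => complex => complex => (int => int => ratfun) => int => int => ratfun"
 where "lform al p q F a b = al * F a b + p *. F (a + 1) b + q *. F a (b + 1)"

lemma int_induct_above:
 assumes "!!m. m < m0 ==> P m" "!!m. P m ==> P (m + 1)"
 shows "P (m :: int)"
proof (cases "m < m0")
 case False
 hence "m0 - 1 <= m" by simp
 thus ?thesis by (induction m rule: int_ge_induct) (use assms in auto)
qed (rule assms(1))

text \<open>The equation determines each coefficient from earlier ones, starting where
  \<open>F\<close> vanishes. If q is nonzero the induction runs over m, for all n at once; otherwise
  it runs over n for fixed m.\<close>

lemma lform_injective: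
 assumes "lowb F" "!!n m. lform al p q F n m = 0" "p = 0 ==> q = 0 ==> al ~= 0"
 shows "F n m = 0"
proof -
 obtain m0 n0 where 0: "!!m n. m < m0 ==> F n m = 0" "!!m n. n < n0 m ==> F n m = 0"
  using assms(1) unfolding lowb_def by metis
 note eq = assms(2)[unfolded lform_def]
 show ?thesis
 proof (cases "q = 0")
  case False
  have "ALL n. F n m = 0"
  proof (rule int_induct_above[of m0])
   fix m assume z: "ALL n. F n m = 0"
   show "ALL n. F n (m + 1) = 0"
   proof
    fix n show "F n (m + 1) = 0" using eq[of n m] z False by simp
   qed
  qed (use 0(1) in simp)
  thus ?thesis by simp
 next
  case q: True
  show ?thesis
  proof (cases "p = 0")
   case True thus ?thesis using eq[of n m] q assms(3) by simp
  next
   case False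
   show ?thesis
   proof (rule int_induct_above[of "n0 m" "%n. F n m = 0"])
    fix n assume "F n m = 0"
    thus "F (n + 1) m = 0" using eq[of n m] q False by simp
   qed (use 0(2) in simp)
  qed
 qed
qed

text \<open>Division by al + p u in one variable. The last clause keeps the solution zero wherever
  the datum is, so that boundedness of a family is preserved.\<close>

lemma recursion_solution:
 assumes "p ~= 0"
 shows "EX e :: nat => ratfun. e 0 = 0 & (ALL k. al * e k + p *. e (Suc k) = d k) & ((ALL k. d k = 0) --> (ALL k. e k = 0))"
proof -
 define e where "e = rec_nat 0 (%k x. inverse p *. (d k - al * x))"
 have e: "e 0 = 0" "e (Suc k) = inverse p *. (d k - al * e k)" for k by (simp_all add: e_def)
 have "e k = 0" if "ALL k. d k = 0" for k by (induction k) (simp_all add: e that)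
 thus ?thesis using assms by (intro exI[of _ e]) (simp add: e scaleC_scaleC scaleC_one)
qed

lemma recursion_solution_int:
 assumes "p ~= 0" "!!j. j < - N ==> d j = 0"
 shows "EX e :: int => ratfun. (ALL j. al * e j + p *. e (j + 1) = d j) & (ALL j<(- N). e j = 0) & ((ALL j. d j = 0) --> (ALL j. e j = 0))"
proof -
 obtain e where e: "e 0 = 0" "!!k. al * e k + p *. e (Suc k) = d (int k - N)" "(ALL k. d (int k - N) = 0) --> (ALL k. e k = 0)"
  using recursion_solution[OF assms(1), of al "%k. d (int k - N)"] by auto
 define e' where "e' j = (if j < - N then 0 else e (nat (j + N)))" for j
 have "al * e' j + p *. e' (j + 1) = d j" for j
 proof -
  consider "j + 1 < - N" | "j + 1 = - N" | "j >= - N" by linarith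
  thus ?thesis
  proof cases
   case 3
   hence "nat (j + 1 + N) = Suc (nat (j + N))" "int (nat (j + N)) - N = j" by simp_all
   thus ?thesis using e(2)[of "nat (j + N)"] 3 by (simp add: e'_def)
  next
   case 2
   hence "j < - N" "nat (j + 1 + N) = 0" by simp_all
   thus ?thesis using assms(2)[of j] e(1) by (simp add: e'_def)
  qed (simp_all add: e'_def assms(2))
 qed
 thus ?thesis using e(3) by (intro exI[of _ e']) (auto simp: e'_def)
qed

lemma lin_mult: "clinear (%x :: ratfun. al * x)"
 by (rule clinearI) (simp_all add: scaleC_ratfun algebra_simps)

lemma expand_lform:
 assumes "bfam c"
 shows "exz ep (%i j k. lform al p q (%i j. c i j k) i j) = lform al p q (exz ep c)"
  "exw ep (%i j k. lform al p q (%i j. c i j k) i j) = lform al p q (exw ep c)"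
  "bfam (%i j k. lform al p q (%i j. c i j k) i j)"
proof -
 let ?d = "%i j k. p *. c (i + 1) j k + q *. c i (j + 1) k"
 note b = bounded_shift[OF assms, of 1 0, simplified] bounded_shift[OF assms, of 0 1, simplified]
 note sz = expand_z_shift[of ep c 1 0, simplified] expand_z_shift[of ep c 0 1, simplified]
 note sw = expand_w_shift[of ep c 1 0, simplified] expand_w_shift[of ep c 0 1, simplified]
 have bd: "bfam ?d" by (rule bounded_combine[OF b]) simp
 have l: "(%i j k. lform al p q (%i j. c i j k) i j) = (%i j k. al * c i j k + ?d i j k)"
  by (simp add: lform_def fun_eq_iff add.assoc)
 note s = lin_scaled[OF lin_id(2)]
 show "exz ep (%i j k. lform al p q (%i j. c i j k) i j) = lform al p q (exz ep c)"
  unfolding l by (intro ext) (simp only: expand_z_linear[OF lin_mult lin_id(2) assms bd] expand_z_linear[OF s s b]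
    sz lform_def add.assoc)
 show "exw ep (%i j k. lform al p q (%i j. c i j k) i j) = lform al p q (exw ep c)"
  unfolding l by (intro ext) (simp only: expand_w_linear[OF lin_mult lin_id(2) assms bd] expand_w_linear[OF s s b]
    sw lform_def add.assoc)
 show "bfam (%i j k. lform al p q (%i j. c i j k) i j)"
  unfolding l by (rule bounded_combine[OF assms bd]) simp
qed

text \<open>The condition on p and q restricts the form to al, al + q w, al + p z or al + p (z + ep
  w). Division by al is termwise; in the other cases it is a recursion in one index of the family,
  namely j, i or k.\<close>

lemma lform_solution:
 assumes c: "bfam c" and pq: "p = 0 | q = 0 | q = ep * p" and e: "ep ~= 0" and al: "p = 0 ==> q = 0 ==> al ~= 0"
 obtains c' where "bfam c'" "lform al p q (exz ep c') = exz ep c"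
  "lform al p q (exw ep c') = exw ep c"
proof -
 obtain N where N: "!!i j k. i < - N | j < - N ==> c i j k = 0" using c by (rule bounded_familyE) blast
 note result = that
 have direct: thesis if "bfam c'" "!!i j k. lform al p q (%i j. c' i j k) i j = c i j k" for c'
  using expand_lform(1,2)[OF that(1), of _ al p q] by (intro result[OF that(1)]) (simp_all add: that(2))
 consider "p = 0" "q = 0" | "p = 0" "q ~= 0" | "p ~= 0" "q = 0" | "p ~= 0" "q = ep * p" using pq by blast
 thus thesis
 proof cases
  case 1
  show thesis
  proof (rule direct)
   show "bfam (%i j k. inverse al * c i j k)" by (rule bounded_familyI[of N]) (simp add: N)
  qed (use 1 al in "simp add: lform_def")
 next
  case 2
  have "ALL i k. EX e :: int => ratfun. (ALL j. al * e j + q *. e (j + 1) = c i j k) & (ALL j<(- N). e j = 0) & ((ALL j. c i j k = 0) --> (ALL j. e j = 0))"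
   by (intro allI recursion_solution_int[OF 2(2)] N) simp
  then obtain e where e: "!!i k j. al * e i k j + q *. e i k (j + 1) = c i j k" "!!i k j. j < - N ==> e i k j = 0"
   "!!i k j. (ALL j. c i j k = 0) ==> e i k j = 0" by metis
  show thesis
  proof (rule direct)
   show "bfam (%i j k. e i k j)" by (rule bounded_familyI[of N]) (use e(2,3) N in blast)
  qed (use 2 e(1) in "simp add: lform_def")
 next
  case 3
  have "ALL j k. EX e :: int => ratfun. (ALL i. al * e i + p *. e (i + 1) = c i j k) & (ALL i<(- N). e i = 0) & ((ALL i. c i j k = 0) --> (ALL i. e i = 0))"
   by (intro allI recursion_solution_int[OF 3(1)] N) simp
  then obtain e where e: "!!j k i. al * e j k i + p *. e j k (i + 1) = c i j k" "!!j k i. i < - N ==> e j k i = 0"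
   "!!j k i. (ALL i. c i j k = 0) ==> e j k i = 0" by metis
  show thesis
  proof (rule direct)
   show "bfam (%i j k. e j k i)" by (rule bounded_familyI[of N]) (use e(2,3) N in blast)
  qed (use 3 e(1) in "simp add: lform_def")
 next
  case 4
  have "ALL i j. EX e :: nat => ratfun. e 0 = 0 & (ALL k. al * e k + p *. e (Suc k) = c i j k) & ((ALL k. c i j k = 0) --> (ALL k. e k = 0))"
   by (intro allI recursion_solution[OF 4(1)])
  then obtain c' where c': "!!i j. c' i j 0 = 0" "!!i j k. al * c' i j k + p *. c' i j (Suc k) = c i j k"
   "!!i j k. (ALL k. c i j k = 0) ==> c' i j k = (0 :: ratfun)" by metis
  have b: "bfam c'" and b': "bfam (%i j k. c' i j (Suc k))" by (rule bounded_familyI[of N]; use c'(3) N in blast)+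
  have cc: "c = (%i j k. al * c' i j k + p *. c' i j (Suc k))" by (simp add: c'(2))
  note s = lin_scaled[OF lin_id(2)]
  show thesis
  proof (rule that[OF b])
   show "lform al p q (exz ep c') = exz ep c"
    unfolding cc by (intro ext) (simp only: expand_z_linear[OF lin_mult s b b'] expand_z_kshift[OF b c'(1), symmetric]
     lform_def 4(2) scaleC_add_right scaleC_scaleC mult.commute[of ep p] add.assoc)
   show "lform al p q (exw ep c') = exw ep c"
    unfolding cc by (intro ext) (simp only: expand_w_linear[OF lin_mult s b b'] expand_w_kshift[OF b c'(1) e, symmetric]
     lform_def 4(2) scaleC_add_right scaleC_scaleC mult.commute[of ep p] add.assoc)
  qed
 qed
qed

subsection \<open>Iterated expansions\<close>

lemma xsh_var:
 assumes "f : conf S"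
 shows "xsh J (var l * f) $$ n = var l * xsh J f $$ n + (if l : J then xsh J f $$ (n + 1) else 0)"
proof -
 have "xsh J (var l * f) = shift_pt J l * xsh J f"
  using lau_hom(2)[OF adm_shift conf_var[of l UNIV] conf_CU[OF assms], of J] by (simp add: xsh_eq)
 moreover have "fls_X_inv * F = fls_shift 1 F" for F :: "ratfun fls"
  by (simp add: fls_X_inv_times_conv_shift)
 ultimately show ?thesis by (simp add: shift_pt_def distrib_right)
qed

text \<open>The coefficient of \<open>z^-a w^-b\<close> in f with z_l translated by z for l in
  \<open>K\<close> and by w for l in \<open>J\<close>; the expansion in z is followed by that of
  each coefficient in w. A label in both sets is translated by z + w.\<close>

definition EE :: "nat set => nat set => ratfun => int => int => ratfun"
 where "EE J K f a b = xsh J (xsh K f $$ a) $$ b"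

lemma EE_linear: "f : conf S ==> g : conf S ==> EE J K (c *. f + g) a b = c *. EE J K f a b + EE J K g a b"
 by (simp add: EE_def xsh_linear[where S = S] xsh_conf)

lemma EE_var: "f : conf S ==> EE J K (var l * f) a b = lform (var l) (if l : K then 1 else 0) (if l : J then 1 else 0) (EE J K f) a b"
 using xsh_add[of "var l * xsh K f $$ a" UNIV "xsh K f $$ (a + 1)" J b]
  conf_CU[OF xsh_conf[of f S K a]] conf_CU[OF xsh_conf[of f S K "a + 1"]]
 by (simp add: EE_def xsh_var[of _ S] xsh_var[OF xsh_conf] lform_def conf_mult conf_var scaleC_one)

lemma EE_1: "EE J K 1 a b = (if a = 0 & b = 0 then 1 else 0)"
 by (simp add: EE_def)

lemma EE_lowb: "lowb (%b a. EE J K f a b)"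
 by (rule lowbI[of "fsubdeg (xsh K f)" _ "%a. fsubdeg (xsh J (xsh K f $$ a))"]) (simp_all add: EE_def)

lemma lowb_diff: "lowb F ==> lowb G ==> lowb (%n m. F n m - G n m :: 'a::ab_group_add)"
proof -
 assume "lowb F" "lowb G"
 then obtain K N K' N' where "!!m n. m < K ==> F n m = 0" "!!m n. n < N m ==> F n m = 0"
  "!!m n. m < K' ==> G n m = 0" "!!m n. n < N' m ==> G n m = 0"
  unfolding lowb_def by metis
 thus ?thesis by (intro lowbI[of "min K K'" _ "%m. min (N m) (N' m)"]) simp_all
qed

lemma lform_diff: "lform al p q (%a b. F a b - G a b) a b = lform al p q F a b - lform al p q G a b"
 by (simp add: lform_def algebra_simps cv_scale_right_diff_distrib)

lemma lform_cancel:
 assumes "lowb F" "lowb G" "!!a b. lform al p q F a b = lform al p q G a b" "p = 0 ==> q = 0 ==> al ~= 0"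
 shows "F = G"
proof (intro ext)
 fix a b
 have "(%a b. F a b - G a b) a b = 0"
  by (rule lform_injective[OF lowb_diff[OF assms(1,2)], of al p q]) (simp_all add: lform_diff assms(3,4))
 thus "F a b = G a b" by simp
qed

lemma lform_cancel_swap:
 assumes "lowb (%b a. F a b)" "lowb (%b a. G a b)" "!!a b. lform al p q F a b = lform al p q G a b" "p = 0 ==> q = 0 ==> al ~= 0"
 shows "F = G"
proof -
 have "(%b a. F a b) = (%b a. G a b)"
  by (rule lform_cancel[OF assms(1,2), of al q p]) (use assms(3,4) in "auto simp: lform_def add_ac")
 thus ?thesis by (simp add: fun_eq_iff)
qed

lemma expand_delta:
 "exz ep (%i j k. if i = 0 & j = 0 & k = 0 then 1 else 0) a b = (if a = 0 & b = 0 then 1 else 0 :: ratfun)"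
 "exw ep (%i j k. if i = 0 & j = 0 & k = 0 then 1 else 0) a b = (if a = 0 & b = 0 then 1 else 0 :: ratfun)"
proof -
 show z: "exz ep (%i j k. if i = 0 & j = 0 & k = 0 then 1 else 0) a b = (if a = 0 & b = 0 then 1 else 0 :: ratfun)" for ep a b
 proof -
  have "exz ep (%i j k. if i = 0 & j = 0 & k = 0 then 1 else 0) a b
   = Sum_any (%x :: nat \<times> nat. if x = (0, 0) then (if a = 0 & b = 0 then 1 else 0 :: ratfun) else 0)"
   unfolding expand_z_large_def
  proof (rule Sum_any.cong)
   fix x :: "nat \<times> nat"
   obtain k m where x: "x = (k, m)" by (cases x)
   show "(case x of (k, m) => ((- of_nat k gchoose m) * ep ^ m) *. (if a - int k - int m = 0 & b + int m = 0 & k = 0 then 1 else 0))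
    = (if x = (0, 0) then (if a = 0 & b = 0 then 1 else 0 :: ratfun) else 0)"
    unfolding x by (cases k; cases m) (simp_all add: scaleC_one)
  qed
  thus ?thesis by (simp only: Sum_any.delta)
 qed
 have eq: "(%i j k. inverse ep ^ k *. (if j = 0 & i = 0 & k = 0 then 1 else 0 :: ratfun))
  = (%i j k. if i = 0 & j = 0 & k = 0 then 1 else 0)" by (auto simp: fun_eq_iff scaleC_one)
 show "exw ep (%i j k. if i = 0 & j = 0 & k = 0 then 1 else 0) a b = (if a = 0 & b = 0 then 1 else 0 :: ratfun)"
  unfolding expand_w_large_eq eq z by auto
qed

lemma expansions_combine:
 fixes L :: "'a::complex_vector => 'c::complex_vector" and L' :: "'b::complex_vector => 'c"
 assumes "clinear L" "clinear L'" "same_exp ep F G" "same_exp ep F' G'"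
 shows "same_exp ep (%a b. L (F a b) + L' (F' a b)) (%a b. L (G a b) + L' (G' a b))"
proof -
 obtain c where c: "bfam c" "F = exz ep c" "G = exw ep c"
  using assms(3) unfolding expansions_of_same_element_def by blast
 obtain d where d: "bfam d" "F' = exz ep d" "G' = exw ep d"
  using assms(4) unfolding expansions_of_same_element_def by blast
 have z: "L 0 = 0" "L' 0 = 0" using assms(1,2) by (simp_all add: lin_zero)
 obtain N N' where N: "!!i j k. i < - N | j < - N ==> c i j k = 0" and N': "!!i j k. i < - N' | j < - N' ==> d i j k = 0"
  using bounded_familyE[OF c(1)] bounded_familyE[OF d(1)] by metis
 have "L (c i j k) + L' (d i j k) = 0" if "i < - max N N' | j < - max N N'" for i j k
 proof -
  have "c i j k = 0" "d i j k = 0" using that by (auto intro!: N N')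
  thus ?thesis by (simp add: z)
 qed
 from bounded_familyI[OF this] show ?thesis
  unfolding expansions_of_same_element_def c d
  by (intro exI[of _ "%i j k. L (c i j k) + L' (d i j k)"] conjI ext)
    (simp_all add: expand_z_linear[OF assms(1,2) c(1) d(1)] expand_w_linear[OF assms(1,2) c(1) d(1)])
qed

text \<open>Both expansions turn multiplication by \<open>z\<^sub>l\<close> into the same operation \<^const>\<open>lform\<close>, which is
  injective on expansions and invertible on their common presentations. Hence the functions with a
  common presentation are closed under multiplication by the generators of the ring.\<close>

lemma common_presentation:
 assumes lin1: "!!f g c a b. f : conf S ==> g : conf S ==> Ph1 (c *. f + g) a b = c *. Ph1 f a b + Ph1 g a b"
  and lin2: "!!f g c a b. f : conf S ==> g : conf S ==> Ph2 (c *. f + g) a b = c *. Ph2 f a b + Ph2 g a b"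
  and var1: "!!l f a b. l : S ==> f : conf S ==> Ph1 (var l * f) a b = lform (var l) (P l) (Q l) (Ph1 f) a b"
  and var2: "!!l f a b. l : S ==> f : conf S ==> Ph2 (var l * f) a b = lform (var l) (P l) (Q l) (Ph2 f) a b"
  and low1: "!!f. f : conf S ==> lowb (%b a. Ph1 f a b)" and low2: "!!f. f : conf S ==> lowb (Ph2 f)"
  and one1: "!!a b. Ph1 1 a b = (if a = 0 & b = 0 then 1 else 0)" and one2: "!!a b. Ph2 1 a b = (if a = 0 & b = 0 then 1 else 0)"
  and wt: "!!l. l : S ==> P l = 0 | Q l = 0 | Q l = ep * P l"
   "!!l m. l : S ==> m : S ==> P l - P m = 0 | Q l - Q m = 0 | Q l - Q m = ep * (P l - P m)"
  and e: "ep ~= 0" and f: "f : conf S"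
 shows "same_exp ep (Ph1 f) (Ph2 f)"
proof -
 define good where "good g \<longleftrightarrow> g : conf S & same_exp ep (Ph1 g) (Ph2 g)" for g
 note s = lin_scaled[OF lin_id(2)]
 have good_lin: "good (c *. g + h)" if g: "good g" and h: "good h" for c g h
 proof -
  have "Ph1 (c *. g + h) = (%a b. c *. Ph1 g a b + Ph1 h a b)" "Ph2 (c *. g + h) = (%a b. c *. Ph2 g a b + Ph2 h a b)"
   using g h by (auto simp: good_def fun_eq_iff lin1 lin2)
  thus ?thesis using g h expansions_combine[OF s lin_id(2), of ep "Ph1 g" "Ph2 g" "Ph1 h" "Ph2 h" c]
   by (auto simp: good_def intro!: conf_add conf_scaleC)
 qed
 have good_1: "good 1"
 proof -
  have "bfam (%i j k. if i = 0 & j = 0 & k = 0 then 1 else 0 :: ratfun)" by (rule bounded_familyI[of 0]) auto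
  thus ?thesis unfolding good_def expansions_of_same_element_def
   by (intro conjI conf_closed(3) exI[of _ "%i j k. if i = 0 & j = 0 & k = 0 then 1 else 0"])
     (auto simp: fun_eq_iff one1 one2 expand_delta)
 qed
 have good_0: "good 0" using good_lin[OF good_1 good_1, of "- 1"] by (simp add: scaleC_one)
 have good_lform: "good (L * g)" if g: "good g" and "L * g : conf S" "!!a b. Ph1 (L * g) a b = lform al p q (Ph1 g) a b"
  "!!a b. Ph2 (L * g) a b = lform al p q (Ph2 g) a b" for L g al p q
 proof -
  obtain c where c: "bfam c" "Ph1 g = exz ep c" "Ph2 g = exw ep c"
   using g unfolding good_def expansions_of_same_element_def by blast
  have "Ph1 (L * g) = exz ep (%i j k. lform al p q (%i j. c i j k) i j)"
   "Ph2 (L * g) = exw ep (%i j k. lform al p q (%i j. c i j k) i j)"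
   by (intro ext, simp only: that(3,4) c(2,3) expand_lform(1,2)[OF c(1)])+
  thus ?thesis using expand_lform(3)[OF c(1)] that(2) unfolding good_def expansions_of_same_element_def by blast
 qed
 \<comment> \<open>In both expansions g is the linear form times h. Dividing the presentation of g
   gives a candidate for h, and injectivity of the form identifies its expansions with those of
   h.\<close>
 have good_inv: "good h" if g: "good g" and h: "h : conf S" "!!a b. Ph1 g a b = lform al p q (Ph1 h) a b"
  "!!a b. Ph2 g a b = lform al p q (Ph2 h) a b" and pq: "p = 0 | q = 0 | q = ep * p" and al: "al ~= 0" for g h al p q
 proof -
  obtain c where c: "bfam c" "Ph1 g = exz ep c" "Ph2 g = exw ep c"
   using g unfolding good_def expansions_of_same_element_def by blast
  obtain c' where c': "bfam c'" "lform al p q (exz ep c') = exz ep c"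
   "lform al p q (exw ep c') = exw ep c"
   using lform_solution[OF c(1) pq e, of al] al by blast
  have "Ph1 h = exz ep c'"
   by (rule lform_cancel_swap[OF low1[OF h(1)] lowb_expand_z[OF c'(1)], of al p q]) (simp_all add: h(2)[symmetric] c c'(2) al)
  moreover have "Ph2 h = exw ep c'"
   by (rule lform_cancel[OF low2[OF h(1)] lowb_expand_w[OF c'(1)], of al p q]) (simp_all add: h(3)[symmetric] c c'(3) al)
  ultimately show ?thesis using c'(1) h(1) unfolding good_def expansions_of_same_element_def by blast
 qed
 have good_conf: "good g ==> g : conf S" for g by (simp add: good_def)
 have diff_lform: "Ph1 ((var l - var m) * g) a b = lform (var l - var m) (P l - P m) (Q l - Q m) (Ph1 g) a b"
   "Ph2 ((var l - var m) * g) a b = lform (var l - var m) (P l - P m) (Q l - Q m) (Ph2 g) a b"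
  if "l : S" "m : S" "g : conf S" for l m g a b
 proof -
  have eq: "(var l - var m) * g = (- 1) *. (var m * g) + var l * g" by (simp add: scaleC_ratfun ratC_uminus algebra_simps)
  have c: "var m * g : conf S" "var l * g : conf S" using that by (auto intro!: conf_mult conf_var)
  show "Ph1 ((var l - var m) * g) a b = lform (var l - var m) (P l - P m) (Q l - Q m) (Ph1 g) a b"
   "Ph2 ((var l - var m) * g) a b = lform (var l - var m) (P l - P m) (Q l - Q m) (Ph2 g) a b"
   unfolding eq lin1[OF c] lin2[OF c] var1[OF that(1,3)] var1[OF that(2,3)] var2[OF that(1,3)] var2[OF that(2,3)]
   by (simp_all add: lform_def complex_vector.scale_left_diff_distrib scaleC_add_right scaleC_one algebra_simps)
 qed
 \<comment> \<open>The claim is strengthened to multiplication by f of every good g, which is what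
   the induction over products and inverted generators requires.\<close>
 have "f : conf S & (ALL g. good g --> good (f * g))"
  using f unfolding conf_def
 proof (induction rule: cring_induct)
  case (const c) thus ?case using good_lin[OF _ good_0, of _ c] by (simp add: scaleC_ratfun)
 next
  case (var l) thus ?case
   using good_lform[of _ "var l" "var l" "P l" "Q l"] var1[OF var] var2[OF var] good_conf conf_mult[OF conf_var[OF var]]
   by (auto intro: cring_var)
 next
  case (inv l)
  have i: "inverse (var l) : conf S" by (rule conf_inv[OF inv])
  have "good (inverse (var l) * g)" if g: "good g" for g
  proof (rule good_inv[OF g, of _ "var l" "P l" "Q l"])
   show h: "inverse (var l) * g : conf S" by (rule conf_mult[OF i good_conf[OF g]])
   have eq: "var l * (inverse (var l) * g) = g" by (simp add: mult.assoc[symmetric])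
   show "Ph1 g a b = lform (var l) (P l) (Q l) (Ph1 (inverse (var l) * g)) a b"
    "Ph2 g a b = lform (var l) (P l) (Q l) (Ph2 (inverse (var l) * g)) a b" for a b
    using var1[OF inv h, of a b] var2[OF inv h, of a b] unfolding eq .
  qed (use wt(1)[OF inv] in simp_all)
  thus ?case using i unfolding conf_def by blast
 next
  case (diff l m)
  hence lm: "l : S" "m : S" "l ~= m" by (auto simp: offdiag_def)
  have i: "inverse (var l - var m) : conf S" unfolding conf_def by (rule cring_invdiff[OF diff])
  have u: "var l - var m ~= 0" using lm by simp
  note u1 = right_inverse[OF u]
  have "good (inverse (var l - var m) * g)" if g: "good g" for g
  proof (rule good_inv[OF g, of _ "var l - var m" "P l - P m" "Q l - Q m"])
   show h: "inverse (var l - var m) * g : conf S" by (rule conf_mult[OF i good_conf[OF g]])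
   have eq: "(var l - var m) * (inverse (var l - var m) * g) = g" by (simp only: mult.assoc[symmetric] u1 mult_1_left)
   show "Ph1 g a b = lform (var l - var m) (P l - P m) (Q l - Q m) (Ph1 (inverse (var l - var m) * g)) a b"
    "Ph2 g a b = lform (var l - var m) (P l - P m) (Q l - Q m) (Ph2 (inverse (var l - var m) * g)) a b" for a b
    using diff_lform[OF lm(1,2) h, of a b] unfolding eq .
  qed (use wt(2)[OF lm(1,2)] u in simp_all)
  thus ?case using i unfolding conf_def by blast
 next
  case (add f g)
  thus ?case using good_lin[of "f * h" "g * h" 1 for h] by (auto simp: distrib_right scaleC_one intro: cring_add)
 next
  case (mult f g) thus ?case by (auto simp: mult.assoc intro: cring_mult)
 qed
 hence "good (f * 1)" using good_1 by blast
 thus ?thesis by (simp add: good_def)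
qed

subsection \<open>The substitution of \<open>z + w\<close>\<close>

lemma shift_by_w_eq:
 assumes "!!a b. a < a0 ==> F a b = 0" "a - a0 <= int T"
 shows "shift_by_w F a b = (SUM m<=T. ((of_int (int m - a) :: complex) gchoose m) *. F (a - int m) (b + int m))"
 unfolding shift_by_w_def
 by (rule Sum_any_superset) (use assms in auto)

lemma lowb_leftE: assumes "lowb (%b a. F a b)" obtains a0 where "!!a b. a < a0 ==> F a b = 0"
 using assms unfolding lowb_def by blast

lemma shift_by_w_linear:
 assumes "clinear L" "clinear L'" "lowb (%b a. F a b)" "lowb (%b a. F' a b)"
 shows "shift_by_w (%a b. L (F a b) + L' (F' a b)) a b = L (shift_by_w F a b) + L' (shift_by_w F' a b)"
proof -
 obtain a0 where a0: "!!a b. a < a0 ==> F a b = 0" using lowb_leftE[OF assms(3)] by blast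
 obtain a1 where a1: "!!a b. a < a1 ==> F' a b = 0" using lowb_leftE[OF assms(4)] by blast
 let ?a = "min a0 a1" and ?T = "nat (a - min a0 a1)"
 have 1: "shift_by_w F a b = (SUM m<=?T. ((of_int (int m - a) :: complex) gchoose m) *. F (a - int m) (b + int m))"
  by (rule shift_by_w_eq[of ?a]) (simp add: a0, linarith)
 have 2: "shift_by_w F' a b = (SUM m<=?T. ((of_int (int m - a) :: complex) gchoose m) *. F' (a - int m) (b + int m))"
  by (rule shift_by_w_eq[of ?a]) (simp add: a1, linarith)
 have "shift_by_w (%a b. L (F a b) + L' (F' a b)) a b
  = (SUM m<=?T. ((of_int (int m - a) :: complex) gchoose m) *. (L (F (a - int m) (b + int m)) + L' (F' (a - int m) (b + int m))))"
  by (rule shift_by_w_eq[of ?a]) (simp add: a0 a1 lin_zero[OF assms(1)] lin_zero[OF assms(2)], linarith)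
 thus ?thesis unfolding 1 2
  by (simp add: lin_sum[OF assms(1)] lin_sum[OF assms(2)] lin_scale[OF assms(1)] lin_scale[OF assms(2)]
    scaleC_add_right sum.distrib)
qed

text \<open>Under u = z + w, multiplication by u becomes multiplication by z + w; on coefficients
  this is Pascal's rule.\<close>

lemma shift_by_w_u:
 assumes "lowb (%b a. F a b)"
 shows "shift_by_w (%a b. F (a + 1) b) a b = shift_by_w F (a + 1) b + shift_by_w F a (b + 1)"
proof -
 obtain a0 where a0: "!!a b. a < a0 ==> F a b = 0" using lowb_leftE[OF assms] by blast
 let ?T = "nat (a + 1 - a0)"
 let ?g = "%m. F (a + 1 - int m) (b + int m)"
 have 1: "shift_by_w (%a b. F (a + 1) b) a b = (SUM m<=Suc ?T. ((of_int (int m - a) :: complex) gchoose m) *. ?g m)"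
  by (subst shift_by_w_eq[of "a0 - 1" _ _ "Suc ?T"]) (simp_all add: a0 algebra_simps del: sum.atMost_Suc)
 have 2: "shift_by_w F (a + 1) b = (SUM m<=Suc ?T. ((of_int (int m - (a + 1)) :: complex) gchoose m) *. ?g m)"
  by (rule shift_by_w_eq[of a0]) (simp_all add: a0)
 have 3: "shift_by_w F a (b + 1) = (SUM m<=?T. ((of_int (int m - a) :: complex) gchoose m) *. ?g (Suc m))"
  by (subst shift_by_w_eq[of a0 _ _ ?T]) (simp_all add: a0 algebra_simps)
 have t: "((of_int (int (Suc m) - a) :: complex) gchoose Suc m) *. ?g (Suc m)
  = ((of_int (int (Suc m) - (a + 1)) :: complex) gchoose Suc m) *. ?g (Suc m) + ((of_int (int m - a) :: complex) gchoose m) *. ?g (Suc m)" for m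
 proof -
  have "(of_int (int (Suc m) - a) :: complex) = of_int (int m - a) + 1" "(of_int (int (Suc m) - (a + 1)) :: complex) = of_int (int m - a)" by simp_all
  thus ?thesis by (simp only: gbinomial_Suc_Suc scaleC_add_left) (rule add.commute)
 qed
 show ?thesis unfolding 1 2 3 sum.atMost_Suc_shift t sum.distrib by (simp add: add.assoc)
qed

lemma lowb_shift_by_w: assumes "lowb (%b a. F a b)" shows "lowb (%b a. shift_by_w F a b)"
proof -
 obtain a0 n0 where 0: "!!a b. a < a0 ==> F a b = 0" "!!a b. b < n0 a ==> F a b = 0"
  using assms unfolding lowb_def by metis
 define B where "B a = Min (insert 0 ((%m. n0 (a - int m) - int m) ` {..nat (a - a0)}))" for a
 show ?thesis
 proof (rule lowbI[of a0 _ B])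
  fix a b assume "a < a0" thus "shift_by_w F a b = 0" by (subst shift_by_w_eq[of a0 _ _ 0]) (simp_all add: 0(1))
 next
  fix a b assume b: "b < B a"
  have "F (a - int m) (b + int m) = 0" if "m <= nat (a - a0)" for m
  proof (rule 0(2))
   have "B a <= n0 (a - int m) - int m" unfolding B_def by (rule Min_le) (use that in auto)
   thus "b + int m < n0 (a - int m)" using b by simp
  qed
  thus "shift_by_w F a b = 0" by (subst shift_by_w_eq[of a0 _ _ "nat (a - a0)"]) (simp_all add: 0(1))
 qed
qed

text \<open>Under u = z + w the form al + p u + q w turns into al + p z + (p + q) w.\<close>

lemma shift_by_w_lform:
 assumes F: "lowb (%b a. F a b)"
 shows "shift_by_w (lform al p q F) a b = lform al p (p + q) (shift_by_w F) a b"
proof -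
 have sh: "lowb (%b a. F (a + r) (b + s))" for r s
 proof -
  obtain a0 n0 where 0: "!!a b. a < a0 ==> F a b = 0" "!!a b. b < n0 a ==> F a b = 0"
   using F unfolding lowb_def by metis
  show ?thesis by (rule lowbI[of "a0 - r" _ "%a. n0 (a + r) - s"]) (simp_all add: 0)
 qed
 note sh1 = sh[of 1 0, simplified] and sh2 = sh[of 0 1, simplified]
 note s = lin_scaled[OF lin_id(2)]
 have sh3: "lowb (%b a. p *. F (a + 1) b + q *. F a (b + 1))"
 proof -
  obtain a0 n0 a1 n1 where 0: "!!a b. a < a0 ==> F (a + 1) b = 0" "!!a b. b < n0 a ==> F (a + 1) b = 0"
   "!!a b. a < a1 ==> F a (b + 1) = 0" "!!a b. b < n1 a ==> F a (b + 1) = 0"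
   using sh1 sh2 unfolding lowb_def by metis
  show ?thesis by (rule lowbI[of "min a0 a1" _ "%a. min (n0 a) (n1 a)"]) (simp_all add: 0)
 qed
 have w: "shift_by_w (%a b. F a (b + 1)) a b = shift_by_w F a (b + 1)"
  unfolding shift_by_w_def by (simp add: algebra_simps)
 have l: "lform al p q F = (%a b. al * F a b + (p *. F (a + 1) b + q *. F a (b + 1)))"
  by (simp add: lform_def fun_eq_iff add.assoc)
 show ?thesis unfolding l shift_by_w_linear[OF lin_mult lin_id(2) F sh3] shift_by_w_linear[OF s s sh1 sh2]
   shift_by_w_u[OF F] w by (simp add: lform_def scaleC_add_left scaleC_add_right add_ac)
qed

lemma shift_by_w_delta: "shift_by_w (%a b. if a = 0 & b = 0 then 1 else 0 :: ratfun) a b = (if a = 0 & b = 0 then 1 else 0)"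
proof -
 have "shift_by_w (%a b. if a = 0 & b = 0 then 1 else 0 :: ratfun) a b
  = Sum_any (%m::nat. if m = 0 then (if a = 0 & b = 0 then 1 else 0 :: ratfun) else 0)"
  unfolding shift_by_w_def by (rule Sum_any.cong) (auto simp: gbinomial_0_left scaleC_one)
 thus ?thesis by (simp only: Sum_any.delta)
qed

lemma locality_expansion:
 assumes "f : conf S" "J Int K = {}"
 shows "same_exp (- 1) (%a b. EE J K f a b) (%a b. EE K J f b a)"
proof -
 have "same_exp (- 1) ((%f a b. EE J K f a b) f) ((%f a b. EE K J f b a) f)"
 proof (rule common_presentation[where S = S and P = "%l. if l : K then 1 else 0" and Q = "%l. if l : J then 1 else 0"])
  show "lowb (%a b. EE K J f b a)" for f by (rule EE_lowb)
 qed (use assms in "simp_all only: EE_linear[where S = S], auto simp: EE_var[where S = S] EE_1 EE_lowb lform_def add_ac")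
 thus ?thesis by simp
qed

text \<open>With u = z + w, labels in \<open>K\<close> are translated by z + w and labels in
  \<open>J\<close> by w on both sides. The differences are then multiples of z, w or z + w, as ep =
  1 requires.\<close>

lemma comodule_expansion:
 assumes "f : conf S" "J Int K = {}"
 shows "same_exp 1 (shift_by_w (%a b. EE J K f a b)) (%a b. EE K (J Un K) f b a)"
proof -
 note s = lin_scaled[OF lin_id(2)]
 have "same_exp 1 ((%f. shift_by_w (%a b. EE J K f a b)) f) ((%f a b. EE K (J Un K) f b a) f)"
 proof (rule common_presentation[where S = S and P = "%l. if l : K then 1 else 0"
    and Q = "%l. (if l : K then 1 else 0) + (if l : J then 1 else 0)"])
  show "lowb (%a b. EE K (J Un K) f b a)" for f by (rule EE_lowb)
  show "lowb (%b a. shift_by_w (%a b. EE J K f a b) a b)" for f by (rule lowb_shift_by_w[OF EE_lowb])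
  show "shift_by_w (%a b. EE J K (c *. f + g) a b) a b = c *. shift_by_w (%a b. EE J K f a b) a b + shift_by_w (%a b. EE J K g a b) a b"
   if "f : conf S" "g : conf S" for c f g a b
   unfolding EE_linear[OF that] by (rule shift_by_w_linear[OF s lin_id(2) EE_lowb EE_lowb])
  show "shift_by_w (%a b. EE J K (var l * f) a b) a b
   = lform (var l) (if l : K then 1 else 0) ((if l : K then 1 else 0) + (if l : J then 1 else 0)) (shift_by_w (%a b. EE J K f a b)) a b"
   if "f : conf S" for l f a b
   unfolding EE_var[OF that] using shift_by_w_lform[OF EE_lowb, of "var l" "if l : K then 1 else 0" "if l : J then 1 else 0" J K f a b] by simp
  show "shift_by_w (%a b. EE J K 1 a b) a b = (if a = 0 & b = 0 then 1 else 0)" for a b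
   unfolding EE_1 by (rule shift_by_w_delta)
 qed (use assms in "simp_all only: EE_linear[where S = S], auto simp: EE_var[where S = S] EE_1 lform_def add_ac")
 thus ?thesis by simp
qed

section \<open>Locality and the comodule axiom\<close>

definition Split3 :: "nat list => nat list => nat list => (nat => 'v::graded_vertex_algebra) => ratfun
  => 'v mode_algebra \<otimes> ('v mode_algebra_plus \<otimes> 'v mode_algebra_plus)"
 where "Split3 is js ks A = (SOME L. clinear L & (ALL p:conf (set is). ALL q:confp (set js). ALL r:confp (set ks).
  L (p * (q * r)) = M is A p \<otimes> (Mp js A q \<otimes> Mp ks A r)))"

lemma Split3:
 assumes "set is Int set js = {}" "set is Int set ks = {}" "set js Int set ks = {}"
 shows "clinear (Split3 is js ks A)"
  "p : conf (set is) ==> q : confp (set js) ==> r : confp (set ks) ==>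
   Split3 is js ks A (p * (q * r)) = M is A p \<otimes> (Mp js A q \<otimes> Mp ks A r)"
proof -
 have "cbilinear (%q r. Mp js A q \<otimes> Mp ks A r)" by (rule cbilinear_tmap[OF lin_Mp lin_Mp])
 from bilinear_extension[OF assms(3) confp_rats confp_rats this] obtain L2
  where L2: "clinear L2" "!!q r. q : confp (set js) ==> r : confp (set ks) ==> L2 (q * r) = Mp js A q \<otimes> Mp ks A r" by metis
 have "cbilinear (%p x. M is A p \<otimes> L2 x)" by (rule cbilinear_tmap[OF lin_M L2(1)])
 moreover have "set is Int (set js Un set ks) = {}" using assms by auto
 ultimately obtain L where L: "clinear L" "!!p x. p : conf (set is) ==> x : conf (set js Un set ks) ==> L (p * x) = M is A p \<otimes> L2 x"
  using bilinear_extension[OF _ conf_rats conf_rats, of "set is" "set js Un set ks" "%p x. M is A p \<otimes> L2 x"] by metis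
 have "q * r : conf (set js Un set ks)" if "q : confp (set js)" "r : confp (set ks)" for q r
  using that confp_conf[of "set js"] confp_conf[of "set ks"] conf_mono[of "set js" "set js Un set ks"] conf_mono[of "set ks" "set js Un set ks"]
  by (intro conf_mult) auto
 hence "EX L. clinear L & (ALL p:conf (set is). ALL q:confp (set js). ALL r:confp (set ks).
  L (p * (q * r)) = M is A p \<otimes> (Mp js A q \<otimes> Mp ks A r))"
  using L L2(2) by (intro exI[of _ L]) simp
 from someI_ex[OF this] show "clinear (Split3 is js ks A)"
  "p : conf (set is) ==> q : confp (set js) ==> r : confp (set ks) ==>
   Split3 is js ks A (p * (q * r)) = M is A p \<otimes> (Mp js A q \<otimes> Mp ks A r)"
  unfolding Split3_def by blast+
qed

lemma lin_cop: "clinear (coeff_map coproduct s)" "clinear (coeff_map copU s)"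
 using lin_coproduct[of s] lin_copp[of s] by (simp_all add: coeff_map_def[abs_def])

lemma xsh_times_const:
 assumes "p : conf S" "q : conf T" "J Int T = {}"
 shows "xsh J (p * q) $$ s = xsh J p $$ s * q" "xsh J (q * p) $$ s = q * xsh J p $$ s"
proof -
 have "xsh J (p * q) = xsh J p * xsh J q"
  unfolding xsh_eq by (rule lau_hom(2)[OF adm_shift conf_CU[OF assms(1)] conf_CU[OF assms(2)]])
 moreover have "xsh J q = fls_const q" by (rule xsh_id[OF assms(2)]) (use assms(3) in auto)
 ultimately show "xsh J (p * q) $$ s = xsh J p $$ s * q" by simp
 thus "xsh J (q * p) $$ s = q * xsh J p $$ s" by (simp add: mult.commute)
qed

lemma lin_expand_on:
 assumes "clinear L" "V = conf S"
 shows "clinear (linext V (%h. L (xsh J h $$ s)))" "h : conf S ==> linext V (%h. L (xsh J h $$ s)) h = L (xsh J h $$ s)"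
 unfolding assms(2)
 by (rule linext[OF conf_subspace(1)];
   simp add: xsh_add[of _ S] xsh_scale[of _ S] lin_add[OF assms(1)] lin_scale[OF assms(1)])+

text \<open>The map \<open>Th\<close> collects what is done after the coproducts: reassociation, and
  in one use also the exchange of the last two factors.\<close>

lemma iterated_left:
 assumes d: "distinct is" and di: "set is Int set ks = {}" and h: "h : mixs (set is) (set ks)"
  and Th: "clinear Th" and S3: "!!J. clinear (S3 J)"
  and eq: "!!J p q r. J <= set is ==> p : conf (set (outl J is)) ==> q : confp (set (inl J is)) ==> r : confp (set ks) ==>
   Th ((M (outl J is) A p \<otimes> Mp (inl J is) A q) \<otimes> Mp ks A r) = S3 J ((p * q) * r)"
 shows "Th (tensor_map (coeff_map coproduct s) id (Split is ks A h)) = (SUM J:Pow (set is). S3 J (xsh J h $$ s))"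
proof -
 let ?V = "conf (set is Un set ks)"
 note E = lin_expand_on[OF S3 refl, where S = "set is Un set ks"]
 have hV: "x : ?V" if "x : mixs (set is) (set ks)" for x using mixs_conf[OF that] .
 have "Th (tensor_map (coeff_map coproduct s) id (Split is ks A h))
  = (SUM J:Pow (set is). linext ?V (%h. S3 J (xsh J h $$ s)) h)"
 proof (rule prods_ext[OF lin_comp[OF Th lin_comp[OF lin_tmap[OF lin_cop(1) lin_id(1)] Split(1)[OF di]]]
    lin_sums[OF E(1)] _ h])
  fix p r assume p: "p : conf (set is)" and r: "r : confp (set ks)"
  have rc: "r : conf (set ks)" using r confp_conf by blast
  have pr: "p * r : ?V" by (rule prods_conf[OF prodsI[OF p r]])
  have 1: "Th (Split (outl J is) (inl J is) A x \<otimes> Mp ks A r) = S3 J (x * r)" if J: "J <= set is" and x: "x : mixs (set (outl J is)) (set (inl J is))" for J x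
  proof (rule prods_ext[OF _ _ _ x])
   show "clinear (%x. Th (Split (outl J is) (inl J is) A x \<otimes> Mp ks A r))"
    by (rule lin_comp[OF Th lin_comp[OF lin_tensor_left Split(1)[OF oi_disj]]])
   show "clinear (%x. S3 J (x * r))" by (rule lin_comp[OF S3 lin_times(1)])
  qed (simp only: Split(2)[OF oi_disj] eq[OF J _ _ r])
  have "Th (tensor_map (coeff_map coproduct s) id (Split is ks A (p * r))) = Th (coproduct (M is A p) $$ s \<otimes> Mp ks A r)"
   unfolding Split(2)[OF di p r] tensor_map[OF lin_cop(1) lin_id(1)] by (simp add: coeff_map_def)
  also have "... = (SUM J:Pow (set is). Th (Split (outl J is) (inl J is) A (xsh J p $$ s) \<otimes> Mp ks A r))"
   unfolding coproduct_M[OF d p] lin_sum[OF lin_comp[OF Th lin_tensor_left]] ..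
  also have "... = (SUM J:Pow (set is). S3 J (xsh J (p * r) $$ s))"
  proof (rule sum.cong[OF refl])
   fix J assume "J : Pow (set is)"
   hence J: "J <= set is" "J Int set ks = {}" using di by auto
   show "Th (Split (outl J is) (inl J is) A (xsh J p $$ s) \<otimes> Mp ks A r) = S3 J (xsh J (p * r) $$ s)"
    unfolding xsh_times_const(1)[OF p rc J(2)] by (rule 1[OF J(1) shift_mixs[OF p J(1)]])
  qed
  finally show "Th (tensor_map (coeff_map coproduct s) id (Split is ks A (p * r)))
   = (SUM J:Pow (set is). linext ?V (%h. S3 J (xsh J h $$ s)) (p * r))" by (simp only: E(2)[OF pr])
 qed
 thus ?thesis by (simp only: E(2)[OF hV[OF h]])
qed

lemma iterated_right:
 assumes d: "distinct ks" and di: "set is Int set ks = {}" and h: "h : mixs (set is) (set ks)"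
 shows "tensor_map id (coeff_map copU s) (Split is ks A h) = (SUM K:Pow (set ks). Split3 is (outl K ks) (inl K ks) A (xsh K h $$ s))"
proof -
 let ?V = "conf (set is Un set ks)"
 have S: "set is Int set (outl K ks) = {}" "set is Int set (inl K ks) = {}" "set (outl K ks) Int set (inl K ks) = {}" for K using di by auto
 note E = lin_expand_on[OF Split3(1)[OF S] refl, where S = "set is Un set ks"]
 have "tensor_map id (coeff_map copU s) (Split is ks A h)
  = (SUM K:Pow (set ks). linext ?V (%h. Split3 is (outl K ks) (inl K ks) A (xsh K h $$ s)) h)"
 proof (rule prods_ext[OF lin_comp[OF lin_tmap[OF lin_id(1) lin_cop(2)] Split(1)[OF di]] lin_sums[OF E(1)] _ h])
  fix p q assume p: "p : conf (set is)" and q: "q : confp (set ks)"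
  have qc: "q : conf (set ks)" using q confp_conf by blast
  have pq: "p * q : ?V" by (rule prods_conf[OF prodsI[OF p q]])
  have 1: "M is A p \<otimes> Splitp (outl K ks) (inl K ks) A x = Split3 is (outl K ks) (inl K ks) A (p * x)"
   if x: "x : cspan (prods (confp (set (outl K ks))) (confp (set (inl K ks))))" for K x
  proof (rule prods_ext[OF lin_comp[OF clinear_tensor_right Splitp(1)[OF S(3)]] lin_comp[OF Split3(1)[OF S] lin_times(2)] _ x])
   fix u v assume u: "u : confp (set (outl K ks))" and v: "v : confp (set (inl K ks))"
   have "u : conf (set (outl K ks))" using u confp_conf by blast
   thus "M is A p \<otimes> Splitp (outl K ks) (inl K ks) A (u * v) = Split3 is (outl K ks) (inl K ks) A (p * (u * v))"
    by (simp only: Splitp(2)[OF S(3) _ v] Split3(2)[OF S p u v])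
  qed
  have "tensor_map id (coeff_map copU s) (Split is ks A (p * q)) = M is A p \<otimes> (copU (Mp ks A q) $$ s)"
   unfolding Split(2)[OF di p q] tensor_map[OF lin_id(1) lin_cop(2)] by (simp add: coeff_map_def)
  also have "... = (SUM K:Pow (set ks). M is A p \<otimes> Splitp (outl K ks) (inl K ks) A (xsh K q $$ s))"
   unfolding copp_Mp[OF d q] lin_sum[OF clinear_tensor_right] ..
  also have "... = (SUM K:Pow (set ks). Split3 is (outl K ks) (inl K ks) A (xsh K (p * q) $$ s))"
  proof (rule sum.cong[OF refl])
   fix K assume "K : Pow (set ks)"
   hence K: "K <= set ks" "K Int set is = {}" using di by auto
   show "M is A p \<otimes> Splitp (outl K ks) (inl K ks) A (xsh K q $$ s) = Split3 is (outl K ks) (inl K ks) A (xsh K (p * q) $$ s)"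
    unfolding xsh_times_const(2)[OF qc p K(2)] by (rule 1[OF shift_mixs_plus[OF q K(1)]])
  qed
  finally show "tensor_map id (coeff_map copU s) (Split is ks A (p * q))
   = (SUM K:Pow (set ks). linext ?V (%h. Split3 is (outl K ks) (inl K ks) A (xsh K h $$ s)) (p * q))" by (simp only: E(2)[OF pq])
 qed
 thus ?thesis by (simp only: E(2)[OF mixs_conf[OF h]])
qed

abbreviation "disj_pairs ls == {(J, K). J <= set ls & K <= set ls & J Int K = {}}"

abbreviation "T3 ls A J K == Split3 (filter (%i. i ~: J & i ~: K) ls) (inl J ls) (inl K ls) A"

lemma lin_T3: "J Int K = {} ==> clinear (T3 ls A J K)"
 by (rule Split3(1)) auto

lemma finite_disj_pairs: "finite (disj_pairs ls)"
 by (rule finite_subset[of _ "Pow (set ls) \<times> Pow (set ls)"]) auto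

text \<open>The two ways to build three groups: choose K and then J outside it, or choose the union
  L and then K inside it. They belong to the coproduct applied to the left factor and to the right
  factor.\<close>

lemma sum_disj_pairs:
 "(SUM K:Pow (set ls). SUM J:Pow (set ls - K). g J K) = (SUM (J, K):disj_pairs ls. g J K)"
 "(SUM L:Pow (set ls). SUM K:Pow L. g (L - K) K) = (SUM (J, K):disj_pairs ls. g J K)"
proof -
 have "(SUM K:Pow (set ls). SUM J:Pow (set ls - K). g J K) = (SUM (K, J):(SIGMA K:Pow (set ls). Pow (set ls - K)). g J K)"
  by (rule sum.Sigma) auto
 also have "... = (SUM (J, K):disj_pairs ls. g J K)"
  by (rule sum.reindex_bij_witness[of _ prod.swap prod.swap]) auto
 finally show "(SUM K:Pow (set ls). SUM J:Pow (set ls - K). g J K) = (SUM (J, K):disj_pairs ls. g J K)" .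
 have "(SUM L:Pow (set ls). SUM K:Pow L. g (L - K) K) = (SUM (L, K):(SIGMA L:Pow (set ls). Pow L). g (L - K) K)"
  by (rule sum.Sigma) (auto intro: finite_subset)
 also have "... = (SUM (J, K):disj_pairs ls. g J K)"
  by (rule sum.reindex_bij_witness[of _ "%(J, K). (J Un K, K)" "%(L, K). (L - K, K)"]) auto
 finally show "(SUM L:Pow (set ls). SUM K:Pow L. g (L - K) K) = (SUM (J, K):disj_pairs ls. g J K)" .
qed

lemma filter_lists:
 "outl J (outl K ls) = filter (%i. i ~: J & i ~: K) ls" "J Int K = {} ==> inl J (outl K ls) = inl J ls"
 "K <= L ==> inl K (inl L ls) = inl K ls" "K <= L ==> outl K (inl L ls) = inl (L - K) ls"
 by (auto intro!: filter_cong)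

definition iter1 :: "'v::graded_vertex_algebra mode_algebra => int => int => 'v mode_algebra \<otimes> ('v mode_algebra_plus \<otimes> 'v mode_algebra_plus)"
 where "iter1 m a b = tensor_assoc (tensor_map (coeff_map coproduct b) id (coproduct m $$ a))"

lemma lin_iter1: "clinear (%m. iter1 m a b)"
 unfolding iter1_def
 by (rule lin_comp[OF lin_tensor_assoc lin_comp[OF lin_tmap[OF lin_cop(1) lin_id(1)] lin_coproduct]])

text \<open>Both iterations are indexed by the same ordered partitions into three groups; exchanging
  the last two tensor factors exchanges J and K, which is undone by reindexing the sum.\<close>

lemma iter1_M:
 fixes A :: "nat => 'v::graded_vertex_algebra"
 assumes d: "distinct ls" and f: "f : conf (set ls)"
 shows "iter1 (M ls A f) a b = (SUM (J, K):disj_pairs ls. T3 ls A J K (EE J K f a b))"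
  "tensor_map id tensor_swap (iter1 (M ls A f) b a) = (SUM (J, K):disj_pairs ls. T3 ls A J K (EE K J f b a))"
proof -
 note cs = lin_tmap[OF lin_id(1) lin_tensor_swap]
 have general: "Th (tensor_map (coeff_map coproduct b) id (coproduct (M ls A f) $$ a))
   = (SUM (J, K):disj_pairs ls. S3 J K (EE J K f a b))"
  if Th: "clinear Th" and S3: "!!J K. J Int K = {} ==> clinear (S3 J K)"
   and eq: "!!J K p q r. J Int K = {} ==> p : conf (set (filter (%i. i ~: J & i ~: K) ls)) ==> q : confp (set (inl J ls)) ==> r : confp (set (inl K ls)) ==>
   Th ((M (filter (%i. i ~: J & i ~: K) ls) A p \<otimes> Mp (inl J ls) A q) \<otimes> Mp (inl K ls) A r) = S3 J K ((p * q) * r)"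
  for Th :: "('v mode_algebra \<otimes> 'v mode_algebra_plus) \<otimes> 'v mode_algebra_plus => 'w::complex_vector" and S3 a b
 proof -
  \<comment> \<open>Extension by 0 to overlapping pairs makes linearity available for all pairs, as
    \<open>iterated_left\<close> requires.\<close>
  define S3' where "S3' J K = (if J Int K = {} then S3 J K else (%_. 0))" for J K
  have S3': "clinear (S3' J K)" for J K unfolding S3'_def using S3 by (simp add: lin_0)
  have "Th (tensor_map (coeff_map coproduct b) id (coproduct (M ls A f) $$ a))
   = (SUM K:Pow (set ls). Th (tensor_map (coeff_map coproduct b) id (Split (outl K ls) (inl K ls) A (xsh K f $$ a))))"
   unfolding coproduct_M[OF d f] lin_sum[OF lin_comp[OF Th lin_tmap[OF lin_cop(1) lin_id(1)]]] ..
  also have "... = (SUM K:Pow (set ls). SUM J:Pow (set ls - K). S3' J K (EE J K f a b))"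
  proof (rule sum.cong[OF refl])
   fix K assume "K : Pow (set ls)"
   hence K: "K <= set ls" by simp
   have set: "set (outl K ls) = set ls - K" by auto
   have "Th (tensor_map (coeff_map coproduct b) id (Split (outl K ls) (inl K ls) A (xsh K f $$ a)))
    = (SUM J:Pow (set (outl K ls)). S3' J K (xsh J (xsh K f $$ a) $$ b))"
   proof (rule iterated_left[OF _ oi_disj shift_mixs[OF f K] Th S3'])
    show "distinct (outl K ls)" using d by simp
    fix J p q r assume "J <= set (outl K ls)" and pqr: "p : conf (set (outl J (outl K ls)))" "q : confp (set (inl J (outl K ls)))" "r : confp (set (inl K ls))"
    hence JK: "J Int K = {}" by auto
    show "Th ((M (outl J (outl K ls)) A p \<otimes> Mp (inl J (outl K ls)) A q) \<otimes> Mp (inl K ls) A r) = S3' J K ((p * q) * r)"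
     unfolding S3'_def if_P[OF JK] filter_lists(1) filter_lists(2)[OF JK]
     by (rule eq[OF JK]) (use pqr[unfolded filter_lists(1) filter_lists(2)[OF JK]] in blast)+
   qed
   thus "Th (tensor_map (coeff_map coproduct b) id (Split (outl K ls) (inl K ls) A (xsh K f $$ a)))
    = (SUM J:Pow (set ls - K). S3' J K (EE J K f a b))" unfolding set EE_def .
  qed
  also have "... = (SUM (J, K):disj_pairs ls. S3' J K (EE J K f a b))" by (rule sum_disj_pairs(1))
  also have "... = (SUM (J, K):disj_pairs ls. S3 J K (EE J K f a b))" by (rule sum.cong) (auto simp: S3'_def)
  finally show ?thesis .
 qed
 note disj = Split3(2)[of "filter (%i. i ~: J & i ~: K) ls" "inl J ls" "inl K ls" for J K]
 show "iter1 (M ls A f) a b = (SUM (J, K):disj_pairs ls. T3 ls A J K (EE J K f a b))"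
  unfolding iter1_def
 proof (rule general[OF lin_tensor_assoc lin_T3])
  fix J K :: "nat set" and p q r
  assume JK: "J Int K = {}" and p: "p : conf (set (filter (%i. i ~: J & i ~: K) ls))" and q: "q : confp (set (inl J ls))" and r: "r : confp (set (inl K ls))"
  show "tensor_assoc ((M (filter (%i. i ~: J & i ~: K) ls) A p \<otimes> Mp (inl J ls) A q) \<otimes> Mp (inl K ls) A r) = T3 ls A J K ((p * q) * r)"
   unfolding mult.assoc[of p q r] tensor_assoc by (rule disj[OF _ _ _ p q r, symmetric]) (use JK in auto)
 qed
 have "tensor_map id tensor_swap (iter1 (M ls A f) b a) = (SUM (J, K):disj_pairs ls. T3 ls A K J (EE J K f b a))"
  unfolding iter1_def
 proof (rule general[OF lin_comp[OF cs lin_tensor_assoc]])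
  fix J K :: "nat set" assume "J Int K = {}"
  hence JK: "K Int J = {}" by auto
  have c: "filter (%i. i ~: J & i ~: K) ls = filter (%i. i ~: K & i ~: J) ls" by (rule filter_cong) auto
  show "clinear (T3 ls A K J)" by (rule lin_T3[OF JK])
  fix p q r assume p: "p : conf (set (filter (%i. i ~: J & i ~: K) ls))" and q: "q : confp (set (inl J ls))" and r: "r : confp (set (inl K ls))"
  have eq: "(p * q) * r = p * (r * q)" by (simp add: mult_ac)
  show "tensor_map id tensor_swap (tensor_assoc ((M (filter (%i. i ~: J & i ~: K) ls) A p \<otimes> Mp (inl J ls) A q) \<otimes> Mp (inl K ls) A r)) = T3 ls A K J ((p * q) * r)"
   unfolding tensor_assoc tensor_map[OF lin_id(1) lin_tensor_swap] tensor_swap id_apply eq c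
   by (rule disj[OF _ _ _ p[unfolded c] r q, symmetric]) (use JK in auto)
 qed
 also have "... = (SUM (J, K):disj_pairs ls. T3 ls A J K (EE K J f b a))"
  by (rule sum.reindex_bij_witness[of _ prod.swap prod.swap]) auto
 finally show "tensor_map id tensor_swap (iter1 (M ls A f) b a) = (SUM (J, K):disj_pairs ls. T3 ls A J K (EE K J f b a))" .
qed

lemma iter2_M:
 assumes d: "distinct ls" and f: "f : conf (set ls)"
 shows "tensor_map id (coeff_map copU a) (coproduct (M ls A f) $$ b) = (SUM (J, K):disj_pairs ls. T3 ls A J K (EE K (J Un K) f b a))"
proof -
 have "tensor_map id (coeff_map copU a) (coproduct (M ls A f) $$ b)
  = (SUM L:Pow (set ls). tensor_map id (coeff_map copU a) (Split (outl L ls) (inl L ls) A (xsh L f $$ b)))"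
  unfolding coproduct_M[OF d f] lin_sum[OF lin_tmap[OF lin_id(1) lin_cop(2)]] ..
 also have "... = (SUM L:Pow (set ls). SUM K:Pow L. T3 ls A (L - K) K (EE K ((L - K) Un K) f b a))"
 proof (rule sum.cong[OF refl])
  fix L assume "L : Pow (set ls)"
  hence L: "L <= set ls" and set: "set (inl L ls) = L" by auto
  have "tensor_map id (coeff_map copU a) (Split (outl L ls) (inl L ls) A (xsh L f $$ b))
   = (SUM K:Pow (set (inl L ls)). Split3 (outl L ls) (outl K (inl L ls)) (inl K (inl L ls)) A (xsh K (xsh L f $$ b) $$ a))"
   by (rule iterated_right[OF _ oi_disj shift_mixs[OF f L]]) (use d in simp)
  also have "... = (SUM K:Pow L. T3 ls A (L - K) K (EE K ((L - K) Un K) f b a))"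
   unfolding set
  proof (rule sum.cong[OF refl])
   fix K assume "K : Pow L"
   hence K: "K <= L" "(L - K) Un K = L" by auto
   have o: "outl L ls = filter (%i. i ~: L - K & i ~: K) ls" by (rule filter_cong) (use K in auto)
   show "Split3 (outl L ls) (outl K (inl L ls)) (inl K (inl L ls)) A (xsh K (xsh L f $$ b) $$ a)
    = T3 ls A (L - K) K (EE K ((L - K) Un K) f b a)"
    unfolding filter_lists(3,4)[OF K(1)] o EE_def K(2) ..
  qed
  finally show "tensor_map id (coeff_map copU a) (Split (outl L ls) (inl L ls) A (xsh L f $$ b))
   = (SUM K:Pow L. T3 ls A (L - K) K (EE K ((L - K) Un K) f b a))" .
 qed
 also have "... = (SUM (J, K):disj_pairs ls. T3 ls A J K (EE K (J Un K) f b a))"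
  by (rule sum_disj_pairs(2))
 finally show ?thesis .
qed

lemma expansions_zero: "same_exp ep (%a b. 0 :: 'a::complex_vector) (%a b. 0)"
proof -
 have "bfam (%i j k. 0 :: 'a)" by (rule bounded_familyI[of 0]) simp
 thus ?thesis unfolding expansions_of_same_element_def
  by (intro exI[of _ "%i j k. 0"]) (simp add: expand_z_large_def[abs_def] expand_w_large_def[abs_def] fun_eq_iff case_prod_beta)
qed

lemma expansions_sum:
 assumes "finite D" "!!x. x : D ==> clinear (L x)" "!!x. x : D ==> same_exp ep (F x) (G x)"
 shows "same_exp ep (%a b. SUM x:D. L x (F x a b)) (%a b. SUM x:D. L x (G x a b))"
 using assms
proof (induction D rule: finite_induct)
 case empty show ?case by (simp add: expansions_zero)
next
 case (insert x D)
 have "same_exp ep (%a b. L x (F x a b) + id (SUM x:D. L x (F x a b))) (%a b. L x (G x a b) + id (SUM x:D. L x (G x a b)))"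
  by (rule expansions_combine[OF _ lin_id(1)]) (use insert in auto)
 thus ?case using insert by simp
qed

lemma lowb_combine:
 assumes "clinear L" "clinear L'" "lowb (%b a. F a b)" "lowb (%b a. F' a b)"
 shows "lowb (%b a. L (F a b) + L' (F' a b))"
proof -
 obtain K N K' N' where 0: "!!a b. a < K ==> F a b = 0" "!!a b. b < N a ==> F a b = 0"
  "!!a b. a < K' ==> F' a b = 0" "!!a b. b < N' a ==> F' a b = 0"
  using assms(3,4) unfolding lowb_def by metis
 show ?thesis by (rule lowbI[of "min K K'" _ "%a. min (N a) (N' a)"]) (simp_all add: 0 lin_zero[OF assms(1)] lin_zero[OF assms(2)])
qed

lemma shift_by_w_sum:
 assumes "finite D" "!!x. x : D ==> clinear (L x)" "!!x. x : D ==> lowb (%b a. F x a b)"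
 shows "shift_by_w (%a b. SUM x:D. L x (F x a b)) = (%a b. SUM x:D. L x (shift_by_w (F x) a b)) & lowb (%b a. SUM x:D. L x (F x a b))"
 using assms
proof (induction D rule: finite_induct)
 case empty show ?case by (simp add: shift_by_w_def[abs_def] lowb_def)
next
 case (insert x D)
 hence IH: "shift_by_w (%a b. SUM x:D. L x (F x a b)) = (%a b. SUM x:D. L x (shift_by_w (F x) a b))" "lowb (%b a. SUM x:D. L x (F x a b))" by auto
 have x: "clinear (L x)" "lowb (%b a. F x a b)" using insert by auto
 show ?case
  using insert(1,2) lowb_combine[OF x(1) lin_id(2) x(2) IH(2)] shift_by_w_linear[OF x(1) lin_id(2) x(2) IH(2)]
  by (simp add: IH(1))
qed

lemma locality_U: "same_exp (- 1) (%a b. iter1 m a b) (%a b. tensor_map id tensor_swap (iter1 m b a))"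
 using M_span[of m]
proof (induction rule: span_induct_in_span)
 case base
 show ?case
  unfolding lin_zero[OF lin_iter1] lin_zero[OF lin_tmap[OF lin_id(1) lin_tensor_swap]]
  by (rule expansions_zero)
next
 case (step c x y)
 obtain ls A f where x: "x = M ls A f" and d: "distinct ls" and f: "f : conf (set ls)" using step(1) by blast
 have "same_exp (- 1) (%a b. SUM z:disj_pairs ls. T3 ls A (fst z) (snd z) (EE (fst z) (snd z) f a b))
  (%a b. SUM z:disj_pairs ls. T3 ls A (fst z) (snd z) (EE (snd z) (fst z) f b a))"
  by (rule expansions_sum[OF finite_disj_pairs]) (auto intro!: lin_T3 locality_expansion[OF f])
 hence "same_exp (- 1) (%a b. iter1 x a b) (%a b. tensor_map id tensor_swap (iter1 x b a))"
  unfolding x iter1_M(2)[OF d f] unfolding iter1_M(1)[OF d f] by (simp add: case_prod_beta)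
 from expansions_combine[OF lin_scaled[OF lin_id(2)] lin_id(2) this step(3), of c] show ?case
  by (simp only: lin_add[OF lin_iter1] lin_scale[OF lin_iter1]
    lin_add[OF lin_tmap[OF lin_id(1) lin_tensor_swap]] lin_scale[OF lin_tmap[OF lin_id(1) lin_tensor_swap]])
qed

text \<open>The lower bound is carried through the induction because the additivity of
  \<open>shift_by_w\<close> rests on it.\<close>

lemma comodule_U:
 "lowb (%b a. iter1 m a b) &
  same_exp 1 (shift_by_w (%a b. iter1 m a b)) (%a b. tensor_map id (coeff_map copU a) (coproduct m $$ b))"
 using M_span[of m]
proof (induction rule: span_induct_in_span)
 case base
 have "shift_by_w (%a b. 0 :: 'a mode_algebra \<otimes> ('a mode_algebra_plus \<otimes> 'a mode_algebra_plus)) = (%a b. 0)" by (simp add: shift_by_w_def[abs_def])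
 thus ?case
  unfolding lin_zero[OF lin_iter1] lin_zero[OF lin_coproduct] lin_zero[OF lin_tmap[OF lin_id(1) lin_cop(2)]]
  using expansions_zero by (simp add: lowb_def)
next
 case (step c x y)
 obtain ls A f where x: "x = M ls A f" and d: "distinct ls" and f: "f : conf (set ls)" using step(1) by blast
 note s = lin_scaled[OF lin_id(2), of c]
 have sh: "shift_by_w (%a b. SUM z:disj_pairs ls. T3 ls A (fst z) (snd z) (EE (fst z) (snd z) f a b))
   = (%a b. SUM z:disj_pairs ls. T3 ls A (fst z) (snd z) (shift_by_w (%a b. EE (fst z) (snd z) f a b) a b))
  & lowb (%b a. SUM z:disj_pairs ls. T3 ls A (fst z) (snd z) (EE (fst z) (snd z) f a b))"
  by (rule shift_by_w_sum[OF finite_disj_pairs]) (auto intro!: lin_T3 EE_lowb)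
 have "same_exp 1 (%a b. SUM z:disj_pairs ls. T3 ls A (fst z) (snd z) (shift_by_w (%a b. EE (fst z) (snd z) f a b) a b))
  (%a b. SUM z:disj_pairs ls. T3 ls A (fst z) (snd z) (EE (snd z) (fst z Un snd z) f b a))"
  by (rule expansions_sum[OF finite_disj_pairs]) (auto intro!: lin_T3 comodule_expansion[OF f])
 hence X: "lowb (%b a. iter1 x a b)"
  "same_exp 1 (shift_by_w (%a b. iter1 x a b)) (%a b. tensor_map id (coeff_map copU a) (coproduct x $$ b))"
  unfolding x iter1_M[OF d f] iter2_M[OF d f] using sh by (simp_all add: case_prod_beta)
 have Y: "lowb (%b a. iter1 y a b)"
  "same_exp 1 (shift_by_w (%a b. iter1 y a b)) (%a b. tensor_map id (coeff_map copU a) (coproduct y $$ b))"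
  using step by blast+
 have i: "iter1 (c *. x + y) a b = c *. iter1 x a b + iter1 y a b" for a b
  by (simp add: lin_add[OF lin_iter1] lin_scale[OF lin_iter1])
 have j: "tensor_map id (coeff_map copU a) (coproduct (c *. x + y) $$ b)
  = c *. tensor_map id (coeff_map copU a) (coproduct x $$ b) + tensor_map id (coeff_map copU a) (coproduct y $$ b)" for a b
  by (simp add: lin_add[OF lin_coproduct] lin_scale[OF lin_coproduct]
    lin_add[OF lin_tmap[OF lin_id(1) lin_cop(2)]] lin_scale[OF lin_tmap[OF lin_id(1) lin_cop(2)]])
 have "shift_by_w (%a b. iter1 (c *. x + y) a b) = (%a b. c *. shift_by_w (%a b. iter1 x a b) a b + shift_by_w (%a b. iter1 y a b) a b)"
  unfolding i by (intro ext shift_by_w_linear[OF s lin_id(2) X(1) Y(1)])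
 thus ?case
  using lowb_combine[OF s lin_id(2) X(1) Y(1)] expansions_combine[OF s lin_id(2) X(2) Y(2)] unfolding i j by simp
qed

text \<open>The projection to U_+ in the first factor is linear and commutes with reassociation and
  with the exchange of the other two factors, so it carries a common presentation over U(V) to one
  over U_+.\<close>

lemma locality_plus:
 fixes v :: "'v::graded_vertex_algebra mode_algebra_plus"
 shows "same_exp (- 1)
   (%a b. tensor_assoc (tensor_map (coeff_map copU b) id (copU v $$ a)))
   (%a b. tensor_map id tensor_swap (tensor_assoc (tensor_map (coeff_map copU a) id (copU v $$ b))))"
proof -
 let ?rh = "tensor_map retract id :: 'v mode_algebra \<otimes> ('v mode_algebra_plus \<otimes> 'v mode_algebra_plus) => _"
 let ?r = "RepU :: 'v mode_algebra_plus => _"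
 have rh: "clinear ?rh" by (rule lin_tmap[OF lin_retract lin_id(1)])
 have cR: "clinear (%x :: 'v mode_algebra_plus. coeff_map coproduct b (?r x))" for b
  by (rule lin_comp[OF lin_cop(1) lin_Rep])
 have assoc: "?rh (tensor_assoc (x \<otimes> y)) = tensor_assoc (tensor_map retract id x \<otimes> y)" for x and y :: "'v mode_algebra_plus"
  by (rule tensor_ext[where x = x, OF lin_comp[OF rh lin_comp[OF lin_tensor_assoc lin_tensor_left]]
     lin_comp[OF lin_tensor_assoc lin_comp[OF lin_tensor_left lin_tmap[OF lin_retract lin_id(1)]]]])
    (simp add: tensor_map[OF lin_retract lin_id(1)])
 have 1: "?rh (iter1 (?r v) a b) = tensor_assoc (tensor_map (coeff_map copU b) id (copU v $$ a))" for a b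
 proof -
  have "?rh (tensor_assoc (tensor_map (%x. coeff_map coproduct b (?r x)) (%y. id (id y)) t)) = tensor_assoc (tensor_map (coeff_map copU b) id t)" for t
  proof (rule tensor_ext[where x = t])
   show "clinear (%t. ?rh (tensor_assoc (tensor_map (%x. coeff_map coproduct b (?r x)) (%y. id (id y)) t)))"
    by (rule lin_comp[OF rh lin_comp[OF lin_tensor_assoc lin_tmap[OF cR lin_comp[OF lin_id(1) lin_id(1)]]]])
   show "clinear (%t :: 'v mode_algebra_plus \<otimes> 'v mode_algebra_plus. tensor_assoc (tensor_map (coeff_map copU b) id t))"
    by (rule lin_comp[OF lin_tensor_assoc lin_tmap[OF lin_cop(2) lin_id(1)]])
   fix x y :: "'v mode_algebra_plus"
   show "?rh (tensor_assoc (tensor_map (%x. coeff_map coproduct b (?r x)) (%y. id (id y)) (x \<otimes> y))) = tensor_assoc (tensor_map (coeff_map copU b) id (x \<otimes> y))"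
    unfolding tensor_map[OF cR lin_comp[OF lin_id(1) lin_id(1)]] tensor_map[OF lin_cop(2) lin_id(1)] assoc
    by (simp add: coeff_map_def copp_nth)
  qed
  thus ?thesis
   unfolding iter1_def Rep_copp[symmetric] tmap_comp[OF lin_cop(1) lin_id(1) lin_Rep lin_id(1)] .
 qed
 have 2: "?rh (tensor_map id tensor_swap t) = tensor_map id tensor_swap (?rh t)" for t
  unfolding tmap_comp[OF lin_retract lin_id(1) lin_id(1) lin_tensor_swap] tmap_comp[OF lin_id(1) lin_tensor_swap lin_retract lin_id(1)]
  by simp
 have "same_exp (- 1) (%a b. ?rh (iter1 (?r v) a b) + ?rh 0) (%a b. ?rh (tensor_map id tensor_swap (iter1 (?r v) b a)) + ?rh 0)"
  by (rule expansions_combine[OF rh rh locality_U expansions_zero])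
 thus ?thesis by (simp add: lin_zero[OF rh] 1 2)
qed

theorem propositionE2p1:
  shows "vertex_coalgebra
      (coproduct_plus :: 'v::graded_vertex_algebra mode_algebra_plus \<Rightarrow> _) covacuum
    \<and> vertex_comodule coproduct_plus covacuum
      (coproduct :: 'v mode_algebra \<Rightarrow> _)"
proof
 show "vertex_coalgebra (copU :: 'v mode_algebra_plus => _) covacuum"
  unfolding vertex_coalgebra_def Let_def
  by (intro conjI allI impI lin_cop lin_covacuum counit_plus cocreation locality_plus
    translation_coproduct[unfolded Dc_def[abs_def]])
 show "vertex_comodule copU covacuum (coproduct :: 'v mode_algebra => _)"
  unfolding vertex_comodule_def
  by (intro conjI allI lin_cop counit comodule_U[THEN conjunct2, unfolded iter1_def])
qed

end
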